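(* Let $p$ be a positive integer and $\epsilon,\delta\in(0,1)$. Then for every $X\in\mathbb{R}^{d\times n}$ there exists a distribution over oblivious linear sketches $\Pi:\mathbb{R}^{d^p}\to\mathbb{R}^m$ such that, if $m=\tilde\Theta(\epsilon^{-2}np^2)$, then with probability at least $1-\delta$, $$(1-\epsilon)(X^{\otimes p})^\top X^{\otimes p}\preceq(\Pi X^{\otimes p})^\top\Pi X^{\otimes p}\preceq(1+\epsilon)(X^{\otimes p})^\top X^{\otimes p}.$$ Moreover, $\Pi X^{\otimes p}$ can be computed in time $\tilde O(nd+\epsilon^{-2}n^2p^2)$.
   Context: For $X\in\mathbb{R}^{d\times n}$ with columns $x_1,\dots,x_n$, $X^{\otimes p}\in\mathbb{R}^{d^p\times n}$ is the matrix whose $j$-th column is the $p$-fold tensor (Kronecker) power $x_j^{\otimes p}$; thus $(X^{\otimes p})^\top X^{\otimes p}$ is the degree-$p$ polynomial kernel matrix with entries $\langle x_i,x_j\rangle^p$. $\preceq$ is the Loewner order. The notations $\tilde O(\cdot),\tilde\Theta(\cdot)$ suppress $\mathrm{poly}(\log(nd/(\epsilon\delta)))$ factors. *)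

theory Defs
  imports "HOL-Probability.Probability_Mass_Function" "Jordan_Normal_Form.Matrix"
begin

text \<open>Dimensions vary with the parameters, so vectors and matrices are the carrier-based ones of
  \<^theory>\<open>Jordan_Normal_Form.Matrix\<close>; matrix and vector indices start at 0.\<close>

section \<open>Tensor powers\<close>

definition kron :: "real vec \<Rightarrow> real vec \<Rightarrow> real vec" where
  "kron u v = vec (dim_vec u * dim_vec v)
     (\<lambda>i. vec_index u (i div dim_vec v) * vec_index v (i mod dim_vec v))"

primrec vec_tpow :: "real vec \<Rightarrow> nat \<Rightarrow> real vec" where
  "vec_tpow x 0 = vec 1 (\<lambda>_. 1)"
| "vec_tpow x (Suc p) = kron x (vec_tpow x p)"

definition mat_tpow :: "real mat \<Rightarrow> nat \<Rightarrow> real mat" where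
  "mat_tpow X p = mat (dim_row X ^ p) (dim_col X) (\<lambda>(i, j). vec_index (vec_tpow (col X j) p) i)"

definition gram :: "real mat \<Rightarrow> real mat" where
  "gram A = transpose_mat A * A"

section \<open>Loewner order\<close>

definition psd :: "real mat \<Rightarrow> bool" where
  "psd A \<longleftrightarrow> square_mat A \<and> transpose_mat A = A \<and>
     (\<forall>v \<in> carrier_vec (dim_row A). scalar_prod v (mult_mat_vec A v) \<ge> 0)"

definition loewner_le :: "real mat \<Rightarrow> real mat \<Rightarrow> bool" (infix "\<preceq>\<^sub>L" 50) where
  "A \<preceq>\<^sub>L B \<longleftrightarrow> dim_row A = dim_row B \<and> dim_col A = dim_col B \<and> psd (B - A)"

section \<open>Soft asymptotic notation\<close>

text \<open>Quantities depend on \<open>(n, d, p, \<epsilon>, \<delta>)\<close>, and the constants hidden by the soft notation are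
  uniform in all five. Only powers of \<open>log (nd/(\<epsilon>\<delta>))\<close> are suppressed; in particular \<open>log p\<close> is not.
  The summand 1 keeps the factor bounded below when \<open>nd/(\<epsilon>\<delta>)\<close> is close to 1.\<close>

type_synonym 'a quantity = "nat \<Rightarrow> nat \<Rightarrow> nat \<Rightarrow> real \<Rightarrow> real \<Rightarrow> 'a"

definition valid_params :: "bool quantity" where
  "valid_params n d p \<epsilon> \<delta> \<longleftrightarrow>
     0 < n \<and> 0 < d \<and> 0 < p \<and> 0 < \<epsilon> \<and> \<epsilon> < 1 \<and> 0 < \<delta> \<and> \<delta> < 1"

definition soft_O :: "real quantity \<Rightarrow> real quantity \<Rightarrow> bool" where
  "soft_O f g \<longleftrightarrow> (\<exists>C > 0. \<exists>c :: nat. \<forall>n d p \<epsilon> \<delta>. valid_params n d p \<epsilon> \<delta> \<longrightarrow>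
     f n d p \<epsilon> \<delta> \<le> C * (1 + ln (real n * real d / (\<epsilon> * \<delta>))) ^ c * g n d p \<epsilon> \<delta>)"

definition soft_Theta :: "real quantity \<Rightarrow> real quantity \<Rightarrow> bool" where
  "soft_Theta f g \<longleftrightarrow> soft_O f g \<and> soft_O g f"

section \<open>A randomized real RAM with unit-cost steps\<close>

text \<open>A program has finitely many integer and real registers and finitely many (unbounded) integer
  and real arrays, each named by a number. Every elementary instruction and every test costs one
  step. On integers there is only addition, truncated subtraction and comparison, so that within
  \<open>t\<close> steps they grow by at most \<open>t\<close> bits; there is no rounding of reals to integers, and the only
  real constants are integers. \<^term>\<open>coins\<close> is the unread part of the tape of random bits.\<close>

record state =
  ireg :: "nat \<Rightarrow> nat"
  rreg :: "nat \<Rightarrow> real"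
  iarr :: "nat \<Rightarrow> nat \<Rightarrow> nat"
  rarr :: "nat \<Rightarrow> nat \<Rightarrow> real"
  coins :: "bool list"

datatype instr =
    IConst nat nat
  | IAdd nat nat nat
  | ISub nat nat nat
  | ILoad nat nat nat
  | IStore nat nat nat
  | RConst nat int
  | RAdd nat nat nat
  | RSub nat nat nat
  | RMul nat nat nat
  | RDiv nat nat nat
  | RLoad nat nat nat
  | RStore nat nat nat
  | Flip nat

definition iset :: "nat \<Rightarrow> nat \<Rightarrow> state \<Rightarrow> state" where
  "iset r k s = s\<lparr>ireg := (ireg s)(r := k)\<rparr>"

definition rset :: "nat \<Rightarrow> real \<Rightarrow> state \<Rightarrow> state" where
  "rset r x s = s\<lparr>rreg := (rreg s)(r := x)\<rparr>"

text \<open>The result is \<^const>\<open>None\<close> only when a bit is requested from an exhausted tape.\<close>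

fun step :: "instr \<Rightarrow> state \<Rightarrow> state option" where
  "step (IConst r k) s = Some (iset r k s)"
| "step (IAdd r i j) s = Some (iset r (ireg s i + ireg s j) s)"
| "step (ISub r i j) s = Some (iset r (ireg s i - ireg s j) s)"
| "step (ILoad r a i) s = Some (iset r (iarr s a (ireg s i)) s)"
| "step (IStore a i r) s =
     Some (s\<lparr>iarr := (iarr s)(a := (iarr s a)(ireg s i := ireg s r))\<rparr>)"
| "step (RConst r k) s = Some (rset r (of_int k) s)"
| "step (RAdd r i j) s = Some (rset r (rreg s i + rreg s j) s)"
| "step (RSub r i j) s = Some (rset r (rreg s i - rreg s j) s)"
| "step (RMul r i j) s = Some (rset r (rreg s i * rreg s j) s)"
| "step (RDiv r i j) s = Some (rset r (rreg s i / rreg s j) s)"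
| "step (RLoad r a i) s = Some (rset r (rarr s a (ireg s i)) s)"
| "step (RStore a i r) s =
     Some (s\<lparr>rarr := (rarr s)(a := (rarr s a)(ireg s i := rreg s r))\<rparr>)"
| "step (Flip r) s = (case coins s of
       [] \<Rightarrow> None
     | b # bs \<Rightarrow> Some (iset r (of_bool b) (s\<lparr>coins := bs\<rparr>)))"

datatype test = ILess nat nat | RLess nat nat

fun holds :: "test \<Rightarrow> state \<Rightarrow> bool" where
  "holds (ILess i j) s \<longleftrightarrow> ireg s i < ireg s j"
| "holds (RLess i j) s \<longleftrightarrow> rreg s i < rreg s j"

datatype prog =
    Skip
  | Instr instr
  | Seq prog prog
  | Cond test prog prog
  | While test prog

text \<open>\<open>exec P s t s'\<close>: started in \<open>s\<close>, the program \<open>P\<close> halts in \<open>s'\<close> after \<open>t\<close> steps.\<close>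

inductive exec :: "prog \<Rightarrow> state \<Rightarrow> nat \<Rightarrow> state \<Rightarrow> bool" where
  Skip: "exec Skip s 1 s"
| Instr: "step i s = Some s' \<Longrightarrow> exec (Instr i) s 1 s'"
| Seq: "exec P s t\<^sub>1 s' \<Longrightarrow> exec Q s' t\<^sub>2 s'' \<Longrightarrow> exec (Seq P Q) s (t\<^sub>1 + t\<^sub>2) s''"
| CondTrue: "holds b s \<Longrightarrow> exec P s t s' \<Longrightarrow> exec (Cond b P Q) s (1 + t) s'"
| CondFalse: "\<not> holds b s \<Longrightarrow> exec Q s t s' \<Longrightarrow> exec (Cond b P Q) s (1 + t) s'"
| WhileFalse: "\<not> holds b s \<Longrightarrow> exec (While b P) s 1 s"
| WhileTrue: "holds b s \<Longrightarrow> exec P s t\<^sub>1 s' \<Longrightarrow> exec (While b P) s' t\<^sub>2 s'' \<Longrightarrow>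
    exec (While b P) s (1 + t\<^sub>1 + t\<^sub>2) s''"

text \<open>Input: \<open>n, d, p\<close> in integer registers 0, 1, 2; \<open>\<epsilon>, \<delta>\<close> in real registers 0, 1; \<open>X\<close> column by
  column in real array 0; everything else is 0.\<close>

definition input_state ::
    "nat \<Rightarrow> nat \<Rightarrow> nat \<Rightarrow> real \<Rightarrow> real \<Rightarrow> real mat \<Rightarrow> bool list \<Rightarrow> state" where
  "input_state n d p \<epsilon> \<delta> X w = \<lparr>
     ireg = (\<lambda>_. 0)(0 := n, 1 := d, 2 := p),
     rreg = (\<lambda>_. 0)(0 := \<epsilon>, 1 := \<delta>),
     iarr = (\<lambda>_ _. 0),
     rarr = (\<lambda>_ _. 0)(0 := (\<lambda>k. if k < n * d then index_mat X (k mod d, k div d) else 0)),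
     coins = w\<rparr>"

text \<open>Output: the number of rows in integer register 0 and the matrix column by column in real
  array 1.\<close>

definition outputs :: "state \<Rightarrow> real mat \<Rightarrow> bool" where
  "outputs s A \<longleftrightarrow> ireg s 0 = dim_row A \<and>
     (\<forall>i < dim_row A. \<forall>j < dim_col A. rarr s 1 (j * dim_row A + i) = index_mat A (i, j))"

definition coin_tosses :: "nat \<Rightarrow> bool list pmf" where
  "coin_tosses l = pmf_of_set {w. length w = l}"

text \<open>The program both draws \<open>\<Pi>\<close> from \<open>D\<close> and computes \<open>\<Pi> X\<^sup>\<otimes>\<^sup>p\<close>: the random bits \<open>w\<close> determine a
  matrix \<open>S w\<close> distributed as \<open>D\<close>, independently of \<open>X\<close>, and on every \<open>X\<close> and every \<open>w\<close> the output is
  \<open>S w * X\<^sup>\<otimes>\<^sup>p\<close> after at most \<open>T\<close> steps.\<close>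

definition sketches_in_time ::
    "prog \<Rightarrow> nat \<Rightarrow> nat \<Rightarrow> nat \<Rightarrow> real \<Rightarrow> real \<Rightarrow> real mat pmf \<Rightarrow> real \<Rightarrow> bool" where
  "sketches_in_time P n d p \<epsilon> \<delta> D T \<longleftrightarrow> (\<exists>l S. D = map_pmf S (coin_tosses l) \<and>
     (\<forall>X \<in> carrier_mat d n. \<forall>w. length w = l \<longrightarrow>
       (\<exists>t s. exec P (input_state n d p \<epsilon> \<delta> X w) t s \<and> real t \<le> T \<and>
              outputs s (S w * mat_tpow X p))))"

end

(* Writing q = p div 2^l, the tensor power x^p is reached from x^q by l steps z -> z (x) z (x) u, where u is x or
   a unit vector according to the binary digits of p. Only x^q is formed exactly. At every step the three factors
   are randomly signed, Hadamard transformed and sampled independently, which sketches z (x) z (x) u without ever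
   forming it. One such step is an oblivious subspace embedding: the vector Khintchine inequality, applied to each
   factor in turn, shows that the transformed rows of an orthonormal basis are flat, and a matrix Bernstein
   inequality controls sampling. For the latter, the traces of all powers of a sum of random rank-one operators
   are bounded one summand at a time, using only that the moments <v, A^k v> of a positive operator are
   log-convex. Errors compose because an inequality between positive kernels survives Schur multiplication by a
   positive kernel. As the level with r levels to go is distorted by the later ones by a factor 2^r, sample sizes
   of order n 4^l / eps^2, thus n p^2 / eps^2, suffice at all levels. *)
theory Submission
  imports Defs
begin

subsection \<open>Averages over coin tosses\<close>

text \<open>Factors \<open>log p\<close> are not suppressed, while the number \<open>l\<close> of
  levels, and with it the transform length \<open>2 ^ L\<close>, may grow with \<open>p\<close>; so
  no bound may lose a factor \<open>l\<close>. The obstacle is flatness of the transformed rows, as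
  a union bound over all \<open>2 ^ (3 * L)\<close> of them needs a threshold that depends on
  \<open>L\<close>. So there are two thresholds. The one for every row, \<open>B\<close>, enters the
  Bernstein inequality only through \<open>\<eta> * B \<le> 2 * V\<close>, and \<eta>, at most
  \<open>(3 / 4) ^ l\<close>, leaves room for it. The variance \<open>V\<close> is governed by a
  smaller \<tau>; rows above it are rare in mean square, which is shown by averaging over rows,
  without \<open>L\<close>. In the running time, factors \<open>l\<close> are absorbed by
  \<open>l * 2 ^ l \<le> 2 * K * p\<close>, a consequence of the minimality of \<open>l\<close>.

  The number of rows must match \<open>n p^2 / \<epsilon>^2\<close> from below too, where
  \<open>n 4^l / \<epsilon>^2\<close> may be far smaller; hence zero rows are appended. The machine
  has no logarithms, roots or integer products: parameters are least indices found by loops, and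
  sample sizes are powers of four, with rational square roots.\<close>

definition avg :: "nat \<Rightarrow> (bool list \<Rightarrow> real) \<Rightarrow> real" where
  "avg l f = (\<Sum>w\<in>{w. length w = l}. f w) / 2 ^ l"

lemma finite_lists [simp]: "finite {w :: bool list. length w = l}"
  using finite_lists_length_eq[of "UNIV :: bool set" l] by simp

lemma card_bool_lists: "card {w :: bool list. length w = l} = 2 ^ l"
  using card_lists_length_eq[of "UNIV :: bool set" l] by simp

lemma avg_0 [simp]: "avg 0 f = f []"
  by (simp add: avg_def)

lemma sum_lists_append:
  fixes f :: "bool list \<Rightarrow> real"
  shows "(\<Sum>w\<in>{w. length w = a + b}. f w) =
    (\<Sum>u\<in>{w. length w = a}. \<Sum>v\<in>{w. length w = b}. f (u @ v))"
proof -
  have "(\<Sum>u\<in>{w. length w = a}. \<Sum>v\<in>{w. length w = b}. f (u @ v)) =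
     (\<Sum>(u, v)\<in>{w. length w = a} \<times> {w. length w = b}. f (u @ v))"
    by (simp add: sum.cartesian_product)
  also have "\<dots> = (\<Sum>w\<in>{w. length w = a + b}. f w)"
    by (rule sum.reindex_bij_witness[of _ "\<lambda>w. (take a w, drop a w)" "\<lambda>(u, v). u @ v"]) auto
  finally show ?thesis by simp
qed

text \<open>Disjoint segments of a uniform string are independent and uniform. Together with
  \<open>avg_swap\<close> this is the only form in which independence is used.\<close>

lemma avg_append: "avg (a + b) f = avg a (\<lambda>u. avg b (\<lambda>v. f (u @ v)))"
  by (simp add: avg_def sum_lists_append sum_divide_distrib power_add field_simps)

lemma avg_swap: "avg a (\<lambda>u. avg b (f u)) = avg b (\<lambda>v. avg a (\<lambda>u. f u v))"
proof -
  have "avg a (\<lambda>u. avg b (f u)) = (\<Sum>u\<in>{w. length w = a}. \<Sum>v\<in>{w. length w = b}. f u v) / 2 ^ b / 2 ^ a"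
    by (simp add: avg_def sum_divide_distrib)
  also have "\<dots> = (\<Sum>v\<in>{w. length w = b}. \<Sum>u\<in>{w. length w = a}. f u v) / 2 ^ a / 2 ^ b"
    by (subst sum.swap) (simp add: field_simps)
  finally show ?thesis by (simp add: avg_def sum_divide_distrib)
qed

lemma avg_mono:
  assumes "\<And>w. length w = l \<Longrightarrow> f w \<le> g w"
  shows "avg l f \<le> avg l g"
  unfolding avg_def using assms by (intro divide_right_mono sum_mono) auto

lemma avg_cong:
  assumes "\<And>w. length w = l \<Longrightarrow> f w = g w"
  shows "avg l f = avg l g"
  unfolding avg_def using assms by (intro arg_cong2[where f="(/)"] sum.cong) auto

lemma avg_const [simp]: "avg l (\<lambda>_. c) = c"
  by (simp add: avg_def card_bool_lists)

lemma avg_add: "avg l (\<lambda>w. f w + g w) = avg l f + avg l g"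
  by (simp add: avg_def sum.distrib add_divide_distrib)

lemma avg_cmult: "avg l (\<lambda>w. c * f w) = c * avg l f"
  by (simp add: avg_def sum_distrib_left)

lemma avg_sum: "avg l (\<lambda>w. \<Sum>i\<in>I. f i w) = (\<Sum>i\<in>I. avg l (f i))"
  unfolding avg_def by (subst sum.swap) (simp add: sum_divide_distrib)

lemma avg_Suc: "avg (Suc l) f = (avg l (\<lambda>w. f (True # w)) + avg l (\<lambda>w. f (False # w))) / 2"
proof -
  have *: "{w. length w = Suc 0} = {[True], [False]}" by (auto simp: length_Suc_conv)
  show ?thesis
    using avg_append[of 1 l f] by (simp add: avg_def[of "Suc 0"] *)
qed

text \<open>The only bridge to measure theory; everywhere else a probability is a finite average of
  an indicator.\<close>

lemma prob_coin_tosses: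
  "measure_pmf.prob (map_pmf S (coin_tosses l)) A = avg l (\<lambda>w. indicator A (S w))"
proof -
  have ne: "{w :: bool list. length w = l} \<noteq> {}"
  proof -
    have "replicate l True \<in> {w. length w = l}" by simp
    then show ?thesis by blast
  qed
  have "measure_pmf.prob (map_pmf S (coin_tosses l)) A = measure_pmf.prob (coin_tosses l) (S -` A)"
    by simp
  also have "\<dots> = real (card ({w. length w = l} \<inter> S -` A)) / 2 ^ l"
    unfolding coin_tosses_def by (subst measure_pmf_of_set[OF ne finite_lists]) (simp add: card_bool_lists)
  also have "real (card ({w. length w = l} \<inter> S -` A)) = (\<Sum>w\<in>{w. length w = l}. indicator A (S w))"
    by (simp add: indicator_def sum.If_cases Int_def)
  finally show ?thesis by (simp add: avg_def)
qed

subsection \<open>Indices and signs read from coins\<close>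

fun bval :: "bool list \<Rightarrow> nat" where
  "bval [] = 0"
| "bval (b # w) = of_bool b * 2 ^ length w + bval w"

lemma bval_less: "bval w < 2 ^ length w"
  by (induction w) auto

lemma bval_snoc: "bval (w @ [b]) = 2 * bval w + of_bool b"
  by (induction w) (auto simp: algebra_simps)

text \<open>The leading coin selects the lower or the upper half of the range, so
  \<open>bval\<close> of a uniform string is uniform below \<open>2 ^ l\<close>.\<close>

lemma avg_bval: "avg l (\<lambda>w. f (bval w)) = (\<Sum>a<2 ^ l. f a) / 2 ^ l"
proof (induction l arbitrary: f)
  case 0
  then show ?case by (simp add: lessThan_Suc)
next
  case (Suc l)
  have s: "(\<Sum>a<2 ^ l + 2 ^ l. f a) = (\<Sum>a<2 ^ l. f a) + (\<Sum>a<2 ^ l. f (2 ^ l + a))"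
    using sum.atLeastLessThan_concat[of 0 "2^l" "2^l + 2^l" f] sum.shift_bounds_nat_ivl[of f 0 "2^l" "2^l"]
    by (simp add: lessThan_atLeast0 add.commute)
  have "avg (Suc l) (\<lambda>w. f (bval w)) = (avg l (\<lambda>w. f (2 ^ length w + bval w)) + avg l (\<lambda>w. f (bval w))) / 2"
    by (simp add: avg_Suc)
  also have "avg l (\<lambda>w. f (2 ^ length w + bval w)) = avg l (\<lambda>w. f (2 ^ l + bval w))"
    by (rule avg_cong) simp
  also have "\<dots> = (\<Sum>a<2 ^ l. f (2 ^ l + a)) / 2 ^ l"
    by (rule Suc.IH[of "\<lambda>a. f (2 ^ l + a)"])
  finally have "avg (Suc l) (\<lambda>w. f (bval w)) = (\<Sum>a<2 ^ l + 2 ^ l. f a) / (2 * 2 ^ l)"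
    unfolding s Suc.IH[of f] by (simp add: add_divide_distrib)
  then show ?case by (simp only: power_Suc mult_2)
qed

definition sg :: "bool \<Rightarrow> real" where "sg b = (if b then 1 else -1)"

lemma sg_sq [simp]: "sg b * sg b = 1" by (simp add: sg_def)

definition idx :: "nat \<Rightarrow> bool list \<Rightarrow> nat \<Rightarrow> nat" where
  "idx L x i = bval (take L (drop (i * L) x))"

lemma idx_less: "length x = m * L \<Longrightarrow> i < m \<Longrightarrow> idx L x i < 2 ^ L"
proof -
  assume "length x = m * L" "i < m"
  then have "i * L + L \<le> length x"
    by (metis Suc_leI mult_Suc mult_le_mono1 add.commute)
  then have "length (take L (drop (i * L) x)) = L" by simp
  then show ?thesis unfolding idx_def using bval_less by metis
qed

lemma idx_append_0: "length y = L \<Longrightarrow> idx L (y @ x) 0 = bval y"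
  by (simp add: idx_def)

lemma idx_append_Suc: "length y = L \<Longrightarrow> idx L (y @ x) (Suc i) = idx L x i"
  by (simp add: idx_def)

subsection \<open>Vector Khintchine inequality\<close>

text \<open>The odd double factorial \<open>(2k - 1)!!\<close>, the moment of order
  \<open>2k\<close> of a standard Gaussian and the classical constant in Khintchine's
  inequality.\<close>

fun dfact :: "nat \<Rightarrow> real" where
  "dfact 0 = 1" | "dfact (Suc k) = (2 * real k + 1) * dfact k"

lemma dfact_pos [simp]: "0 < dfact k" by (induction k) auto
lemma dfact_nonneg [simp]: "0 \<le> dfact k" using dfact_pos[of k] by linarith

lemma dfact_le: "dfact k \<le> (2 * real k) ^ k"
proof (induction k)
  case (Suc k)
  have "dfact (Suc k) \<le> (2 * real (Suc k)) * (2 * real k) ^ k"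
    using Suc by (auto intro!: mult_mono)
  also have "\<dots> \<le> (2 * real (Suc k)) * (2 * real (Suc k)) ^ k"
    by (intro mult_left_mono power_mono) auto
  finally show ?case by simp
qed simp

lemma dfact_fact: "dfact k * (2 ^ k * fact k) = fact (2 * k)"
proof (induction k)
  case (Suc k)
  have "dfact (Suc k) * (2 ^ Suc k * fact (Suc k)) = (2 * real k + 1) * (2 * real k + 2) * (dfact k * (2 ^ k * fact k))"
    by (simp add: field_simps)
  also have "\<dots> = fact (2 * Suc k)"
    unfolding Suc by (simp add: field_simps)
  finally show ?case .
qed simp

lemma pow2_fact_le: "2 ^ j * fact j \<le> (fact (2 * j) :: real)"
proof -
  have "1 * (2 ^ j * fact j) \<le> dfact j * (2 ^ j * fact j :: real)"
  proof (intro mult_right_mono)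
    show "1 \<le> dfact j" by (induction j) (auto intro: order_trans[OF _ mult_mono[of 1 _ 1, simplified]])
  qed simp
  then show ?thesis by (simp add: dfact_fact)
qed

text \<open>With \<open>dfact m = (2m)! / (2^m m!)\<close> both sides have the same numerator, and
  the claim reduces to \<open>pow2_fact_le\<close>. It turns an expansion over even powers into a
  binomial expansion that can be summed up again.\<close>

lemma dfact_choose:
  assumes "j \<le> k"
  shows "real (2 * k choose (2 * j)) * dfact (k - j) \<le> dfact k * real (k choose j)"
proof -
  have d: "dfact m = fact (2 * m) / (2 ^ m * fact m)" for m
    using dfact_fact[of m] by (simp add: field_simps)
  have e: "2 * k - 2 * j = 2 * (k - j)" by simp
  have c1: "real (2 * k choose (2 * j)) = fact (2 * k) / (fact (2 * j) * fact (2 * (k - j)))"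
    using binomial_fact[of "2 * j" "2 * k", where 'a = real] assms by (simp add: e)
  have c2: "real (k choose j) = fact k / (fact j * fact (k - j))"
    using binomial_fact[of j k, where 'a = real] assms by simp
  have "real (2 * k choose (2 * j)) * dfact (k - j) = fact (2 * k) / (fact (2 * j) * 2 ^ (k - j) * fact (k - j))"
    unfolding c1 d by (simp add: field_simps)
  also have "\<dots> \<le> fact (2 * k) / ((2 ^ j * fact j) * 2 ^ (k - j) * fact (k - j))"
    by (intro divide_left_mono mult_right_mono pow2_fact_le) auto
  also have "\<dots> = dfact k * real (k choose j)"
    unfolding c2 d using assms by (simp add: field_simps flip: power_add)
  finally show ?thesis .
qed

definition nsq :: "'i set \<Rightarrow> ('i \<Rightarrow> real) \<Rightarrow> real" where
  "nsq I v = (\<Sum>i\<in>I. (v i)\<^sup>2)"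

lemma nsq_nonneg [simp]: "0 \<le> nsq I v" by (simp add: nsq_def sum_nonneg)

lemma pow_sign_average:
  fixes A b :: real
  shows "((A + b) ^ k + (A - b) ^ k) / 2 = (\<Sum>j\<le>k. of_bool (even j) * real (k choose j) * A ^ (k - j) * b ^ j)"
proof -
  have "(A + b) ^ k = (\<Sum>j\<le>k. real (k choose j) * b ^ j * A ^ (k - j))"
    using binomial_ring[of b A k] by (simp add: add.commute)
  moreover have "(A - b) ^ k = (\<Sum>j\<le>k. real (k choose j) * (-b) ^ j * A ^ (k - j))"
    using binomial_ring[of "-b" A k] by (simp add: add.commute)
  ultimately have "((A + b) ^ k + (A - b) ^ k) / 2 = (\<Sum>j\<le>k. (real (k choose j) * b ^ j * A ^ (k - j) + real (k choose j) * (-b) ^ j * A ^ (k - j)) / 2)"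
    by (simp add: sum.distrib sum_divide_distrib add_divide_distrib)
  also have "\<dots> = (\<Sum>j\<le>k. of_bool (even j) * real (k choose j) * A ^ (k - j) * b ^ j)"
    by (intro sum.cong) (auto simp: uminus_power_if)
  finally show ?thesis .
qed

text \<open>Averaging over the sign removes the odd powers of \<open>b\<close>, and the even ones
  are monotone in its absolute value, with nonnegative coefficients because
  \<open>0 \<le> A\<close>.\<close>

lemma pow_sign_average_mono:
  fixes A b c :: real
  assumes "0 \<le> A" "\<bar>b\<bar> \<le> c"
  shows "((A + b) ^ k + (A - b) ^ k) / 2 \<le> ((A + c) ^ k + (A - c) ^ k) / 2"
  unfolding pow_sign_average
proof (intro sum_mono)
  fix j
  have "b ^ j \<le> c ^ j" if "even j"
    using power_mono[of "\<bar>b\<bar>" c j] assms that by (simp add: power_even_abs)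
  then show "of_bool (even j) * real (k choose j) * A ^ (k - j) * b ^ j \<le> of_bool (even j) * real (k choose j) * A ^ (k - j) * c ^ j"
    using assms(1) by (auto intro!: mult_left_mono)
qed

lemma pow_sign_average_even:
  fixes x y :: real
  shows "((x + y) ^ (2 * k) + (x - y) ^ (2 * k)) / 2 = (\<Sum>j\<le>k. real (2 * k choose (2 * j)) * (x\<^sup>2) ^ (k - j) * (y\<^sup>2) ^ j)"
proof -
  have "(\<Sum>j\<le>2*k. of_bool (even j) * real (2*k choose j) * x ^ (2*k - j) * y ^ j) =
     (\<Sum>j\<in>(\<lambda>j. 2 * j) ` {..k}. real (2*k choose j) * x ^ (2*k - j) * y ^ j)"
    by (rule sum.mono_neutral_cong_right) (auto elim!: evenE)
  also have "\<dots> = (\<Sum>j\<le>k. real (2 * k choose (2 * j)) * (x\<^sup>2) ^ (k - j) * (y\<^sup>2) ^ j)"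
    by (subst sum.reindex) (auto intro!: sum.cong simp: inj_on_def diff_mult_distrib2 simp flip: power_mult)
  finally show ?thesis by (simp add: pow_sign_average)
qed

text \<open>The two squared lengths are \<open>A + b\<close> and \<open>A - b\<close>, and by
  Cauchy-Schwarz the worst \<open>b\<close> is that of collinear vectors. So the vector case is
  dominated by the scalar one, with \<open>x\<close> and \<open>y\<close> the two lengths.\<close>

lemma nsq_add_sign_average:
  fixes S w :: "'i \<Rightarrow> real"
  assumes "finite I"
  shows "(nsq I (\<lambda>i. S i + w i) ^ k + nsq I (\<lambda>i. S i - w i) ^ k) / 2
      \<le> (\<Sum>j\<le>k. real (2 * k choose (2 * j)) * nsq I S ^ (k - j) * nsq I w ^ j)"
proof -
  define A where "A = nsq I S + nsq I w"
  define b where "b = 2 * (\<Sum>i\<in>I. S i * w i)"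
  define x where "x = sqrt (nsq I S)"
  define y where "y = sqrt (nsq I w)"
  have x: "x\<^sup>2 = nsq I S" "0 \<le> x" and y: "y\<^sup>2 = nsq I w" "0 \<le> y" by (simp_all add: x_def y_def)
  have 1: "nsq I (\<lambda>i. S i + w i) = A + b" "nsq I (\<lambda>i. S i - w i) = A - b"
    by (simp_all add: nsq_def A_def b_def power2_sum power2_diff sum.distrib sum_subtractf sum_distrib_left mult_ac)
  have "(\<Sum>i\<in>I. S i * w i)\<^sup>2 \<le> nsq I S * nsq I w"
    unfolding nsq_def by (rule Cauchy_Schwarz_ineq_sum)
  also have "\<dots> = (x * y)\<^sup>2" by (simp add: x y power_mult_distrib)
  finally have "\<bar>\<Sum>i\<in>I. S i * w i\<bar> \<le> x * y"
    using x y by (simp add: abs_le_square_iff flip: abs_le_square_iff)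
  then have b: "\<bar>b\<bar> \<le> 2 * (x * y)" by (simp add: b_def abs_mult)
  have "(nsq I (\<lambda>i. S i + w i) ^ k + nsq I (\<lambda>i. S i - w i) ^ k) / 2 = ((A + b) ^ k + (A - b) ^ k) / 2"
    unfolding 1 ..
  also have "\<dots> \<le> ((A + 2 * (x * y)) ^ k + (A - 2 * (x * y)) ^ k) / 2"
    by (rule pow_sign_average_mono[OF _ b]) (simp add: A_def)
  also have "\<dots> = ((x + y) ^ (2 * k) + (x - y) ^ (2 * k)) / 2"
    unfolding power_mult[of "x + y"] power_mult[of "x - y"]
    by (simp add: power2_sum power2_diff A_def x y mult_ac)
  also have "\<dots> = (\<Sum>j\<le>k. real (2 * k choose (2 * j)) * nsq I S ^ (k - j) * nsq I w ^ j)"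
    unfolding pow_sign_average_even x y ..
  finally show ?thesis .
qed

text \<open>One sign is split off and averaged explicitly; the induction hypothesis is applied to
  all moments \<open>k - j\<close>, hence the generalisation over \<open>k\<close>. By
  \<open>dfact_choose\<close> the sum closes up to the binomial
  \<open>(nsq I (w 0) + W) ^ k\<close>.\<close>

lemma Khintchine_vector:
  assumes I: "finite I"
  shows "avg N (\<lambda>s. nsq I (\<lambda>i. \<Sum>a<N. sg (s ! a) * w a i) ^ k) \<le> dfact k * (\<Sum>a<N. nsq I (w a)) ^ k"
proof (induction N arbitrary: w k)
  case 0
  then show ?case using I by (cases k) (simp_all add: nsq_def)
next
  case (Suc N)
  define S where "S = (\<lambda>s i. \<Sum>a<N. sg (s ! a) * w (Suc a) i)"
  define W where "W = (\<Sum>a<N. nsq I (w (Suc a)))"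
  have W: "0 \<le> W" by (simp add: W_def sum_nonneg)
  have 1: "(\<Sum>a<Suc N. sg ((b # s) ! a) * w a i) = S s i + sg b * w 0 i" for s b i
    unfolding S_def by (subst sum.lessThan_Suc_shift) simp
  have "avg (Suc N) (\<lambda>s. nsq I (\<lambda>i. \<Sum>a<Suc N. sg (s ! a) * w a i) ^ k) =
     avg N (\<lambda>s. (nsq I (\<lambda>i. S s i + w 0 i) ^ k + nsq I (\<lambda>i. S s i - w 0 i) ^ k) / 2)"
    unfolding avg_Suc 1 using avg_cmult[of N "1/2"] by (simp add: sg_def avg_add)
  also have "\<dots> \<le> avg N (\<lambda>s. \<Sum>j\<le>k. real (2 * k choose (2 * j)) * nsq I (w 0) ^ j * nsq I (S s) ^ (k - j))"
    using nsq_add_sign_average[OF I] by (intro avg_mono) (simp add: mult_ac)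
  also have "\<dots> = (\<Sum>j\<le>k. real (2 * k choose (2 * j)) * nsq I (w 0) ^ j * avg N (\<lambda>s. nsq I (S s) ^ (k - j)))"
    unfolding avg_sum avg_cmult ..
  also have "\<dots> \<le> (\<Sum>j\<le>k. real (2 * k choose (2 * j)) * nsq I (w 0) ^ j * (dfact (k - j) * W ^ (k - j)))"
    unfolding S_def W_def by (intro sum_mono mult_left_mono Suc.IH) auto
  also have "\<dots> = (\<Sum>j\<le>k. (real (2 * k choose (2 * j)) * dfact (k - j)) * (nsq I (w 0) ^ j * W ^ (k - j)))"
    by (simp add: mult_ac)
  also have "\<dots> \<le> (\<Sum>j\<le>k. (dfact k * real (k choose j)) * (nsq I (w 0) ^ j * W ^ (k - j)))"
    using W by (intro sum_mono mult_right_mono dfact_choose) auto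
  also have "\<dots> = dfact k * (nsq I (w 0) + W) ^ k"
    by (simp add: binomial_ring sum_distrib_left mult_ac)
  also have "nsq I (w 0) + W = (\<Sum>a<Suc N. nsq I (w a))"
    unfolding W_def by (subst sum.lessThan_Suc_shift) simp
  finally show ?case .
qed

lemma nsq_prod:
  "finite I \<Longrightarrow> finite J \<Longrightarrow> nsq (J \<times> I) (\<lambda>(j, i). f j i) = (\<Sum>j\<in>J. nsq I (f j))"
  by (simp add: nsq_def sum.cartesian_product case_prod_unfold)

text \<open>With the outer signs fixed, the sum is linear in the inner ones. The bound that results
  is again a squared length, over the enlarged index set \<open>{..<N'} \<times> I\<close>, so the
  inequality applies once more. A scalar inequality could not be iterated in this way.\<close>

lemma Khintchine_vector2:
  assumes I: "finite I"
  shows "avg N (\<lambda>s. avg N' (\<lambda>s'. nsq I (\<lambda>i. \<Sum>a<N. \<Sum>b<N'. sg (s ! a) * sg (s' ! b) * w a b i) ^ k))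
     \<le> dfact k ^ 2 * (\<Sum>a<N. \<Sum>b<N'. nsq I (w a b)) ^ k"
proof -
  have "avg N' (\<lambda>s'. nsq I (\<lambda>i. \<Sum>a<N. \<Sum>b<N'. sg (s ! a) * sg (s' ! b) * w a b i) ^ k)
    \<le> dfact k * nsq ({..<N'} \<times> I) (\<lambda>p. \<Sum>a<N. sg (s ! a) * w a (fst p) (snd p)) ^ k" for s
  proof -
    have "(\<Sum>a<N. \<Sum>b<N'. sg (s ! a) * sg (s' ! b) * w a b i) = (\<Sum>b<N'. sg (s' ! b) * (\<Sum>a<N. sg (s ! a) * w a b i))" for s' i
      by (subst sum.swap) (simp add: sum_distrib_left mult_ac)
    then show ?thesis
      using Khintchine_vector[OF I, of N' "\<lambda>b i. \<Sum>a<N. sg (s ! a) * w a b i" k]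
        nsq_prod[OF I, of "{..<N'}" "\<lambda>b i. \<Sum>a<N. sg (s ! a) * w a b i"]
      by (simp add: case_prod_unfold)
  qed
  then have "avg N (\<lambda>s. avg N' (\<lambda>s'. nsq I (\<lambda>i. \<Sum>a<N. \<Sum>b<N'. sg (s ! a) * sg (s' ! b) * w a b i) ^ k))
    \<le> avg N (\<lambda>s. dfact k * nsq ({..<N'} \<times> I) (\<lambda>p. \<Sum>a<N. sg (s ! a) * w a (fst p) (snd p)) ^ k)"
    by (intro avg_mono)
  also have "\<dots> \<le> dfact k * (dfact k * (\<Sum>a<N. nsq ({..<N'} \<times> I) (\<lambda>p. w a (fst p) (snd p))) ^ k)"
    unfolding avg_cmult using I by (intro mult_left_mono Khintchine_vector) auto
  also have "\<dots> = dfact k ^ 2 * (\<Sum>a<N. \<Sum>b<N'. nsq I (w a b)) ^ k"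
    using nsq_prod[OF I, of "{..<N'}"] by (simp add: case_prod_unfold power2_eq_square)
  finally show ?thesis .
qed

lemma Khintchine_vector3:
  assumes I: "finite I"
  shows "avg N (\<lambda>s. avg N' (\<lambda>s'. avg N'' (\<lambda>s''. nsq I (\<lambda>i. \<Sum>a<N. \<Sum>b<N'. \<Sum>c<N''. sg (s ! a) * sg (s' ! b) * sg (s'' ! c) * w a b c i) ^ k)))
     \<le> dfact k ^ 3 * (\<Sum>a<N. \<Sum>b<N'. \<Sum>c<N''. nsq I (w a b c)) ^ k"
proof -
  have "avg N'' (\<lambda>s''. nsq I (\<lambda>i. \<Sum>a<N. \<Sum>b<N'. \<Sum>c<N''. sg (s ! a) * sg (s' ! b) * sg (s'' ! c) * w a b c i) ^ k)
    \<le> dfact k * nsq ({..<N''} \<times> I) (\<lambda>p. \<Sum>a<N. \<Sum>b<N'. sg (s ! a) * sg (s' ! b) * w a b (fst p) (snd p)) ^ k" for s s'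
  proof -
    have "(\<Sum>a<N. \<Sum>b<N'. \<Sum>c<N''. sg (s ! a) * sg (s' ! b) * sg (s'' ! c) * w a b c i)
       = (\<Sum>c<N''. sg (s'' ! c) * (\<Sum>a<N. \<Sum>b<N'. sg (s ! a) * sg (s' ! b) * w a b c i))" for s'' i
    proof -
      have "(\<Sum>a<N. \<Sum>b<N'. \<Sum>c<N''. sg (s ! a) * sg (s' ! b) * sg (s'' ! c) * w a b c i)
        = (\<Sum>a<N. \<Sum>c<N''. \<Sum>b<N'. sg (s ! a) * sg (s' ! b) * sg (s'' ! c) * w a b c i)"
        by (intro sum.cong refl sum.swap)
      also have "\<dots> = (\<Sum>c<N''. \<Sum>a<N. \<Sum>b<N'. sg (s ! a) * sg (s' ! b) * sg (s'' ! c) * w a b c i)"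
        by (rule sum.swap)
      finally show ?thesis by (simp add: sum_distrib_left mult_ac)
    qed
    then show ?thesis
      using Khintchine_vector[OF I, of N'' "\<lambda>c i. \<Sum>a<N. \<Sum>b<N'. sg (s ! a) * sg (s' ! b) * w a b c i" k]
        nsq_prod[OF I, of "{..<N''}" "\<lambda>c i. \<Sum>a<N. \<Sum>b<N'. sg (s ! a) * sg (s' ! b) * w a b c i"]
      by (simp add: case_prod_unfold)
  qed
  then have "avg N (\<lambda>s. avg N' (\<lambda>s'. avg N'' (\<lambda>s''. nsq I (\<lambda>i. \<Sum>a<N. \<Sum>b<N'. \<Sum>c<N''. sg (s ! a) * sg (s' ! b) * sg (s'' ! c) * w a b c i) ^ k)))
    \<le> avg N (\<lambda>s. avg N' (\<lambda>s'. dfact k * nsq ({..<N''} \<times> I) (\<lambda>p. \<Sum>a<N. \<Sum>b<N'. sg (s ! a) * sg (s' ! b) * w a b (fst p) (snd p)) ^ k))"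
    by (intro avg_mono)
  also have "\<dots> \<le> dfact k * (dfact k ^ 2 * (\<Sum>a<N. \<Sum>b<N'. nsq ({..<N''} \<times> I) (\<lambda>p. w a b (fst p) (snd p))) ^ k)"
    unfolding avg_cmult using I by (intro mult_left_mono Khintchine_vector2) auto
  also have "\<dots> = dfact k ^ 3 * (\<Sum>a<N. \<Sum>b<N'. \<Sum>c<N''. nsq I (w a b c)) ^ k"
    using nsq_prod[OF I, of "{..<N''}"] by (simp add: case_prod_unfold power2_eq_square power3_eq_cube)
  finally show ?thesis .
qed

subsection \<open>The fast Hadamard transform\<close>

text \<open>The butterfly in constant geometry: all rounds have the same access pattern, so a program needs no
  division or shift to index it.\<close>

definition hstep :: "nat \<Rightarrow> (nat \<Rightarrow> real) \<Rightarrow> nat \<Rightarrow> real" where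
  "hstep H f i = (if i < H then f (2 * i) + f (2 * i + 1) else f (2 * (i - H)) - f (2 * (i - H) + 1))"

definition had :: "nat \<Rightarrow> (nat \<Rightarrow> real) \<Rightarrow> nat \<Rightarrow> real" where
  "had L f = (hstep (2 ^ (L - 1)) ^^ L) f"

text \<open>Coefficients of \<open>t\<close> rounds. Only their absolute value 1 is ever used;
  orthogonality comes from \<open>hstep\<close> directly, so the sign pattern need not be identified
  with a Walsh matrix.\<close>

fun hsign :: "nat \<Rightarrow> nat \<Rightarrow> nat \<Rightarrow> nat \<Rightarrow> real" where
  "hsign H 0 i c = 1"
| "hsign H (Suc t) i c = (let i' = if i < H then i else i - H in
     if c < 2 ^ t then hsign H t (2 * i') c
     else (if i < H then 1 else -1) * hsign H t (2 * i' + 1) (c - 2 ^ t))"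

lemma abs_hsign [simp]: "\<bar>hsign H t i c\<bar> = 1"
  by (induction t arbitrary: i c) (auto simp: Let_def abs_mult)

lemma sum_lessThan_double: "(\<Sum>c<2 * (m::nat). f c) = (\<Sum>c<m. f c) + (\<Sum>c<m. f (m + c) :: real)"
  using sum.atLeastLessThan_concat[of 0 m "2 * m" f] sum.shift_bounds_nat_ivl[of f 0 m m]
  by (simp add: lessThan_atLeast0 add.commute mult_2)

lemma sum_lessThan_even_odd: "(\<Sum>c<2 * (m::nat). f c) = (\<Sum>c<m. f (2 * c) + f (2 * c + 1) :: real)"
  by (induction m) auto

text \<open>After \<open>t\<close> rounds, entry \<open>i\<close> combines a block of
  \<open>2 ^ t\<close> consecutive inputs, and the low bits of \<open>i\<close> are the number of
  the block. One more round joins the blocks numbered \<open>2c\<close> and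
  \<open>2c + 1\<close>.\<close>

lemma hstep_pow:
  assumes "t \<le> L" "i < 2 ^ L"
  shows "(hstep (2 ^ (L - 1)) ^^ t) f i =
    (\<Sum>c<2 ^ t. hsign (2 ^ (L - 1)) t i c * f ((i mod 2 ^ (L - t)) * 2 ^ t + c))"
  using assms
proof (induction t arbitrary: i)
  case 0
  then show ?case by simp
next
  case (Suc t)
  define H where "H = (2::nat) ^ (L - 1)"
  have L: "2 ^ L = 2 * H" using Suc.prems unfolding H_def by (cases L) auto
  define i' where "i' = (if i < H then i else i - H)"
  have i': "i' < H" using Suc.prems L by (auto simp: i'_def)
  have e: "L - t = Suc (L - Suc t)" using Suc.prems by simp
  \<comment> \<open>\<open>H\<close> is a multiple of the modulus, so passing from \<open>i\<close>
    to \<open>i - H\<close> does not change the residue.\<close>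
  have dv: "(2::nat) ^ (L - Suc t) dvd H" unfolding H_def
    using Suc.prems by (intro le_imp_power_dvd) simp
  have im: "i mod 2 ^ (L - Suc t) = i' mod 2 ^ (L - Suc t)"
  proof (cases "i < H")
    case False
    then have "i = i' + H" by (simp add: i'_def)
    then show ?thesis using dv by (auto elim!: dvdE)
  qed (simp add: i'_def)
  have m0: "(2 * i') mod 2 ^ (L - t) = 2 * (i mod 2 ^ (L - Suc t))"
    unfolding e im power_Suc by (simp only: mult_mod_right)
  have m1: "(2 * i' + 1) mod 2 ^ (L - t) = 2 * (i mod 2 ^ (L - Suc t)) + 1"
    unfolding e im power_Suc by (subst mod_mult2_eq) simp
  have IH0: "(hstep H ^^ t) f (2 * i') = (\<Sum>c<2 ^ t. hsign H t (2 * i') c * f ((i mod 2 ^ (L - Suc t)) * 2 ^ Suc t + c))"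
    using Suc.IH[of "2 * i'"] Suc.prems i' L m0 by (simp add: H_def mult_ac)
  have IH1: "(hstep H ^^ t) f (2 * i' + 1) = (\<Sum>c<2 ^ t. hsign H t (2 * i' + 1) c * f ((i mod 2 ^ (L - Suc t)) * 2 ^ Suc t + (2 ^ t + c)))"
    using Suc.IH[of "2 * i' + 1"] Suc.prems i' L m1 by (simp add: H_def algebra_simps)
  have "(hstep H ^^ Suc t) f i = (hstep H ^^ t) f (2 * i') + (if i < H then 1 else -1) * (hstep H ^^ t) f (2 * i' + 1)"
    by (simp add: hstep_def i'_def)
  also have "\<dots> = (\<Sum>c<2 ^ Suc t. hsign H (Suc t) i c * f ((i mod 2 ^ (L - Suc t)) * 2 ^ Suc t + c))"
    unfolding IH0 IH1 power_Suc[of 2 t] sum_lessThan_double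
    by (simp add: i'_def Let_def sum_distrib_left mult_ac cong: if_cong)
  finally show ?case by (simp add: H_def)
qed

definition hcoef :: "nat \<Rightarrow> nat \<Rightarrow> nat \<Rightarrow> real" where
  "hcoef L = hsign (2 ^ (L - 1)) L"

lemma abs_hcoef [simp]: "\<bar>hcoef L i c\<bar> = 1"
  by (simp add: hcoef_def)

lemma had_eq: "i < 2 ^ L \<Longrightarrow> had L f i = (\<Sum>c<2 ^ L. hcoef L i c * f c)"
  using hstep_pow[of L L i f] by (simp add: had_def hcoef_def)

text \<open>On each pair of inputs the step sends (a, b) to (a + b, a - b), which is
  \<open>sqrt 2\<close> times an isometry.\<close>

lemma hstep_inner: "(\<Sum>i<2 * H. hstep H f i * hstep H g i) = 2 * (\<Sum>i<2 * H. f i * g i)"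
proof -
  have "(\<Sum>i<2 * H. hstep H f i * hstep H g i) =
    (\<Sum>i<H. (f (2*i) + f (2*i+1)) * (g (2*i) + g (2*i+1)) + (f (2*i) - f (2*i+1)) * (g (2*i) - g (2*i+1)))"
    unfolding sum_lessThan_double by (simp add: hstep_def sum.distrib)
  also have "\<dots> = 2 * (\<Sum>i<2 * H. f i * g i)"
    unfolding sum_lessThan_even_odd sum_distrib_left by (intro sum.cong) (auto simp: algebra_simps)
  finally show ?thesis .
qed

lemma had_inner: "(\<Sum>i<2 ^ L. had L f i * had L g i) = 2 ^ L * (\<Sum>i<2 ^ L. f i * g i)"
proof (cases L)
  case (Suc l)
  have "(\<Sum>i<2 * 2 ^ l. (hstep (2 ^ l) ^^ t) f i * (hstep (2 ^ l) ^^ t) g i) = 2 ^ t * (\<Sum>i<2 * 2 ^ l. f i * g i)" for t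
    by (induction t) (simp_all add: hstep_inner)
  from this[of "Suc l"] show ?thesis using Suc by (simp add: had_def)
qed (simp add: had_def)

subsection \<open>Moments of symmetric operators\<close>

text \<open>Moving two indices apart, with their sum fixed, does not decrease the product. This
  replaces spectral arguments: products of moments of an operator can be merged into a single
  moment.\<close>

lemma logconvex_mult_le:
  fixes f :: "nat \<Rightarrow> real"
  assumes nn: "\<And>k. 0 \<le> f k" and lc: "\<And>k. (f (Suc k))\<^sup>2 \<le> f k * f (Suc (Suc k))"
  shows "f a * f b \<le> f 0 * f (a + b)"
proof -
  have 1: "f (Suc a) * f (a + m) \<le> f a * f (Suc (a + m))" for a m
  proof (induction m)
    case (Suc m)
    let ?b = "a + m"
    show ?case
    \<comment> \<open>The induction step cancels this value; where it vanishes, the left-hand side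
      is zero.\<close>
    proof (cases "f (Suc ?b) = 0")
      case True
      then show ?thesis using nn by simp
    next
      case False
      then have pos: "0 < f (Suc ?b)" using nn[of "Suc ?b"] by simp
      have "f (Suc a) * f (Suc ?b) * f (Suc ?b) \<le> f (Suc a) * (f ?b * f (Suc (Suc ?b)))"
        using mult_left_mono[OF lc[of ?b] nn[of "Suc a"]] by (simp add: power2_eq_square mult_ac)
      also have "\<dots> \<le> f a * f (Suc ?b) * f (Suc (Suc ?b))"
        using mult_right_mono[OF Suc.IH nn[of "Suc (Suc ?b)"]] by (simp add: mult_ac)
      finally have "f (Suc a) * f (Suc ?b) * f (Suc ?b) \<le> (f a * f (Suc (Suc ?b))) * f (Suc ?b)"
        by (simp add: mult_ac)
      then have "f (Suc a) * f (Suc ?b) \<le> f a * f (Suc (Suc ?b))"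
        using pos by (rule mult_right_le_imp_le)
      then show ?thesis by simp
    qed
  qed (simp add: mult.commute)
  have 2: "a \<le> b \<Longrightarrow> f a * f b \<le> f 0 * f (a + b)" for a b
  proof (induction a arbitrary: b)
    case (Suc a)
    have "f (Suc a) * f b \<le> f a * f (Suc b)"
      using 1[of a "b - a"] Suc.prems by simp
    also have "\<dots> \<le> f 0 * f (a + Suc b)" using Suc.prems by (intro Suc.IH) simp
    finally show ?case by simp
  qed simp
  show ?thesis
    using 2[of a b] 2[of b a] by (cases "a \<le> b") (simp_all add: add.commute mult.commute)
qed

lemma quadratic_nonneg_discriminant:
  fixes a b c :: real
  assumes "\<And>t. 0 \<le> a + 2 * b * t + c * t\<^sup>2" "0 \<le> c"
  shows "b\<^sup>2 \<le> a * c"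
proof (cases "c = 0")
  case True
  have "b = 0"
  proof (rule ccontr)
    assume "b \<noteq> 0"
    have "0 \<le> a + 2 * b * (- (\<bar>a\<bar> + 1) / b)" using assms(1)[of "- (\<bar>a\<bar> + 1) / b"] True by simp
    also have "\<dots> = a - 2 * (\<bar>a\<bar> + 1)" using \<open>b \<noteq> 0\<close> by (simp add: field_simps)
    finally show False by (simp add: abs_if split: if_splits)
  qed
  then show ?thesis using True by simp
next
  case False
  then have c: "0 < c" using assms(2) by simp
  have "0 \<le> a + 2 * b * (- b / c) + c * (- b / c)\<^sup>2" by (rule assms(1))
  also have "\<dots> = a - b\<^sup>2 / c" using c by (simp add: power2_eq_square field_simps)
  finally show ?thesis using c by (simp add: field_simps)
qed

lemma sum_choose_lessThan: "(\<Sum>i<l. real (i choose j)) = real (l choose Suc j)"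
  by (induction l) simp_all

lemma sum_sum_choose:
  "(\<Sum>i<l. \<Sum>j<K. real (i choose j) * g j) = (\<Sum>j<K. real (l choose Suc j) * g j)"
proof -
  have "(\<Sum>i<l. \<Sum>j<K. real (i choose j) * g j) = (\<Sum>j<K. \<Sum>i<l. real (i choose j) * g j)"
    by (rule sum.swap)
  then show ?thesis by (simp only: sum_distrib_right[symmetric] sum_choose_lessThan)
qed

context
  fixes r :: nat
begin

definition ip :: "(nat \<Rightarrow> real) \<Rightarrow> (nat \<Rightarrow> real) \<Rightarrow> real" where
  "ip u v = (\<Sum>i<r. u i * v i)"

definition unit :: "nat \<Rightarrow> nat \<Rightarrow> real" where "unit e i = of_bool (i = e)"

lemma ip_commute: "ip u v = ip v u"
  by (simp add: ip_def mult.commute)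

lemma ip_self_nonneg [simp]: "0 \<le> ip v v"
  by (simp add: ip_def sum_nonneg)

lemma ip_unit: "e < r \<Longrightarrow> ip (unit e) v = v e"
proof -
  assume "e < r"
  have "ip (unit e) v = (\<Sum>i<r. if i = e then v e else 0)"
    unfolding ip_def unit_def by (intro sum.cong) auto
  then show ?thesis using \<open>e < r\<close> by simp
qed

lemma ip_add: "ip u (\<lambda>i. x i + y i) = ip u x + ip u y"
  by (simp add: ip_def sum.distrib distrib_left)

lemma ip_scale: "ip u (\<lambda>i. a * x i) = a * ip u x"
  by (simp add: ip_def sum_distrib_left mult_ac)

lemma ip_sum: "ip u (\<lambda>i. \<Sum>l\<in>L. c l * y l i) = (\<Sum>l\<in>L. c l * ip u (y l))"
  unfolding ip_def sum_distrib_left by (subst sum.swap) (simp add: mult_ac)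

lemma ip_Cauchy_Schwarz: "(ip u v)\<^sup>2 \<le> ip u u * ip v v"
  unfolding ip_def using Cauchy_Schwarz_ineq_sum[of u v "{..<r}"] by (simp add: power2_eq_square)

text \<open>Vectors are functions on all of \<open>nat\<close>, of which \<open>ip\<close> sees the
  first \<open>r\<close> coordinates only. So \<open>ip\<close> is merely semidefinite, and vectors
  of length zero need separate care.\<close>

definition lin :: "((nat \<Rightarrow> real) \<Rightarrow> nat \<Rightarrow> real) \<Rightarrow> bool" where
  "lin A \<longleftrightarrow> (\<forall>a b x y. A (\<lambda>i. a * x i + b * y i) = (\<lambda>i. a * A x i + b * A y i)) \<and>
     (\<forall>u v. ip u (A v) = ip (A u) v)"

definition sop :: "((nat \<Rightarrow> real) \<Rightarrow> nat \<Rightarrow> real) \<Rightarrow> bool" where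
  "sop A \<longleftrightarrow> lin A \<and> (\<forall>v. 0 \<le> ip v (A v))"

lemma lin_comb: "lin A \<Longrightarrow> A (\<lambda>i. a * x i + b * y i) = (\<lambda>i. a * A x i + b * A y i)"
  by (auto simp: lin_def)

lemma lin_sym: "lin A \<Longrightarrow> ip u (A v) = ip (A u) v"
  by (auto simp: lin_def)

lemma lin_sum:
  assumes "lin A" "finite L"
  shows "A (\<lambda>i. x i + (\<Sum>l\<in>L. c l * y l i)) = (\<lambda>i. A x i + (\<Sum>l\<in>L. c l * A (y l) i))"
  using assms(2)
proof (induction L rule: finite_induct)
  case empty
  then show ?case by simp
next
  case (insert l L)
  have "A (\<lambda>i. x i + (\<Sum>l\<in>insert l L. c l * y l i)) = A (\<lambda>i. c l * y l i + 1 * (x i + (\<Sum>l\<in>L. c l * y l i)))"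
    using insert by (simp add: algebra_simps)
  also have "\<dots> = (\<lambda>i. c l * A (y l) i + 1 * (A x i + (\<Sum>l\<in>L. c l * A (y l) i)))"
    unfolding lin_comb[OF assms(1)] insert.IH by simp
  finally show ?case using insert by (simp add: algebra_simps)
qed

lemma lin_pow: "lin A \<Longrightarrow> lin (A ^^ k)"
proof (induction k)
  case 0
  then show ?case by (simp add: lin_def)
next
  case (Suc k)
  then have l: "lin A" "lin (A ^^ k)" by auto
  show ?case
    unfolding lin_def funpow.simps comp_def
    using lin_comb[OF l(1)] lin_comb[OF l(2)] lin_sym[OF l(1)] lin_sym[OF l(2)] 
    by (metis funpow_swap1)
qed

lemma ip_pow_add:
  assumes "lin A"
  shows "ip u ((A ^^ (a + b)) v) = ip ((A ^^ a) u) ((A ^^ b) v)"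
  using lin_sym[OF lin_pow[OF assms], of u a] by (simp add: funpow_add)

text \<open>No square root of \<open>A\<close> is taken: an even power gives the squared length of
  \<open>(A ^^ j) v\<close>, an odd one the form of \<open>A\<close> at that vector.\<close>

lemma sop_pow: 
  assumes "sop A"
  shows "sop (A ^^ k)"
proof -
  have l: "lin A" using assms by (simp add: sop_def)
  have "0 \<le> ip v ((A ^^ k) v)" for v
  proof (cases "even k")
    case True
    then obtain j where "k = j + j" by (metis evenE mult_2)
    then show ?thesis using ip_pow_add[OF l, of v j j v] by simp
  next
    case False
    then obtain j where "k = j + Suc j" by (metis add_Suc_right mult_2 oddE Suc_eq_plus1)
    then show ?thesis using ip_pow_add[OF l, of v j "Suc j" v] assms by (simp add: sop_def)
  qed
  then show ?thesis using lin_pow[OF l] by (simp add: sop_def)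
qed

lemma sop_Cauchy_Schwarz:
  assumes "sop A"
  shows "(ip u (A v))\<^sup>2 \<le> ip u (A u) * ip v (A v)"
proof (rule quadratic_nonneg_discriminant)
  fix t
  have l: "lin A" using assms by (simp add: sop_def)
  have c: "A (\<lambda>i. u i + t * v i) = (\<lambda>i. A u i + t * A v i)"
    using lin_comb[OF l, of 1 u t v] by simp
  have s: "ip (\<lambda>i. u i + t * v i) w = ip u w + t * ip v w" for w
    by (simp add: ip_commute[of _ w] ip_add ip_scale)
  have "0 \<le> ip (\<lambda>i. u i + t * v i) (A (\<lambda>i. u i + t * v i))" using assms by (simp add: sop_def)
  also have "\<dots> = ip u (A u) + 2 * ip u (A v) * t + ip v (A v) * t\<^sup>2"
    unfolding c s ip_add ip_scale using lin_sym[OF l, of v u] ip_commute[of "A v" u]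
    by (simp add: algebra_simps power2_eq_square)
  finally show "0 \<le> ip u (A u) + 2 * ip u (A v) * t + ip v (A v) * t\<^sup>2" .
qed (use assms in \<open>simp add: sop_def\<close>)

definition mom :: "((nat \<Rightarrow> real) \<Rightarrow> nat \<Rightarrow> real) \<Rightarrow> (nat \<Rightarrow> real) \<Rightarrow> nat \<Rightarrow> real" where
  "mom A v k = ip v ((A ^^ k) v)"

lemma mom_0: "mom A v 0 = ip v v" by (simp add: mom_def)

lemma mom_nonneg: "sop A \<Longrightarrow> 0 \<le> mom A v k"
  using sop_pow[of A k] by (simp add: mom_def sop_def)

text \<open>The Cauchy-Schwarz inequality of the positive form \<open>A ^^ k\<close>, at
  \<open>v\<close> and \<open>A v\<close>.\<close>

lemma mom_logconvex:
  assumes "sop A"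
  shows "(mom A v (Suc k))\<^sup>2 \<le> mom A v k * mom A v (Suc (Suc k))"
proof -
  have l: "lin A" using assms by (simp add: sop_def)
  have "mom A v (Suc k) = ip v ((A ^^ k) (A v))"
    by (simp add: mom_def funpow_swap1)
  moreover have "ip (A v) ((A ^^ k) (A v)) = mom A v (Suc (Suc k))"
    using lin_sym[OF l, of v "(A ^^ k) (A v)"] by (simp add: mom_def funpow_swap1)
  ultimately show ?thesis
    using sop_Cauchy_Schwarz[OF sop_pow[OF assms, of k], of v "A v"] by (simp add: mom_def)
qed

lemma mom_mult_le: "sop A \<Longrightarrow> mom A v a * mom A v b \<le> ip v v * mom A v (a + b)"
  using logconvex_mult_le[of "mom A v" a b] mom_nonneg mom_logconvex mom_0 by simp

definition tr :: "((nat \<Rightarrow> real) \<Rightarrow> nat \<Rightarrow> real) \<Rightarrow> nat \<Rightarrow> real" where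
  "tr A k = (\<Sum>e<r. mom A (unit e) k)"

lemma tr_nonneg: "sop A \<Longrightarrow> 0 \<le> tr A k"
  by (simp add: tr_def sum_nonneg mom_nonneg)

lemma ip_op_expand:
  assumes "lin A"
  shows "ip v (A v) = (\<Sum>e<r. \<Sum>f<r. v e * v f * ip (unit e) (A (unit f)))"
proof -
  have 1: "ip w (A v) = (\<Sum>f<r. v f * ip w (A (unit f)))" for w
  proof -
    have "ip w (A v) = (\<Sum>f<r. A w f * v f)" using lin_sym[OF assms] by (simp add: ip_def)
    also have "\<dots> = (\<Sum>f<r. ip (unit f) (A w) * v f)" by (intro sum.cong) (auto simp: ip_unit)
    also have "\<dots> = (\<Sum>f<r. v f * ip w (A (unit f)))"
      using lin_sym[OF assms, of w] ip_commute by (intro sum.cong) (simp_all add: mult.commute)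
    finally show ?thesis .
  qed
  have "ip v (A v) = (\<Sum>e<r. v e * ip (unit e) (A v))" unfolding ip_def[of v] by (intro sum.cong) (auto simp: ip_unit)
  then show ?thesis unfolding 1 by (simp add: sum_distrib_left mult_ac)
qed

text \<open>The largest eigenvalue is at most the trace, but without eigenvalues: the entries of a
  positive form are bounded by geometric means of diagonal ones, and Cauchy-Schwarz does the
  rest.\<close>

lemma ip_op_le_trace:
  assumes "sop A"
  shows "ip v (A v) \<le> ip v v * (\<Sum>e<r. ip (unit e) (A (unit e)))"
proof -
  define p where "p e = ip (unit e) (A (unit e))" for e
  have p: "0 \<le> p e" for e using assms by (simp add: p_def sop_def)
  have "ip v (A v) = (\<Sum>e<r. \<Sum>f<r. v e * v f * ip (unit e) (A (unit f)))"
    using ip_op_expand assms by (simp add: sop_def)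
  also have "\<dots> \<le> (\<Sum>e<r. \<Sum>f<r. (\<bar>v e\<bar> * sqrt (p e)) * (\<bar>v f\<bar> * sqrt (p f)))"
  proof (intro sum_mono)
    fix e f
    have "(ip (unit e) (A (unit f)))\<^sup>2 \<le> (sqrt (p e) * sqrt (p f))\<^sup>2"
      using sop_Cauchy_Schwarz[OF assms, of "unit e" "unit f"] p by (simp add: p_def power_mult_distrib)
    then have "\<bar>ip (unit e) (A (unit f))\<bar> \<le> sqrt (p e) * sqrt (p f)"
      using p by (intro power2_le_imp_le[OF _ mult_nonneg_nonneg]) simp_all
    then have "\<bar>v e * v f\<bar> * \<bar>ip (unit e) (A (unit f))\<bar> \<le> \<bar>v e * v f\<bar> * (sqrt (p e) * sqrt (p f))"
      by (intro mult_left_mono) auto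
    then have "\<bar>v e * v f * ip (unit e) (A (unit f))\<bar> \<le> (\<bar>v e\<bar> * sqrt (p e)) * (\<bar>v f\<bar> * sqrt (p f))"
      by (simp add: abs_mult mult_ac)
    then show "v e * v f * ip (unit e) (A (unit f)) \<le> (\<bar>v e\<bar> * sqrt (p e)) * (\<bar>v f\<bar> * sqrt (p f))"
      by (rule abs_le_D1)
  qed
  also have "\<dots> = (\<Sum>e<r. \<bar>v e\<bar> * sqrt (p e))\<^sup>2"
    by (simp add: power2_eq_square sum_product)
  also have "\<dots> \<le> (\<Sum>e<r. \<bar>v e\<bar>\<^sup>2) * (\<Sum>e<r. (sqrt (p e))\<^sup>2)"
    by (rule Cauchy_Schwarz_ineq_sum)
  also have "\<dots> = ip v v * (\<Sum>e<r. p e)"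
    using p by (simp add: ip_def power2_eq_square[of "v _"])
  finally show ?thesis by (simp add: p_def)
qed

lemma mom_le_tr: "sop A \<Longrightarrow> mom A v k \<le> ip v v * tr A k"
  using ip_op_le_trace[OF sop_pow[of A k], of v] by (simp add: mom_def tr_def)

subsection \<open>Rank-one perturbations\<close>

definition upd :: "real \<Rightarrow> (nat \<Rightarrow> real) \<Rightarrow> ((nat \<Rightarrow> real) \<Rightarrow> nat \<Rightarrow> real) \<Rightarrow> (nat \<Rightarrow> real) \<Rightarrow> nat \<Rightarrow> real" where
  "upd \<sigma> u A v = (\<lambda>i. A v i + \<sigma> * ip u v * u i)"

lemma lin_upd:
  assumes "lin A"
  shows "lin (upd \<sigma> u A)"
proof -
  have "upd \<sigma> u A (\<lambda>i. a * x i + b * y i) = (\<lambda>i. a * upd \<sigma> u A x i + b * upd \<sigma> u A y i)" for a b x y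
    unfolding upd_def lin_comb[OF assms] ip_add ip_scale by (simp add: algebra_simps)
  moreover have "ip v (upd \<sigma> u A w) = ip (upd \<sigma> u A v) w" for v w
    unfolding upd_def ip_add ip_scale ip_commute[of "\<lambda>i. A v i + _ i" w] 
    using lin_sym[OF assms, of v w] by (simp add: ip_commute)
  ultimately show ?thesis by (simp add: lin_def)
qed

text \<open>Duhamel's formula for \<open>B^k - A^k\<close>, the sum over \<open>l < k\<close> of
  \<open>A^(k-1-l) (B - A) B^l\<close>, in the case \<open>B - A = \<sigma> u u^T\<close>.\<close>

lemma upd_pow:
  assumes "lin A"
  shows "(upd \<sigma> u A ^^ k) x = (\<lambda>i. (A ^^ k) x i + (\<Sum>l<k. (\<sigma> * ip u ((upd \<sigma> u A ^^ l) x)) * (A ^^ (k - 1 - l)) u i))"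
proof (induction k)
  case (Suc k)
  let ?B = "upd \<sigma> u A"
  have "(?B ^^ Suc k) x = (\<lambda>i. A ((?B ^^ k) x) i + \<sigma> * ip u ((?B ^^ k) x) * u i)"
    by (simp add: upd_def)
  also have "A ((?B ^^ k) x) = (\<lambda>i. (A ^^ Suc k) x i + (\<Sum>l<k. (\<sigma> * ip u ((?B ^^ l) x)) * A ((A ^^ (k - 1 - l)) u) i))"
    by (subst Suc.IH, subst lin_sum[OF assms]) auto
  also have "\<dots> = (\<lambda>i. (A ^^ Suc k) x i + (\<Sum>l<k. (\<sigma> * ip u ((?B ^^ l) x)) * (A ^^ (Suc k - 1 - l)) u i))"
  proof (intro ext arg_cong2[where f="(+)"] sum.cong refl arg_cong2[where f="(*)"])
    fix i l assume "l \<in> {..<k}"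
    then have "Suc k - 1 - l = Suc (k - 1 - l)" by auto
    then show "A ((A ^^ (k - 1 - l)) u) i = (A ^^ (Suc k - 1 - l)) u i" by simp
  qed
  finally show ?case by (simp add: add.assoc)
qed simp

lemma upd_mom_expand:
  assumes "lin A" "\<bar>\<sigma>\<bar> = 1"
  shows "ip ((A ^^ a) u) ((upd \<sigma> u A ^^ l) u) =
     mom A u (a + l) + \<sigma> * (\<Sum>i<l. mom (upd \<sigma> u A) u i * mom A u (a + (l - 1 - i)))"
proof -
  have "ip ((A ^^ a) u) ((upd \<sigma> u A ^^ l) u) = ip ((A ^^ a) u) ((A ^^ l) u) +
      (\<Sum>i<l. \<sigma> * ip u ((upd \<sigma> u A ^^ i) u) * ip ((A ^^ a) u) ((A ^^ (l - 1 - i)) u))"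
    by (subst upd_pow[OF assms(1)]) (simp only: ip_add ip_sum)
  then show ?thesis
    unfolding ip_pow_add[OF assms(1), symmetric] by (simp add: mom_def sum_distrib_left mult_ac)
qed

text \<open>Log-convexity collapses every product of two moments arising from the perturbation series into a single
  one; the binomials count the terms.\<close>

lemma upd_mom_le:
  assumes "sop A" "\<bar>\<sigma>\<bar> = 1"
  shows "\<bar>mom (upd \<sigma> u A) u l\<bar> \<le> (\<Sum>j\<le>l. real (l choose j) * ip u u ^ j * mom A u (l - j))"
proof (induction l rule: less_induct)
  case (less l)
  have A: "lin A" using assms by (simp add: sop_def)
  let ?h = "mom A u" and ?U = "ip u u"
  have hn: "0 \<le> ?h k" for k by (rule mom_nonneg[OF assms(1)])
  have "\<bar>mom (upd \<sigma> u A) u l\<bar> = \<bar>?h l + \<sigma> * (\<Sum>i<l. mom (upd \<sigma> u A) u i * ?h (l - 1 - i))\<bar>"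
    using upd_mom_expand[OF A assms(2), of 0 u l] by (simp add: mom_def)
  also have "\<dots> \<le> ?h l + \<bar>\<Sum>i<l. mom (upd \<sigma> u A) u i * ?h (l - 1 - i)\<bar>"
    using assms(2) hn[of l] by (intro order_trans[OF abs_triangle_ineq]) (simp add: abs_mult)
  also have "\<bar>\<Sum>i<l. mom (upd \<sigma> u A) u i * ?h (l - 1 - i)\<bar> \<le> (\<Sum>i<l. (\<Sum>j\<le>i. real (i choose j) * ?U ^ j * ?h (i - j)) * ?h (l - 1 - i))"
    using hn less.IH by (intro order_trans[OF sum_abs] sum_mono) (auto simp: abs_mult intro!: mult_right_mono)
  also have "\<dots> \<le> (\<Sum>i<l. \<Sum>j\<le>i. real (i choose j) * ?U ^ Suc j * ?h (l - 1 - j))"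
  proof (intro sum_mono)
    fix i assume i: "i \<in> {..<l}"
    have "(\<Sum>j\<le>i. real (i choose j) * ?U ^ j * ?h (i - j)) * ?h (l - 1 - i) = (\<Sum>j\<le>i. (real (i choose j) * ?U ^ j) * (?h (i - j) * ?h (l - 1 - i)))"
      unfolding sum_distrib_right by (simp only: mult.assoc)
    also have "\<dots> \<le> (\<Sum>j\<le>i. (real (i choose j) * ?U ^ j) * (?U * ?h (l - 1 - j)))"
    proof (intro sum_mono mult_left_mono)
      fix j assume "j \<in> {..i}"
      then have "i - j + (l - 1 - i) = l - 1 - j" using i by auto
      then show "?h (i - j) * ?h (l - 1 - i) \<le> ?U * ?h (l - 1 - j)" using mom_mult_le[OF assms(1), of u "i - j" "l - 1 - i"] by simp
    qed simp
    finally show "(\<Sum>j\<le>i. real (i choose j) * ?U ^ j * ?h (i - j)) * ?h (l - 1 - i) \<le> (\<Sum>j\<le>i. real (i choose j) * ?U ^ Suc j * ?h (l - 1 - j))"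
      by (simp add: mult_ac)
  qed
  also have "\<dots> = (\<Sum>i<l. \<Sum>j<l. real (i choose j) * ?U ^ Suc j * ?h (l - 1 - j))"
    by (intro sum.cong refl sum.mono_neutral_left) auto
  also have "\<dots> = (\<Sum>j<l. real (l choose Suc j) * ?U ^ Suc j * ?h (l - Suc j))"
    using sum_sum_choose[where l = l and K = l and g = "\<lambda>j. ?U ^ Suc j * ?h (l - 1 - j)"] by (simp add: mult.assoc)
  finally have "\<bar>mom (upd \<sigma> u A) u l\<bar> \<le> ?h l + (\<Sum>j<l. real (l choose Suc j) * ?U ^ Suc j * ?h (l - Suc j))" by simp
  also have "\<dots> = (\<Sum>j\<le>l. real (l choose j) * ?U ^ j * ?h (l - j))"
    unfolding lessThan_Suc_atMost[symmetric] by (subst sum.lessThan_Suc_shift) simp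
  finally show ?case .
qed

text \<open>The first-order term is kept exactly, sign included, because its mean has to cancel the
  mean of the samples later on. From order two on a bound suffices: there
  \<open>\<sigma> * \<sigma> = 1\<close> removes the outer sign and \<open>upd_mom_le\<close> the
  inner ones. For \<open>j + 2 > K\<close> the binomial vanishes, which makes the truncated
  \<open>K - 2 - j\<close> harmless.\<close>

lemma tr_upd_le:
  assumes "sop A" "\<bar>\<sigma>\<bar> = 1"
  shows "tr (upd \<sigma> u A) K \<le> tr A K + \<sigma> * K * mom A u (K - 1)
     + (\<Sum>j<K. real (K choose (j + 2)) * ip u u ^ Suc j * mom A u (K - 2 - j))"
proof -
  have A: "lin A" using assms by (simp add: sop_def)
  let ?B = "upd \<sigma> u A"
  have B: "lin ?B" by (rule lin_upd[OF A])
  let ?h = "mom A u" and ?U = "ip u u"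
  have hn: "0 \<le> ?h k" for k by (rule mom_nonneg[OF assms(1)])
  have s2: "\<sigma> * \<sigma> = 1" using assms(2) by (metis abs_mult_self_eq mult_1)
  have "tr ?B K = (\<Sum>e<r. mom A (unit e) K + (\<Sum>l<K. \<sigma> * ip u ((?B ^^ l) (unit e)) * ip (unit e) ((A ^^ (K - 1 - l)) u)))"
    unfolding tr_def mom_def by (subst upd_pow[OF A]) (simp only: ip_add ip_sum)
  also have "\<dots> = tr A K + \<sigma> * (\<Sum>e<r. \<Sum>l<K. (?B ^^ l) u e * (A ^^ (K - 1 - l)) u e)"
  proof -
    have "ip u ((?B ^^ l) (unit e)) = (?B ^^ l) u e" if "e < r" for e l
      using lin_sym[OF lin_pow[OF B], of u l "unit e"] ip_unit[OF that] by (simp add: ip_commute)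
    then show ?thesis
      by (simp add: tr_def sum.distrib sum_distrib_left ip_unit mult_ac)
  qed
  also have "(\<Sum>e<r. \<Sum>l<K. (?B ^^ l) u e * (A ^^ (K - 1 - l)) u e) = (\<Sum>l<K. ip ((A ^^ (K - 1 - l)) u) ((?B ^^ l) u))"
    by (subst sum.swap) (simp add: ip_def mult.commute)
  also have "\<dots> = (\<Sum>l<K. ?h (K - 1) + \<sigma> * (\<Sum>i<l. mom ?B u i * ?h (K - 2 - i)))"
  proof (intro sum.cong refl)
    fix l assume l: "l \<in> {..<K}"
    have "ip ((A ^^ (K - 1 - l)) u) ((?B ^^ l) u) = ?h (K - 1 - l + l) + \<sigma> * (\<Sum>i<l. mom ?B u i * ?h (K - 1 - l + (l - 1 - i)))"
      by (rule upd_mom_expand[OF A assms(2)])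
    also have "(\<Sum>i<l. mom ?B u i * ?h (K - 1 - l + (l - 1 - i))) = (\<Sum>i<l. mom ?B u i * ?h (K - 2 - i))"
    proof (intro sum.cong refl)
      fix i assume "i \<in> {..<l}"
      then have "K - 1 - l + (l - 1 - i) = K - 2 - i" using l by auto
      then show "mom ?B u i * ?h (K - 1 - l + (l - 1 - i)) = mom ?B u i * ?h (K - 2 - i)" by simp
    qed
    finally show "ip ((A ^^ (K - 1 - l)) u) ((?B ^^ l) u) = ?h (K - 1) + \<sigma> * (\<Sum>i<l. mom ?B u i * ?h (K - 2 - i))"
      using l by simp
  qed
  also have "tr A K + \<sigma> * \<dots> = tr A K + \<sigma> * K * ?h (K - 1) + (\<Sum>l<K. \<Sum>i<l. mom ?B u i * ?h (K - 2 - i))"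
    using s2 by (simp add: sum.distrib distrib_left sum_distrib_left flip: mult.assoc)
  finally have 1: "tr ?B K = tr A K + \<sigma> * K * ?h (K - 1) + (\<Sum>l<K. \<Sum>i<l. mom ?B u i * ?h (K - 2 - i))" .
  have "(\<Sum>l<K. \<Sum>i<l. mom ?B u i * ?h (K - 2 - i)) \<le> (\<Sum>l<K. \<Sum>i<l. \<Sum>j<K. real (i choose j) * (?U ^ Suc j * ?h (K - 2 - j)))"
  proof (intro sum_mono)
    fix l i assume l: "l \<in> {..<K}" and i: "i \<in> {..<l}"
    have "mom ?B u i * ?h (K - 2 - i) \<le> (\<Sum>j\<le>i. real (i choose j) * ?U ^ j * ?h (i - j)) * ?h (K - 2 - i)"
      using upd_mom_le[OF assms, of u i] hn by (intro mult_right_mono) auto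
    also have "\<dots> = (\<Sum>j\<le>i. (real (i choose j) * ?U ^ j) * (?h (i - j) * ?h (K - 2 - i)))"
      unfolding sum_distrib_right by (simp only: mult.assoc)
    also have "\<dots> \<le> (\<Sum>j\<le>i. (real (i choose j) * ?U ^ j) * (?U * ?h (K - 2 - j)))"
    proof (intro sum_mono mult_left_mono)
      fix j assume "j \<in> {..i}"
      then have "i - j + (K - 2 - i) = K - 2 - j" using i l by auto
      then show "?h (i - j) * ?h (K - 2 - i) \<le> ?U * ?h (K - 2 - j)" using mom_mult_le[OF assms(1), of u "i - j" "K - 2 - i"] by simp
    qed simp
    also have "\<dots> = (\<Sum>j\<le>i. real (i choose j) * (?U ^ Suc j * ?h (K - 2 - j)))" by (simp add: mult_ac)
    also have "\<dots> = (\<Sum>j<K. real (i choose j) * (?U ^ Suc j * ?h (K - 2 - j)))"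
      using i l by (intro sum.mono_neutral_left) auto
    finally show "mom ?B u i * ?h (K - 2 - i) \<le> (\<Sum>j<K. real (i choose j) * (?U ^ Suc j * ?h (K - 2 - j)))" .
  qed
  also have "\<dots> = (\<Sum>l<K. \<Sum>j<K. real (l choose Suc j) * (?U ^ Suc j * ?h (K - 2 - j)))"
    by (subst sum_sum_choose[where g = "\<lambda>j. ?U ^ Suc j * ?h (K - 2 - j)"]) (rule refl)
  also have "\<dots> = (\<Sum>j<K. \<Sum>l<K. real (l choose Suc j) * (?U ^ Suc j * ?h (K - 2 - j)))"
    by (rule sum.swap)
  also have "\<dots> = (\<Sum>j<K. real (K choose Suc (Suc j)) * (?U ^ Suc j * ?h (K - 2 - j)))"
    by (simp only: sum_distrib_right[symmetric] sum_choose_lessThan)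
  finally show ?thesis using 1 by (simp add: mult_ac)
qed

end

section \<open>Averages over three independent strings, and the trace of an exponential\<close>

definition avg3 :: "nat \<Rightarrow> (bool list \<Rightarrow> bool list \<Rightarrow> bool list \<Rightarrow> real) \<Rightarrow> real" where
  "avg3 l F = avg l (\<lambda>x. avg l (\<lambda>y. avg l (\<lambda>z. F x y z)))"

lemma avg3_mono:
  assumes "\<And>x y z. length x = l \<Longrightarrow> length y = l \<Longrightarrow> length z = l \<Longrightarrow> F x y z \<le> G x y z"
  shows "avg3 l F \<le> avg3 l G"
  unfolding avg3_def using assms by (intro avg_mono) auto

lemma avg3_cmult: "avg3 l (\<lambda>x y z. c * F x y z) = c * avg3 l F"
  by (simp add: avg3_def avg_cmult)

lemma avg3_add: "avg3 l (\<lambda>x y z. F x y z + G x y z) = avg3 l F + avg3 l G"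
  by (simp add: avg3_def avg_add)

text \<open>The front segments, from which the next sample is read, are averaged innermost, with the
  remaining samples fixed.\<close>

lemma avg3_append:
  "avg3 (a + b) F = avg3 b (\<lambda>x' y' z'. avg3 a (\<lambda>x y z. F (x @ x') (y @ y') (z @ z')))"
proof -
  have "avg3 (a + b) F = avg a (\<lambda>x. avg b (\<lambda>x'. avg a (\<lambda>y. avg b (\<lambda>y'. avg a (\<lambda>z. avg b (\<lambda>z'. F (x @ x') (y @ y') (z @ z')))))))"
    by (simp add: avg3_def avg_append)
  also have "\<dots> = avg b (\<lambda>x'. avg a (\<lambda>x. avg b (\<lambda>y'. avg a (\<lambda>y. avg b (\<lambda>z'. avg a (\<lambda>z. F (x @ x') (y @ y') (z @ z')))))))"
    by (simp only: avg_swap[of a b])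
  also have "\<dots> = avg b (\<lambda>x'. avg b (\<lambda>y'. avg b (\<lambda>z'. avg a (\<lambda>x. avg a (\<lambda>y. avg a (\<lambda>z. F (x @ x') (y @ y') (z @ z')))))))"
  proof -
    have 1: "avg a (\<lambda>y. avg b (\<lambda>z'. avg a (\<lambda>z. G y z' z))) = avg b (\<lambda>z'. avg a (\<lambda>y. avg a (\<lambda>z. G y z' z)))" for G
      by (rule avg_swap)
    have 2: "avg a (\<lambda>x. avg b (\<lambda>y'. H x y')) = avg b (\<lambda>y'. avg a (\<lambda>x. H x y'))" for H
      by (rule avg_swap)
    show ?thesis by (simp only: 1 2)
  qed
  finally show ?thesis by (simp add: avg3_def)
qed

lemma avg3_bval:
  "avg3 L (\<lambda>x y z. f (bval x, bval y, bval z)) =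
     (\<Sum>t\<in>{..<2 ^ L} \<times> {..<2 ^ L} \<times> {..<2 ^ L}. f t) / (2 ^ L) ^ 3"
proof -
  have "avg3 L (\<lambda>x y z. f (bval x, bval y, bval z)) = (\<Sum>a<2 ^ L. (\<Sum>b<2 ^ L. (\<Sum>c<2 ^ L. f (a, b, c)) / 2 ^ L) / 2 ^ L) / 2 ^ L"
    using avg_bval[of L "\<lambda>c. f (_, _, c)"] avg_bval[of L "\<lambda>b. (\<Sum>c<2 ^ L. f (_, b, c)) / 2 ^ L"]
      avg_bval[of L "\<lambda>a. (\<Sum>b<2 ^ L. (\<Sum>c<2 ^ L. f (a, b, c)) / 2 ^ L) / 2 ^ L"]
    by (simp add: avg3_def)
  also have "\<dots> = (\<Sum>a<2 ^ L. \<Sum>b<2 ^ L. \<Sum>c<2 ^ L. f (a, b, c)) / (2 ^ L) ^ 3"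
    by (simp add: sum_divide_distrib power3_eq_cube)
  finally show ?thesis by (simp add: sum.cartesian_product)
qed

lemma exp_bound_square:
  fixes x :: real
  assumes "0 \<le> x" "x \<le> 1"
  shows "exp x - 1 - x \<le> x\<^sup>2"
  using exp_bound[OF assms] by simp

text \<open>The trace of \<open>exp (s A)\<close>, given by its series so that bounds on traces of
  powers carry over term by term.\<close>

definition pot :: "nat \<Rightarrow> real \<Rightarrow> ((nat \<Rightarrow> real) \<Rightarrow> nat \<Rightarrow> real) \<Rightarrow> real" where
  "pot r s A = (\<Sum>K. s ^ K / fact K * tr r A K)"

subsection \<open>Boundedness of operators, for summability\<close>

text \<open>A bound in the supremum norm of the first \<open>r\<close> coordinates. Its size is
  immaterial, as only the convergence of \<open>pot\<close> depends on it.\<close>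

definition bop :: "nat \<Rightarrow> real \<Rightarrow> ((nat \<Rightarrow> real) \<Rightarrow> nat \<Rightarrow> real) \<Rightarrow> bool" where
  "bop r \<beta> A \<longleftrightarrow> 0 \<le> \<beta> \<and> (\<forall>v x. (\<forall>i<r. \<bar>v i\<bar> \<le> x) \<longrightarrow> (\<forall>i<r. \<bar>A v i\<bar> \<le> \<beta> * x))"

lemma bop_pow:
  assumes "bop r \<beta> A" "\<forall>i<r. \<bar>v i\<bar> \<le> x"
  shows "\<forall>i<r. \<bar>(A ^^ k) v i\<bar> \<le> \<beta> ^ k * x"
proof (induction k)
  case (Suc k)
  have "\<forall>i<r. \<bar>A ((A ^^ k) v) i\<bar> \<le> \<beta> * (\<beta> ^ k * x)"
    using assms(1) Suc unfolding bop_def by blast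
  then show ?case by (simp add: mult_ac)
qed (use assms in simp)

lemma bop_tr:
  assumes "bop r \<beta> A"
  shows "\<bar>tr r A k\<bar> \<le> real r * \<beta> ^ k"
proof -
  have "\<bar>tr r A k\<bar> \<le> (\<Sum>e<r. \<bar>(A ^^ k) (unit e) e\<bar>)"
    unfolding tr_def mom_def by (intro order_trans[OF sum_abs] sum_mono) (simp add: ip_unit)
  also have "\<dots> \<le> (\<Sum>e<r. \<beta> ^ k * 1)"
  proof (intro sum_mono)
    fix e assume "e \<in> {..<r}"
    then show "\<bar>(A ^^ k) (unit e) e\<bar> \<le> \<beta> ^ k * 1"
      using bop_pow[OF assms, of "unit e" 1 k] by (auto simp: unit_def)
  qed
  finally show ?thesis by simp
qed

lemma bop_upd:
  assumes "bop r \<beta> A"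
  shows "\<exists>\<beta>'. bop r \<beta>' (upd r \<sigma> u A)"
proof -
  define U where "U = (\<Sum>i<r. \<bar>u i\<bar>)"
  have U: "0 \<le> U" by (simp add: U_def sum_nonneg)
  have "bop r (\<beta> + \<bar>\<sigma>\<bar> * U * U) (upd r \<sigma> u A)"
    unfolding bop_def
  proof (intro conjI allI impI)
    show "0 \<le> \<beta> + \<bar>\<sigma>\<bar> * U * U" using assms U by (simp add: bop_def)
    fix v :: "nat \<Rightarrow> real" and x :: real and i assume v: "\<forall>i<r. \<bar>v i\<bar> \<le> x" and i: "i < r"
    have x: "0 \<le> x" using v i by force
    have "\<bar>ip r u v\<bar> \<le> (\<Sum>i<r. \<bar>u i\<bar> * x)"
      unfolding ip_def using v by (intro order_trans[OF sum_abs] sum_mono) (auto simp: abs_mult intro!: mult_left_mono)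
    then have 1: "\<bar>ip r u v\<bar> \<le> U * x" by (simp add: U_def sum_distrib_right)
    have 2: "\<bar>u i\<bar> \<le> U" unfolding U_def using i by (intro member_le_sum) auto
    have "\<bar>upd r \<sigma> u A v i\<bar> \<le> \<bar>A v i\<bar> + \<bar>\<sigma>\<bar> * (\<bar>ip r u v\<bar> * \<bar>u i\<bar>)"
      unfolding upd_def by (intro order_trans[OF abs_triangle_ineq]) (simp add: abs_mult)
    also have "\<dots> \<le> \<beta> * x + \<bar>\<sigma>\<bar> * ((U * x) * U)"
      using assms v i 1 2 U x by (intro add_mono mult_left_mono mult_mono) (auto simp: bop_def)
    finally show "\<bar>upd r \<sigma> u A v i\<bar> \<le> (\<beta> + \<bar>\<sigma>\<bar> * U * U) * x"
      by (simp add: algebra_simps)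
  qed
  then show ?thesis by blast
qed

lemma pot_abs_summable:
  assumes "bop r \<beta> A" "0 \<le> s"
  shows "summable (\<lambda>K. \<bar>s ^ K / fact K * tr r A K\<bar>)"
proof (rule summable_comparison_test')
  show "summable (\<lambda>K. real r * (inverse (fact K) * (s * \<beta>) ^ K))"
    using summable_exp[of "s * \<beta>"] by (intro summable_mult) simp
  fix K :: nat
  have "s ^ K / fact K * \<bar>tr r A K\<bar> \<le> s ^ K / fact K * (real r * \<beta> ^ K)"
    using assms(2) by (intro mult_left_mono bop_tr[OF assms(1)]) auto
  then show "norm \<bar>s ^ K / fact K * tr r A K\<bar> \<le> real r * (inverse (fact K) * (s * \<beta>) ^ K)"
    using assms(2) by (simp add: abs_mult power_mult_distrib field_simps)
qed

lemma pot_summable: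
  assumes "bop r \<beta> A" "0 \<le> s"
  shows "summable (\<lambda>K. s ^ K / fact K * tr r A K)"
  using pot_abs_summable[OF assms] by (rule summable_rabs_cancel)

subsection \<open>One random rank-one update\<close>

text \<open>Rows of squared length above \<open>\<tau>\<close> are not excluded, they only have to be rare on average; so \<open>V\<close> is much smaller than
  the worst-case bound \<open>B\<close>.\<close>

locale isotropic =
  fixes r :: nat and P :: "'t set" and R :: "'t \<Rightarrow> nat \<Rightarrow> real" and B V \<tau> H :: real
  assumes finP: "finite P"
    and iso: "\<And>i j. i < r \<Longrightarrow> j < r \<Longrightarrow> (\<Sum>t\<in>P. R t i * R t j) = (if i = j then real (card P) else 0)"
    and bound: "\<And>t. t \<in> P \<Longrightarrow> ip r (R t) (R t) \<le> B"
    and heavy: "(\<Sum>t | t \<in> P \<and> ip r (R t) (R t) > \<tau>. (ip r (R t) (R t))\<^sup>2) \<le> real (card P) * H"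
    and V: "\<tau> + H \<le> V"
    and B: "1 \<le> B" and \<tau>: "0 \<le> \<tau>" and neP: "P \<noteq> {}"
begin

text \<open>The rows form a tight frame: their rank-one operators sum to \<open>card P\<close> times
  the identity. So summing a quadratic form over them gives its trace.\<close>

lemma sum_mom:
  assumes "sop r A"
  shows "(\<Sum>t\<in>P. mom r A (R t) k) = card P * tr r A k"
proof -
  have l: "lin r (A ^^ k)" using lin_pow assms by (simp add: sop_def)
  have "(\<Sum>t\<in>P. mom r A (R t) k) = (\<Sum>t\<in>P. \<Sum>e<r. \<Sum>f<r. ip r (unit e) ((A ^^ k) (unit f)) * (R t e * R t f))"
    unfolding mom_def by (subst ip_op_expand[OF l]) (simp add: mult_ac)
  also have "\<dots> = (\<Sum>e<r. \<Sum>t\<in>P. \<Sum>f<r. ip r (unit e) ((A ^^ k) (unit f)) * (R t e * R t f))"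
    by (rule sum.swap)
  also have "\<dots> = (\<Sum>e<r. \<Sum>f<r. ip r (unit e) ((A ^^ k) (unit f)) * (\<Sum>t\<in>P. R t e * R t f))"
    by (subst sum.swap) (simp add: sum_distrib_left)
  also have "\<dots> = (\<Sum>e<r. \<Sum>f<r. if e = f then ip r (unit e) ((A ^^ k) (unit f)) * card P else 0)"
    by (intro sum.cong) (auto simp: iso)
  also have "\<dots> = card P * tr r A k"
    by (simp add: tr_def mom_def sum_distrib_left mult_ac)
  finally show ?thesis .
qed

text \<open>Up to \<tau> the weight is bounded by \<tau> and \<open>sum_mom\<close> applies. Above
  \<tau> a moment is at most squared length times trace, and what remains is the mean-square weight
  controlled by \<open>heavy\<close>.\<close>

lemma sum_mom_weighted:
  assumes "sop r A"
  shows "(\<Sum>t\<in>P. ip r (R t) (R t) * mom r A (R t) k) \<le> card P * V * tr r A k"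
proof -
  let ?q = "\<lambda>t. ip r (R t) (R t)"
  have tr: "0 \<le> tr r A k" by (rule tr_nonneg[OF assms])
  have "(\<Sum>t\<in>P. ?q t * mom r A (R t) k) \<le> (\<Sum>t\<in>P. \<tau> * mom r A (R t) k + (if ?q t > \<tau> then (?q t)\<^sup>2 else 0) * tr r A k)"
  proof (intro sum_mono)
    fix t
    have 1: "0 \<le> mom r A (R t) k" by (rule mom_nonneg[OF assms])
    have 2: "mom r A (R t) k \<le> ?q t * tr r A k" by (rule mom_le_tr[OF assms])
    show "?q t * mom r A (R t) k \<le> \<tau> * mom r A (R t) k + (if ?q t > \<tau> then (?q t)\<^sup>2 else 0) * tr r A k"
    proof (cases "?q t > \<tau>")
      case True
      have "?q t * mom r A (R t) k \<le> ?q t * (?q t * tr r A k)"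
        by (intro mult_left_mono 2) simp
      moreover have "0 \<le> \<tau> * mom r A (R t) k" using \<tau> 1 by simp
      ultimately show ?thesis using True by (simp add: power2_eq_square mult_ac)
    qed (use mult_right_mono[OF _ 1, of "?q t" \<tau>] in simp)
  qed
  also have "\<dots> = \<tau> * (card P * tr r A k) + (\<Sum>t\<in>P. if ?q t > \<tau> then (?q t)\<^sup>2 else 0) * tr r A k"
    by (simp add: sum.distrib sum_mom[OF assms] flip: sum_distrib_left sum_distrib_right)
  also have "(\<Sum>t\<in>P. if ?q t > \<tau> then (?q t)\<^sup>2 else 0) = (\<Sum>t | t \<in> P \<and> ?q t > \<tau>. (?q t)\<^sup>2)"
    using finP by (simp add: sum.If_cases Int_def)
  also have "\<tau> * (card P * tr r A k) + \<dots> * tr r A k \<le> \<tau> * (card P * tr r A k) + card P * H * tr r A k"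
    using heavy tr by (intro add_left_mono mult_right_mono) auto
  also have "\<dots> = card P * (\<tau> + H) * tr r A k" by (simp add: algebra_simps)
  also have "\<dots> \<le> card P * V * tr r A k"
    using V tr by (intro mult_right_mono mult_left_mono) auto
  finally show ?thesis .
qed

lemma V_nonneg: "0 \<le> V"
proof -
  have "0 \<le> (\<Sum>t | t \<in> P \<and> ip r (R t) (R t) > \<tau>. (ip r (R t) (R t))\<^sup>2)" by (intro sum_nonneg) simp
  then have "0 \<le> real (card P) * H" using heavy by linarith
  moreover have "0 < card P" using finP neP by (simp add: card_gt_0_iff)
  ultimately have "0 \<le> H" by (simp add: zero_le_mult_iff)
  then show ?thesis using V \<tau> by linarith
qed

text \<open>The terms of degree \<open>j\<close> in \<open>s\<close> of
  \<open>1 + \<sigma> s + V / B^2 (exp (s B) - 1 - s B)\<close>, the bound that the scalar Bernstein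
  argument gives for a moment generating function.\<close>

definition cf :: "real \<Rightarrow> real \<Rightarrow> nat \<Rightarrow> real" where
  "cf \<sigma> s j = (if j = 0 then 1 else if j = 1 then \<sigma> * s else V * B ^ (j - 2) * s ^ j / fact j)"

text \<open>Of the \<open>j + 1\<close> squared lengths in a term of \<open>tr_upd_le\<close>, all
  but one are bounded by \<open>B\<close>, and the last is averaged together with the moment, which
  costs only \<open>V\<close>. The factorials are arranged so that the right-hand side is a
  coefficient of a Cauchy product.\<close>

lemma sum_tr_upd:
  assumes A: "sop r A" and \<sigma>: "\<bar>\<sigma>\<bar> = 1" and s: "0 \<le> s"
  shows "(\<Sum>t\<in>P. s ^ K / fact K * tr r (upd r \<sigma> (R t) A) K) \<le>
     card P * (\<Sum>j\<le>K. cf \<sigma> s j * (s ^ (K - j) / fact (K - j) * tr r A (K - j)))"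
proof -
  let ?q = "\<lambda>t. ip r (R t) (R t)"
  have hn: "0 \<le> mom r A v k" for v k by (rule mom_nonneg[OF A])
  have "(\<Sum>t\<in>P. tr r (upd r \<sigma> (R t) A) K) \<le> (\<Sum>t\<in>P. tr r A K + \<sigma> * K * mom r A (R t) (K - 1)
     + (\<Sum>j<K. real (K choose (j + 2)) * B ^ j * (?q t * mom r A (R t) (K - 2 - j))))"
  proof (intro sum_mono order_trans[OF tr_upd_le[OF A \<sigma>]] add_left_mono)
    fix t j assume "t \<in> P"
    have "?q t ^ j \<le> B ^ j" using bound[OF \<open>t \<in> P\<close>] by (intro power_mono) auto
    then have "real (K choose (j + 2)) * ?q t ^ j * (?q t * mom r A (R t) (K - 2 - j)) \<le> real (K choose (j + 2)) * B ^ j * (?q t * mom r A (R t) (K - 2 - j))"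
      using hn by (intro mult_right_mono mult_left_mono mult_nonneg_nonneg) auto
    then show "real (K choose (j + 2)) * ?q t ^ Suc j * mom r A (R t) (K - 2 - j) \<le> real (K choose (j + 2)) * B ^ j * (?q t * mom r A (R t) (K - 2 - j))"
      by (simp add: mult_ac)
  qed
  also have "\<dots> = card P * tr r A K + \<sigma> * K * (\<Sum>t\<in>P. mom r A (R t) (K - 1)) +
     (\<Sum>j<K. real (K choose (j + 2)) * B ^ j * (\<Sum>t\<in>P. ?q t * mom r A (R t) (K - 2 - j)))"
    by (subst (2) sum_distrib_left, subst sum.swap) (simp add: sum.distrib sum_distrib_left)
  finally have 1: "(\<Sum>t\<in>P. tr r (upd r \<sigma> (R t) A) K) \<le> \<dots>" .
  have 2: "(\<Sum>j<K. real (K choose (j + 2)) * B ^ j * (\<Sum>t\<in>P. ?q t * mom r A (R t) (K - 2 - j)))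
      \<le> (\<Sum>j<K. real (K choose (j + 2)) * B ^ j * (card P * V * tr r A (K - 2 - j)))"
    using B by (intro sum_mono mult_left_mono sum_mom_weighted[OF A]) auto
  have 3: "(\<Sum>t\<in>P. tr r (upd r \<sigma> (R t) A) K) \<le> card P * (tr r A K + \<sigma> * K * tr r A (K - 1)
     + (\<Sum>j<K. real (K choose (j + 2)) * B ^ j * V * tr r A (K - 2 - j)))"
    using 1 2 unfolding sum_mom[OF A] by (simp add: algebra_simps sum_distrib_left)
  have "(\<Sum>t\<in>P. s ^ K / fact K * tr r (upd r \<sigma> (R t) A) K) = s ^ K / fact K * (\<Sum>t\<in>P. tr r (upd r \<sigma> (R t) A) K)"
    by (simp add: sum_distrib_left)
  also have "\<dots> \<le> s ^ K / fact K * (card P * (tr r A K + \<sigma> * K * tr r A (K - 1)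
     + (\<Sum>j<K. real (K choose (j + 2)) * B ^ j * V * tr r A (K - 2 - j))))"
    using s by (intro mult_left_mono 3) auto
  also have "\<dots> = card P * (s ^ K / fact K * tr r A K + s ^ K / fact K * (\<sigma> * K * tr r A (K - 1))
     + (\<Sum>j<K. s ^ K / fact K * (real (K choose (j + 2)) * B ^ j * V * tr r A (K - 2 - j))))"
    by (simp add: algebra_simps sum_distrib_left)
  also have "\<dots> = card P * (\<Sum>j\<le>K. cf \<sigma> s j * (s ^ (K - j) / fact (K - j) * tr r A (K - j)))"
  proof (cases K)
    case 0
    then show ?thesis by (simp add: cf_def)
  next
    case (Suc k)
    let ?g = "\<lambda>j. cf \<sigma> s j * (s ^ (K - j) / fact (K - j) * tr r A (K - j))"
    have c: "s ^ K / fact K * (real (K choose j) * B ^ (j - 2) * V * tr r A (K - j)) = ?g j" if "2 \<le> j" "j \<le> K" for j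
    proof -
      have "s ^ K = s ^ j * s ^ (K - j)" using that by (simp flip: power_add)
      then show ?thesis using that by (simp add: binomial_fact cf_def)
    qed
    have "(\<Sum>j<K. s ^ K / fact K * (real (K choose (j + 2)) * B ^ j * V * tr r A (K - 2 - j)))
       = (\<Sum>j<k. s ^ K / fact K * (real (K choose (j + 2)) * B ^ (j + 2 - 2) * V * tr r A (K - (j + 2))))"
      by (simp add: Suc binomial_eq_0)
    also have "\<dots> = (\<Sum>j<k. ?g (j + 2))"
      by (intro sum.cong refl c) (auto simp: Suc)
    finally have 4: "(\<Sum>j<K. s ^ K / fact K * (real (K choose (j + 2)) * B ^ j * V * tr r A (K - 2 - j))) = (\<Sum>j<k. ?g (j + 2))" .
    have 5: "s ^ K / fact K * (\<sigma> * K * tr r A (K - 1)) = ?g 1"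
    proof -
      have "s ^ K / fact K * K = s ^ k / fact k * s" unfolding Suc fact_Suc power_Suc
        by (simp add: divide_simps del: of_nat_Suc)
      then show ?thesis by (simp add: Suc cf_def mult_ac)
    qed
    have 6: "s ^ K / fact K * tr r A K = ?g 0" by (simp add: cf_def)
    have "(\<Sum>j\<le>K. ?g j) = ?g 0 + (?g 1 + (\<Sum>j<k. ?g (j + 2)))"
      unfolding Suc lessThan_Suc_atMost[symmetric] sum.lessThan_Suc_shift[of _ "Suc k"] sum.lessThan_Suc_shift[of _ k]
      by simp
    then show ?thesis unfolding 4 5 6 by simp
  qed
  finally show ?thesis .
qed

text \<open>The condition \<open>s * B \<le> 1\<close> is what
  \<open>exp x - 1 - x \<le> x^2\<close> requires at \<open>x = s * B\<close>; the powers of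
  \<open>B\<close> then cancel and \<open>V * s\<^sup>2\<close> is left.\<close>

lemma cf_sums:
  shows "summable (\<lambda>j. \<bar>cf \<sigma> s j\<bar>)" "0 \<le> s \<Longrightarrow> s * B \<le> 1 \<Longrightarrow> (\<Sum>j. cf \<sigma> s j) \<le> exp (\<sigma> * s + V * s\<^sup>2)"
proof -
  have B0: "0 < B" using B by simp
  have e: "(\<lambda>j. (s * B) ^ (j + 2) / fact (j + 2)) sums (exp (s * B) - 1 - s * B)"
    using exp_converges[of "s * B"] sums_iff_shift[of "\<lambda>j. (s * B) ^ j / fact j" 2 "exp (s * B) - 1 - s * B"]
    by (simp add: numeral_2_eq_2 divide_inverse mult.commute)
  have c: "cf \<sigma> s (j + 2) = V / B\<^sup>2 * ((s * B) ^ (j + 2) / fact (j + 2))" for j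
    using B0 by (simp add: cf_def field_simps power2_eq_square)
  have s2: "(\<lambda>j. cf \<sigma> s (j + 2)) sums (V / B\<^sup>2 * (exp (s * B) - 1 - s * B))"
    unfolding c by (rule sums_mult[OF e])
  then have s: "cf \<sigma> s sums (V / B\<^sup>2 * (exp (s * B) - 1 - s * B) + (1 + \<sigma> * s))"
    using sums_iff_shift[of "cf \<sigma> s" 2 "V / B\<^sup>2 * (exp (s * B) - 1 - s * B)"]
    by (simp add: numeral_2_eq_2 cf_def[of _ _ 0] cf_def[of _ _ "Suc 0"])
  show "summable (\<lambda>j. \<bar>cf \<sigma> s j\<bar>)"
  proof -
    have "summable (\<lambda>j. \<bar>V / B\<^sup>2\<bar> * (\<bar>s * B\<bar> ^ (j + 2) / fact (j + 2)))"
      using exp_converges[of "\<bar>s * B\<bar>"]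
      by (intro summable_mult summable_ignore_initial_segment) (simp add: sums_iff divide_inverse mult.commute)
    then have "summable (\<lambda>j. \<bar>cf \<sigma> s (j + 2)\<bar>)"
      unfolding c by (simp add: abs_mult power_abs)
    then show ?thesis by (subst (asm) summable_iff_shift)
  qed
  assume s0: "0 \<le> s" and s1: "s * B \<le> 1"
  have "V / B\<^sup>2 * (exp (s * B) - 1 - s * B) \<le> V / B\<^sup>2 * (s * B)\<^sup>2"
    using s0 s1 B0 V_nonneg by (intro mult_left_mono exp_bound_square) auto
  also have "\<dots> = V * s\<^sup>2" using B0 by (simp add: power_mult_distrib)
  finally have "(\<Sum>j. cf \<sigma> s j) \<le> 1 + (\<sigma> * s + V * s\<^sup>2)" using s by (simp add: sums_iff)
  also have "\<dots> \<le> exp (\<sigma> * s + V * s\<^sup>2)" by (rule exp_ge_add_one_self)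
  finally show "(\<Sum>j. cf \<sigma> s j) \<le> exp (\<sigma> * s + V * s\<^sup>2)" .
qed

text \<open>One sampling step multiplies the mean of the trace exponential by a scalar. This takes
  the place of the Golden-Thompson or Lieb inequality in the usual proofs; positivity of
  \<open>A\<close> is the price.\<close>

lemma sum_pot_upd:
  assumes A: "sop r A" "bop r \<beta> A" and \<sigma>: "\<bar>\<sigma>\<bar> = 1" and s: "0 \<le> s" "s * B \<le> 1"
  shows "(\<Sum>t\<in>P. pot r s (upd r \<sigma> (R t) A)) \<le> card P * (exp (\<sigma> * s + V * s\<^sup>2) * pot r s A)"
proof -
  let ?b = "\<lambda>K. s ^ K / fact K * tr r A K"
  have sb: "summable (\<lambda>K. norm (?b K))" using pot_abs_summable[OF A(2) s(1)] by simp
  have sc: "summable (\<lambda>j. norm (cf \<sigma> s j))" using cf_sums(1) by simp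
  have su: "summable (\<lambda>K. s ^ K / fact K * tr r (upd r \<sigma> (R t) A) K)" for t
    using bop_upd[OF A(2)] pot_summable s(1) by blast
  have "(\<Sum>t\<in>P. pot r s (upd r \<sigma> (R t) A)) = (\<Sum>K. \<Sum>t\<in>P. s ^ K / fact K * tr r (upd r \<sigma> (R t) A) K)"
    unfolding pot_def using su by (intro suminf_sum[symmetric]) auto
  also have "\<dots> \<le> (\<Sum>K. card P * (\<Sum>j\<le>K. cf \<sigma> s j * ?b (K - j)))"
    using su Cauchy_product_sums[OF sc sb]
    by (intro suminf_le sum_tr_upd[OF A(1) \<sigma> s(1)] summable_sum summable_mult) (auto simp: sums_iff)
  also have "\<dots> = card P * ((\<Sum>j. cf \<sigma> s j) * pot r s A)"
    unfolding pot_def Cauchy_product[OF sc sb]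
    using Cauchy_product_sums[OF sc sb] by (intro suminf_mult) (auto simp: sums_iff)
  also have "\<dots> \<le> card P * (exp (\<sigma> * s + V * s\<^sup>2) * pot r s A)"
  proof (intro mult_left_mono mult_right_mono cf_sums(2) s)
    show "0 \<le> pot r s A" unfolding pot_def
      using tr_nonneg[OF A(1)] s pot_summable[OF A(2) s(1)] by (intro suminf_nonneg) auto
  qed simp
  finally show ?thesis .
qed

end

subsection \<open>Matrix Bernstein inequality\<close>

text \<open>Both signs \<open>\<sigma> = \<plusminus>1\<close> need positive operators; this is what the shift by \<open>c\<close> times the identity is for.\<close>

definition gop :: "nat \<Rightarrow> real \<Rightarrow> real \<Rightarrow> (nat \<Rightarrow> real) list \<Rightarrow> (nat \<Rightarrow> real) \<Rightarrow> nat \<Rightarrow> real" where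
  "gop r c \<sigma> us = foldr (upd r \<sigma>) us (\<lambda>v i. c * v i)"

lemma gop_Nil: "gop r c \<sigma> [] = (\<lambda>v i. c * v i)" by (simp add: gop_def)
lemma gop_Cons: "gop r c \<sigma> (u # us) = upd r \<sigma> u (gop r c \<sigma> us)" by (simp add: gop_def)

lemma ip_gop: "ip r w (gop r c \<sigma> us v) = c * ip r w v + \<sigma> * (\<Sum>u\<leftarrow>us. ip r u v * ip r u w)"
  by (induction us) (simp_all add: gop_Nil gop_Cons upd_def ip_add ip_scale distrib_left mult.assoc ip_commute)

lemma lin_gop: "lin r (gop r c \<sigma> us)"
proof (induction us)
  case Nil
  then show ?case by (auto simp: gop_Nil lin_def ip_def algebra_simps)
qed (simp add: gop_Cons lin_upd)

lemma bop_gop: "\<exists>\<beta>. bop r \<beta> (gop r c \<sigma> us)"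
proof (induction us)
  case Nil
  have "bop r \<bar>c\<bar> (gop r c \<sigma> [])"
    by (auto simp: gop_Nil bop_def abs_mult intro!: mult_left_mono)
  then show ?case by blast
next
  case (Cons u us)
  then show ?case using bop_upd by (auto simp: gop_Cons)
qed

lemma sop_gop:
  assumes "\<bar>\<sigma>\<bar> = 1" "(\<Sum>u\<leftarrow>us. ip r u u) \<le> c"
  shows "sop r (gop r c \<sigma> us)"
proof -
  have "0 \<le> ip r v (gop r c \<sigma> us v)" for v
  proof -
    have "(\<Sum>u\<leftarrow>us. ip r u v * ip r u v) \<le> (\<Sum>u\<leftarrow>us. ip r u u * ip r v v)"
      using ip_Cauchy_Schwarz by (intro sum_list_mono) (auto simp: power2_eq_square)
    also have "\<dots> = (\<Sum>u\<leftarrow>us. ip r u u) * ip r v v" by (simp add: sum_list_mult_const)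
    also have "\<dots> \<le> c * ip r v v" using assms(2) by (intro mult_right_mono) auto
    finally have 1: "(\<Sum>u\<leftarrow>us. ip r u v * ip r u v) \<le> c * ip r v v" .
    have 2: "0 \<le> (\<Sum>u\<leftarrow>us. ip r u v * ip r u v)" by (intro sum_list_nonneg) auto
    have "- (\<Sum>u\<leftarrow>us. ip r u v * ip r u v) \<le> \<sigma> * (\<Sum>u\<leftarrow>us. ip r u v * ip r u v)"
      using mult_right_mono[OF _ 2, of "-1" \<sigma>] assms(1) by auto
    then show ?thesis using 1 unfolding ip_gop by linarith
  qed
  then show ?thesis using lin_gop by (simp add: sop_def)
qed

lemma exp_le_pot:
  assumes A: "sop r A" "bop r \<beta> A" and s: "0 \<le> s" and v: "\<rho> * ip r v v \<le> ip r v (A v)" "0 < ip r v v" "0 \<le> \<rho>"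
  shows "exp (s * \<rho>) \<le> pot r s A"
proof -
  have 1: "\<rho> ^ k * ip r v v \<le> mom r A v k" for k
  proof (induction k)
    case (Suc k)
    have "ip r v v * (\<rho> ^ Suc k * ip r v v) = (\<rho> * ip r v v) * (\<rho> ^ k * ip r v v)" by simp
    also have "\<dots> \<le> mom r A v 1 * mom r A v k"
      using Suc v by (intro mult_mono) (auto simp: mom_def mom_nonneg[OF A(1)] A(1)[unfolded sop_def])
    also have "\<dots> \<le> ip r v v * mom r A v (Suc k)" using mom_mult_le[OF A(1), of v 1 k] by simp
    finally show ?case using v(2) by (rule mult_left_le_imp_le)
  qed (simp add: mom_def)
  have 2: "\<rho> ^ k \<le> tr r A k" for k
  proof -
    have "ip r v v * \<rho> ^ k \<le> ip r v v * tr r A k"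
      using 1[of k] mom_le_tr[OF A(1), of v k] by (simp add: mult.commute)
    then show ?thesis using v(2) by (rule mult_left_le_imp_le)
  qed
  have e: "(\<lambda>k. (s * \<rho>) ^ k / fact k) sums exp (s * \<rho>)"
    using exp_converges[of "s * \<rho>"] by (simp add: divide_inverse mult.commute)
  have "exp (s * \<rho>) = (\<Sum>k. (s * \<rho>) ^ k / fact k)" using e by (simp add: sums_iff)
  also have "\<dots> \<le> pot r s A"
    unfolding pot_def
  proof (rule suminf_le[OF _ _ pot_summable[OF A(2) s]])
    fix k
    have "s ^ k / fact k * \<rho> ^ k \<le> s ^ k / fact k * tr r A k"
      using s by (intro mult_left_mono 2) auto
    then show "(s * \<rho>) ^ k / fact k \<le> s ^ k / fact k * tr r A k"
      by (simp add: power_mult_distrib)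
  qed (use e in \<open>simp add: sums_iff\<close>)
  finally show ?thesis .
qed

lemma pot_scalar: "pot r s (\<lambda>v i. c * v i) = real r * exp (s * c)"
proof -
  have p: "((\<lambda>v i. c * v i) ^^ k) v = (\<lambda>i. c ^ k * v i)" for k and v :: "nat \<Rightarrow> real"
    by (induction k) (auto simp: mult_ac)
  have "ip r (unit e) (unit e) = 1" if "e < r" for e using that by (simp add: ip_unit) (simp add: unit_def)
  then have "tr r (\<lambda>v i. c * v i) k = real r * c ^ k" for k
    unfolding tr_def mom_def p ip_scale by simp
  then have "pot r s (\<lambda>v i. c * v i) = (\<Sum>k. real r * ((s * c) ^ k / fact k))"
    by (simp add: pot_def power_mult_distrib mult_ac)
  also have "\<dots> = real r * exp (s * c)"
    using exp_converges[of "s * c"] by (subst suminf_mult) (auto simp: sums_iff divide_inverse mult.commute)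
  finally show ?thesis .
qed

section \<open>Independent samples from a cube of index triples\<close>

abbreviation cube :: "nat \<Rightarrow> (nat \<times> nat \<times> nat) set" where
  "cube L \<equiv> {..<2 ^ L} \<times> {..<2 ^ L} \<times> {..<2 ^ L}"

definition smp :: "nat \<Rightarrow> bool list \<Rightarrow> bool list \<Rightarrow> bool list \<Rightarrow> nat \<Rightarrow> nat \<times> nat \<times> nat" where
  "smp L x y z i = (idx L x i, idx L y i, idx L z i)"

lemma smp_in_cube:
  "length x = m * L \<Longrightarrow> length y = m * L \<Longrightarrow> length z = m * L \<Longrightarrow> i < m \<Longrightarrow> smp L x y z i \<in> cube L"
  by (simp add: smp_def idx_less[of _ m])

lemma card_cube: "real (card (cube L)) = (2 ^ L) ^ 3"
  by (simp add: power3_eq_cube)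

locale isotropic_cube = isotropic r "cube L" R B V \<tau> H
  for r L R B V \<tau> H
begin

abbreviation samples :: "nat \<Rightarrow> bool list \<Rightarrow> bool list \<Rightarrow> bool list \<Rightarrow> (nat \<Rightarrow> real) list" where
  "samples m x y z \<equiv> map (\<lambda>i. R (smp L x y z i)) [0..<m]"

lemma samples_Cons:
  assumes "length x = L" "length y = L" "length z = L"
  shows "samples (Suc m) (x @ x') (y @ y') (z @ z') = R (bval x, bval y, bval z) # samples m x' y' z'"
  using assms by (simp add: map_upt_Suc smp_def idx_append_0 idx_append_Suc del: upt_Suc)

text \<open>The operator built from the later samples is independent of the first one, which
  \<open>sum_pot_upd\<close> therefore peels off. The shift \<open>c\<close> stays fixed while
  \<open>m\<close> decreases, so that all partial operators are positive.\<close>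

lemma avg3_pot_gop:
  assumes \<sigma>: "\<bar>\<sigma>\<bar> = 1" and s: "0 \<le> s" "s * B \<le> 1" and c: "real m * B \<le> c"
  shows "avg3 (m * L) (\<lambda>x y z. pot r s (gop r c \<sigma> (samples m x y z)))
     \<le> real r * exp (s * c + m * (\<sigma> * s + V * s\<^sup>2))"
  using c
proof (induction m)
  case 0
  show ?case by (simp add: gop_Nil pot_scalar avg3_def)
next
  case (Suc m)
  let ?\<gamma> = "exp (\<sigma> * s + V * s\<^sup>2)"
  have "avg3 (Suc m * L) (\<lambda>x y z. pot r s (gop r c \<sigma> (samples (Suc m) x y z))) =
     avg3 (m * L) (\<lambda>x' y' z'. avg3 L (\<lambda>x y z. pot r s (gop r c \<sigma> (samples (Suc m) (x @ x') (y @ y') (z @ z')))))"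
    unfolding mult_Suc avg3_append ..
  also have "\<dots> \<le> avg3 (m * L) (\<lambda>x' y' z'. ?\<gamma> * pot r s (gop r c \<sigma> (samples m x' y' z')))"
  proof (rule avg3_mono)
    fix x' y' z' :: "bool list"
    assume l: "length x' = m * L" "length y' = m * L" "length z' = m * L"
    let ?A = "gop r c \<sigma> (samples m x' y' z')"
    have "(\<Sum>u\<leftarrow>samples m x' y' z'. ip r u u) \<le> (\<Sum>i\<leftarrow>[0..<m]. B)"
      unfolding map_map comp_def using smp_in_cube[OF l] bound by (intro sum_list_mono) auto
    also have "\<dots> \<le> c" using Suc.prems B by (simp add: sum_list_triv algebra_simps)
    finally have A: "sop r ?A" by (rule sop_gop[OF \<sigma>])
    obtain \<beta> where \<beta>: "bop r \<beta> ?A" using bop_gop by blast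
    have "avg3 L (\<lambda>x y z. pot r s (gop r c \<sigma> (samples (Suc m) (x @ x') (y @ y') (z @ z'))))
      \<le> avg3 L (\<lambda>x y z. pot r s (upd r \<sigma> (R (bval x, bval y, bval z)) ?A))"
      by (intro avg3_mono) (simp add: samples_Cons gop_Cons del: upt_Suc)
    also have "\<dots> = (\<Sum>t\<in>cube L. pot r s (upd r \<sigma> (R t) ?A)) / (2 ^ L) ^ 3"
      by (rule avg3_bval[of L "\<lambda>t. pot r s (upd r \<sigma> (R t) ?A)"])
    also have "\<dots> \<le> real (card (cube L)) * (?\<gamma> * pot r s ?A) / (2 ^ L) ^ 3"
      by (intro divide_right_mono sum_pot_upd[OF A \<beta> \<sigma> s]) auto
    also have "\<dots> = ?\<gamma> * pot r s ?A" unfolding card_cube by simp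
    finally show "avg3 L (\<lambda>x y z. pot r s (gop r c \<sigma> (samples (Suc m) (x @ x') (y @ y') (z @ z')))) \<le> ?\<gamma> * pot r s ?A" .
  qed
  also have "\<dots> \<le> ?\<gamma> * (real r * exp (s * c + m * (\<sigma> * s + V * s\<^sup>2)))"
    unfolding avg3_cmult using Suc.prems B by (intro mult_left_mono Suc.IH) (auto simp: algebra_simps)
  also have "\<dots> = real r * exp (s * c + Suc m * (\<sigma> * s + V * s\<^sup>2))"
    by (simp add: algebra_simps flip: exp_add)
  finally show ?case .
qed

definition samp_err :: "nat \<Rightarrow> bool list \<Rightarrow> bool list \<Rightarrow> bool list \<Rightarrow> (nat \<Rightarrow> real) \<Rightarrow> real" where
  "samp_err m x y z c = (\<Sum>i<m. (ip r (R (smp L x y z i)) c)\<^sup>2) - m * ip r c c"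

lemma tail_one_sided:
  assumes \<sigma>: "\<bar>\<sigma>\<bar> = 1" and \<eta>: "0 < \<eta>" "\<eta> * B \<le> 2 * V"
  shows "avg3 (m * L) (\<lambda>x y z. of_bool (\<exists>v. \<sigma> * samp_err m x y z v > \<eta> * m * ip r v v))
    \<le> real r * exp (- (m * \<eta>\<^sup>2 / (4 * V)))"
proof -
  have Vp: "0 < V"
  proof -
    have "0 < \<eta> * B" using \<eta> B by simp
    then show ?thesis using \<eta> by linarith
  qed
  \<comment> \<open>The minimiser of \<open>V * s\<^sup>2 - \<eta> * s\<close>; the assumption on
    \<open>\<eta> * B\<close> is exactly \<open>s * B \<le> 1\<close>.\<close>
  define s where "s = \<eta> / (2 * V)"
  have s: "0 \<le> s" "s * B \<le> 1" using \<eta> Vp by (simp_all add: s_def field_simps)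
  define c where "c = real m * B"
  \<comment> \<open>The value that the form exceeds in a bad direction, per unit of squared length:
    shift, mean and deviation.\<close>
  define \<rho> where "\<rho> = c + \<sigma> * m + \<eta> * m"
  have "- real m \<le> \<sigma> * real m" using mult_right_mono[of "-1" \<sigma> "real m"] \<sigma> by auto
  moreover have "real m * 1 \<le> real m * B" using B by (intro mult_left_mono) auto
  ultimately have \<rho>: "0 \<le> \<rho>" using \<eta> by (simp add: \<rho>_def c_def)
  have "avg3 (m * L) (\<lambda>x y z. exp (s * \<rho>) * of_bool (\<exists>v. \<sigma> * samp_err m x y z v > \<eta> * m * ip r v v))
     \<le> avg3 (m * L) (\<lambda>x y z. pot r s (gop r c \<sigma> (samples m x y z)))"
  proof (rule avg3_mono)
    fix x y z :: "bool list"
    assume l: "length x = m * L" "length y = m * L" "length z = m * L"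
    let ?A = "gop r c \<sigma> (samples m x y z)"
    have "(\<Sum>u\<leftarrow>samples m x y z. ip r u u) \<le> (\<Sum>i\<leftarrow>[0..<m]. B)"
      unfolding map_map comp_def using smp_in_cube[OF l] bound by (intro sum_list_mono) auto
    also have "\<dots> \<le> c" by (simp add: sum_list_triv c_def)
    finally have A: "sop r ?A" by (rule sop_gop[OF \<sigma>])
    obtain \<beta> where \<beta>: "bop r \<beta> ?A" using bop_gop by blast
    have p0: "0 \<le> pot r s ?A"
      unfolding pot_def using tr_nonneg[OF A] s pot_summable[OF \<beta> s(1)] by (intro suminf_nonneg) auto
    show "exp (s * \<rho>) * of_bool (\<exists>v. \<sigma> * samp_err m x y z v > \<eta> * m * ip r v v) \<le> pot r s ?A"
    proof (cases "\<exists>v. \<sigma> * samp_err m x y z v > \<eta> * m * ip r v v")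
      case True
      then obtain v where v: "\<sigma> * samp_err m x y z v > \<eta> * m * ip r v v" by blast
      have sl: "(\<Sum>u\<leftarrow>samples m x y z. ip r u v * ip r u v) = (\<Sum>i<m. (ip r (R (smp L x y z i)) v)\<^sup>2)"
        by (simp add: comp_def power2_eq_square interv_sum_list_conv_sum_set_nat lessThan_atLeast0)
      have 1: "ip r v (?A v) = c * ip r v v + \<sigma> * (samp_err m x y z v + m * ip r v v)"
        unfolding ip_gop sl by (simp add: samp_err_def)
      then have 2: "\<rho> * ip r v v \<le> ip r v (?A v)" using v by (simp add: \<rho>_def algebra_simps)
      \<comment> \<open>On vectors of length zero every sample vanishes, so the strict inequality
        fails.\<close>
      have "ip r v v \<noteq> 0"
      proof
        assume 0: "ip r v v = 0"
        have "(ip r u v)\<^sup>2 \<le> 0" for u using ip_Cauchy_Schwarz[of r u v] 0 by simp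
        then have "samp_err m x y z v = 0" using 0 by (simp add: samp_err_def)
        then show False using v 0 by simp
      qed
      then have "0 < ip r v v" using ip_self_nonneg[of r v] by linarith
      from exp_le_pot[OF A \<beta> s(1) 2 this \<rho>] show ?thesis using True by simp
    qed (use p0 in simp)
  qed
  also have "\<dots> \<le> real r * exp (s * c + m * (\<sigma> * s + V * s\<^sup>2))"
    by (rule avg3_pot_gop[OF \<sigma> s]) (simp add: c_def)
  also have "s * c + m * (\<sigma> * s + V * s\<^sup>2) = s * \<rho> + - (m * \<eta>\<^sup>2 / (4 * V))"
    using Vp by (simp add: \<rho>_def s_def power2_eq_square field_simps)
  finally show ?thesis unfolding avg3_cmult exp_add
    by (simp add: mult.left_commute)
qed

theorem tail:
  assumes \<eta>: "0 < \<eta>" "\<eta> * B \<le> 2 * V"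
  shows "avg3 (m * L) (\<lambda>x y z. of_bool (\<exists>v. \<bar>samp_err m x y z v\<bar> > \<eta> * m * ip r v v))
    \<le> 2 * real r * exp (- (m * \<eta>\<^sup>2 / (4 * V)))"
proof -
  have "avg3 (m * L) (\<lambda>x y z. of_bool (\<exists>v. \<bar>samp_err m x y z v\<bar> > \<eta> * m * ip r v v)) \<le>
    avg3 (m * L) (\<lambda>x y z. of_bool (\<exists>v. 1 * samp_err m x y z v > \<eta> * m * ip r v v) + of_bool (\<exists>v. (-1) * samp_err m x y z v > \<eta> * m * ip r v v))"
    by (intro avg3_mono) (auto simp: of_bool_def abs_if)
  also have "\<dots> \<le> 2 * real r * exp (- (m * \<eta>\<^sup>2 / (4 * V)))"
    unfolding avg3_add using tail_one_sided[OF _ \<eta>, of 1 m] tail_one_sided[OF _ \<eta>, of "-1" m] by simp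
  finally show ?thesis .
qed

end

subsection \<open>Sampling a randomly signed tensor transform\<close>

text \<open>Gram-Schmidt, one vector at a time. A vanishing residual adds no basis element, so
  \<open>r\<close> is the rank and no independence is required.\<close>

lemma orthonormal_basis:
  fixes A :: "nat \<Rightarrow> 't \<Rightarrow> real"
  assumes P: "finite P"
  shows "\<exists>r U C. r \<le> n \<and> (\<forall>i<r. \<forall>k<r. (\<Sum>t\<in>P. U i t * U k t) = (if i = k then 1 else 0)) \<and>
     (\<forall>j<n. \<forall>t\<in>P. A j t = (\<Sum>i<r. C j i * U i t))"
proof (induction n)
  case 0
  show ?case by (intro exI[of _ "0::nat"]) simp
next
  case (Suc n)
  then obtain r U C where r: "r \<le> n" and o: "\<And>i k. i < r \<Longrightarrow> k < r \<Longrightarrow> (\<Sum>t\<in>P. U i t * U k t) = (if i = k then 1 else 0)"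
    and C: "\<And>j t. j < n \<Longrightarrow> t \<in> P \<Longrightarrow> A j t = (\<Sum>i<r. C j i * U i t)" by blast
  define c where "c i = (\<Sum>t\<in>P. A n t * U i t)" for i
  define res where "res t = A n t - (\<Sum>i<r. c i * U i t)" for t
  define q where "q = (\<Sum>t\<in>P. (res t)\<^sup>2)"
  have orth: "(\<Sum>t\<in>P. res t * U k t) = 0" if k: "k < r" for k
  proof -
    have "(\<Sum>t\<in>P. res t * U k t) = c k - (\<Sum>i<r. c i * (\<Sum>t\<in>P. U i t * U k t))"
    proof -
      have "(\<Sum>t\<in>P. res t * U k t) = c k - (\<Sum>t\<in>P. \<Sum>i<r. c i * (U i t * U k t))"
        by (simp add: res_def c_def left_diff_distrib sum_subtractf sum_distrib_right mult.assoc)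
      also have "(\<Sum>t\<in>P. \<Sum>i<r. c i * (U i t * U k t)) = (\<Sum>i<r. \<Sum>t\<in>P. c i * (U i t * U k t))"
        by (rule sum.swap)
      finally show ?thesis by (simp add: sum_distrib_left)
    qed
    also have "(\<Sum>i<r. c i * (\<Sum>t\<in>P. U i t * U k t)) = (\<Sum>i<r. if i = k then c k else 0)"
      using o k by (intro sum.cong) auto
    finally show ?thesis using k by simp
  qed
  show ?case
  proof (cases "q = 0")
    case True
    then have res0: "res t = 0" if "t \<in> P" for t
      using that P unfolding q_def by (subst (asm) sum_nonneg_eq_0_iff) auto
    show ?thesis
    proof (intro exI[of _ r] exI[of _ U] exI[of _ "\<lambda>j. if j = n then c else C j"] conjI allI impI ballI)
      fix j t assume "j < Suc n" "t \<in> P"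
      then show "A j t = (\<Sum>i<r. (if j = n then c else C j) i * U i t)"
        using C[of j t] res0[of t] by (auto simp: res_def less_Suc_eq)
    qed (use r o in auto)
  next
    case False
    then have q: "0 < q" using sum_nonneg[of P "\<lambda>t. (res t)\<^sup>2"] by (simp add: q_def less_le)
    define U' where "U' i t = (if i = r then res t / sqrt q else U i t)" for i t
    have 1: "(\<Sum>t\<in>P. U' r t * U' r t) = 1"
    proof -
      have "(\<Sum>t\<in>P. U' r t * U' r t) = (\<Sum>t\<in>P. (res t)\<^sup>2 / q)"
        using q by (intro sum.cong) (simp_all add: U'_def power2_eq_square)
      also have "\<dots> = 1" using q by (simp add: q_def flip: sum_divide_distrib)
      finally show ?thesis .
    qed
    have 2: "(\<Sum>t\<in>P. U' r t * U' k t) = 0" if "k < r" for k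
      using that orth[OF that] by (simp add: U'_def flip: sum_divide_distrib)
    show ?thesis
    proof (intro exI[of _ "Suc r"] exI[of _ U'] exI[of _ "\<lambda>j i. if j = n then (if i = r then sqrt q else c i) else if i = r then 0 else C j i"] conjI allI impI ballI)
      fix i k assume "i < Suc r" "k < Suc r"
      then consider "i = r" "k = r" | "i = r" "k < r" | "i < r" "k = r" | "i < r" "k < r" by linarith
      then show "(\<Sum>t\<in>P. U' i t * U' k t) = (if i = k then 1 else 0)"
      proof cases
        case 3
        then show ?thesis using 2[of i] by (simp add: mult.commute)
      qed (use 1 2 o in \<open>auto simp: U'_def\<close>)
    next
      fix j t assume j: "j < Suc n" and t: "t \<in> P"
      let ?C = "\<lambda>i. if j = n then (if i = r then sqrt q else c i) else if i = r then 0 else C j i"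
      have "(\<Sum>i<Suc r. ?C i * U' i t) = (\<Sum>i<r. (if j = n then c i else C j i) * U i t) + (if j = n then res t else 0)"
        using q by (simp add: U'_def)
      also have "\<dots> = A j t" using j C[of j t] t by (auto simp: res_def less_Suc_eq)
      finally show "A j t = (\<Sum>i<Suc r. ?C i * U' i t)" by simp
    qed (use r in simp)
  qed
qed

definition had3 :: "nat \<Rightarrow> (nat \<Rightarrow> nat \<Rightarrow> nat \<Rightarrow> real) \<Rightarrow> nat \<Rightarrow> nat \<Rightarrow> nat \<Rightarrow> real" where
  "had3 L f i j k = had L (\<lambda>a. had L (\<lambda>b. had L (\<lambda>c. f a b c) k) j) i"

lemma had3_eq:
  assumes "i < 2 ^ L" "j < 2 ^ L" "k < 2 ^ L"
  shows "had3 L f i j k = (\<Sum>a<2 ^ L. \<Sum>b<2 ^ L. \<Sum>c<2 ^ L. hcoef L i a * hcoef L j b * hcoef L k c * f a b c)"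
  using assms by (simp add: had3_def had_eq sum_distrib_left mult_ac)

text \<open>The three transforms are removed one coordinate at a time, each time after moving the
  sum over that coordinate innermost.\<close>

lemma had3_inner:
  "(\<Sum>i<2 ^ L. \<Sum>j<2 ^ L. \<Sum>k<2 ^ L. had3 L f i j k * had3 L g i j k) =
    (2 ^ L) ^ 3 * (\<Sum>a<2 ^ L. \<Sum>b<2 ^ L. \<Sum>c<2 ^ L. f a b c * g a b c)"
proof -
  let ?N = "{..<(2::nat) ^ L}"
  let ?F = "\<lambda>f a j k. had L (\<lambda>b. had L (\<lambda>c. f a b c) k) j"
  have "(\<Sum>i\<in>?N. \<Sum>j\<in>?N. \<Sum>k\<in>?N. had3 L f i j k * had3 L g i j k) = (\<Sum>j\<in>?N. \<Sum>k\<in>?N. \<Sum>i\<in>?N. had3 L f i j k * had3 L g i j k)"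
    by (subst sum.swap) (intro sum.cong refl sum.swap)
  also have "\<dots> = (\<Sum>j\<in>?N. \<Sum>k\<in>?N. 2 ^ L * (\<Sum>a\<in>?N. ?F f a j k * ?F g a j k))"
    unfolding had3_def had_inner ..
  also have "\<dots> = 2 ^ L * (\<Sum>a\<in>?N. \<Sum>k\<in>?N. \<Sum>j\<in>?N. ?F f a j k * ?F g a j k)"
  proof -
    have "(\<Sum>j\<in>?N. \<Sum>k\<in>?N. \<Sum>a\<in>?N. ?F f a j k * ?F g a j k) = (\<Sum>j\<in>?N. \<Sum>a\<in>?N. \<Sum>k\<in>?N. ?F f a j k * ?F g a j k)"
      by (intro sum.cong refl sum.swap)
    also have "\<dots> = (\<Sum>a\<in>?N. \<Sum>j\<in>?N. \<Sum>k\<in>?N. ?F f a j k * ?F g a j k)" by (rule sum.swap)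
    also have "\<dots> = (\<Sum>a\<in>?N. \<Sum>k\<in>?N. \<Sum>j\<in>?N. ?F f a j k * ?F g a j k)" by (intro sum.cong refl sum.swap)
    finally show ?thesis unfolding sum_distrib_left[symmetric] by simp
  qed
  also have "\<dots> = 2 ^ L * (\<Sum>a\<in>?N. \<Sum>k\<in>?N. 2 ^ L * (\<Sum>b\<in>?N. had L (\<lambda>c. f a b c) k * had L (\<lambda>c. g a b c) k))"
    unfolding had_inner ..
  also have "\<dots> = 2 ^ L * (\<Sum>a\<in>?N. 2 ^ L * (\<Sum>b\<in>?N. \<Sum>k\<in>?N. had L (\<lambda>c. f a b c) k * had L (\<lambda>c. g a b c) k))"
    unfolding sum_distrib_left[symmetric]
    by (intro arg_cong2[where f="(*)"] sum.cong refl sum.swap)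
  also have "\<dots> = 2 ^ L * (\<Sum>a\<in>?N. 2 ^ L * (\<Sum>b\<in>?N. 2 ^ L * (\<Sum>c\<in>?N. f a b c * g a b c)))"
    unfolding had_inner ..
  finally show ?thesis by (simp add: sum_distrib_left power3_eq_cube mult_ac)
qed

lemma sum_cube: "(\<Sum>t\<in>cube L. f t) = (\<Sum>a<2 ^ L. \<Sum>b<2 ^ L. \<Sum>c<2 ^ L. f (a, b, c))"
  by (simp add: sum.cartesian_product)

lemma sg_sq_left [simp]: "sg b * (sg b * x) = x"
  by (simp add: sg_def)

locale orthonormal_cube =
  fixes r L :: nat and U :: "nat \<Rightarrow> nat \<times> nat \<times> nat \<Rightarrow> real"
  assumes orth: "\<And>i k. i < r \<Longrightarrow> k < r \<Longrightarrow> (\<Sum>t\<in>cube L. U i t * U k t) = (if i = k then 1 else 0)"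
begin

definition R :: "bool list \<Rightarrow> bool list \<Rightarrow> bool list \<Rightarrow> nat \<times> nat \<times> nat \<Rightarrow> nat \<Rightarrow> real" where
  "R s1 s2 s3 t i = had3 L (\<lambda>a b c. sg (s1 ! a) * sg (s2 ! b) * sg (s3 ! c) * U i (a, b, c)) (fst t) (fst (snd t)) (snd (snd t))"

text \<open>Signs and transforms are isometries up to scale, so isotropy holds for every choice of
  signs; their randomness serves flatness alone.\<close>

lemma R_iso:
  assumes "i < r" "k < r"
  shows "(\<Sum>t\<in>cube L. R s1 s2 s3 t i * R s1 s2 s3 t k) = (if i = k then real (card (cube L)) else 0)"
proof -
  have "(\<Sum>t\<in>cube L. R s1 s2 s3 t i * R s1 s2 s3 t k) = (2 ^ L) ^ 3 * (\<Sum>t\<in>cube L. (\<lambda>(a, b, c).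
       (sg (s1 ! a) * sg (s1 ! a)) * (sg (s2 ! b) * sg (s2 ! b)) * (sg (s3 ! c) * sg (s3 ! c)) * (U i (a, b, c) * U k (a, b, c))) t)"
    unfolding sum_cube R_def fst_conv snd_conv had3_inner by (simp add: mult_ac)
  also have "\<dots> = (2 ^ L) ^ 3 * (\<Sum>t\<in>cube L. U i t * U k t)"
    by (intro arg_cong2[where f="(*)"] sum.cong) auto
  finally show ?thesis using orth[OF assms] card_cube[of L] by simp
qed

text \<open>A transformed row is a trilinear form in the three families of signs. Its vector
  coefficients have total squared length \<open>r\<close>, since the transform has entries of
  modulus 1 and the \<open>r\<close> basis tensors have length 1.\<close>

lemma R_moment:
  assumes t: "t \<in> cube L"
  shows "avg3 (2 ^ L) (\<lambda>s1 s2 s3. ip r (R s1 s2 s3 t) (R s1 s2 s3 t) ^ k) \<le> dfact k ^ 3 * real r ^ k"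
proof -
  obtain i j l where t': "t = (i, j, l)" "i < 2 ^ L" "j < 2 ^ L" "l < 2 ^ L" using t by auto
  define w where "w a b c e = hcoef L i a * hcoef L j b * hcoef L l c * U e (a, b, c)" for a b c e
  have sq: "hcoef L i a * hcoef L i a = 1" for i a
    using abs_hcoef[of L i a] by (metis abs_mult_self_eq mult_1)
  have "ip r (R s1 s2 s3 t) (R s1 s2 s3 t) = nsq {..<r} (\<lambda>e. \<Sum>a<2 ^ L. \<Sum>b<2 ^ L. \<Sum>c<2 ^ L. sg (s1 ! a) * sg (s2 ! b) * sg (s3 ! c) * w a b c e)" for s1 s2 s3
    unfolding ip_def nsq_def power2_eq_square R_def t' fst_conv snd_conv had3_eq[OF t'(2-4)] w_def
    by (simp only: mult_ac)
  then have "avg3 (2 ^ L) (\<lambda>s1 s2 s3. ip r (R s1 s2 s3 t) (R s1 s2 s3 t) ^ k) \<le> dfact k ^ 3 * (\<Sum>a<2 ^ L. \<Sum>b<2 ^ L. \<Sum>c<2 ^ L. nsq {..<r} (w a b c)) ^ k"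
    unfolding avg3_def using Khintchine_vector3[of "{..<r}" "2 ^ L" "2 ^ L" "2 ^ L" w k] by simp
  also have "(\<Sum>a<2 ^ L. \<Sum>b<2 ^ L. \<Sum>c<2 ^ L. nsq {..<r} (w a b c)) = (\<Sum>t\<in>cube L. \<Sum>e<r. U e t * U e t)"
  proof -
    have "nsq {..<r} (w a b c) = (\<Sum>e<r. U e (a, b, c) * U e (a, b, c))" for a b c
    proof -
      have "(w a b c e)\<^sup>2 = (hcoef L i a * hcoef L i a) * (hcoef L j b * hcoef L j b) * (hcoef L l c * hcoef L l c) * (U e (a, b, c) * U e (a, b, c))" for e
        by (simp only: w_def power2_eq_square mult_ac)
      then show ?thesis by (simp add: nsq_def sq)
    qed
    then show ?thesis by (simp add: sum_cube)
  qed
  also have "\<dots> = (\<Sum>e<r. \<Sum>t\<in>cube L. U e t * U e t)" by (rule sum.swap)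
  also have "\<dots> = real r" by (simp add: orth)
  finally show ?thesis .
qed

end

lemma avg3_sum: "avg3 l (\<lambda>x y z. \<Sum>i\<in>I. F i x y z) = (\<Sum>i\<in>I. avg3 l (F i))"
  by (simp add: avg3_def avg_sum)

lemma avg3_Markov:
  assumes "0 < c" "\<And>x y z. 0 \<le> F x y z"
  shows "avg3 l (\<lambda>x y z. of_bool (F x y z > c)) \<le> avg3 l F / c"
proof -
  have "avg3 l (\<lambda>x y z. of_bool (F x y z > c)) \<le> avg3 l (\<lambda>x y z. (1 / c) * F x y z)"
    using assms by (intro avg3_mono) (auto simp: field_simps of_bool_def)
  then show ?thesis unfolding avg3_cmult by simp
qed

lemma avg3_const: "avg3 l (\<lambda>x y z. c) = c" by (simp add: avg3_def)

context orthonormal_cube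
begin

text \<open>A union bound with moments of order \<open>k\<close>; the factor
  \<open>(2 ^ L) ^ 3\<close> counts the rows.\<close>

lemma flat_max:
  assumes "0 < B"
  shows "avg3 (2 ^ L) (\<lambda>s1 s2 s3. of_bool (\<exists>t\<in>cube L. ip r (R s1 s2 s3 t) (R s1 s2 s3 t) > B))
    \<le> (2 ^ L) ^ 3 * dfact k ^ 3 * real r ^ k / B ^ k"
proof -
  let ?q = "\<lambda>s1 s2 s3 t. ip r (R s1 s2 s3 t) (R s1 s2 s3 t)"
  have "avg3 (2 ^ L) (\<lambda>s1 s2 s3. of_bool (\<exists>t\<in>cube L. ?q s1 s2 s3 t > B))
     \<le> avg3 (2 ^ L) (\<lambda>s1 s2 s3. \<Sum>t\<in>cube L. (1 / B ^ k) * ?q s1 s2 s3 t ^ k)"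
  proof (rule avg3_mono)
    fix s1 s2 s3 :: "bool list"
    have nn: "0 \<le> (1 / B ^ k) * ?q s1 s2 s3 t ^ k" for t using assms by simp
    show "of_bool (\<exists>t\<in>cube L. ?q s1 s2 s3 t > B) \<le> (\<Sum>t\<in>cube L. (1 / B ^ k) * ?q s1 s2 s3 t ^ k)"
    proof (cases "\<exists>t\<in>cube L. ?q s1 s2 s3 t > B")
      case True
      then obtain t where t: "t \<in> cube L" "?q s1 s2 s3 t > B" by blast
      have "1 \<le> (1 / B ^ k) * ?q s1 s2 s3 t ^ k"
        using power_mono[of B "?q s1 s2 s3 t" k] t assms by simp
      also have "\<dots> \<le> (\<Sum>t\<in>cube L. (1 / B ^ k) * ?q s1 s2 s3 t ^ k)"
        using t nn by (intro member_le_sum) auto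
      finally show ?thesis using True by simp
    next
      case False
      then show ?thesis using nn by (simp add: sum_nonneg)
    qed
  qed
  also have "\<dots> \<le> (\<Sum>t\<in>cube L. (1 / B ^ k) * (dfact k ^ 3 * real r ^ k))"
    unfolding avg3_sum avg3_cmult using assms by (intro sum_mono mult_left_mono R_moment) auto
  finally show ?thesis by (simp add: power3_eq_cube mult_ac)
qed

text \<open>Markov's inequality for the total weight of the heavy rows, on which the squared weight
  is at most \<open>q ^ (k + 2) / \<tau> ^ k\<close>. Averaging over the rows replaces the union
  bound, so the number of rows cancels.\<close>

lemma flat_heavy:
  assumes "0 < \<tau>" "0 < H"
  shows "avg3 (2 ^ L) (\<lambda>s1 s2 s3. of_bool ((\<Sum>t | t \<in> cube L \<and> ip r (R s1 s2 s3 t) (R s1 s2 s3 t) > \<tau>. (ip r (R s1 s2 s3 t) (R s1 s2 s3 t))\<^sup>2)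
     > real (card (cube L)) * H)) \<le> dfact (k + 2) ^ 3 * real r ^ (k + 2) / (\<tau> ^ k * H)"
proof -
  let ?q = "\<lambda>s1 s2 s3 t. ip r (R s1 s2 s3 t) (R s1 s2 s3 t)"
  have c: "0 < real (card (cube L))" unfolding card_cube by simp
  have "avg3 (2 ^ L) (\<lambda>s1 s2 s3. of_bool ((\<Sum>t | t \<in> cube L \<and> ?q s1 s2 s3 t > \<tau>. (?q s1 s2 s3 t)\<^sup>2) > real (card (cube L)) * H))
    \<le> avg3 (2 ^ L) (\<lambda>s1 s2 s3. \<Sum>t | t \<in> cube L \<and> ?q s1 s2 s3 t > \<tau>. (?q s1 s2 s3 t)\<^sup>2) / (real (card (cube L)) * H)"
    using assms c by (intro avg3_Markov) (auto intro!: sum_nonneg mult_pos_pos)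
  also have "\<dots> \<le> avg3 (2 ^ L) (\<lambda>s1 s2 s3. \<Sum>t\<in>cube L. (1 / \<tau> ^ k) * ?q s1 s2 s3 t ^ (k + 2)) / (real (card (cube L)) * H)"
  proof (intro divide_right_mono avg3_mono)
    fix s1 s2 s3 :: "bool list"
    have nn: "0 \<le> (1 / \<tau> ^ k) * ?q s1 s2 s3 t ^ (k + 2)" for t using assms by (simp del: power_add_numeral)
    have "(\<Sum>t | t \<in> cube L \<and> ?q s1 s2 s3 t > \<tau>. (?q s1 s2 s3 t)\<^sup>2) \<le> (\<Sum>t | t \<in> cube L \<and> ?q s1 s2 s3 t > \<tau>. (1 / \<tau> ^ k) * ?q s1 s2 s3 t ^ (k + 2))"
    proof (intro sum_mono)
      fix t assume "t \<in> {t. t \<in> cube L \<and> ?q s1 s2 s3 t > \<tau>}"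
      then have "1 \<le> ?q s1 s2 s3 t ^ k / \<tau> ^ k"
        using power_mono[of \<tau> "?q s1 s2 s3 t" k] assms by simp
      then have "1 * (?q s1 s2 s3 t)\<^sup>2 \<le> ?q s1 s2 s3 t ^ k / \<tau> ^ k * (?q s1 s2 s3 t)\<^sup>2"
        by (intro mult_right_mono) auto
      then show "(?q s1 s2 s3 t)\<^sup>2 \<le> (1 / \<tau> ^ k) * ?q s1 s2 s3 t ^ (k + 2)"
        unfolding power_add by (simp add: mult_ac)
    qed
    also have "\<dots> \<le> (\<Sum>t\<in>cube L. (1 / \<tau> ^ k) * ?q s1 s2 s3 t ^ (k + 2))"
      using nn by (intro sum_mono2) auto
    finally show "(\<Sum>t | t \<in> cube L \<and> ?q s1 s2 s3 t > \<tau>. (?q s1 s2 s3 t)\<^sup>2) \<le> (\<Sum>t\<in>cube L. (1 / \<tau> ^ k) * ?q s1 s2 s3 t ^ (k + 2))" .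
  qed (use assms c in simp)
  also have "\<dots> \<le> (\<Sum>t\<in>cube L. (1 / \<tau> ^ k) * (dfact (k + 2) ^ 3 * real r ^ (k + 2))) / (real (card (cube L)) * H)"
    unfolding avg3_sum avg3_cmult using assms c by (intro divide_right_mono sum_mono mult_left_mono R_moment) auto
  also have "\<dots> = real (card (cube L)) * ((1 / \<tau> ^ k) * (dfact (k + 2) ^ 3 * real r ^ (k + 2))) / (real (card (cube L)) * H)"
    by (simp only: sum_constant)
  also have "\<dots> = dfact (k + 2) ^ 3 * real r ^ (k + 2) / (\<tau> ^ k * H)"
  proof -
    have "C * (1 / a * b) / (C * H) = b / (a * H)" if "0 < C" "0 < a" for C a b :: real
      using that assms by (simp add: field_simps)
    then show ?thesis using c assms by simp
  qed
  finally show ?thesis .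
qed

text \<open>For signs that make the rows flat in both senses the sampling tail applies; for all
  other signs failure is assumed.\<close>

lemma embed:
  assumes "0 < \<tau>" "0 < H" "1 \<le> B" "0 < \<eta>" "\<eta> * B \<le> 2 * (\<tau> + H)"
  shows "avg3 (2 ^ L) (\<lambda>s1 s2 s3. avg3 (m * L) (\<lambda>x y z. of_bool (\<exists>v.
       \<bar>(\<Sum>i<m. (ip r (R s1 s2 s3 (smp L x y z i)) v)\<^sup>2) - m * ip r v v\<bar> > \<eta> * m * ip r v v)))
     \<le> (2 ^ L) ^ 3 * dfact k ^ 3 * real r ^ k / B ^ k + dfact (k + 2) ^ 3 * real r ^ (k + 2) / (\<tau> ^ k * H)
        + 2 * real r * exp (- (m * \<eta>\<^sup>2 / (4 * (\<tau> + H))))"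
proof -
  let ?q = "\<lambda>s1 s2 s3 t. ip r (R s1 s2 s3 t) (R s1 s2 s3 t)"
  let ?e = "2 * real r * exp (- (m * \<eta>\<^sup>2 / (4 * (\<tau> + H))))"
  let ?bad = "\<lambda>s1 s2 s3 x y z. \<exists>v. \<bar>(\<Sum>i<m. (ip r (R s1 s2 s3 (smp L x y z i)) v)\<^sup>2) - m * ip r v v\<bar> > \<eta> * m * ip r v v"
  have "avg3 (m * L) (\<lambda>x y z. of_bool (?bad s1 s2 s3 x y z)) \<le>
      of_bool (\<exists>t\<in>cube L. ?q s1 s2 s3 t > B) +
      of_bool ((\<Sum>t | t \<in> cube L \<and> ?q s1 s2 s3 t > \<tau>. (?q s1 s2 s3 t)\<^sup>2) > real (card (cube L)) * H) + ?e" for s1 s2 s3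
  proof (cases "(\<exists>t\<in>cube L. ?q s1 s2 s3 t > B) \<or> (\<Sum>t | t \<in> cube L \<and> ?q s1 s2 s3 t > \<tau>. (?q s1 s2 s3 t)\<^sup>2) > real (card (cube L)) * H")
    case True
    have "avg3 (m * L) (\<lambda>x y z. of_bool (?bad s1 s2 s3 x y z)) \<le> avg3 (m * L) (\<lambda>x y z. 1)"
      by (intro avg3_mono) (simp add: of_bool_def)
    then have "avg3 (m * L) (\<lambda>x y z. of_bool (?bad s1 s2 s3 x y z)) \<le> 1" by (simp add: avg3_const)
    moreover have "1 \<le> (of_bool (\<exists>t\<in>cube L. ?q s1 s2 s3 t > B) +
      of_bool ((\<Sum>t | t \<in> cube L \<and> ?q s1 s2 s3 t > \<tau>. (?q s1 s2 s3 t)\<^sup>2) > real (card (cube L)) * H) :: real)"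
      using True by (auto simp: of_bool_def)
    moreover have "0 \<le> ?e" by simp
    ultimately show ?thesis by linarith
  next
    case False
    have "(0::nat, 0::nat, 0::nat) \<in> cube L" by simp
    then interpret I: isotropic_cube r L "R s1 s2 s3" B "\<tau> + H" \<tau> H
      using False assms R_iso by unfold_locales (auto simp: not_less lessThan_empty_iff)
    have "avg3 (m * L) (\<lambda>x y z. of_bool (?bad s1 s2 s3 x y z)) \<le> ?e"
      using I.tail[OF assms(4,5), of m] by (simp add: I.samp_err_def)
    then show ?thesis by (simp add: of_bool_def)
  qed
  then have "avg3 (2 ^ L) (\<lambda>s1 s2 s3. avg3 (m * L) (\<lambda>x y z. of_bool (?bad s1 s2 s3 x y z))) \<le>
     avg3 (2 ^ L) (\<lambda>s1 s2 s3. of_bool (\<exists>t\<in>cube L. ?q s1 s2 s3 t > B) +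
      of_bool ((\<Sum>t | t \<in> cube L \<and> ?q s1 s2 s3 t > \<tau>. (?q s1 s2 s3 t)\<^sup>2) > real (card (cube L)) * H) + ?e)"
    by (intro avg3_mono)
  also have "\<dots> \<le> (2 ^ L) ^ 3 * dfact k ^ 3 * real r ^ k / B ^ k + dfact (k + 2) ^ 3 * real r ^ (k + 2) / (\<tau> ^ k * H) + ?e"
    unfolding avg3_add avg3_const using assms by (intro add_mono flat_max flat_heavy order_refl) auto
  finally show ?thesis .
qed

end

text \<open>Combinations of the \<open>n\<close> tensors are described by their coordinates
  \<open>?v c\<close> in an orthonormal basis of the span, so a bad \<open>c\<close> yields a bad
  coordinate vector. Passing from the dimension \<open>r\<close> of the span to \<open>n\<close>
  only weakens the bound.\<close>

theorem tensor_embedding: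
  fixes A :: "nat \<Rightarrow> nat \<times> nat \<times> nat \<Rightarrow> real"
  assumes "0 < \<tau>" "0 < H" "1 \<le> B" "0 < \<eta>" "\<eta> * B \<le> 2 * (\<tau> + H)"
  shows "avg3 (2 ^ L) (\<lambda>s1 s2 s3. avg3 (m * L) (\<lambda>x y z. of_bool (\<exists>c.
       \<bar>(\<Sum>i<m. (\<Sum>j<n. c j * had3 L (\<lambda>a b d. sg (s1 ! a) * sg (s2 ! b) * sg (s3 ! d) * A j (a, b, d)) (idx L x i) (idx L y i) (idx L z i))\<^sup>2)
         - m * (\<Sum>t\<in>cube L. (\<Sum>j<n. c j * A j t)\<^sup>2)\<bar> > \<eta> * m * (\<Sum>t\<in>cube L. (\<Sum>j<n. c j * A j t)\<^sup>2))))
     \<le> (2 ^ L) ^ 3 * dfact k ^ 3 * real n ^ k / B ^ k + dfact (k + 2) ^ 3 * real n ^ (k + 2) / (\<tau> ^ k * H)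
        + 2 * real n * exp (- (m * \<eta>\<^sup>2 / (4 * (\<tau> + H))))"
proof -
  obtain r U C where r: "r \<le> n" and o: "\<And>i k. i < r \<Longrightarrow> k < r \<Longrightarrow> (\<Sum>t\<in>cube L. U i t * U k t) = (if i = k then 1 else 0)"
    and C: "\<And>j t. j < n \<Longrightarrow> t \<in> cube L \<Longrightarrow> A j t = (\<Sum>i<r. C j i * U i t)"
    using orthonormal_basis[of "cube L" n A] by auto blast
  interpret orthonormal_cube r L U by unfold_locales (rule o)
  let ?v = "\<lambda>c i. \<Sum>j<n. c j * C j i"
  have cA: "(\<Sum>j<n. c j * A j t) = (\<Sum>i<r. ?v c i * U i t)" if "t \<in> cube L" for c t
  proof -
    have "(\<Sum>j<n. c j * A j t) = (\<Sum>j<n. \<Sum>i<r. c j * C j i * U i t)"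
      using C that by (intro sum.cong) (auto simp: sum_distrib_left mult_ac)
    also have "\<dots> = (\<Sum>i<r. ?v c i * U i t)" by (subst sum.swap) (simp add: sum_distrib_right)
    finally show ?thesis .
  qed
  have Q: "(\<Sum>t\<in>cube L. (\<Sum>j<n. c j * A j t)\<^sup>2) = ip r (?v c) (?v c)" for c
  proof -
    have "(\<Sum>t\<in>cube L. (\<Sum>j<n. c j * A j t)\<^sup>2) = (\<Sum>t\<in>cube L. \<Sum>i<r. \<Sum>k<r. (?v c i * ?v c k) * (U i t * U k t))"
      by (intro sum.cong) (simp_all add: cA power2_eq_square sum_product mult_ac)
    also have "\<dots> = (\<Sum>i<r. \<Sum>t\<in>cube L. \<Sum>k<r. (?v c i * ?v c k) * (U i t * U k t))" by (rule sum.swap)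
    also have "\<dots> = (\<Sum>i<r. \<Sum>k<r. \<Sum>t\<in>cube L. (?v c i * ?v c k) * (U i t * U k t))" by (intro sum.cong refl sum.swap)
    also have "\<dots> = (\<Sum>i<r. \<Sum>k<r. if i = k then ?v c i * ?v c k else 0)"
      by (intro sum.cong refl) (auto simp: o simp flip: sum_distrib_left)
    finally show ?thesis by (simp add: ip_def)
  qed
  have S: "(\<Sum>j<n. c j * had3 L (\<lambda>a b d. sg (s1 ! a) * sg (s2 ! b) * sg (s3 ! d) * A j (a, b, d)) e f g) = ip r (R s1 s2 s3 (e, f, g)) (?v c)"
    if "e < 2 ^ L" "f < 2 ^ L" "g < 2 ^ L" for c s1 s2 s3 e f g
  proof -
    define K where "K = (\<lambda>(a, b, d). hcoef L e a * hcoef L f b * hcoef L g d * (sg (s1 ! a) * sg (s2 ! b) * sg (s3 ! d)))"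
    have h: "had3 L (\<lambda>a b d. sg (s1 ! a) * sg (s2 ! b) * sg (s3 ! d) * F (a, b, d)) e f g = (\<Sum>t\<in>cube L. K t * F t)" for F :: "nat \<times> nat \<times> nat \<Rightarrow> real"
      unfolding had3_eq[OF that] sum_cube by (simp add: K_def mult_ac)
    have "(\<Sum>j<n. c j * (\<Sum>t\<in>cube L. K t * A j t)) = (\<Sum>t\<in>cube L. K t * (\<Sum>j<n. c j * A j t))"
      unfolding sum_distrib_left by (subst sum.swap) (simp add: mult_ac)
    also have "\<dots> = (\<Sum>t\<in>cube L. K t * (\<Sum>i<r. ?v c i * U i t))"
      by (intro sum.cong) (simp_all only: cA)
    also have "\<dots> = (\<Sum>i<r. (\<Sum>t\<in>cube L. K t * U i t) * ?v c i)"
    proof -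
      have "(\<Sum>t\<in>cube L. K t * (\<Sum>i<r. w i * U i t)) = (\<Sum>i<r. (\<Sum>t\<in>cube L. K t * U i t) * w i)" for w
        unfolding sum_distrib_left sum_distrib_right by (subst sum.swap) (simp add: mult_ac)
      then show ?thesis .
    qed
    finally show ?thesis by (simp only: h R_def ip_def fst_conv snd_conv)
  qed
  have "avg3 (2 ^ L) (\<lambda>s1 s2 s3. avg3 (m * L) (\<lambda>x y z. of_bool (\<exists>c.
       \<bar>(\<Sum>i<m. (\<Sum>j<n. c j * had3 L (\<lambda>a b d. sg (s1 ! a) * sg (s2 ! b) * sg (s3 ! d) * A j (a, b, d)) (idx L x i) (idx L y i) (idx L z i))\<^sup>2)
         - m * (\<Sum>t\<in>cube L. (\<Sum>j<n. c j * A j t)\<^sup>2)\<bar> > \<eta> * m * (\<Sum>t\<in>cube L. (\<Sum>j<n. c j * A j t)\<^sup>2))))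
    \<le> avg3 (2 ^ L) (\<lambda>s1 s2 s3. avg3 (m * L) (\<lambda>x y z. of_bool (\<exists>v.
       \<bar>(\<Sum>i<m. (ip r (R s1 s2 s3 (smp L x y z i)) v)\<^sup>2) - m * ip r v v\<bar> > \<eta> * m * ip r v v)))"
  proof (intro avg3_mono)
    fix s1 s2 s3 x y z :: "bool list"
    assume l: "length x = m * L" "length y = m * L" "length z = m * L"
    have e: "(\<Sum>i<m. (\<Sum>j<n. c j * had3 L (\<lambda>a b d. sg (s1 ! a) * sg (s2 ! b) * sg (s3 ! d) * A j (a, b, d)) (idx L x i) (idx L y i) (idx L z i))\<^sup>2)
      = (\<Sum>i<m. (ip r (R s1 s2 s3 (smp L x y z i)) (?v c))\<^sup>2)" for c
      unfolding smp_def by (intro sum.cong refl arg_cong[where f="\<lambda>x. x\<^sup>2"] S) (auto simp: idx_less[OF l(1)] idx_less[OF l(2)] idx_less[OF l(3)])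
    show "of_bool (\<exists>c. \<bar>(\<Sum>i<m. (\<Sum>j<n. c j * had3 L (\<lambda>a b d. sg (s1 ! a) * sg (s2 ! b) * sg (s3 ! d) * A j (a, b, d)) (idx L x i) (idx L y i) (idx L z i))\<^sup>2)
         - m * (\<Sum>t\<in>cube L. (\<Sum>j<n. c j * A j t)\<^sup>2)\<bar> > \<eta> * m * (\<Sum>t\<in>cube L. (\<Sum>j<n. c j * A j t)\<^sup>2))
      \<le> (of_bool (\<exists>v. \<bar>(\<Sum>i<m. (ip r (R s1 s2 s3 (smp L x y z i)) v)\<^sup>2) - m * ip r v v\<bar> > \<eta> * m * ip r v v) :: real)"
      unfolding e Q by (auto simp: of_bool_def)
  qed
  also have "\<dots> \<le> (2 ^ L) ^ 3 * dfact k ^ 3 * real r ^ k / B ^ k + dfact (k + 2) ^ 3 * real r ^ (k + 2) / (\<tau> ^ k * H)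
        + 2 * real r * exp (- (m * \<eta>\<^sup>2 / (4 * (\<tau> + H))))"
    by (rule embed[OF assms])
  also have "\<dots> \<le> (2 ^ L) ^ 3 * dfact k ^ 3 * real n ^ k / B ^ k + dfact (k + 2) ^ 3 * real n ^ (k + 2) / (\<tau> ^ k * H)
        + 2 * real n * exp (- (m * \<eta>\<^sup>2 / (4 * (\<tau> + H))))"
    using r assms by (intro add_mono divide_right_mono mult_mono mult_left_mono power_mono mult_nonneg_nonneg zero_le_power) auto
  finally show ?thesis .
qed

subsection \<open>The sketch and its kernels\<close>

text \<open>A segment of \<open>flen L M\<close> coins holds \<open>2 ^ L\<close> signs, followed by
  \<open>M\<close> indices of \<open>L\<close> bits each.\<close>

definition fact_sk :: "nat \<Rightarrow> bool list \<Rightarrow> (nat \<Rightarrow> real) \<Rightarrow> nat \<Rightarrow> real" where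
  "fact_sk L w f i = had L (\<lambda>a. sg (w ! a) * f a) (idx L (drop (2 ^ L) w) i)"

definition flen :: "nat \<Rightarrow> nat \<Rightarrow> nat" where "flen L M = 2 ^ L + M * L"

text \<open>The tensor product \<open>z \<otimes> z \<otimes> u\<close> is transformed and sampled factor by factor, never formed; \<open>u\<close> is
  the data vector or the unit vector \<open>e0\<close> according to the current binary digit of the exponent.\<close>

definition level :: "nat \<Rightarrow> nat \<Rightarrow> real \<Rightarrow> bool list \<Rightarrow> (nat \<Rightarrow> real) \<Rightarrow> (nat \<Rightarrow> real) \<Rightarrow> nat \<Rightarrow> real" where
  "level L M sc w u z i = (if i < M then sc * fact_sk L w z i * fact_sk L (drop (flen L M) w) z i *
     fact_sk L (drop (flen L M) (drop (flen L M) w)) u i else 0)"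

definition e0 :: "nat \<Rightarrow> real" where "e0 a = of_bool (a = 0)"

fun sk :: "nat \<Rightarrow> nat \<Rightarrow> real \<Rightarrow> bool list \<Rightarrow> bool list \<Rightarrow> (nat \<Rightarrow> real) \<Rightarrow> (nat \<Rightarrow> real) \<Rightarrow> nat \<Rightarrow> real" where
  "sk L M sc [] w x z = z"
| "sk L M sc (b # bs) w x z = sk L M sc bs (drop (3 * flen L M) w) x (level L M sc w (if b then x else e0) z)"

definition Kq :: "nat \<Rightarrow> (nat \<Rightarrow> nat \<Rightarrow> real) \<Rightarrow> (nat \<Rightarrow> real) \<Rightarrow> real" where
  "Kq n k c = (\<Sum>i<n. \<Sum>j<n. c i * c j * k i j)"

definition gr :: "nat \<Rightarrow> (nat \<Rightarrow> nat \<Rightarrow> real) \<Rightarrow> nat \<Rightarrow> nat \<Rightarrow> real" where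
  "gr N Z i j = (\<Sum>a<N. Z i a * Z j a)"

lemma sum_square_swap:
  fixes Z :: "nat \<Rightarrow> 'a \<Rightarrow> real"
  shows "(\<Sum>a\<in>S. (\<Sum>j<n. c j * Z j a)\<^sup>2) = (\<Sum>i<n. \<Sum>j<n. c i * c j * (\<Sum>a\<in>S. Z i a * Z j a))"
proof -
  have "(\<Sum>a\<in>S. (\<Sum>j<n. c j * Z j a)\<^sup>2) = (\<Sum>a\<in>S. \<Sum>i<n. \<Sum>j<n. c i * c j * (Z i a * Z j a))"
    by (simp add: power2_eq_square sum_product mult_ac)
  also have "\<dots> = (\<Sum>i<n. \<Sum>a\<in>S. \<Sum>j<n. c i * c j * (Z i a * Z j a))" by (rule sum.swap)
  also have "\<dots> = (\<Sum>i<n. \<Sum>j<n. \<Sum>a\<in>S. c i * c j * (Z i a * Z j a))" by (intro sum.cong refl sum.swap)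
  finally show ?thesis by (simp add: sum_distrib_left)
qed

lemma Kq_gr: "Kq n (gr N Z) c = (\<Sum>a<N. (\<Sum>j<n. c j * Z j a)\<^sup>2)"
  unfolding sum_square_swap by (simp add: Kq_def gr_def)

subsection \<open>Positive kernels and Schur products\<close>

text \<open>Positivity is witnessed by a finite factorisation instead of nonnegative forms, so that
  the Schur product theorem \<open>pk_mult\<close> is mere multiplying out.\<close>

definition pk :: "(nat \<Rightarrow> nat \<Rightarrow> real) \<Rightarrow> bool" where
  "pk k \<longleftrightarrow> (\<exists>F. \<forall>i j. k i j = (\<Sum>f\<leftarrow>F. f i * f j))"

lemma pk_gr: "pk (gr N Z)"
  unfolding pk_def gr_def
  by (intro exI[of _ "map (\<lambda>a i. Z i a) [0..<N]"]) (simp add: comp_def interv_sum_list_conv_sum_set_nat lessThan_atLeast0)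

lemma pk_1: "pk (\<lambda>i j. 1)"
  unfolding pk_def by (intro exI[of _ "[\<lambda>_. 1]"]) simp

lemma sum_list_product_concat:
  fixes F G :: "(nat \<Rightarrow> real) list"
  shows "(\<Sum>f\<leftarrow>F. f i * f j) * (\<Sum>g\<leftarrow>G. g i * g j) = (\<Sum>h\<leftarrow>concat (map (\<lambda>f. map (\<lambda>g i. f i * g i) G) F). h i * h j)"
proof (induction F)
  case (Cons f F)
  have "f i * f j * (\<Sum>g\<leftarrow>G. g i * g j) = (\<Sum>g\<leftarrow>G. (f i * g i) * (f j * g j))"
    by (simp add: mult_ac flip: sum_list_const_mult)
  then show ?case using Cons by (simp add: distrib_right comp_def)
qed simp

lemma pk_mult: "pk k \<Longrightarrow> pk h \<Longrightarrow> pk (\<lambda>i j. k i j * h i j)"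
proof -
  assume "pk k" "pk h"
  then obtain F G where "\<forall>i j. k i j = (\<Sum>f\<leftarrow>F. f i * f j)" "\<forall>i j. h i j = (\<Sum>g\<leftarrow>G. g i * g j)"
    by (auto simp: pk_def)
  then show ?thesis unfolding pk_def
    by (intro exI[of _ "concat (map (\<lambda>f. map (\<lambda>g i. f i * g i) G) F)"]) (simp only: sum_list_product_concat simp_thms)
qed

lemma pk_power: "pk k \<Longrightarrow> pk (\<lambda>i j. k i j ^ e)"
  by (induction e) (simp_all add: pk_1 pk_mult)

lemma Kq_mult_expand:
  assumes "\<forall>i j. h i j = (\<Sum>f\<leftarrow>F. f i * f j)"
  shows "Kq n (\<lambda>i j. k i j * h i j) c = (\<Sum>f\<leftarrow>F. Kq n k (\<lambda>i. c i * f i))"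
proof -
  have h: "h = (\<lambda>i j. \<Sum>f\<leftarrow>F. f i * f j)" using assms by blast
  show ?thesis unfolding h
  proof (induction F)
    case Nil
    then show ?case by (simp add: Kq_def)
  next
    case (Cons f F)
    then show ?case by (simp add: Kq_def distrib_left sum.distrib mult_ac)
  qed
qed

text \<open>Multiplication by a rank-one kernel \<open>f i * f j\<close> only replaces the
  coefficients \<open>c i\<close> by \<open>c i * f i\<close>, and the hypothesis holds for all
  coefficients.\<close>

lemma Schur_mono:
  assumes "pk h" "\<And>c. Kq n k c \<le> \<kappa> * Kq n k' c"
  shows "Kq n (\<lambda>i j. k i j * h i j) c \<le> \<kappa> * Kq n (\<lambda>i j. k' i j * h i j) c"
proof -
  obtain F where F: "\<forall>i j. h i j = (\<Sum>f\<leftarrow>F. f i * f j)" using assms(1) by (auto simp: pk_def)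
  have "(\<Sum>f\<leftarrow>F. Kq n k (\<lambda>i. c i * f i)) \<le> (\<Sum>f\<leftarrow>F. \<kappa> * Kq n k' (\<lambda>i. c i * f i))"
    by (intro sum_list_mono assms(2))
  then show ?thesis unfolding Kq_mult_expand[OF F] by (simp add: sum_list_const_mult)
qed

lemma Schur_mono':
  assumes "pk h" "\<And>c. \<kappa> * Kq n k' c \<le> Kq n k c"
  shows "\<kappa> * Kq n (\<lambda>i j. k' i j * h i j) c \<le> Kq n (\<lambda>i j. k i j * h i j) c"
proof -
  obtain F where F: "\<forall>i j. h i j = (\<Sum>f\<leftarrow>F. f i * f j)" using assms(1) by (auto simp: pk_def)
  have "(\<Sum>f\<leftarrow>F. \<kappa> * Kq n k' (\<lambda>i. c i * f i)) \<le> (\<Sum>f\<leftarrow>F. Kq n k (\<lambda>i. c i * f i))"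
    by (intro sum_list_mono assms(2))
  then show ?thesis unfolding Kq_mult_expand[OF F] by (simp add: sum_list_const_mult)
qed

definition approx :: "nat \<Rightarrow> real \<Rightarrow> real \<Rightarrow> (nat \<Rightarrow> nat \<Rightarrow> real) \<Rightarrow> (nat \<Rightarrow> nat \<Rightarrow> real) \<Rightarrow> bool" where
  "approx n lo hi k k' \<longleftrightarrow> (\<forall>c. lo * Kq n k' c \<le> Kq n k c \<and> Kq n k c \<le> hi * Kq n k' c)"

text \<open>The two copies of \<open>k\<close> are exchanged for \<open>k'\<close> one after the
  other; each time the remaining factors form a positive kernel, so the relative errors
  multiply.\<close>

lemma approx_Schur_square:
  assumes a: "approx n lo hi k k'" and pk: "pk k" "pk k'" "pk h" and nn: "0 \<le> lo" "0 \<le> hi"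
  shows "approx n (lo\<^sup>2) (hi\<^sup>2) (\<lambda>i j. k i j * k i j * h i j) (\<lambda>i j. k' i j * k' i j * h i j)"
proof -
  have p1: "pk (\<lambda>i j. k i j * h i j)" and p2: "pk (\<lambda>i j. k' i j * h i j)" using pk by (simp_all add: pk_mult)
  have 1: "Kq n (\<lambda>i j. k i j * (k i j * h i j)) c \<le> hi * Kq n (\<lambda>i j. k' i j * (k i j * h i j)) c"
    and 2: "lo * Kq n (\<lambda>i j. k' i j * (k i j * h i j)) c \<le> Kq n (\<lambda>i j. k i j * (k i j * h i j)) c"
    and 3: "Kq n (\<lambda>i j. k i j * (k' i j * h i j)) c \<le> hi * Kq n (\<lambda>i j. k' i j * (k' i j * h i j)) c"
    and 4: "lo * Kq n (\<lambda>i j. k' i j * (k' i j * h i j)) c \<le> Kq n (\<lambda>i j. k i j * (k' i j * h i j)) c" for c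
    using a p1 p2 by (intro Schur_mono Schur_mono'; simp add: approx_def)+
  have e: "(\<lambda>i j. k' i j * (k i j * h i j)) = (\<lambda>i j. k i j * (k' i j * h i j))" by (simp add: mult_ac)
  show ?thesis
    unfolding approx_def power2_eq_square mult.assoc
    using order_trans[OF 1[unfolded e] mult_left_mono[OF 3 nn(2)]] order_trans[OF mult_left_mono[OF 4 nn(1)] 2[unfolded e]]
    by blast
qed

lemma approx_trans:
  assumes "approx n lo hi k k'" "approx n lo' hi' k'' k" "0 \<le> lo'" "0 \<le> hi'"
  shows "approx n (lo' * lo) (hi' * hi) k'' k'"
  using assms unfolding approx_def mult.assoc
  by (meson mult_left_mono order_trans)

lemma Kq_nonneg: "pk k \<Longrightarrow> 0 \<le> Kq n k c"
proof -
  assume "pk k"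
  then obtain F where F: "\<forall>i j. k i j = (\<Sum>f\<leftarrow>F. f i * f j)" by (auto simp: pk_def)
  have "Kq n (\<lambda>i j. 1 * k i j) c = (\<Sum>f\<leftarrow>F. Kq n (\<lambda>i j. 1) (\<lambda>i. c i * f i))"
    by (rule Kq_mult_expand[OF F])
  moreover have "0 \<le> Kq n (\<lambda>i j. 1) d" for d
  proof -
    have "Kq n (\<lambda>i j. 1) d = (\<Sum>i<n. d i) * (\<Sum>i<n. d i)" by (simp add: Kq_def sum_product)
    then show ?thesis by simp
  qed
  ultimately show ?thesis by (auto intro!: sum_list_nonneg)
qed

lemma approx_weaken:
  assumes "approx n lo hi k k'" "pk k'" "lo' \<le> lo" "hi \<le> hi'"
  shows "approx n lo' hi' k k'"
  using assms Kq_nonneg[OF assms(2)] unfolding approx_def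
  by (meson mult_right_mono order_trans)

subsection \<open>One level\<close>

lemma sum_product3:
  fixes f g h :: "nat \<Rightarrow> real"
  shows "sum f A * sum g B * sum h C = (\<Sum>a\<in>A. \<Sum>b\<in>B. \<Sum>d\<in>C. f a * g b * h d)"
proof -
  have "sum f A * sum g B * sum h C = (\<Sum>a\<in>A. f a * (sum g B * sum h C))"
    by (simp only: sum_distrib_right[symmetric] mult.assoc)
  also have "\<dots> = (\<Sum>a\<in>A. f a * (\<Sum>b\<in>B. \<Sum>d\<in>C. g b * h d))"
    unfolding sum_product ..
  finally show ?thesis by (simp only: sum_distrib_left mult.assoc)
qed

text \<open>The Gram kernel of the tensors \<open>z \<otimes> z \<otimes> w\<close>: tensor products
  of vectors correspond to Schur products of kernels.\<close>

definition level_gram :: "nat \<Rightarrow> (nat \<Rightarrow> nat \<Rightarrow> real) \<Rightarrow> (nat \<Rightarrow> nat \<Rightarrow> real) \<Rightarrow> nat \<Rightarrow> nat \<Rightarrow> real" where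
  "level_gram N Z W i j = gr N Z i j * gr N Z i j * gr N W i j"

lemma level_gram_cube:
  "Kq n (level_gram (2 ^ L) Z W) c = (\<Sum>t\<in>cube L. (\<Sum>j<n. c j * (\<lambda>(a, b, d). Z j a * Z j b * W j d) t)\<^sup>2)"
proof -
  have "(\<Sum>t\<in>cube L. (\<lambda>(a, b, d). Z i a * Z i b * W i d) t * (\<lambda>(a, b, d). Z j a * Z j b * W j d) t) = level_gram (2 ^ L) Z W i j" for i j
  proof -
    have "level_gram (2 ^ L) Z W i j = (\<Sum>a<2 ^ L. \<Sum>b<2 ^ L. \<Sum>d<2 ^ L. (Z i a * Z j a) * (Z i b * Z j b) * (W i d * W j d))"
      unfolding level_gram_def gr_def by (rule sum_product3)
    then show ?thesis by (simp add: sum_cube mult_ac)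
  qed
  then show ?thesis unfolding sum_square_swap Kq_def by simp
qed

lemma had3_product: "had3 L (\<lambda>a b d. f a * g b * h d) i j k = had L f i * had L g j * had L h k"
  if "i < 2 ^ L" "j < 2 ^ L" "k < 2 ^ L"
  unfolding had3_eq[OF that] had_eq[OF that(1)] had_eq[OF that(2)] had_eq[OF that(3)] sum_product3
  by (simp add: mult_ac)

text \<open>The coins come factor by factor, signs before indices, whereas the embedding estimate
  fixes all signs before drawing any index.\<close>

lemma avg_level:
  "avg (3 * flen L M) (\<lambda>w. f w) = avg3 (2 ^ L) (\<lambda>s1 s2 s3. avg3 (M * L) (\<lambda>x y z. f ((s1 @ x) @ (s2 @ y) @ (s3 @ z))))"
proof -
  have "avg (3 * flen L M) f = avg (2 ^ L) (\<lambda>s1. avg (M * L) (\<lambda>x. avg (2 ^ L) (\<lambda>s2. avg (M * L) (\<lambda>y. avg (2 ^ L) (\<lambda>s3. avg (M * L) (\<lambda>z. f ((s1 @ x) @ (s2 @ y) @ (s3 @ z))))))))"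
  proof -
    have "3 * flen L M = (2 ^ L + M * L) + ((2 ^ L + M * L) + (2 ^ L + M * L))" by (simp add: flen_def)
    then show ?thesis by (simp only: avg_append)
  qed
  also have "\<dots> = avg (2 ^ L) (\<lambda>s1. avg (2 ^ L) (\<lambda>s2. avg (M * L) (\<lambda>x. avg (2 ^ L) (\<lambda>s3. avg (M * L) (\<lambda>y. avg (M * L) (\<lambda>z. f ((s1 @ x) @ (s2 @ y) @ (s3 @ z))))))))"
    by (simp only: avg_swap[of "M * L" "2 ^ L"])
  also have "\<dots> = avg (2 ^ L) (\<lambda>s1. avg (2 ^ L) (\<lambda>s2. avg (2 ^ L) (\<lambda>s3. avg (M * L) (\<lambda>x. avg (M * L) (\<lambda>y. avg (M * L) (\<lambda>z. f ((s1 @ x) @ (s2 @ y) @ (s3 @ z))))))))"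
    by (simp only: avg_swap[of "M * L" "2 ^ L"])
  finally show ?thesis by (simp add: avg3_def)
qed

text \<open>The transforms are not normalised, so each squared sample already has the right mean and
  \<open>sc\<close> only averages over the \<open>M\<close> samples. \<open>M \<le> 2 ^ L\<close>
  leaves room for padding the samples to the common vector length.\<close>

lemma level_prob:
  assumes p: "0 < \<tau>" "0 < H" "1 \<le> B" "0 < \<eta>" "\<eta> * B \<le> 2 * (\<tau> + H)"
    and M: "0 < M" "M \<le> 2 ^ L" and sc: "sc\<^sup>2 * real M = 1"
  shows "avg (3 * flen L M) (\<lambda>w. of_bool (\<not> approx n (1 - \<eta>) (1 + \<eta>)
        (gr (2 ^ L) (\<lambda>j. level L M sc w (W j) (Z j))) (level_gram (2 ^ L) Z W)))
     \<le> (2 ^ L) ^ 3 * dfact k ^ 3 * real n ^ k / B ^ k + dfact (k + 2) ^ 3 * real n ^ (k + 2) / (\<tau> ^ k * H)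
        + 2 * real n * exp (- (M * \<eta>\<^sup>2 / (4 * (\<tau> + H))))"
proof -
  let ?A = "\<lambda>j. \<lambda>(a, b, d). Z j a * Z j b * W j d"
  have "avg (3 * flen L M) (\<lambda>w. of_bool (\<not> approx n (1 - \<eta>) (1 + \<eta>)
        (gr (2 ^ L) (\<lambda>j. level L M sc w (W j) (Z j))) (level_gram (2 ^ L) Z W)))
    \<le> avg3 (2 ^ L) (\<lambda>s1 s2 s3. avg3 (M * L) (\<lambda>x y z. of_bool (\<exists>c.
       \<bar>(\<Sum>i<M. (\<Sum>j<n. c j * had3 L (\<lambda>a b d. sg (s1 ! a) * sg (s2 ! b) * sg (s3 ! d) * ?A j (a, b, d)) (idx L x i) (idx L y i) (idx L z i))\<^sup>2)
         - M * (\<Sum>t\<in>cube L. (\<Sum>j<n. c j * ?A j t)\<^sup>2)\<bar> > \<eta> * M * (\<Sum>t\<in>cube L. (\<Sum>j<n. c j * ?A j t)\<^sup>2))))"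
    unfolding avg_level
  proof (intro avg3_mono)
    fix s1 s2 s3 x y z :: "bool list"
    assume s: "length s1 = 2 ^ L" "length s2 = 2 ^ L" "length s3 = 2 ^ L"
      and l: "length x = M * L" "length y = M * L" "length z = M * L"
    let ?w = "(s1 @ x) @ (s2 @ y) @ (s3 @ z)"
    have F: "flen L M = length (s1 @ x)" "flen L M = length (s2 @ y)" using s l by (simp_all add: flen_def)
    have ix: "idx L (x @ u) i = idx L x i" if "i < M" "length x = M * L" for x u i
    proof -
      have "i * L + L \<le> length x" using that
        by (metis Suc_leI mult_Suc mult_le_mono1 add.commute)
      then show ?thesis by (simp add: idx_def)
    qed
    have f: "fact_sk L (s @ x @ u) f i = had L (\<lambda>a. sg (s ! a) * f a) (idx L x i)"
      if "length s = 2 ^ L" "i < M" "length x = M * L" for s x u f i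
    proof -
      have "idx L (drop (2 ^ L) (s @ x @ u)) i = idx L x i" using that ix by simp
      moreover have "idx L x i < 2 ^ L" using that idx_less by blast
      ultimately show ?thesis using that by (simp add: fact_sk_def had_eq nth_append)
    qed
    have d1: "drop (flen L M) ?w = s2 @ y @ s3 @ z" unfolding F(1) by simp
    have d2: "drop (flen L M) (s2 @ y @ s3 @ z) = s3 @ z @ []" using F(2) by simp
    let ?h = "\<lambda>j i. had3 L (\<lambda>a b d. sg (s1 ! a) * sg (s2 ! b) * sg (s3 ! d) * ?A j (a, b, d)) (idx L x i) (idx L y i) (idx L z i)"
    have lv: "level L M sc ?w (W j) (Z j) i = sc * ?h j i" if i: "i < M" for i j
    proof -
      have "?h j i = had3 L (\<lambda>a b d. (sg (s1 ! a) * Z j a) * (sg (s2 ! b) * Z j b) * (sg (s3 ! d) * W j d)) (idx L x i) (idx L y i) (idx L z i)"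
        by (simp add: mult_ac)
      also have "\<dots> = had L (\<lambda>a. sg (s1 ! a) * Z j a) (idx L x i) * had L (\<lambda>b. sg (s2 ! b) * Z j b) (idx L y i) * had L (\<lambda>d. sg (s3 ! d) * W j d) (idx L z i)"
        using i l idx_less by (intro had3_product) blast+
      finally show ?thesis
        using i f[OF s(1) i l(1), of "s2 @ y @ s3 @ z"] f[OF s(2) i l(2), of "s3 @ z"] f[OF s(3) i l(3), of "[]"]
        unfolding level_def d1 d2 by (simp add: mult_ac)
    qed
    have K: "Kq n (gr (2 ^ L) (\<lambda>j. level L M sc ?w (W j) (Z j))) c = sc\<^sup>2 * (\<Sum>i<M. (\<Sum>j<n. c j * ?h j i)\<^sup>2)" for c
    proof -
      have "Kq n (gr (2 ^ L) (\<lambda>j. level L M sc ?w (W j) (Z j))) c = (\<Sum>i<M. (\<Sum>j<n. c j * level L M sc ?w (W j) (Z j) i)\<^sup>2)"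
        unfolding Kq_gr using M by (intro sum.mono_neutral_right) (auto simp: level_def)
      also have "\<dots> = (\<Sum>i<M. sc\<^sup>2 * (\<Sum>j<n. c j * ?h j i)\<^sup>2)"
      proof (intro sum.cong refl)
        fix i assume "i \<in> {..<M}"
        then have "(\<Sum>j<n. c j * level L M sc ?w (W j) (Z j) i) = sc * (\<Sum>j<n. c j * ?h j i)"
          using lv by (simp add: sum_distrib_left mult_ac)
        then show "(\<Sum>j<n. c j * level L M sc ?w (W j) (Z j) i)\<^sup>2 = sc\<^sup>2 * (\<Sum>j<n. c j * ?h j i)\<^sup>2"
          by (simp only: power_mult_distrib)
      qed
      finally show ?thesis by (simp only: sum_distrib_left)
    qed
    have "approx n (1 - \<eta>) (1 + \<eta>) (gr (2 ^ L) (\<lambda>j. level L M sc ?w (W j) (Z j))) (level_gram (2 ^ L) Z W)"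
      if "\<not> (\<exists>c. \<bar>(\<Sum>i<M. (\<Sum>j<n. c j * ?h j i)\<^sup>2) - M * (\<Sum>t\<in>cube L. (\<Sum>j<n. c j * ?A j t)\<^sup>2)\<bar> > \<eta> * M * (\<Sum>t\<in>cube L. (\<Sum>j<n. c j * ?A j t)\<^sup>2))"
      unfolding approx_def
    proof
      fix c
      let ?S = "\<Sum>i<M. (\<Sum>j<n. c j * ?h j i)\<^sup>2" and ?Q = "Kq n (level_gram (2 ^ L) Z W) c"
      have "\<bar>?S - M * ?Q\<bar> \<le> \<eta> * M * ?Q" using that unfolding level_gram_cube by (meson not_less)
      then have "sc\<^sup>2 * \<bar>?S - M * ?Q\<bar> \<le> sc\<^sup>2 * (\<eta> * M * ?Q)" by (intro mult_left_mono) auto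
      moreover have "sc\<^sup>2 * (\<eta> * M * ?Q) = (sc\<^sup>2 * M) * (\<eta> * ?Q)" by simp
      moreover have "sc\<^sup>2 * \<bar>?S - M * ?Q\<bar> = \<bar>sc\<^sup>2 * ?S - (sc\<^sup>2 * M) * ?Q\<bar>"
      proof -
        have "s * \<bar>a - b * q\<bar> = \<bar>s * a - (s * b) * q\<bar>" if "0 \<le> s" for s a b q :: real
        proof -
          have "s * a - (s * b) * q = s * (a - b * q)" by (simp add: algebra_simps)
          then show ?thesis using that by (simp add: abs_mult)
        qed
        then show ?thesis by simp
      qed
      ultimately have "\<bar>sc\<^sup>2 * ?S - ?Q\<bar> \<le> \<eta> * ?Q" unfolding sc by simp
      then show "(1 - \<eta>) * ?Q \<le> Kq n (gr (2 ^ L) (\<lambda>j. level L M sc ?w (W j) (Z j))) c \<and>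
         Kq n (gr (2 ^ L) (\<lambda>j. level L M sc ?w (W j) (Z j))) c \<le> (1 + \<eta>) * ?Q"
        unfolding K by (simp add: algebra_simps abs_le_iff)
    qed
    then show "of_bool (\<not> approx n (1 - \<eta>) (1 + \<eta>) (gr (2 ^ L) (\<lambda>j. level L M sc ?w (W j) (Z j))) (level_gram (2 ^ L) Z W))
      \<le> (of_bool (\<exists>c. \<bar>(\<Sum>i<M. (\<Sum>j<n. c j * ?h j i)\<^sup>2) - M * (\<Sum>t\<in>cube L. (\<Sum>j<n. c j * ?A j t)\<^sup>2)\<bar> > \<eta> * M * (\<Sum>t\<in>cube L. (\<Sum>j<n. c j * ?A j t)\<^sup>2)) :: real)"
      by (auto simp only: of_bool_def split: if_split)
  qed
  also have "\<dots> \<le> (2 ^ L) ^ 3 * dfact k ^ 3 * real n ^ k / B ^ k + dfact (k + 2) ^ 3 * real n ^ (k + 2) / (\<tau> ^ k * H)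
        + 2 * real n * exp (- (M * \<eta>\<^sup>2 / (4 * (\<tau> + H))))"
    by (rule tensor_embedding[OF p])
  finally show ?thesis .
qed

subsection \<open>Composition of the levels\<close>

lemma level_append:
  assumes "length w = 3 * flen L M"
  shows "level L M sc (w @ v) u z = level L M sc w u z"
proof
  fix i
  have f: "fact_sk L (w @ v) f i = fact_sk L w f i" if "flen L M \<le> length w" "i < M" for w f
  proof -
    have a: "i * L + L \<le> M * L" using that
      by (metis Suc_leI mult_Suc mult_le_mono1 add.commute)
    have i: "idx L (drop (2 ^ L) (w @ v)) i = idx L (drop (2 ^ L) w) i"
      using that a by (simp add: idx_def flen_def)
    have "length (take L (drop (i * L) (drop (2 ^ L) w))) = L" using that a by (simp add: flen_def)
    then have "idx L (drop (2 ^ L) w) i < 2 ^ L" unfolding idx_def using bval_less by metis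
    then show ?thesis using that i by (simp add: fact_sk_def had_eq nth_append flen_def)
  qed
  show "level L M sc (w @ v) u z i = level L M sc w u z i"
    using assms f[of w] f[of "drop (flen L M) w"] f[of "drop (flen L M) (drop (flen L M) w)"]
    by (simp add: level_def)
qed

text \<open>Horner's rule in base two, leading digit first.\<close>

fun expo :: "nat \<Rightarrow> bool list \<Rightarrow> nat" where
  "expo e [] = e"
| "expo e (b # bs) = expo (2 * e + of_bool b) bs"

text \<open>Each of the \<open>r\<close> later levels doubles the relative error, which the factor \<open>2\<^sup>r\<close> compensates. The weights
  \<open>(3/4)\<^sup>j\<close> with \<open>j = l - r\<close> are summable, while \<open>4\<^sup>j (3/4)\<^sup>2\<^sup>j\<close> still grows, which pays for failure probabilities
  that halve from level to level.\<close>

definition eta :: "real \<Rightarrow> nat \<Rightarrow> nat \<Rightarrow> real" where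
  "eta \<epsilon> l r = \<epsilon> / 6 * (3 / 4) ^ (l - r) / 2 ^ r"

lemma gr_e0: "gr (2 ^ L) (\<lambda>_. e0) i j = 1"
proof -
  have "gr (2 ^ L) (\<lambda>_. e0) i j = (\<Sum>a<(2::nat) ^ L. if a = 0 then 1 else 0)"
    unfolding gr_def e0_def by (intro sum.cong) auto
  then show ?thesis by simp
qed

text \<open>Converts relative errors into exponents, where composition is additive. This is the
  source of the asymmetric pair \<open>exp (- 2 * h)\<close> and \<open>exp h\<close>.\<close>

lemma exp_neg_le: 
  fixes x :: real
  assumes "0 \<le> x" "x \<le> 1 / 2"
  shows "exp (- 2 * x) \<le> 1 - x"
proof -
  have "exp (- 2 * x) = 1 / exp (2 * x)" by (simp add: exp_minus inverse_eq_divide)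
  also have "\<dots> \<le> 1 / (1 + 2 * x)"
    using exp_ge_add_one_self[of "2 * x"] assms by (intro divide_left_mono) auto
  also have "\<dots> \<le> 1 - x"
  proof -
    have "x * (2 * x) \<le> x * 1" using assms by (intro mult_left_mono) auto
    then show ?thesis using assms by (simp add: field_simps)
  qed
  finally show ?thesis .
qed

text \<open>With errors written as exponents, a level turns \<open>h\<close> into
  \<open>2 * h + \<eta>\<close>: squaring the kernel doubles, the fresh embedding adds. Scaled by
  \<open>2 ^ r\<close>, the increments are \<open>\<epsilon> / 6 * (3 / 4) ^ j\<close> with
  \<open>j = l - r\<close>; their partial sums \<open>\<epsilon> / 2 * (1 - (3 / 4) ^ j)\<close>
  form the invariant on \<open>h\<close>. The failure probability allowed to a level equals the
  total for all later ones, so every level doubles the total.\<close>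

lemma sketch_prob:
  assumes M: "0 < M" "M \<le> 2 ^ L" and sc: "sc\<^sup>2 * real M = 1"
    and \<epsilon>: "0 < \<epsilon>" "\<epsilon> < 1" and \<delta>: "0 \<le> \<delta>"
    and lev: "\<And>r Z W. r < l \<Longrightarrow> avg (3 * flen L M) (\<lambda>w. of_bool (\<not> approx n (1 - eta \<epsilon> l r) (1 + eta \<epsilon> l r)
        (gr (2 ^ L) (\<lambda>j. level L M sc w (W j) (Z j))) (level_gram (2 ^ L) Z W))) \<le> \<delta> / 2 ^ (l - r)"
    and bs: "length bs \<le> l" and h: "0 \<le> h" "2 ^ length bs * h \<le> \<epsilon> / 2 * (1 - (3 / 4) ^ (l - length bs))"
    and Z: "approx n (exp (- 2 * h)) (exp h) (gr (2 ^ L) Z) (\<lambda>i j. gr (2 ^ L) X i j ^ e)"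
  shows "avg (3 * flen L M * length bs) (\<lambda>w. of_bool (\<not> approx n (1 - \<epsilon>) (1 + \<epsilon>)
       (gr (2 ^ L) (\<lambda>j. sk L M sc bs w (X j) (Z j))) (\<lambda>i j. gr (2 ^ L) X i j ^ expo e bs))) \<le> \<delta> / 2 ^ (l - length bs)"
  using bs h Z
proof (induction bs arbitrary: h Z e)
  case Nil
  have h: "h \<le> \<epsilon> / 2" using Nil.prems \<epsilon>
    by (auto intro: order_trans[OF _ mult_left_mono[of "1 - (3 / 4) ^ l" 1 "\<epsilon> / 2"], simplified])
  \<comment> \<open>Since \<open>h \<le> \<epsilon> / 2\<close>, both \<open>2 * h\<close> and
    \<open>h + h\<^sup>2\<close> are at most \<epsilon>.\<close>
  have "1 - \<epsilon> \<le> exp (- 2 * h)" using exp_ge_add_one_self[of "- 2 * h"] h by linarith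
  moreover have "exp h \<le> 1 + \<epsilon>"
  proof -
    have "exp h \<le> 1 + h + h\<^sup>2" using exp_bound[of h] h \<epsilon> Nil.prems by simp
    also have "h\<^sup>2 \<le> h * 1" unfolding power2_eq_square using h \<epsilon> Nil.prems by (intro mult_left_mono) auto
    finally show ?thesis using h by simp
  qed
  ultimately have "approx n (1 - \<epsilon>) (1 + \<epsilon>) (gr (2 ^ L) Z) (\<lambda>i j. gr (2 ^ L) X i j ^ e)"
    using Nil.prems by (intro approx_weaken[OF Nil.prems(4)] pk_power pk_gr)
  then show ?case using \<delta> by simp
next
  case (Cons b bs)
  let ?N = "(2::nat) ^ L" and ?F = "3 * flen L M" and ?r = "length bs"
  let ?W = "\<lambda>j. if b then X j else e0"
  let ?\<eta> = "eta \<epsilon> l ?r"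
  define h' where "h' = 2 * h + ?\<eta>"
  have \<eta>: "0 < ?\<eta>" "?\<eta> \<le> 1 / 2"
  proof -
    show "0 < ?\<eta>" using \<epsilon> by (simp add: eta_def)
    have "\<epsilon> / 6 * (3 / 4) ^ (l - ?r) / 2 ^ ?r \<le> 1 / 6 * 1 / 1"
      using \<epsilon> by (intro frac_le mult_mono) (auto simp: power_le_one)
    then have "?\<eta> \<le> 1 / 6" by (simp add: eta_def)
    then show "?\<eta> \<le> 1 / 2" by linarith
  qed
  have h': "0 \<le> h'" "2 ^ ?r * h' \<le> \<epsilon> / 2 * (1 - (3 / 4) ^ (l - ?r))"
  proof -
    show "0 \<le> h'" using Cons.prems \<eta> by (simp add: h'_def)
    have e: "l - ?r = Suc (l - length (b # bs))" using Cons.prems by simp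
    have "2 ^ ?r * h' = 2 ^ length (b # bs) * h + \<epsilon> / 6 * (3 / 4) ^ (l - ?r)"
      by (simp add: h'_def eta_def algebra_simps)
    also have "\<dots> \<le> \<epsilon> / 2 * (1 - (3 / 4) ^ (l - length (b # bs))) + \<epsilon> / 6 * (3 / 4) ^ (l - ?r)"
      using Cons.prems by (intro add_right_mono)
    also have "\<dots> = \<epsilon> / 2 * (1 - (3 / 4) ^ (l - ?r))" unfolding e power_Suc by (simp add: algebra_simps)
    finally show "2 ^ ?r * h' \<le> \<epsilon> / 2 * (1 - (3 / 4) ^ (l - ?r))" .
  qed
  let ?good = "\<lambda>w. approx n (1 - ?\<eta>) (1 + ?\<eta>) (gr ?N (\<lambda>j. level L M sc w (?W j) (Z j))) (level_gram ?N Z ?W)"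
  have Wpk: "pk (gr ?N ?W)" by (rule pk_gr)
  have sq: "approx n ((exp (- 2 * h))\<^sup>2) ((exp h)\<^sup>2) (level_gram ?N Z ?W) (\<lambda>i j. gr ?N X i j ^ (2 * e + of_bool b))"
  proof -
    have "gr ?N X i j ^ (2 * e + of_bool b) = gr ?N X i j ^ e * gr ?N X i j ^ e * gr ?N ?W i j" for i j
      by (cases b) (simp_all add: gr_e0 power_add mult_2)
    then show ?thesis
      unfolding level_gram_def
      using approx_Schur_square[OF Cons.prems(4) pk_gr pk_power[OF pk_gr] Wpk] by simp
  qed
  have step: "approx n (exp (- 2 * h')) (exp h') (gr ?N (\<lambda>j. level L M sc w (?W j) (Z j))) (\<lambda>i j. gr ?N X i j ^ (2 * e + of_bool b))"
    if "?good w" for w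
  proof (rule approx_weaken[OF approx_trans[OF sq that] pk_power[OF pk_gr]])
    have "exp (- 2 * h') = exp (- 2 * ?\<eta>) * (exp (- 2 * h))\<^sup>2"
      by (simp add: h'_def algebra_simps power2_eq_square flip: exp_add)
    then show "exp (- 2 * h') \<le> (1 - ?\<eta>) * (exp (- 2 * h))\<^sup>2"
      using exp_neg_le[of ?\<eta>] \<eta> by (simp add: mult_right_mono)
    have "exp h' = exp ?\<eta> * (exp h)\<^sup>2" by (simp add: h'_def power2_eq_square flip: exp_add)
    then show "(1 + ?\<eta>) * (exp h)\<^sup>2 \<le> exp h'"
      using exp_ge_add_one_self[of ?\<eta>] by (simp add: mult_right_mono)
  qed (use \<eta> in auto)
  let ?bad = "\<lambda>bs w Z e. \<not> approx n (1 - \<epsilon>) (1 + \<epsilon>) (gr ?N (\<lambda>j. sk L M sc bs w (X j) (Z j))) (\<lambda>i j. gr ?N X i j ^ expo e bs)"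
  have len: "?F * length (b # bs) = ?F + ?F * ?r" by simp
  have "avg (?F * length (b # bs)) (\<lambda>w. of_bool (?bad (b # bs) w Z e)) =
     avg ?F (\<lambda>w. avg (?F * ?r) (\<lambda>v. of_bool (?bad bs v (\<lambda>j. level L M sc w (?W j) (Z j)) (2 * e + of_bool b))))"
    unfolding len avg_append
    by (intro avg_cong) (simp add: level_append if_distrib cong: if_cong)
  also have "\<dots> \<le> avg ?F (\<lambda>w. of_bool (\<not> ?good w) + \<delta> / 2 ^ (l - ?r))"
  proof (rule avg_mono)
    fix w :: "bool list" assume "length w = ?F"
    show "avg (?F * ?r) (\<lambda>v. of_bool (?bad bs v (\<lambda>j. level L M sc w (?W j) (Z j)) (2 * e + of_bool b)))
      \<le> of_bool (\<not> ?good w) + \<delta> / 2 ^ (l - ?r)"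
    proof (cases "?good w")
      case True
      then show ?thesis using Cons.IH[OF _ h' step[OF True]] Cons.prems by simp
    next
      case False
      have "avg (?F * ?r) (\<lambda>v. of_bool (?bad bs v (\<lambda>j. level L M sc w (?W j) (Z j)) (2 * e + of_bool b))) \<le> avg (?F * ?r) (\<lambda>v. 1)"
        by (intro avg_mono) (simp add: of_bool_def)
      moreover have "0 \<le> \<delta> / 2 ^ (l - ?r)" using \<delta> by simp
      ultimately show ?thesis using False by simp
    qed
  qed
  also have "\<dots> \<le> \<delta> / 2 ^ (l - ?r) + \<delta> / 2 ^ (l - ?r)"
    unfolding avg_add avg_const using Cons.prems by (intro add_right_mono lev) simp
  also have "\<dots> = \<delta> / 2 ^ (l - length (b # bs))"
  proof -
    have "l - ?r = Suc (l - length (b # bs))" using Cons.prems by simp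
    then show ?thesis by simp
  qed
  finally show ?case .
qed

subsection \<open>Hoare rules with time bounds\<close>

text \<open>Only the existence of a bounded run from the given start state is asserted, which is
  what \<open>sketches_in_time\<close> asks for.\<close>

definition runs :: "prog \<Rightarrow> state \<Rightarrow> (state \<Rightarrow> bool) \<Rightarrow> nat \<Rightarrow> bool" where
  "runs P s Q T \<longleftrightarrow> (\<exists>t s'. exec P s t s' \<and> t \<le> T \<and> Q s')"

lemma runs_conseq: "runs P s Q T \<Longrightarrow> (\<And>s'. Q s' \<Longrightarrow> Q' s') \<Longrightarrow> T \<le> T' \<Longrightarrow> runs P s Q' T'"
  unfolding runs_def by (meson order_trans)

lemma runs_Seq:
  assumes "runs P s Q T" "\<And>s'. Q s' \<Longrightarrow> runs P' s' Q' T'"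
  shows "runs (Seq P P') s Q' (T + T')"
proof -
  from assms(1) obtain t s' where 1: "exec P s t s'" "t \<le> T" "Q s'" by (auto simp: runs_def)
  from assms(2)[OF 1(3)] obtain t' s'' where 2: "exec P' s' t' s''" "t' \<le> T'" "Q' s''" by (auto simp: runs_def)
  show ?thesis unfolding runs_def
    by (intro exI[of _ "t + t'"] exI[of _ s'']) (use exec.Seq[OF 1(1) 2(1)] 1 2 in auto)
qed

lemma runs_Cond:
  assumes "holds b s \<Longrightarrow> runs P s Q T" "\<not> holds b s \<Longrightarrow> runs P' s Q T"
  shows "runs (Cond b P P') s Q (1 + T)"
proof (cases "holds b s")
  case True
  with assms(1) obtain t s' where "exec P s t s'" "t \<le> T" "Q s'" by (auto simp: runs_def)
  then show ?thesis unfolding runs_def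
    by (intro exI[of _ "1 + t"] exI[of _ s']) (use exec.CondTrue[OF True] in auto)
next
  case False
  with assms(2) obtain t s' where "exec P' s t s'" "t \<le> T" "Q s'" by (auto simp: runs_def)
  then show ?thesis unfolding runs_def
    by (intro exI[of _ "1 + t"] exI[of _ s']) (use exec.CondFalse[OF False] in auto)
qed

fun steps :: "instr list \<Rightarrow> state \<Rightarrow> state option" where
  "steps [] s = Some s"
| "steps (i # is) s = (case step i s of None \<Rightarrow> None | Some s' \<Rightarrow> steps is s')"

fun block :: "instr list \<Rightarrow> prog" where
  "block [] = Skip"
| "block (i # is) = Seq (Instr i) (block is)"

lemma runs_block:
  assumes "steps is s = Some s'" "Q s'" "length is + 1 \<le> T"
  shows "runs (block is) s Q T"
proof -
  have "exec (block is) s (length is + 1) s'"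
    using assms(1)
  proof (induction "is" arbitrary: s)
    case Nil
    then show ?case using exec.Skip by simp
  next
    case (Cons i "is")
    then obtain s1 where s1: "step i s = Some s1" "steps is s1 = Some s'" by (auto split: option.splits)
    show ?case using exec.Seq[OF exec.Instr[OF s1(1)] Cons.IH[OF s1(2)]] by simp
  qed
  then show ?thesis using assms unfolding runs_def by blast
qed

lemma runs_block':
  assumes "case steps is s of None \<Rightarrow> False | Some s' \<Rightarrow> Q s'" "length is + 1 \<le> T"
  shows "runs (block is) s Q T"
  using assms runs_block by (auto split: option.splits)

lemma runs_Instr: "step i s = Some s' \<Longrightarrow> Q s' \<Longrightarrow> 1 \<le> T \<Longrightarrow> runs (Instr i) s Q T"
  unfolding runs_def using exec.Instr by blast

lemma runs_while:
  assumes step: "\<And>i s. i < m \<Longrightarrow> I i s \<Longrightarrow> holds b s \<and> runs P s (I (Suc i)) T"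
    and stop: "\<And>s. I m s \<Longrightarrow> \<not> holds b s"
    and init: "I 0 s"
  shows "runs (While b P) s (I m) (m * (T + 1) + 1)"
proof -
  have "I i s \<Longrightarrow> i \<le> m \<Longrightarrow> runs (While b P) s (I m) ((m - i) * (T + 1) + 1)" for i s
  proof (induction "m - i" arbitrary: i s)
    case 0
    then have "i = m" by simp
    then show ?case using 0 stop[of s] exec.WhileFalse[of b s P] by (auto simp: runs_def intro!: exI[of _ 1])
  next
    case (Suc k)
    then have i: "i < m" by simp
    obtain t1 s1 where 1: "exec P s t1 s1" "t1 \<le> T" "I (Suc i) s1" and h: "holds b s"
      using step[OF i Suc.prems(1)] by (auto simp: runs_def)
    have "runs (While b P) s1 (I m) ((m - Suc i) * (T + 1) + 1)"
      using Suc.hyps 1 i by (intro Suc.hyps(1)) auto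
    then obtain t2 s2 where 2: "exec (While b P) s1 t2 s2" "t2 \<le> (m - Suc i) * (T + 1) + 1" "I m s2"
      by (auto simp: runs_def)
    have "(m - i) * (T + 1) = (m - Suc i) * (T + 1) + (T + 1)"
      using i by (metis Suc_diff_Suc add.commute mult_Suc)
    then show ?case unfolding runs_def
      by (intro exI[of _ "1 + t1 + t2"] exI[of _ s2]) (use exec.WhileTrue[OF h 1(1) 2(1)] 1 2 in auto)
  qed
  from this[OF init] show ?thesis by simp
qed

text \<open>Integer register 3 holds the constant 1 throughout.\<close>

definition FOR :: "nat \<Rightarrow> nat \<Rightarrow> prog \<Rightarrow> prog" where
  "FOR c b P = Seq (Instr (IConst c 0)) (While (ILess c b) (Seq P (Instr (IAdd c c 3))))"

text \<open>The sets are those integer registers, real registers, integer arrays and real arrays that may change.\<close>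

definition frame :: "nat set \<Rightarrow> nat set \<Rightarrow> nat set \<Rightarrow> nat set \<Rightarrow> state \<Rightarrow> state \<Rightarrow> bool" where
  "frame A B C D s s' \<longleftrightarrow> (\<forall>r. r \<notin> A \<longrightarrow> ireg s' r = ireg s r) \<and> (\<forall>r. r \<notin> B \<longrightarrow> rreg s' r = rreg s r) \<and>
     (\<forall>r. r \<notin> C \<longrightarrow> iarr s' r = iarr s r) \<and> (\<forall>r. r \<notin> D \<longrightarrow> rarr s' r = rarr s r)"

lemma frame_refl [simp]: "frame A B C D s s" by (simp add: frame_def)

text \<open>An iteration costs the body, one test and one increment; initialisation and the final
  test add 2. The invariant must ignore the counter (\<open>ins\<close>), which the loop itself
  changes between iterations.\<close>

lemma runs_FOR:
  assumes body: "\<And>i s1. i < m \<Longrightarrow> I i s1 \<Longrightarrow> ireg s1 c = i \<Longrightarrow> ireg s1 b = m \<Longrightarrow> ireg s1 3 = 1 \<Longrightarrow>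
      runs P s1 (\<lambda>s2. I (Suc i) s2 \<and> ireg s2 c = i \<and> ireg s2 b = m \<and> ireg s2 3 = 1) T"
    and ins: "\<And>i s v. I i s \<Longrightarrow> I i (iset c v s)"
    and init: "I 0 s" "ireg s b = m" "ireg s 3 = 1"
    and c: "c \<noteq> b" "c \<noteq> 3"
    and T': "m * (T + 2) + 2 \<le> T'"
  shows "runs (FOR c b P) s (I m) T'"
proof -
  let ?J = "\<lambda>i s. I i s \<and> ireg s c = i \<and> ireg s b = m \<and> ireg s 3 = 1"
  have 1: "runs (While (ILess c b) (Seq P (Instr (IAdd c c 3)))) (iset c 0 s) (?J m) (m * ((T + 1) + 1) + 1)"
  proof (rule runs_while[where I = ?J and T = "T + 1"])
    fix i s assume i: "i < m" and J: "?J i s"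
    have "runs (Seq P (Instr (IAdd c c 3))) s (?J (Suc i)) (T + 1)"
    proof (rule runs_Seq[OF body])
      fix s2 assume s2: "I (Suc i) s2 \<and> ireg s2 c = i \<and> ireg s2 b = m \<and> ireg s2 3 = 1"
      show "runs (Instr (IAdd c c 3)) s2 (?J (Suc i)) 1"
        by (rule runs_Instr[where s' = "iset c (Suc i) s2"]) (use s2 ins c in \<open>auto simp: iset_def\<close>)
    qed (use i J in auto)
    then show "holds (ILess c b) s \<and> runs (Seq P (Instr (IAdd c c 3))) s (?J (Suc i)) (T + 1)"
      using i J by simp
  qed (use init c ins in \<open>auto simp: iset_def\<close>)
  have "runs (FOR c b P) s (?J m) (1 + (m * ((T + 1) + 1) + 1))"
    unfolding FOR_def
  proof (rule runs_Seq)
    show "runs (Instr (IConst c 0)) s (\<lambda>s'. s' = iset c 0 s) 1"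
      by (rule runs_Instr) auto
  qed (use 1 in simp)
  then show ?thesis by (rule runs_conseq) (use T' in auto)
qed

lemmas steps_simps = iset_def rset_def

subsection \<open>Reading signs and indices from the coins\<close>

text \<open>Throughout the sketching part, real array 7 holds signs, 8 and 9 are the buffers of the
  transform, 6 collects products, and integer array 1 holds sample indices.\<close>

definition SIGNS :: prog where
  "SIGNS = FOR 20 4 (Seq (Instr (Flip 30)) (Seq (Cond (ILess 30 3) (block [RConst 10 (-1)]) (block [RConst 10 1]))
     (block [RStore 7 20 10])))"

lemma runs_SIGNS:
  assumes s: "ireg s 3 = 1" "ireg s 4 = N" "N \<le> length (coins s)"
  shows "runs SIGNS s (\<lambda>s'. frame {20,30} {10} {} {7} s s' \<and> coins s' = drop N (coins s) \<and>
     (\<forall>a<N. rarr s' 7 a = sg (coins s ! a))) (10 * N + 2)"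
  unfolding SIGNS_def
proof (rule runs_conseq[OF runs_FOR[where m = N and T = 8 and I = "\<lambda>i s'. frame {20,30} {10} {} {7} s s' \<and> coins s' = drop i (coins s) \<and>
     (\<forall>a<i. rarr s' 7 a = sg (coins s ! a))"]])
  fix i s1 assume i: "i < N" and I: "frame {20,30} {10} {} {7} s s1 \<and> coins s1 = drop i (coins s) \<and> (\<forall>a<i. rarr s1 7 a = sg (coins s ! a))"
    and r: "ireg s1 20 = i" "ireg s1 4 = N" "ireg s1 3 = 1"
  have c: "coins s1 = (coins s ! i) # drop (Suc i) (coins s)"
    using I i s by (simp add: Cons_nth_drop_Suc)
  let ?b = "coins s ! i"
  let ?s2 = "iset 30 (of_bool ?b) (s1\<lparr>coins := drop (Suc i) (coins s)\<rparr>)"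
  have "runs (Seq (Instr (Flip 30)) (Seq (Cond (ILess 30 3) (block [RConst 10 (-1)]) (block [RConst 10 1])) (block [RStore 7 20 10]))) s1
     (\<lambda>s2. (frame {20,30} {10} {} {7} s s2 \<and> coins s2 = drop (Suc i) (coins s) \<and> (\<forall>a<Suc i. rarr s2 7 a = sg (coins s ! a))) \<and> ireg s2 20 = i \<and> ireg s2 4 = N \<and> ireg s2 3 = 1) (1 + ((1 + 2) + 2))"
  proof (rule runs_Seq[where Q = "\<lambda>s'. s' = ?s2"])
    show "runs (Instr (Flip 30)) s1 (\<lambda>s'. s' = ?s2) 1"
      by (rule runs_Instr) (auto simp: c)
    fix s' assume s': "s' = ?s2"
    show "runs (Seq (Cond (ILess 30 3) (block [RConst 10 (-1)]) (block [RConst 10 1])) (block [RStore 7 20 10])) s'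
       (\<lambda>s2. (frame {20,30} {10} {} {7} s s2 \<and> coins s2 = drop (Suc i) (coins s) \<and> (\<forall>a<Suc i. rarr s2 7 a = sg (coins s ! a))) \<and> ireg s2 20 = i \<and> ireg s2 4 = N \<and> ireg s2 3 = 1) ((1 + 2) + 2)"
    proof (rule runs_Seq[where Q = "\<lambda>s3. s3 = rset 10 (sg ?b) s'"])
      show "runs (Cond (ILess 30 3) (block [RConst 10 (-1)]) (block [RConst 10 1])) s' (\<lambda>s3. s3 = rset 10 (sg ?b) s') (1 + 2)"
        by (intro runs_Cond; rule runs_block) (use r s' in \<open>auto simp: steps_simps sg_def split: if_splits\<close>)
      fix s3 assume s3: "s3 = rset 10 (sg ?b) s'"
      show "runs (block [RStore 7 20 10]) s3 (\<lambda>s2. (frame {20,30} {10} {} {7} s s2 \<and> coins s2 = drop (Suc i) (coins s) \<and> (\<forall>a<Suc i. rarr s2 7 a = sg (coins s ! a))) \<and> ireg s2 20 = i \<and> ireg s2 4 = N \<and> ireg s2 3 = 1) 2"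
        by (rule runs_block) (use r s3 s' I in \<open>auto simp: steps_simps frame_def less_Suc_eq\<close>)
    qed
  qed
  then show "runs (Seq (Instr (Flip 30)) (Seq (Cond (ILess 30 3) (block [RConst 10 (-1)]) (block [RConst 10 1])) (block [RStore 7 20 10]))) s1
     (\<lambda>s2. (frame {20,30} {10} {} {7} s s2 \<and> coins s2 = drop (Suc i) (coins s) \<and> (\<forall>a<Suc i. rarr s2 7 a = sg (coins s ! a))) \<and> ireg s2 20 = i \<and> ireg s2 4 = N \<and> ireg s2 3 = 1) 8"
    by (rule runs_conseq) auto
qed (use s in \<open>auto simp: frame_def iset_def\<close>)

text \<open>Doubling and adding a coin reads an index with its most significant bit first, in
  agreement with \<open>bval\<close>.\<close>

definition IDX :: prog where
  "IDX = FOR 20 5 (Seq (block [IConst 31 0]) (Seq (FOR 21 6 (block [Flip 30, IAdd 31 31 31, IAdd 31 31 30])) (block [IStore 1 20 31])))"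

lemma runs_IDX:
  assumes s: "ireg s 3 = 1" "ireg s 5 = M" "ireg s 6 = L" "M * L \<le> length (coins s)"
  shows "runs IDX s (\<lambda>s'. frame {20,21,30,31} {} {1} {} s s' \<and> coins s' = drop (M * L) (coins s) \<and>
     (\<forall>i<M. iarr s' 1 i = idx L (coins s) i)) (M * (6 * L + 8) + 2)"
  unfolding IDX_def
proof (rule runs_conseq[OF runs_FOR[where m = M and T = "6 * L + 6" and I = "\<lambda>i s'. frame {20,21,30,31} {} {1} {} s s' \<and> coins s' = drop (i * L) (coins s) \<and>
     (\<forall>a<i. iarr s' 1 a = idx L (coins s) a)"]])
  fix i s1 assume i: "i < M" and I: "frame {20,21,30,31} {} {1} {} s s1 \<and> coins s1 = drop (i * L) (coins s) \<and> (\<forall>a<i. iarr s1 1 a = idx L (coins s) a)"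
    and r: "ireg s1 20 = i" "ireg s1 5 = M" "ireg s1 3 = 1"
  have iL: "i * L + L \<le> length (coins s)"
    using i s by (metis Suc_leI add.commute mult_Suc mult_le_mono1 order_trans)
  have L1: "ireg s1 6 = L" using I s by (simp add: frame_def)
  let ?Q = "\<lambda>s2. (frame {20,21,30,31} {} {1} {} s s2 \<and> coins s2 = drop (Suc i * L) (coins s) \<and> (\<forall>a<Suc i. iarr s2 1 a = idx L (coins s) a)) \<and> ireg s2 20 = i \<and> ireg s2 5 = M \<and> ireg s2 3 = 1"
  let ?J = "\<lambda>q s'. frame {21,30,31} {} {} {} s1 s' \<and> coins s' = drop q (coins s1) \<and> ireg s' 31 = bval (take q (coins s1))"
  have "runs (Seq (block [IConst 31 0]) (Seq (FOR 21 6 (block [Flip 30, IAdd 31 31 31, IAdd 31 31 30])) (block [IStore 1 20 31]))) s1 ?Q (2 + ((6 * L + 2) + 2))"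
  proof (rule runs_Seq[where Q = "\<lambda>s'. s' = iset 31 0 s1"])
    show "runs (block [IConst 31 0]) s1 (\<lambda>s'. s' = iset 31 0 s1) 2" by (rule runs_block) auto
    fix s' assume s': "s' = iset 31 0 s1"
    show "runs (Seq (FOR 21 6 (block [Flip 30, IAdd 31 31 31, IAdd 31 31 30])) (block [IStore 1 20 31])) s' ?Q ((6 * L + 2) + 2)"
    proof (rule runs_Seq)
      show "runs (FOR 21 6 (block [Flip 30, IAdd 31 31 31, IAdd 31 31 30])) s' (?J L) (6 * L + 2)"
      proof (rule runs_FOR[where T = 4 and I = ?J])
        fix q s2 assume q: "q < L" and J: "?J q s2" and r2: "ireg s2 21 = q" "ireg s2 6 = L" "ireg s2 3 = 1"
        have ql: "q < length (coins s1)" using q iL I by simp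
        have c: "coins s2 = (coins s1 ! q) # drop (Suc q) (coins s1)"
          using J ql by (simp add: Cons_nth_drop_Suc)
        show "runs (block [Flip 30, IAdd 31 31 31, IAdd 31 31 30]) s2 (\<lambda>s2. ?J (Suc q) s2 \<and> ireg s2 21 = q \<and> ireg s2 6 = L \<and> ireg s2 3 = 1) 4"
        proof -
          have b: "bval (take (Suc q) (coins s1)) = 2 * bval (take q (coins s1)) + of_bool (coins s1 ! q)"
            using ql by (simp add: take_Suc_conv_app_nth bval_snoc)
          show ?thesis
            by (rule runs_block', simp add: steps_simps c) (use J r2 b in \<open>auto simp: frame_def\<close>)
        qed
      qed (use r s' L1 in \<open>auto simp: frame_def iset_def\<close>)
      fix s2 assume J: "?J L s2"
      have "ireg s2 31 = idx L (coins s) i" using J I by (simp add: idx_def)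
      then show "runs (block [IStore 1 20 31]) s2 ?Q 2"
        by (intro runs_block) (use J I r in \<open>auto simp: frame_def less_Suc_eq add.commute\<close>)
    qed
  qed
  then show "runs (Seq (block [IConst 31 0]) (Seq (FOR 21 6 (block [Flip 30, IAdd 31 31 31, IAdd 31 31 30])) (block [IStore 1 20 31]))) s1 ?Q (6 * L + 6)"
    by (rule runs_conseq) auto
qed (use s in \<open>auto simp: frame_def iset_def\<close>)

section \<open>Transforming and sampling one tensor factor on the machine\<close>

definition HSTEP :: prog where
  "HSTEP = FOR 21 9 (block [IAdd 33 21 21, RLoad 10 8 33, IAdd 33 33 3, RLoad 11 8 33, RAdd 12 10 11, RStore 9 21 12,
     IAdd 34 21 9, RSub 12 10 11, RStore 9 34 12])"

lemma runs_HSTEP: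
  assumes s: "ireg s 3 = 1" "ireg s 9 = H"
  shows "runs HSTEP s (\<lambda>s'. frame {21,33,34} {10,11,12} {} {9} s s' \<and> coins s' = coins s \<and>
     (\<forall>a<2 * H. rarr s' 9 a = hstep H (rarr s 8) a)) (12 * H + 2)"
  unfolding HSTEP_def
proof (rule runs_conseq[OF runs_FOR[where m = H and T = 10 and I = "\<lambda>i s'. frame {21,33,34} {10,11,12} {} {9} s s' \<and> coins s' = coins s \<and>
     (\<forall>a<i. rarr s' 9 a = hstep H (rarr s 8) a \<and> rarr s' 9 (a + H) = hstep H (rarr s 8) (a + H))"]])
  fix i s1 assume i: "i < H" and I: "frame {21,33,34} {10,11,12} {} {9} s s1 \<and> coins s1 = coins s \<and>
     (\<forall>a<i. rarr s1 9 a = hstep H (rarr s 8) a \<and> rarr s1 9 (a + H) = hstep H (rarr s 8) (a + H))"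
    and r: "ireg s1 21 = i" "ireg s1 9 = H" "ireg s1 3 = 1"
  have 8: "rarr s1 8 = rarr s 8" using I by (simp add: frame_def)
  show "runs (block [IAdd 33 21 21, RLoad 10 8 33, IAdd 33 33 3, RLoad 11 8 33, RAdd 12 10 11, RStore 9 21 12,
     IAdd 34 21 9, RSub 12 10 11, RStore 9 34 12]) s1 (\<lambda>s2. (frame {21,33,34} {10,11,12} {} {9} s s2 \<and> coins s2 = coins s \<and>
     (\<forall>a<Suc i. rarr s2 9 a = hstep H (rarr s 8) a \<and> rarr s2 9 (a + H) = hstep H (rarr s 8) (a + H))) \<and>
       ireg s2 21 = i \<and> ireg s2 9 = H \<and> ireg s2 3 = 1) 10"
    by (rule runs_block', simp add: steps_simps r 8)
       (use I i r in \<open>auto simp: frame_def less_Suc_eq hstep_def mult_2\<close>)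
next
  fix s' assume I: "frame {21,33,34} {10,11,12} {} {9} s s' \<and> coins s' = coins s \<and>
     (\<forall>a<H. rarr s' 9 a = hstep H (rarr s 8) a \<and> rarr s' 9 (a + H) = hstep H (rarr s 8) (a + H))"
  have "rarr s' 9 a = hstep H (rarr s 8) a" if "a < 2 * H" for a
    using I that by (cases "a < H") (simp, metis add.commute le_add_diff_inverse2 less_diff_conv2 mult_2 not_less)
  then show "frame {21,33,34} {10,11,12} {} {9} s s' \<and> coins s' = coins s \<and> (\<forall>a<2 * H. rarr s' 9 a = hstep H (rarr s 8) a)"
    using I by blast
qed (use s in \<open>auto simp: frame_def iset_def\<close>)

definition COPYB :: prog where
  "COPYB = FOR 21 4 (block [RLoad 10 9 21, RStore 8 21 10])"

lemma runs_COPYB: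
  assumes s: "ireg s 3 = 1" "ireg s 4 = N"
  shows "runs COPYB s (\<lambda>s'. frame {21} {10} {} {8} s s' \<and> coins s' = coins s \<and>
     (\<forall>a<N. rarr s' 8 a = rarr s 9 a)) (5 * N + 2)"
  unfolding COPYB_def
proof (rule runs_conseq[OF runs_FOR[where m = N and T = 3 and I = "\<lambda>i s'. frame {21} {10} {} {8} s s' \<and> coins s' = coins s \<and>
     (\<forall>a<i. rarr s' 8 a = rarr s 9 a)"]])
  fix i s1 assume i: "i < N" and I: "frame {21} {10} {} {8} s s1 \<and> coins s1 = coins s \<and> (\<forall>a<i. rarr s1 8 a = rarr s 9 a)"
    and r: "ireg s1 21 = i" "ireg s1 4 = N" "ireg s1 3 = 1"
  have 9: "rarr s1 9 = rarr s 9" using I by (simp add: frame_def)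
  show "runs (block [RLoad 10 9 21, RStore 8 21 10]) s1 (\<lambda>s2. (frame {21} {10} {} {8} s s2 \<and> coins s2 = coins s \<and> (\<forall>a<Suc i. rarr s2 8 a = rarr s 9 a)) \<and>
       ireg s2 21 = i \<and> ireg s2 4 = N \<and> ireg s2 3 = 1) 3"
    by (rule runs_block', simp add: steps_simps r 9) (use I i r in \<open>auto simp: frame_def less_Suc_eq\<close>)
qed (use s in \<open>auto simp: frame_def iset_def\<close>)

lemma hstep_cong: "(\<And>a. a < 2 * H \<Longrightarrow> f a = g a) \<Longrightarrow> a < 2 * H \<Longrightarrow> hstep H f a = hstep H g a"
  by (auto simp: hstep_def)

definition HADB :: prog where
  "HADB = FOR 22 6 (Seq HSTEP COPYB)"

lemma runs_HADB:
  assumes s: "ireg s 3 = 1" "ireg s 4 = 2 ^ L" "ireg s 6 = L" "ireg s 9 = 2 ^ (L - 1)" and L: "1 \<le> L"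
  shows "runs HADB s (\<lambda>s'. frame {21,22,33,34} {10,11,12} {} {8,9} s s' \<and> coins s' = coins s \<and>
     (\<forall>a<2 ^ L. rarr s' 8 a = had L (rarr s 8) a)) (L * (11 * 2 ^ L + 6) + 2)"
proof -
  define H where "H = (2::nat) ^ (L - 1)"
  have N: "2 ^ L = 2 * H" using L unfolding H_def by (cases L) auto
  let ?I = "\<lambda>q s'. frame {21,22,33,34} {10,11,12} {} {8,9} s s' \<and> coins s' = coins s \<and>
     (\<forall>a<2 * H. rarr s' 8 a = (hstep H ^^ q) (rarr s 8) a)"
  have "runs HADB s (?I L) (L * ((12 * H + 2 + (5 * (2 * H) + 2)) + 2) + 2)"
    unfolding HADB_def
  proof (rule runs_FOR[where m = L and T = "12 * H + 2 + (5 * (2 * H) + 2)" and I = ?I])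
    fix q s1 assume q: "q < L" and I: "?I q s1" and r: "ireg s1 22 = q" "ireg s1 6 = L" "ireg s1 3 = 1"
    have r': "ireg s1 4 = 2 * H" "ireg s1 9 = H" using I s N by (simp_all add: frame_def H_def)
    show "runs (Seq HSTEP COPYB) s1 (\<lambda>s2. ?I (Suc q) s2 \<and> ireg s2 22 = q \<and> ireg s2 6 = L \<and> ireg s2 3 = 1) (12 * H + 2 + (5 * (2 * H) + 2))"
    proof (rule runs_Seq[OF runs_HSTEP[OF r(3) r'(2)]])
      fix s2 assume J: "frame {21,33,34} {10,11,12} {} {9} s1 s2 \<and> coins s2 = coins s1 \<and> (\<forall>a<2 * H. rarr s2 9 a = hstep H (rarr s1 8) a)"
      show "runs COPYB s2 (\<lambda>s2. ?I (Suc q) s2 \<and> ireg s2 22 = q \<and> ireg s2 6 = L \<and> ireg s2 3 = 1) (5 * (2 * H) + 2)"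
      proof (rule runs_conseq[OF runs_COPYB[where N = "2 * H"]])
        fix s3 assume K: "frame {21} {10} {} {8} s2 s3 \<and> coins s3 = coins s2 \<and> (\<forall>a<2 * H. rarr s3 8 a = rarr s2 9 a)"
        have "rarr s3 8 a = (hstep H ^^ Suc q) (rarr s 8) a" if "a < 2 * H" for a
          using K J I that hstep_cong[of H "rarr s1 8" "(hstep H ^^ q) (rarr s 8)" a] by simp
        moreover have "frame {21,22,33,34} {10,11,12} {} {8,9} s s3" using I J K by (auto simp: frame_def)
        ultimately show "?I (Suc q) s3 \<and> ireg s3 22 = q \<and> ireg s3 6 = L \<and> ireg s3 3 = 1"
          using I J K r by (auto simp: frame_def)
      qed (use J r r' in \<open>auto simp: frame_def\<close>)
    qed
  qed (use s in \<open>auto simp: frame_def iset_def\<close>)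
  then show ?thesis
    by (rule runs_conseq) (auto simp: N had_def H_def algebra_simps)
qed

definition LOADB :: "nat \<Rightarrow> prog" where
  "LOADB src = FOR 21 4 (block [IAdd 33 32 21, RLoad 10 src 33, RLoad 11 7 21, RMul 10 11 10, RStore 8 21 10])"

lemma runs_LOADB:
  assumes s: "ireg s 3 = 1" "ireg s 4 = N" "src \<noteq> 8"
  shows "runs (LOADB src) s (\<lambda>s'. frame {21,33} {10,11} {} {8} s s' \<and> coins s' = coins s \<and>
     (\<forall>a<N. rarr s' 8 a = rarr s 7 a * rarr s src (ireg s 32 + a))) (8 * N + 2)"
  unfolding LOADB_def
proof (rule runs_conseq[OF runs_FOR[where m = N and T = 6 and I = "\<lambda>i s'. frame {21,33} {10,11} {} {8} s s' \<and> coins s' = coins s \<and>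
     (\<forall>a<i. rarr s' 8 a = rarr s 7 a * rarr s src (ireg s 32 + a))"]])
  fix i s1 assume i: "i < N" and I: "frame {21,33} {10,11} {} {8} s s1 \<and> coins s1 = coins s \<and> (\<forall>a<i. rarr s1 8 a = rarr s 7 a * rarr s src (ireg s 32 + a))"
    and r: "ireg s1 21 = i" "ireg s1 4 = N" "ireg s1 3 = 1"
  have e: "rarr s1 7 = rarr s 7" "rarr s1 src = rarr s src" "ireg s1 32 = ireg s 32" using I s by (simp_all add: frame_def)
  show "runs (block [IAdd 33 32 21, RLoad 10 src 33, RLoad 11 7 21, RMul 10 11 10, RStore 8 21 10]) s1 (\<lambda>s2. (frame {21,33} {10,11} {} {8} s s2 \<and> coins s2 = coins s \<and> (\<forall>a<Suc i. rarr s2 8 a = rarr s 7 a * rarr s src (ireg s 32 + a))) \<and>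
       ireg s2 21 = i \<and> ireg s2 4 = N \<and> ireg s2 3 = 1) 6"
    by (rule runs_block', simp add: steps_simps r e) (use I i r in \<open>auto simp: frame_def less_Suc_eq\<close>)
qed (use s in \<open>auto simp: frame_def iset_def\<close>)

definition MULB :: prog where
  "MULB = FOR 21 5 (block [ILoad 33 1 21, RLoad 10 8 33, IAdd 34 32 21, RLoad 11 6 34, RMul 11 11 10, RStore 6 34 11])"

lemma runs_MULB:
  assumes s: "ireg s 3 = 1" "ireg s 5 = M"
  shows "runs MULB s (\<lambda>s'. frame {21,33,34} {10,11} {} {6} s s' \<and> coins s' = coins s \<and>
     (\<forall>i<M. rarr s' 6 (ireg s 32 + i) = rarr s 6 (ireg s 32 + i) * rarr s 8 (iarr s 1 i)) \<and>
     (\<forall>x. x < ireg s 32 \<or> ireg s 32 + M \<le> x \<longrightarrow> rarr s' 6 x = rarr s 6 x)) (9 * M + 2)"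
  unfolding MULB_def
proof (rule runs_conseq[OF runs_FOR[where m = M and T = 7 and I = "\<lambda>i s'. frame {21,33,34} {10,11} {} {6} s s' \<and> coins s' = coins s \<and>
     (\<forall>a<i. rarr s' 6 (ireg s 32 + a) = rarr s 6 (ireg s 32 + a) * rarr s 8 (iarr s 1 a)) \<and>
     (\<forall>x. x < ireg s 32 \<or> ireg s 32 + i \<le> x \<longrightarrow> rarr s' 6 x = rarr s 6 x)"]])
  fix i s1 assume i: "i < M" and I: "frame {21,33,34} {10,11} {} {6} s s1 \<and> coins s1 = coins s \<and>
     (\<forall>a<i. rarr s1 6 (ireg s 32 + a) = rarr s 6 (ireg s 32 + a) * rarr s 8 (iarr s 1 a)) \<and>
     (\<forall>x. x < ireg s 32 \<or> ireg s 32 + i \<le> x \<longrightarrow> rarr s1 6 x = rarr s 6 x)"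
    and r: "ireg s1 21 = i" "ireg s1 5 = M" "ireg s1 3 = 1"
  have e: "rarr s1 8 = rarr s 8" "iarr s1 1 = iarr s 1" "ireg s1 32 = ireg s 32" using I s by (simp_all add: frame_def)
  show "runs (block [ILoad 33 1 21, RLoad 10 8 33, IAdd 34 32 21, RLoad 11 6 34, RMul 11 11 10, RStore 6 34 11]) s1 (\<lambda>s2. (frame {21,33,34} {10,11} {} {6} s s2 \<and> coins s2 = coins s \<and>
     (\<forall>a<Suc i. rarr s2 6 (ireg s 32 + a) = rarr s 6 (ireg s 32 + a) * rarr s 8 (iarr s 1 a)) \<and>
     (\<forall>x. x < ireg s 32 \<or> ireg s 32 + Suc i \<le> x \<longrightarrow> rarr s2 6 x = rarr s 6 x)) \<and>
       ireg s2 21 = i \<and> ireg s2 5 = M \<and> ireg s2 3 = 1) 7"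
    by (rule runs_block', simp add: steps_simps r e) (use I i r in \<open>auto simp: frame_def less_Suc_eq\<close>)
qed (use s in \<open>auto simp: frame_def iset_def\<close>)

text \<open>Register 32 is the offset of the current column, advanced by the stride since integers
  cannot be multiplied. Results are multiplied into array 6, so that successive factors accumulate
  there.\<close>

definition APPLY :: "nat \<Rightarrow> prog" where
  "APPLY src = Seq (block [IConst 32 0]) (FOR 20 0 (Seq (LOADB src) (Seq HADB (Seq MULB (block [IAdd 32 32 4])))))"

lemma had_cong: "(\<And>a. a < 2 ^ L \<Longrightarrow> f a = g a) \<Longrightarrow> i < 2 ^ L \<Longrightarrow> had L f i = had L g i"
  by (simp add: had_eq)

lemma stride_neq: 
  assumes "j' \<noteq> j" "i < M" "M \<le> (N::nat)"
  shows "j' * N + i < j * N \<or> j * N + M \<le> j' * N + i"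
proof (cases "j' < j")
  case True
  then have "Suc j' * N \<le> j * N" by (intro mult_le_mono1) simp
  then show ?thesis using assms by simp
next
  case False
  then have "Suc j * N \<le> j' * N" using assms by (intro mult_le_mono1) simp
  then show ?thesis using assms by simp
qed

lemma runs_APPLY:
  assumes s: "ireg s 3 = 1" "ireg s 0 = n" "ireg s 4 = 2 ^ L" "ireg s 5 = M" "ireg s 6 = L" "ireg s 9 = 2 ^ (L - 1)" and L: "1 \<le> L"
    and M: "M \<le> 2 ^ L" and src: "src \<notin> {6, 8, 9}" and id: "\<And>i. i < M \<Longrightarrow> iarr s 1 i < 2 ^ L"
  shows "runs (APPLY src) s (\<lambda>s'. frame {20,21,22,32,33,34} {10,11,12} {} {6,8,9} s s' \<and> coins s' = coins s \<and>
     (\<forall>j<n. \<forall>i<M. rarr s' 6 (j * 2 ^ L + i) = rarr s 6 (j * 2 ^ L + i) *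
         had L (\<lambda>a. rarr s 7 a * rarr s src (j * 2 ^ L + a)) (iarr s 1 i))) (46 * n * L * 2 ^ L + 4)"
proof -
  let ?N = "(2::nat) ^ L"
  let ?g = "\<lambda>j i. had L (\<lambda>a. rarr s 7 a * rarr s src (j * ?N + a)) (iarr s 1 i)"
  let ?I = "\<lambda>j s'. frame {20,21,22,32,33,34} {10,11,12} {} {6,8,9} s s' \<and> coins s' = coins s \<and> ireg s' 32 = j * ?N \<and>
     (\<forall>j'<n. \<forall>i<M. rarr s' 6 (j' * ?N + i) = rarr s 6 (j' * ?N + i) * (if j' < j then ?g j' i else 1))"
  let ?Tb = "(8 * ?N + 2) + ((L * (11 * ?N + 6) + 2) + ((9 * M + 2) + 2))"
  have "1 * 1 \<le> L * ?N" using L by (intro mult_le_mono) auto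
  moreover have "L \<le> L * ?N" "?N \<le> L * ?N" using L by auto
  moreover have "L * (11 * ?N + 6) = 11 * (L * ?N) + 6 * L" by (simp add: algebra_simps)
  ultimately have Tb: "?Tb + 2 \<le> 46 * (L * ?N)" using M by linarith
  have "runs (APPLY src) s (?I n) (2 + (n * (?Tb + 2) + 2))"
    unfolding APPLY_def
  proof (rule runs_Seq[where Q = "\<lambda>s'. s' = iset 32 0 s"])
    show "runs (block [IConst 32 0]) s (\<lambda>s'. s' = iset 32 0 s) 2" by (rule runs_block) auto
    fix s0 assume s0: "s0 = iset 32 0 s"
    show "runs (FOR 20 0 (Seq (LOADB src) (Seq HADB (Seq MULB (block [IAdd 32 32 4]))))) s0 (?I n) (n * (?Tb + 2) + 2)"
    proof (rule runs_FOR[where I = ?I and m = n and T = ?Tb])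
      fix j s1 assume j: "j < n" and I: "?I j s1" and r: "ireg s1 20 = j" "ireg s1 0 = n" "ireg s1 3 = 1"
      have e: "rarr s1 7 = rarr s 7" "rarr s1 src = rarr s src" "iarr s1 1 = iarr s 1" "ireg s1 4 = ?N" "ireg s1 5 = M" "ireg s1 6 = L" "ireg s1 9 = 2 ^ (L - 1)"
        using I s src by (simp_all add: frame_def)
      show "runs (Seq (LOADB src) (Seq HADB (Seq MULB (block [IAdd 32 32 4])))) s1 (\<lambda>s2. ?I (Suc j) s2 \<and> ireg s2 20 = j \<and> ireg s2 0 = n \<and> ireg s2 3 = 1) ?Tb"
      proof (rule runs_Seq[OF runs_LOADB])
        fix s2 assume A: "frame {21,33} {10,11} {} {8} s1 s2 \<and> coins s2 = coins s1 \<and> (\<forall>a<?N. rarr s2 8 a = rarr s1 7 a * rarr s1 src (ireg s1 32 + a))"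
        show "runs (Seq HADB (Seq MULB (block [IAdd 32 32 4]))) s2 (\<lambda>s2. ?I (Suc j) s2 \<and> ireg s2 20 = j \<and> ireg s2 0 = n \<and> ireg s2 3 = 1) ((L * (11 * ?N + 6) + 2) + ((9 * M + 2) + 2))"
        proof (rule runs_Seq[OF runs_HADB])
          fix s3 assume B: "frame {21,22,33,34} {10,11,12} {} {8,9} s2 s3 \<and> coins s3 = coins s2 \<and> (\<forall>a<?N. rarr s3 8 a = had L (rarr s2 8) a)"
          show "runs (Seq MULB (block [IAdd 32 32 4])) s3 (\<lambda>s2. ?I (Suc j) s2 \<and> ireg s2 20 = j \<and> ireg s2 0 = n \<and> ireg s2 3 = 1) ((9 * M + 2) + 2)"
          proof (rule runs_Seq[OF runs_MULB[where M = M]])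
            fix s4 assume C: "frame {21,33,34} {10,11} {} {6} s3 s4 \<and> coins s4 = coins s3 \<and>
              (\<forall>i<M. rarr s4 6 (ireg s3 32 + i) = rarr s3 6 (ireg s3 32 + i) * rarr s3 8 (iarr s3 1 i)) \<and>
              (\<forall>x. x < ireg s3 32 \<or> ireg s3 32 + M \<le> x \<longrightarrow> rarr s4 6 x = rarr s3 6 x)"
            have f13: "ireg s3 32 = j * ?N" "iarr s3 1 = iarr s 1" "rarr s3 6 = rarr s1 6"
              using A B I e by (simp_all add: frame_def)
            have "rarr s4 6 (j' * ?N + i) = rarr s 6 (j' * ?N + i) * (if j' < Suc j then ?g j' i else 1)" if "j' < n" "i < M" for j' i
            proof (cases "j' = j")
              case True
              have "rarr s3 8 (iarr s 1 i) = ?g j i"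
                using B A e I id[OF that(2)] had_cong[of L "rarr s2 8" "\<lambda>a. rarr s 7 a * rarr s src (j * ?N + a)"] by simp
              then show ?thesis using C f13 that True I by simp
            next
              case False
              have "x < j * ?N \<or> j * ?N + M \<le> x \<Longrightarrow> rarr s4 6 x = rarr s1 6 x" for x
                using C f13 by auto
              then have "rarr s4 6 (j' * ?N + i) = rarr s1 6 (j' * ?N + i)" using stride_neq[OF False that(2) M] by blast
              then show ?thesis using I that False by auto
            qed
            moreover have "frame {20,21,22,32,33,34} {10,11,12} {} {6,8,9} s s4" using I A B C by (auto simp: frame_def)
            moreover have "ireg s4 32 = j * ?N" "ireg s4 4 = ?N" "ireg s4 20 = j" "ireg s4 0 = n" "ireg s4 3 = 1" "coins s4 = coins s"
              using A B C I r e by (auto simp: frame_def)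
            ultimately show "runs (block [IAdd 32 32 4]) s4 (\<lambda>s2. ?I (Suc j) s2 \<and> ireg s2 20 = j \<and> ireg s2 0 = n \<and> ireg s2 3 = 1) 2"
              by (intro runs_block'; simp add: steps_simps) (auto simp: frame_def)
          qed (use A B r e in \<open>simp_all add: frame_def\<close>)
        qed (use A r e L in \<open>simp_all add: frame_def\<close>)
      qed (use r e src in simp_all)
    qed (use s s0 in \<open>auto simp: frame_def iset_def\<close>)
  qed
  then show ?thesis
  proof (rule runs_conseq)
    have "n * (?Tb + 2) \<le> n * (46 * (L * ?N))" using Tb by (intro mult_le_mono) auto
    then show "2 + (n * (?Tb + 2) + 2) \<le> 46 * n * L * ?N + 4" by (simp add: mult_ac)
  qed auto
qed

definition FACT :: "nat \<Rightarrow> prog" where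
  "FACT src = Seq SIGNS (Seq IDX (APPLY src))"

lemma runs_FACT:
  assumes s: "ireg s 3 = 1" "ireg s 0 = n" "ireg s 4 = 2 ^ L" "ireg s 5 = M" "ireg s 6 = L" "ireg s 9 = 2 ^ (L - 1)" and L: "1 \<le> L"
    and M: "M \<le> 2 ^ L" and src: "src \<notin> {6, 7, 8, 9}" and c: "flen L M \<le> length (coins s)" and n: "1 \<le> n"
  shows "runs (FACT src) s (\<lambda>s'. frame {20,21,22,30,31,32,33,34} {10,11,12} {1} {6,7,8,9} s s' \<and> coins s' = drop (flen L M) (coins s) \<and>
     (\<forall>j<n. \<forall>i<M. rarr s' 6 (j * 2 ^ L + i) = rarr s 6 (j * 2 ^ L + i) *
         fact_sk L (coins s) (\<lambda>a. rarr s src (j * 2 ^ L + a)) i)) (78 * n * L * 2 ^ L)"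
proof -
  let ?N = "(2::nat) ^ L"
  have "runs (FACT src) s (\<lambda>s'. frame {20,21,22,30,31,32,33,34} {10,11,12} {1} {6,7,8,9} s s' \<and> coins s' = drop (flen L M) (coins s) \<and>
     (\<forall>j<n. \<forall>i<M. rarr s' 6 (j * ?N + i) = rarr s 6 (j * ?N + i) *
         fact_sk L (coins s) (\<lambda>a. rarr s src (j * ?N + a)) i)) ((10 * ?N + 2) + ((M * (6 * L + 8) + 2) + (46 * n * L * ?N + 4)))"
    unfolding FACT_def
  proof (rule runs_Seq[OF runs_SIGNS[where N = ?N]])
    fix s1 assume A: "frame {20,30} {10} {} {7} s s1 \<and> coins s1 = drop ?N (coins s) \<and> (\<forall>a<?N. rarr s1 7 a = sg (coins s ! a))"
    show "runs (Seq IDX (APPLY src)) s1 (\<lambda>s'. frame {20,21,22,30,31,32,33,34} {10,11,12} {1} {6,7,8,9} s s' \<and> coins s' = drop (flen L M) (coins s) \<and>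
     (\<forall>j<n. \<forall>i<M. rarr s' 6 (j * ?N + i) = rarr s 6 (j * ?N + i) *
         fact_sk L (coins s) (\<lambda>a. rarr s src (j * ?N + a)) i)) ((M * (6 * L + 8) + 2) + (46 * n * L * ?N + 4))"
    proof (rule runs_Seq[OF runs_IDX[where M = M and L = L]])
      fix s2 assume B: "frame {20,21,30,31} {} {1} {} s1 s2 \<and> coins s2 = drop (M * L) (coins s1) \<and> (\<forall>i<M. iarr s2 1 i = idx L (coins s1) i)"
      have id: "iarr s2 1 i < ?N" if "i < M" for i
      proof -
        have "i * L + L \<le> M * L" using that by (metis Suc_leI mult_Suc mult_le_mono1 add.commute)
        then have "length (take L (drop (i * L) (coins s1))) = L" using c A by (simp add: flen_def)
        then have "idx L (coins s1) i < ?N" unfolding idx_def using bval_less by metis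
        then show ?thesis using B that by simp
      qed
      have e: "rarr s2 src = rarr s src" "rarr s2 6 = rarr s 6" "rarr s2 7 = rarr s1 7" using A B src by (simp_all add: frame_def)
      show "runs (APPLY src) s2 (\<lambda>s'. frame {20,21,22,30,31,32,33,34} {10,11,12} {1} {6,7,8,9} s s' \<and> coins s' = drop (flen L M) (coins s) \<and>
         (\<forall>j<n. \<forall>i<M. rarr s' 6 (j * ?N + i) = rarr s 6 (j * ?N + i) *
         fact_sk L (coins s) (\<lambda>a. rarr s src (j * ?N + a)) i)) (46 * n * L * ?N + 4)"
      proof (rule runs_conseq[OF runs_APPLY[where n = n and L = L and M = M]])
        fix s3 assume C: "frame {20,21,22,32,33,34} {10,11,12} {} {6,8,9} s2 s3 \<and> coins s3 = coins s2 \<and>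
          (\<forall>j<n. \<forall>i<M. rarr s3 6 (j * ?N + i) = rarr s2 6 (j * ?N + i) *
             had L (\<lambda>a. rarr s2 7 a * rarr s2 src (j * ?N + a)) (iarr s2 1 i))"
        have "had L (\<lambda>a. rarr s2 7 a * rarr s2 src (j * ?N + a)) (iarr s2 1 i) = fact_sk L (coins s) (\<lambda>a. rarr s src (j * ?N + a)) i" if "i < M" for i j
          unfolding fact_sk_def using A B that id[OF that] e by (simp add: had_eq)
        moreover have "frame {20,21,22,30,31,32,33,34} {10,11,12} {1} {6,7,8,9} s s3" using A B C by (auto simp: frame_def)
        moreover have "coins s3 = drop (flen L M) (coins s)" using A B C by (simp add: flen_def add.commute)
        ultimately show "frame {20,21,22,30,31,32,33,34} {10,11,12} {1} {6,7,8,9} s s3 \<and> coins s3 = drop (flen L M) (coins s) \<and>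
         (\<forall>j<n. \<forall>i<M. rarr s3 6 (j * ?N + i) = rarr s 6 (j * ?N + i) * fact_sk L (coins s) (\<lambda>a. rarr s src (j * ?N + a)) i)"
          using C e by simp
      qed (use A B s L M src id in \<open>auto simp: frame_def\<close>)
    qed (use A s c in \<open>auto simp: frame_def flen_def\<close>)
  qed (use s c in \<open>auto simp: flen_def\<close>)
  then show ?thesis
  proof (rule runs_conseq)
    let ?P = "n * (L * ?N)"
    have l1: "1 * (1 * 1) \<le> ?P" using L n by (intro mult_le_mono) auto
    have l2: "1 * (1 * ?N) \<le> ?P" using L n by (intro mult_le_mono) auto
    have l3: "M * (6 * L + 8) \<le> ?N * (14 * L)" using M L by (intro mult_le_mono) auto
    have l4: "1 * (L * ?N) \<le> ?P" using n by (intro mult_le_mono) auto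
    have "?N * (14 * L) = 14 * (L * ?N)" by simp
    then show "(10 * ?N + 2) + ((M * (6 * L + 8) + 2) + (46 * n * L * ?N + 4)) \<le> 78 * n * L * ?N"
      using l1 l2 l3 l4 unfolding mult.assoc by linarith
  qed auto
qed

text \<open>Strides are given by registers. Source stride 0, from register 36, repeats the same
  entries in every column.\<close>

definition TRANSFER :: "nat \<Rightarrow> nat \<Rightarrow> nat \<Rightarrow> nat \<Rightarrow> nat \<Rightarrow> prog" where
  "TRANSFER src ss dst ds cnt = Seq (block [IConst 37 0, IConst 38 0])
     (FOR 20 0 (Seq (FOR 21 cnt (block [IAdd 33 37 21, RLoad 10 src 33, IAdd 34 38 21, RStore dst 34 10]))
        (block [IAdd 37 37 ss, IAdd 38 38 ds])))"

text \<open>\<open>c \<le> b\<close> keeps the columns from overwriting each other. That all other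
  cells survive is what preserves zero padding.\<close>

lemma runs_TRANSFER:
  assumes s: "ireg s 3 = 1" "ireg s 0 = n" "ireg s ss = a" "ireg s ds = b" "ireg s cnt = c"
    and r: "{ss, ds, cnt} \<inter> {20,21,33,34,37,38} = {}" and sd: "src \<noteq> dst" and cb: "c \<le> b"
  shows "runs (TRANSFER src ss dst ds cnt) s (\<lambda>s'. frame {20,21,33,34,37,38} {10} {} {dst} s s' \<and> coins s' = coins s \<and>
     (\<forall>j<n. \<forall>i<c. rarr s' dst (j * b + i) = rarr s src (j * a + i)) \<and>
     (\<forall>x. (\<forall>j<n. \<forall>i<c. x \<noteq> j * b + i) \<longrightarrow> rarr s' dst x = rarr s dst x)) (n * (7 * c + 7) + 5)"
proof -
  let ?F = "frame {20,21,33,34,37,38} {10} {} {dst} s"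
  let ?I = "\<lambda>k s'. ?F s' \<and> coins s' = coins s \<and> ireg s' 37 = k * a \<and> ireg s' 38 = k * b \<and>
     (\<forall>j<k. \<forall>i<c. rarr s' dst (j * b + i) = rarr s src (j * a + i)) \<and>
     (\<forall>x. (\<forall>j<k. \<forall>i<c. x \<noteq> j * b + i) \<longrightarrow> rarr s' dst x = rarr s dst x)"
  have r': "ss \<notin> {20,21,33,34,37,38}" "ds \<notin> {20,21,33,34,37,38}" "cnt \<notin> {20,21,33,34,37,38}" using r by auto
  let ?s0 = "iset 38 0 (iset 37 0 s)"
  have "runs (TRANSFER src ss dst ds cnt) s (?I n) (3 + (n * ((7 * c + 2 + 3) + 2) + 2))"
    unfolding TRANSFER_def
  proof (rule runs_Seq[where Q = "\<lambda>s'. s' = ?s0"])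
    show "runs (block [IConst 37 0, IConst 38 0]) s (\<lambda>s'. s' = ?s0) 3" by (rule runs_block) auto
    fix s0 assume s0: "s0 = ?s0"
    show "runs (FOR 20 0 (Seq (FOR 21 cnt (block [IAdd 33 37 21, RLoad 10 src 33, IAdd 34 38 21, RStore dst 34 10]))
        (block [IAdd 37 37 ss, IAdd 38 38 ds]))) s0 (?I n) (n * ((7 * c + 2 + 3) + 2) + 2)"
    proof (rule runs_FOR[where I = ?I and m = n and T = "7 * c + 2 + 3"])
      fix k s1 assume k: "k < n" and I: "?I k s1" and q: "ireg s1 20 = k" "ireg s1 0 = n" "ireg s1 3 = 1"
      let ?J = "\<lambda>i s'. frame {21,33,34} {10} {} {dst} s1 s' \<and> coins s' = coins s \<and>
        (\<forall>i'<i. rarr s' dst (k * b + i') = rarr s src (k * a + i')) \<and> (\<forall>x. (\<forall>i'<i. x \<noteq> k * b + i') \<longrightarrow> rarr s' dst x = rarr s1 dst x)"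
      have src1: "rarr s1 src = rarr s src" using I sd by (simp add: frame_def)
      have regs1: "ireg s1 ss = a" "ireg s1 ds = b" "ireg s1 cnt = c" using I s r' by (simp_all add: frame_def)
      show "runs (Seq (FOR 21 cnt (block [IAdd 33 37 21, RLoad 10 src 33, IAdd 34 38 21, RStore dst 34 10])) (block [IAdd 37 37 ss, IAdd 38 38 ds]))
         s1 (\<lambda>s2. ?I (Suc k) s2 \<and> ireg s2 20 = k \<and> ireg s2 0 = n \<and> ireg s2 3 = 1) (7 * c + 2 + 3)"
      proof (rule runs_Seq)
        show "runs (FOR 21 cnt (block [IAdd 33 37 21, RLoad 10 src 33, IAdd 34 38 21, RStore dst 34 10])) s1 (?J c) (7 * c + 2)"
        proof (rule runs_FOR[where T = 5 and I = ?J and m = c])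
          fix i s2 assume i: "i < c" and J: "?J i s2" and q2: "ireg s2 21 = i" "ireg s2 cnt = c" "ireg s2 3 = 1"
          have e: "rarr s2 src = rarr s src" "ireg s2 37 = k * a" "ireg s2 38 = k * b"
            using J I src1 sd by (simp_all add: frame_def)
          have cn: "cnt \<noteq> 33" "cnt \<noteq> 34" using r' by auto
          show "runs (block [IAdd 33 37 21, RLoad 10 src 33, IAdd 34 38 21, RStore dst 34 10]) s2
            (\<lambda>s2. ?J (Suc i) s2 \<and> ireg s2 21 = i \<and> ireg s2 cnt = c \<and> ireg s2 3 = 1) 5"
            by (rule runs_block', simp add: steps_simps q2 e cn) (use J in \<open>auto simp: frame_def less_Suc_eq\<close>)
        qed (use q regs1 r' I in \<open>auto simp: frame_def iset_def\<close>)
        fix s2 assume J: "?J c s2"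
        have e: "ireg s2 37 = k * a" "ireg s2 38 = k * b" "ireg s2 ss = a" "ireg s2 ds = b" "ireg s2 20 = k" "ireg s2 0 = n" "ireg s2 3 = 1"
          using J I regs1 q r' by (simp_all add: frame_def)
        have A: "rarr s2 dst (j * b + i) = rarr s src (j * a + i)" if "j < Suc k" "i < c" for j i
        proof (cases "j = k")
          case False
          then have "\<forall>i'<c. j * b + i \<noteq> k * b + i'"
            using stride_neq[OF False that(2) cb] by auto
          then have "rarr s2 dst (j * b + i) = rarr s1 dst (j * b + i)" using J by blast
          then show ?thesis using I that False by auto
        qed (use J that in auto)
        have B: "rarr s2 dst x = rarr s dst x" if x: "\<forall>j<Suc k. \<forall>i<c. x \<noteq> j * b + i" for x
        proof -
          have "rarr s2 dst x = rarr s1 dst x" using J x by blast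
          also have "\<dots> = rarr s dst x" using I x by auto
          finally show ?thesis .
        qed
        have F: "?F s2" "coins s2 = coins s" using I J by (auto simp: frame_def)
        have dn: "ds \<noteq> 37" using r' by auto
        show "runs (block [IAdd 37 37 ss, IAdd 38 38 ds]) s2 (\<lambda>s2. ?I (Suc k) s2 \<and> ireg s2 20 = k \<and> ireg s2 0 = n \<and> ireg s2 3 = 1) 3"
          by (rule runs_block', simp add: steps_simps e dn) (use A B F in \<open>auto simp: frame_def\<close>)
      qed
    qed (use s s0 in \<open>auto simp: frame_def iset_def\<close>)
  qed
  then show ?thesis by (rule runs_conseq) (auto simp: algebra_simps)
qed

subsection \<open>One level and the main loop\<close>

text \<open>Array 6 starts with the scale factor in every column and each \<open>FACT\<close>
  multiplies in one sketched factor, so the entry of the tensor product is complete after three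
  calls.\<close>

definition LEVEL :: prog where
  "LEVEL = Seq (block [ISub 7 7 3, ILoad 35 0 7]) (Seq (TRANSFER 5 36 6 4 5) (Seq (FACT 4) (Seq (FACT 4)
     (Seq (Cond (ILess 36 35) (FACT 2) (FACT 3)) (TRANSFER 6 4 4 4 5)))))"

text \<open>Adding register 36, which holds 0, serves as a move. Only as many output rows as there
  are samples are written; the rest of array 1 is still zero.\<close>

definition MAIN :: prog where
  "MAIN = Seq (While (ILess 36 7) LEVEL) (Seq (TRANSFER 4 4 1 8 5) (block [IAdd 0 8 36]))"

locale machine =
  fixes n L M l mo :: nat and sc :: real and xf :: "nat \<Rightarrow> nat \<Rightarrow> real" and bit :: "nat \<Rightarrow> bool"
  assumes n: "1 \<le> n" and L: "1 \<le> L" and M: "M \<le> 2 ^ L"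
begin

text \<open>Integer registers: 0 the number of columns, 4 the transform length, 9 half of it, 6 its logarithm, 5 the
  number of samples, 8 the number of output rows. Real arrays: 1 output, 2 padded data,
  3 copies of \<open>e0\<close>, 4 the current vectors, 5 scale factors. Integer array 0 holds the binary digits of the
  exponent.\<close>

definition stat :: "state \<Rightarrow> bool" where
  "stat s \<longleftrightarrow> ireg s 0 = n \<and> ireg s 3 = 1 \<and> ireg s 4 = 2 ^ L \<and> ireg s 5 = M \<and> ireg s 6 = L \<and> ireg s 8 = mo \<and> ireg s 9 = 2 ^ (L - 1) \<and> ireg s 36 = 0 \<and>
     (\<forall>j<n. \<forall>a<2 ^ L. rarr s 2 (j * 2 ^ L + a) = xf j a) \<and> (\<forall>j<n. \<forall>a<2 ^ L. rarr s 3 (j * 2 ^ L + a) = e0 a) \<and>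
     (\<forall>i<M. rarr s 5 i = sc) \<and> (\<forall>j<l. iarr s 0 j = of_bool (bit j)) \<and> rarr s 1 = (\<lambda>_. 0)"

definition Zrep :: "(nat \<Rightarrow> nat \<Rightarrow> real) \<Rightarrow> state \<Rightarrow> bool" where
  "Zrep z s \<longleftrightarrow> (\<forall>j<n. \<forall>a<2 ^ L. rarr s 4 (j * 2 ^ L + a) = z j a)"

lemma stat_frame:
  assumes "stat s" "frame A B C D s s'" "A \<inter> {0,3,4,5,6,8,9,36} = {}" "0 \<notin> C" "D \<inter> {1,2,3,5} = {}"
  shows "stat s'"
proof -
  have "ireg s' r = ireg s r" if "r \<in> {0,3,4,5,6,8,9,36}" for r using assms that by (auto simp: frame_def)
  moreover have "rarr s' r = rarr s r" if "r \<in> {1,2,3,5}" for r using assms that by (auto simp: frame_def)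
  moreover have "iarr s' 0 = iarr s 0" using assms by (auto simp: frame_def)
  ultimately show ?thesis using assms(1) unfolding stat_def by simp
qed

lemma runs_LEVEL:
  assumes s: "stat s" "Zrep z s" "ireg s 7 = Suc r" "r < l" and c: "3 * flen L M \<le> length (coins s)"
    and z: "\<And>j a. M \<le> a \<Longrightarrow> z j a = 0"
  shows "runs LEVEL s (\<lambda>s'. stat s' \<and> Zrep (\<lambda>j. level L M sc (coins s) (if bit r then xf j else e0) (z j)) s' \<and> ireg s' 7 = r \<and>
     coins s' = drop (3 * flen L M) (coins s)) (280 * n * L * 2 ^ L)"
proof -
  let ?N = "(2::nat) ^ L" and ?F = "flen L M" and ?T = "78 * n * L * 2 ^ L"
  let ?u = "\<lambda>j. if bit r then xf j else e0"
  let ?Q = "\<lambda>s'. stat s' \<and> Zrep (\<lambda>j. level L M sc (coins s) (?u j) (z j)) s' \<and> ireg s' 7 = r \<and> coins s' = drop (3 * ?F) (coins s)"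
  have st: "ireg s 0 = n" "ireg s 3 = 1" "ireg s 4 = ?N" "ireg s 5 = M" "ireg s 6 = L" "ireg s 9 = 2 ^ (L - 1)" "ireg s 36 = 0" "iarr s 0 r = of_bool (bit r)"
    using s unfolding stat_def by auto
  define s1 where "s1 = iset 35 (of_bool (bit r)) (iset 7 r s)"
  have f1: "frame {7,35} {} {} {} s s1" "coins s1 = coins s" "ireg s1 7 = r" "ireg s1 35 = of_bool (bit r)" by (simp_all add: s1_def frame_def iset_def)
  have S1: "stat s1" using stat_frame[OF s(1) f1(1)] by simp
  have "runs LEVEL s ?Q (3 + ((n * (7 * M + 7) + 5) + (?T + (?T + ((1 + ?T) + (n * (7 * M + 7) + 5))))))"
    unfolding LEVEL_def
  proof (rule runs_Seq[where Q = "\<lambda>s'. s' = s1"])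
    show "runs (block [ISub 7 7 3, ILoad 35 0 7]) s (\<lambda>s'. s' = s1) 3"
      by (rule runs_block', simp_all add: steps_simps st s s1_def)
    fix s1' assume "s1' = s1"
    then show "runs (Seq (TRANSFER 5 36 6 4 5) (Seq (FACT 4) (Seq (FACT 4) (Seq (Cond (ILess 36 35) (FACT 2) (FACT 3)) (TRANSFER 6 4 4 4 5))))) s1' ?Q
       ((n * (7 * M + 7) + 5) + (?T + (?T + ((1 + ?T) + (n * (7 * M + 7) + 5)))))"
    proof (simp only:, intro runs_Seq[OF runs_TRANSFER[where n = n and a = 0 and b = ?N and c = M]])
      fix s2 assume A: "frame {20,21,33,34,37,38} {10} {} {6} s1 s2 \<and> coins s2 = coins s1 \<and>
         (\<forall>j<n. \<forall>i<M. rarr s2 6 (j * ?N + i) = rarr s1 5 (j * 0 + i)) \<and>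
         (\<forall>x. (\<forall>j<n. \<forall>i<M. x \<noteq> j * ?N + i) \<longrightarrow> rarr s2 6 x = rarr s1 6 x)"
      have S2: "stat s2" using stat_frame[OF S1, of _ _ _ _ s2] A by (elim conjE) (auto intro: stat_frame[OF S1])
      have a2: "rarr s2 6 (j * ?N + i) = sc" if "j < n" "i < M" for j i using A S1 that by (simp add: stat_def)
      have z2: "rarr s2 4 = rarr s 4" "coins s2 = coins s" "ireg s2 7 = r" "ireg s2 35 = of_bool (bit r)" using A f1 by (simp_all add: frame_def)
      show "runs (Seq (FACT 4) (Seq (FACT 4) (Seq (Cond (ILess 36 35) (FACT 2) (FACT 3)) (TRANSFER 6 4 4 4 5)))) s2 ?Q (?T + (?T + ((1 + ?T) + (n * (7 * M + 7) + 5))))"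
      proof (rule runs_Seq[OF runs_FACT[where n = n and L = L and M = M]])
        fix s3 assume B: "frame {20,21,22,30,31,32,33,34} {10,11,12} {1} {6,7,8,9} s2 s3 \<and> coins s3 = drop ?F (coins s2) \<and>
         (\<forall>j<n. \<forall>i<M. rarr s3 6 (j * ?N + i) = rarr s2 6 (j * ?N + i) * fact_sk L (coins s2) (\<lambda>a. rarr s2 4 (j * ?N + a)) i)"
        have S3: "stat s3" using B by (elim conjE) (auto intro: stat_frame[OF S2])
        have z3: "rarr s3 4 = rarr s 4" "coins s3 = drop ?F (coins s)" "ireg s3 7 = r" "ireg s3 35 = of_bool (bit r)" using B z2 by (simp_all add: frame_def)
        show "runs (Seq (FACT 4) (Seq (Cond (ILess 36 35) (FACT 2) (FACT 3)) (TRANSFER 6 4 4 4 5))) s3 ?Q (?T + ((1 + ?T) + (n * (7 * M + 7) + 5)))"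
        proof (rule runs_Seq[OF runs_FACT[where n = n and L = L and M = M]])
          fix s4 assume C: "frame {20,21,22,30,31,32,33,34} {10,11,12} {1} {6,7,8,9} s3 s4 \<and> coins s4 = drop ?F (coins s3) \<and>
           (\<forall>j<n. \<forall>i<M. rarr s4 6 (j * ?N + i) = rarr s3 6 (j * ?N + i) * fact_sk L (coins s3) (\<lambda>a. rarr s3 4 (j * ?N + a)) i)"
          have S4: "stat s4" using C by (elim conjE) (auto intro: stat_frame[OF S3])
          have z4: "rarr s4 4 = rarr s 4" "coins s4 = drop ?F (drop ?F (coins s))" "ireg s4 7 = r" "ireg s4 35 = of_bool (bit r)" using C z3 by (simp_all add: frame_def)
          let ?G = "\<lambda>s5. frame {20,21,22,30,31,32,33,34} {10,11,12} {1} {6,7,8,9} s4 s5 \<and> coins s5 = drop ?F (coins s4) \<and>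
             (\<forall>j<n. \<forall>i<M. rarr s5 6 (j * ?N + i) = rarr s4 6 (j * ?N + i) * fact_sk L (coins s4) (?u j) i)"
          have cong: "fact_sk L w f i = fact_sk L w g i" if "\<forall>a<?N. f a = g a" "length w \<ge> ?F" "i < M" for w f g i
          proof -
            have "i * L + L \<le> M * L" using that by (metis Suc_leI mult_Suc mult_le_mono1 add.commute)
            then have "length (take L (drop (i * L) (drop ?N w))) = L" using that by (simp add: flen_def)
            then have "idx L (drop ?N w) i < ?N" unfolding idx_def using bval_less by metis
            then show ?thesis using that by (simp add: fact_sk_def had_eq)
          qed
          have len: "?F \<le> length (coins s4)" "?F \<le> length (coins s3)" "?F \<le> length (coins s2)" using c z4 z3 z2 by simp_all
          have st4: "ireg s4 3 = 1" "ireg s4 0 = n" "ireg s4 4 = ?N" "ireg s4 5 = M" "ireg s4 6 = L" "ireg s4 9 = 2 ^ (L - 1)" "ireg s4 36 = 0"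
            and arr4: "\<And>j a. j < n \<Longrightarrow> a < ?N \<Longrightarrow> rarr s4 2 (j * ?N + a) = xf j a" "\<And>j a. j < n \<Longrightarrow> a < ?N \<Longrightarrow> rarr s4 3 (j * ?N + a) = e0 a"
            using S4 by (simp_all add: stat_def)
          show "runs (Seq (Cond (ILess 36 35) (FACT 2) (FACT 3)) (TRANSFER 6 4 4 4 5)) s4 ?Q ((1 + ?T) + (n * (7 * M + 7) + 5))"
          proof (rule runs_Seq[where Q = ?G, OF runs_Cond])
            assume "holds (ILess 36 35) s4"
            then have b: "bit r" using z4 st4 by simp
            show "runs (FACT 2) s4 ?G ?T"
              by (rule runs_conseq[OF runs_FACT[OF st4(1-6) L M _ len(1) n]])
                 (use b arr4 len in \<open>auto intro!: cong\<close>)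
          next
            assume "\<not> holds (ILess 36 35) s4"
            then have b: "\<not> bit r" using z4 st4 by simp
            show "runs (FACT 3) s4 ?G ?T"
              by (rule runs_conseq[OF runs_FACT[OF st4(1-6) L M _ len(1) n]])
                 (use b arr4 len in \<open>auto intro!: cong\<close>)
          next
            fix s5 assume D: "?G s5"
            have S5: "stat s5" using D by (elim conjE) (auto intro: stat_frame[OF S4])
            have z5: "rarr s5 4 = rarr s 4" "coins s5 = drop (3 * ?F) (coins s)" "ireg s5 7 = r"
              using D z4 by (simp_all add: frame_def numeral_3_eq_3 add.commute)
            have Zc: "fact_sk L w (\<lambda>a. rarr s 4 (j * ?N + a)) i = fact_sk L w (z j) i" if "?F \<le> length w" "j < n" "i < M" for w j i
              using s(2) that by (intro cong) (auto simp: Zrep_def)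
            have v: "rarr s5 6 (j * ?N + i) = level L M sc (coins s) (?u j) (z j) i" if "j < n" "i < M" for j i
            proof -
              have "rarr s5 6 (j * ?N + i) = sc * fact_sk L (coins s2) (\<lambda>a. rarr s 4 (j * ?N + a)) i
                * fact_sk L (coins s3) (\<lambda>a. rarr s 4 (j * ?N + a)) i * fact_sk L (coins s4) (?u j) i"
                using D C B a2 that z2(1) z3(1) by simp
              also have "\<dots> = sc * fact_sk L (coins s2) (z j) i * fact_sk L (coins s3) (z j) i * fact_sk L (coins s4) (?u j) i"
                using Zc len that by simp
              finally show ?thesis using that z2 z3 z4 by (simp add: level_def)
            qed
            show "runs (TRANSFER 6 4 4 4 5) s5 ?Q (n * (7 * M + 7) + 5)"
            proof (rule runs_conseq[OF runs_TRANSFER[where n = n and a = ?N and b = ?N and c = M]])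
              fix s6 assume E: "frame {20,21,33,34,37,38} {10} {} {4} s5 s6 \<and> coins s6 = coins s5 \<and>
                 (\<forall>j<n. \<forall>i<M. rarr s6 4 (j * ?N + i) = rarr s5 6 (j * ?N + i)) \<and>
                 (\<forall>x. (\<forall>j<n. \<forall>i<M. x \<noteq> j * ?N + i) \<longrightarrow> rarr s6 4 x = rarr s5 4 x)"
              have S6: "stat s6" using E by (elim conjE) (auto intro: stat_frame[OF S5])
              have "rarr s6 4 (j * ?N + a) = level L M sc (coins s) (?u j) (z j) a" if "j < n" "a < ?N" for j a
              \<comment> \<open>From \<open>M\<close> on nothing is written: the old vector is zero
                there by assumption, and so is the result of a level.\<close>
              proof (cases "a < M")
                case False
                have "\<forall>j'<n. \<forall>i<M. j * ?N + a \<noteq> j' * ?N + i"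
                proof (intro allI impI notI)
                  fix j' i assume "j' < n" "i < M" and eq: "j * ?N + a = j' * ?N + i"
                  then have i: "i < ?N" using M by simp
                  have "(j * ?N + a) mod ?N = a" "(j' * ?N + i) mod ?N = i" using that i by auto
                  then show False using eq \<open>i < M\<close> False by simp
                qed
                then have "rarr s6 4 (j * ?N + a) = rarr s5 4 (j * ?N + a)" using E by blast
                also have "\<dots> = z j a" using z5 s(2) that by (simp add: Zrep_def)
                finally show ?thesis using False z by (simp add: level_def)
              qed (use E v that in simp)
              then show "?Q s6" using S6 E z5 by (simp add: Zrep_def frame_def)
            qed (use S5 M in \<open>auto simp: stat_def\<close>)
          qed
        qed (use S3 L M n c z3 in \<open>auto simp: stat_def\<close>)
      qed (use S2 L M n c z2 in \<open>auto simp: stat_def\<close>)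
    qed (use S1 M in \<open>auto simp: stat_def\<close>)
  qed
  then show ?thesis
  proof (rule runs_conseq)
    let ?P = "n * (L * ?N)"
    have l1: "1 * (1 * 1) \<le> ?P" using L n by (intro mult_le_mono) auto
    have l2: "n * (1 * 1) \<le> ?P" using L n by (intro mult_le_mono) auto
    have l3: "n * (1 * M) \<le> ?P" using L M by (intro mult_le_mono) auto
    have "n * (7 * M + 7) = 7 * (n * M) + 7 * n" by (simp add: algebra_simps)
    then show "3 + ((n * (7 * M + 7) + 5) + (?T + (?T + ((1 + ?T) + (n * (7 * M + 7) + 5))))) \<le> 280 * n * L * ?N"
      using l1 l2 l3 unfolding mult.assoc by linarith
  qed auto
qed

definition bits :: "nat \<Rightarrow> bool list" where
  "bits r = map bit (rev [0..<r])"

text \<open>Register 7 counts the remaining levels and, once decremented, is the position of the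
  next digit. The invariant says that sketching the current vectors with the remaining coins and
  digits gives the final result.\<close>

lemma runs_MAIN:
  assumes s: "stat s" "Zrep z s" "ireg s 7 = l" and c: "length (coins s) = 3 * flen L M * l"
    and z: "\<And>j a. M \<le> a \<Longrightarrow> z j a = 0" and mo: "M \<le> mo"
  shows "runs MAIN s (\<lambda>s'. ireg s' 0 = mo \<and>
     (\<forall>j<n. \<forall>i<mo. rarr s' 1 (j * mo + i) = sk L M sc (bits l) (coins s) (xf j) (z j) i)) (l * (280 * n * L * 2 ^ L + 1) + (n * (7 * M + 7) + 8))"
proof -
  let ?fin = "\<lambda>j. sk L M sc (bits l) (coins s) (xf j) (z j)"
  let ?I = "\<lambda>k s'. stat s' \<and> ireg s' 7 = l - k \<and> length (coins s') = 3 * flen L M * (l - k) \<and>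
     (\<exists>z'. Zrep z' s' \<and> (\<forall>j a. M \<le> a \<longrightarrow> z' j a = 0) \<and> (\<forall>j. sk L M sc (bits (l - k)) (coins s') (xf j) (z' j) = ?fin j))"
  have "runs MAIN s (\<lambda>s'. ireg s' 0 = mo \<and> (\<forall>j<n. \<forall>i<mo. rarr s' 1 (j * mo + i) = ?fin j i)) ((l * (280 * n * L * 2 ^ L + 1) + 1) + ((n * (7 * M + 7) + 5) + 2))"
    unfolding MAIN_def
  proof (rule runs_Seq)
    show "runs (While (ILess 36 7) LEVEL) s (?I l) (l * (280 * n * L * 2 ^ L + 1) + 1)"
    proof (rule runs_while[where I = ?I])
      show "?I 0 s" using s c z by (auto intro!: exI[of _ z])
      fix k s1 assume k: "k < l" and I: "?I k s1"
      then obtain z' where z': "Zrep z' s1" "\<And>j a. M \<le> a \<Longrightarrow> z' j a = 0"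
        and fin: "\<And>j. sk L M sc (bits (l - k)) (coins s1) (xf j) (z' j) = ?fin j" by blast
      let ?r = "l - Suc k"
      have r: "l - k = Suc ?r" using k by simp
      have cs: "length (coins s1) = 3 * flen L M + 3 * flen L M * ?r" using I unfolding r by simp
      have b: "bits (l - k) = bit ?r # bits ?r" unfolding r by (simp add: bits_def)
      have "runs LEVEL s1 (?I (Suc k)) (280 * n * L * 2 ^ L)"
      proof (rule runs_conseq[OF runs_LEVEL[where z = z' and r = ?r]])
        fix s2 assume A: "stat s2 \<and> Zrep (\<lambda>j. level L M sc (coins s1) (if bit ?r then xf j else e0) (z' j)) s2 \<and> ireg s2 7 = ?r \<and>
          coins s2 = drop (3 * flen L M) (coins s1)"
        show "?I (Suc k) s2"
          using A cs fin unfolding b by (auto intro!: exI[of _ "\<lambda>j. level L M sc (coins s1) (if bit ?r then xf j else e0) (z' j)"] simp: level_def)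
      qed (use I r z' cs in auto)
      then show "holds (ILess 36 7) s1 \<and> runs LEVEL s1 (?I (Suc k)) (280 * n * L * 2 ^ L)"
        using I k by (simp add: stat_def)
    qed (auto simp: stat_def)
    fix s1 assume I: "?I l s1"
    then obtain z' where z': "Zrep z' s1" "\<And>j a. M \<le> a \<Longrightarrow> z' j a = 0" "\<And>j. z' j = ?fin j" by (auto simp: bits_def)
    have st: "ireg s1 0 = n" "ireg s1 3 = 1" "ireg s1 4 = 2 ^ L" "ireg s1 5 = M" "ireg s1 8 = mo" "ireg s1 36 = 0" "rarr s1 1 = (\<lambda>_. 0)"
      using I by (simp_all add: stat_def)
    show "runs (Seq (TRANSFER 4 4 1 8 5) (block [IAdd 0 8 36])) s1 (\<lambda>s'. ireg s' 0 = mo \<and> (\<forall>j<n. \<forall>i<mo. rarr s' 1 (j * mo + i) = ?fin j i)) ((n * (7 * M + 7) + 5) + 2)"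
    proof (rule runs_Seq[OF runs_TRANSFER[where n = n and a = "2 ^ L" and b = mo and c = M]])
      fix s2 assume E: "frame {20,21,33,34,37,38} {10} {} {1} s1 s2 \<and> coins s2 = coins s1 \<and>
           (\<forall>j<n. \<forall>i<M. rarr s2 1 (j * mo + i) = rarr s1 4 (j * 2 ^ L + i)) \<and>
           (\<forall>x. (\<forall>j<n. \<forall>i<M. x \<noteq> j * mo + i) \<longrightarrow> rarr s2 1 x = rarr s1 1 x)"
      have "rarr s2 1 (j * mo + i) = ?fin j i" if "j < n" "i < mo" for j i
      proof (cases "i < M")
        case True
        then have "i < 2 ^ L" using M by simp
        then show ?thesis using E z' True that by (simp add: Zrep_def)
      next
        case False
        have "\<forall>j'<n. \<forall>i'<M. j * mo + i \<noteq> j' * mo + i'"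
        proof (intro allI impI notI)
          fix j' i' assume "j' < n" "i' < M" and eq: "j * mo + i = j' * mo + i'"
          then have i: "i' < mo" using mo by simp
          have "(j * mo + i) mod mo = i" "(j' * mo + i') mod mo = i'" using that i by auto
          then show False using eq \<open>i' < M\<close> False by simp
        qed
        then have "rarr s2 1 (j * mo + i) = 0" using E st by simp
        then show ?thesis using False z' by (metis not_less)
      qed
      moreover have "ireg s2 8 = mo" "ireg s2 36 = 0" using E st by (simp_all add: frame_def)
      ultimately show "runs (block [IAdd 0 8 36]) s2 (\<lambda>s'. ireg s' 0 = mo \<and> (\<forall>j<n. \<forall>i<mo. rarr s' 1 (j * mo + i) = ?fin j i)) 2"
        by (intro runs_block'; simp add: steps_simps)
    qed (use st mo in auto)
  qed
  then show ?thesis by (rule runs_conseq) auto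
qed

end

section \<open>Computing the parameters on the machine\<close>

lemma runs_while_Least:
  assumes ex: "\<exists>i. P i"
    and step: "\<And>i s. I i s \<Longrightarrow> \<not> P i \<Longrightarrow> i < (LEAST i. P i) \<Longrightarrow> holds b s \<and> runs body s (I (Suc i)) T"
    and stop: "\<And>i s. I i s \<Longrightarrow> P i \<Longrightarrow> \<not> holds b s"
    and init: "I 0 s"
  shows "runs (While b body) s (I (LEAST i. P i)) ((LEAST i. P i) * (T + 1) + 1)"
proof (rule runs_while)
  show "\<not> holds b s" if "I (LEAST i. P i) s" for s
    using stop[OF that] LeastI_ex[OF ex] by blast
  show "holds b s \<and> runs body s (I (Suc i)) T" if "i < (LEAST i. P i)" "I i s" for i s
    using step[OF that(2)] not_less_Least[OF that(1)] that(1) by blast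
qed (rule init)

text \<open>No instruction converts an integer to a real, so the value is counted up; the cost,
  linear in \<open>n\<close>, \<open>d\<close> and \<open>p\<close>, fits the time bound.\<close>

definition CVT :: "nat \<Rightarrow> nat \<Rightarrow> prog" where
  "CVT i x = Seq (block [RConst x 0]) (FOR 20 i (block [RAdd x x 3]))"

lemma runs_CVT:
  assumes s: "ireg s 3 = 1" "rreg s 3 = 1" "ireg s i = m" and x: "x \<noteq> 3" "i \<noteq> 20"
  shows "runs (CVT i x) s (\<lambda>s'. frame {20} {x} {} {} s s' \<and> coins s' = coins s \<and> rreg s' x = real m) (4 * m + 4)"
proof -
  let ?I = "\<lambda>j s'. frame {20} {x} {} {} s s' \<and> coins s' = coins s \<and> rreg s' x = real j"
  have "runs (CVT i x) s (?I m) (2 + (m * (2 + 2) + 2))"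
    unfolding CVT_def
  proof (rule runs_Seq[where Q = "\<lambda>s'. s' = rset x 0 s"])
    show "runs (block [RConst x 0]) s (\<lambda>s'. s' = rset x 0 s) 2" by (rule runs_block) auto
    fix s0 assume s0: "s0 = rset x 0 s"
    show "runs (FOR 20 i (block [RAdd x x 3])) s0 (?I m) (m * (2 + 2) + 2)"
    proof (rule runs_FOR[where I = ?I and m = m and T = 2])
      fix j s1 assume I: "?I j s1" and q: "ireg s1 20 = j" "ireg s1 i = m" "ireg s1 3 = 1"
      have e: "rreg s1 x = real j" "rreg s1 3 = 1" using I s x by (simp_all add: frame_def)
      show "runs (block [RAdd x x 3]) s1 (\<lambda>s2. ?I (Suc j) s2 \<and> ireg s2 20 = j \<and> ireg s2 i = m \<and> ireg s2 3 = 1) 2"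
        by (rule runs_block', simp add: steps_simps q e) (use I in \<open>auto simp: frame_def\<close>)
    qed (use s s0 x in \<open>auto simp: frame_def iset_def rset_def\<close>)
  qed
  then show ?thesis by (rule runs_conseq) auto
qed

text \<open>An integer in place of the binary logarithm of
  \<open>n d / (\<epsilon> \<delta>)\<close>. It is a least index, as are \<open>ll\<close>,
  \<open>lg4\<close> and \<open>lg2\<close>, so that a loop of comparisons finds it exactly, without
  logarithms or rounding.\<close>

definition kk :: "nat \<Rightarrow> nat \<Rightarrow> real \<Rightarrow> real \<Rightarrow> nat" where
  "kk n d \<epsilon> \<delta> = (LEAST k. real n * real d \<le> 2 ^ k * (\<epsilon> * \<delta>))"

lemma kk_ex: "0 < c \<Longrightarrow> \<exists>k. x \<le> 2 ^ k * (c :: real)"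
proof -
  assume c: "0 < c"
  obtain k where "x / c < 2 ^ k" using real_arch_pow[of 2 "x / c"] by auto
  then show ?thesis using c by (intro exI[of _ k]) (simp add: field_simps)
qed

definition CONSTS :: prog where
  "CONSTS = Seq (block [IConst 3 1, RConst 3 1, IConst 36 0]) (Seq (CVT 0 13) (Seq (CVT 1 14) (Seq (CVT 2 20)
     (Seq (block [RMul 12 0 1, RMul 15 13 14, RConst 16 0]) (While (RLess 12 15) (block [RAdd 12 12 12, RAdd 16 16 3]))))))"

lemma runs_CONSTS:
  assumes s: "ireg s 0 = n" "ireg s 1 = d" "ireg s 2 = p" "rreg s 0 = \<epsilon>" "rreg s 1 = \<delta>" and pos: "0 < \<epsilon>" "0 < \<delta>"
  shows "runs CONSTS s (\<lambda>s'. frame {3,20,36} {3,12,13,14,15,16,20} {} {} s s' \<and> coins s' = coins s \<and> ireg s' 3 = 1 \<and> ireg s' 36 = 0 \<and> rreg s' 3 = 1 \<and>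
     rreg s' 13 = n \<and> rreg s' 14 = d \<and> rreg s' 20 = p \<and> rreg s' 16 = kk n d \<epsilon> \<delta>) (4 * n + 4 * d + 4 * p + 4 * kk n d \<epsilon> \<delta> + 30)"
proof -
  let ?k = "kk n d \<epsilon> \<delta>"
  let ?A = "{3,20,36}" and ?B = "{3,12,13,14,15,16,20}"
  let ?Q = "\<lambda>s'. frame ?A ?B {} {} s s' \<and> coins s' = coins s \<and> ireg s' 3 = 1 \<and> ireg s' 36 = 0 \<and> rreg s' 3 = 1 \<and>
     rreg s' 13 = n \<and> rreg s' 14 = d \<and> rreg s' 20 = p \<and> rreg s' 16 = ?k"
  let ?G = "\<lambda>s'. frame ?A ?B {} {} s s' \<and> coins s' = coins s \<and> ireg s' 3 = 1 \<and> ireg s' 36 = 0 \<and> rreg s' 3 = 1"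
  have "runs CONSTS s ?Q (4 + ((4 * n + 4) + ((4 * d + 4) + ((4 * p + 4) + (4 + (?k * (3 + 1) + 1))))))"
    unfolding CONSTS_def
  proof (rule runs_Seq[where Q = ?G])
    show "runs (block [IConst 3 1, RConst 3 1, IConst 36 0]) s ?G 4"
      by (rule runs_block', simp add: steps_simps) (auto simp: frame_def)
    fix s1 assume G: "?G s1"
    show "runs (Seq (CVT 0 13) (Seq (CVT 1 14) (Seq (CVT 2 20)
     (Seq (block [RMul 12 0 1, RMul 15 13 14, RConst 16 0]) (While (RLess 12 15) (block [RAdd 12 12 12, RAdd 16 16 3])))))) s1 ?Q ((4 * n + 4) + ((4 * d + 4) + ((4 * p + 4) + (4 + (?k * (3 + 1) + 1)))))"
    proof (rule runs_Seq[OF runs_CVT[where m = n]])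
      fix s2 assume 2: "frame {20} {13} {} {} s1 s2 \<and> coins s2 = coins s1 \<and> rreg s2 13 = real n"
      have G2: "?G s2" "rreg s2 13 = n" using G 2 by (auto simp: frame_def)
      show "runs (Seq (CVT 1 14) (Seq (CVT 2 20)
       (Seq (block [RMul 12 0 1, RMul 15 13 14, RConst 16 0]) (While (RLess 12 15) (block [RAdd 12 12 12, RAdd 16 16 3]))))) s2 ?Q ((4 * d + 4) + ((4 * p + 4) + (4 + (?k * (3 + 1) + 1))))"
      proof (rule runs_Seq[OF runs_CVT[where m = d]])
        fix s3 assume 3: "frame {20} {14} {} {} s2 s3 \<and> coins s3 = coins s2 \<and> rreg s3 14 = real d"
        have G3: "?G s3" "rreg s3 13 = n" "rreg s3 14 = d" using G2 3 by (auto simp: frame_def)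
        show "runs (Seq (CVT 2 20) (Seq (block [RMul 12 0 1, RMul 15 13 14, RConst 16 0]) (While (RLess 12 15) (block [RAdd 12 12 12, RAdd 16 16 3])))) s3 ?Q ((4 * p + 4) + (4 + (?k * (3 + 1) + 1)))"
        proof (rule runs_Seq[OF runs_CVT[where m = p]])
          fix s4 assume 4: "frame {20} {20} {} {} s3 s4 \<and> coins s4 = coins s3 \<and> rreg s4 20 = real p"
          have G4: "?G s4" "rreg s4 13 = n" "rreg s4 14 = d" "rreg s4 20 = p" using G3 4 by (auto simp: frame_def)
          have e4: "rreg s4 0 = \<epsilon>" "rreg s4 1 = \<delta>" using G4 s by (auto simp: frame_def)
          let ?W = "\<lambda>i s'. ?G s' \<and> rreg s' 13 = n \<and> rreg s' 14 = d \<and> rreg s' 20 = p \<and> rreg s' 12 = 2 ^ i * (\<epsilon> * \<delta>) \<and> rreg s' 15 = real n * real d \<and> rreg s' 16 = real i"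
          show "runs (Seq (block [RMul 12 0 1, RMul 15 13 14, RConst 16 0]) (While (RLess 12 15) (block [RAdd 12 12 12, RAdd 16 16 3]))) s4 ?Q (4 + (?k * (3 + 1) + 1))"
          proof (rule runs_Seq[where Q = "?W 0"])
            show "runs (block [RMul 12 0 1, RMul 15 13 14, RConst 16 0]) s4 (?W 0) 4"
              by (rule runs_block', simp add: steps_simps e4[unfolded One_nat_def] G4) (use G4 in \<open>auto simp: frame_def\<close>)
            fix s5 assume W: "?W 0 s5"
            have "runs (While (RLess 12 15) (block [RAdd 12 12 12, RAdd 16 16 3])) s5 (?W (LEAST k. real n * real d \<le> 2 ^ k * (\<epsilon> * \<delta>)))
                 ((LEAST k. real n * real d \<le> 2 ^ k * (\<epsilon> * \<delta>)) * (3 + 1) + 1)"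
            proof (rule runs_while_Least[where I = ?W])
              show "\<exists>k. real n * real d \<le> 2 ^ k * (\<epsilon> * \<delta>)" using pos by (intro kk_ex) simp
              fix i s6 assume W6: "?W i s6" and P: "\<not> real n * real d \<le> 2 ^ i * (\<epsilon> * \<delta>)"
              have "runs (block [RAdd 12 12 12, RAdd 16 16 3]) s6 (?W (Suc i)) 3"
                by (rule runs_block', simp add: steps_simps) (use W6 in \<open>auto simp: frame_def\<close>)
              then show "holds (RLess 12 15) s6 \<and> runs (block [RAdd 12 12 12, RAdd 16 16 3]) s6 (?W (Suc i)) 3"
                using W6 P by simp
            qed (use W in auto)
            then show "runs (While (RLess 12 15) (block [RAdd 12 12 12, RAdd 16 16 3])) s5 ?Q (?k * (3 + 1) + 1)"
              unfolding kk_def by (rule runs_conseq) auto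
          qed
        qed (use G3 s in \<open>auto simp: frame_def\<close>)
      qed (use G2 s in \<open>auto simp: frame_def\<close>)
    qed (use G s in \<open>auto simp: frame_def\<close>)
  qed
  then show ?thesis by (rule runs_conseq) auto
qed

subsection \<open>Choosing the number of levels\<close>

text \<open>For the least such \<open>l\<close> one has \<open>2\<^sup>l (l - 1) \<le> p log\<^sub>2 d\<close>. Halving only until the bottom tensor power fits
  into the sketch, rather than until it is trivial, is what avoids factors \<open>log p\<close>.\<close>

definition stopl :: "nat \<Rightarrow> nat \<Rightarrow> nat \<Rightarrow> bool" where
  "stopl d p l \<longleftrightarrow> 1 \<le> l \<and> d ^ (p div 2 ^ l) \<le> 4 ^ l"

definition ll :: "nat \<Rightarrow> nat \<Rightarrow> nat" where "ll d p = (LEAST l. stopl d p l)"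

lemma stopl_ex: "\<exists>l. stopl d p l"
proof -
  have "p < 2 ^ (p + 1)" by (metis less_exp less_SucI Suc_eq_plus1 power_strict_increasing_iff lessI less_trans one_less_numeral_iff semiring_norm(76))
  then have "p div 2 ^ (p + 1) = 0" by simp
  then have "stopl d p (p + 1)" by (simp add: stopl_def)
  then show ?thesis by blast
qed

text \<open>Halving by counting: with at most \<open>p\<close> levels, the total of order
  \<open>p^2\<close> fits the time bound.\<close>

definition HALF :: prog where
  "HALF = Seq (block [IConst 23 0, IConst 24 1]) (While (ILess 24 10) (block [IAdd 23 23 3, IAdd 24 24 3, IAdd 24 24 3]))"

lemma runs_HALF:
  assumes s: "ireg s 3 = 1" "ireg s 10 = h"
  shows "runs HALF s (\<lambda>s'. frame {23,24} {} {} {} s s' \<and> coins s' = coins s \<and> ireg s' 23 = h div 2) (5 * h + 4)"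
proof -
  let ?I = "\<lambda>i s'. frame {23,24} {} {} {} s s' \<and> coins s' = coins s \<and> ireg s' 23 = i \<and> ireg s' 24 = 2 * i + 1"
  have "runs HALF s (?I (h div 2)) (3 + (h div 2 * (4 + 1) + 1))"
    unfolding HALF_def
  proof (rule runs_Seq[where Q = "?I 0"])
    show "runs (block [IConst 23 0, IConst 24 1]) s (?I 0) 3"
      by (rule runs_block', simp add: steps_simps) (auto simp: frame_def)
    fix s1 assume I0: "?I 0 s1"
    show "runs (While (ILess 24 10) (block [IAdd 23 23 3, IAdd 24 24 3, IAdd 24 24 3])) s1 (?I (h div 2)) (h div 2 * (4 + 1) + 1)"
    proof (rule runs_while[where I = ?I])
      fix i s2 assume i: "i < h div 2" and I: "?I i s2"
      have e: "ireg s2 3 = 1" "ireg s2 10 = h" using I s by (simp_all add: frame_def)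
      have "runs (block [IAdd 23 23 3, IAdd 24 24 3, IAdd 24 24 3]) s2 (?I (Suc i)) 4"
        by (rule runs_block', simp add: steps_simps e) (use I in \<open>auto simp: frame_def\<close>)
      then show "holds (ILess 24 10) s2 \<and> runs (block [IAdd 23 23 3, IAdd 24 24 3, IAdd 24 24 3]) s2 (?I (Suc i)) 4"
        using i I e by auto
    next
      fix s2 assume I: "?I (h div 2) s2"
      have e: "ireg s2 10 = h" using I s by (simp_all add: frame_def)
      show "\<not> holds (ILess 24 10) s2" using I e by auto
    qed (use I0 in auto)
  qed
  then show ?thesis by (rule runs_conseq) auto
qed

text \<open>The digit split off is \<open>h - 2 * (h div 2)\<close>. Powers of \<open>d\<close> are
  formed in real registers because integers cannot be multiplied.\<close>

definition PLB :: prog where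
  "PLB = Seq HALF (Seq (block [IAdd 25 23 23, ISub 26 10 25, IStore 0 7 26, IAdd 7 7 3, IAdd 10 23 36, RAdd 17 17 17, RMul 18 17 17, RConst 19 1])
     (FOR 20 10 (block [RMul 19 19 14])))"

text \<open>The initial values 0 and 1 of the two compared registers force a first round, in
  accordance with \<open>1 \<le> l\<close> in \<open>stopl\<close>.\<close>

definition LEVELS :: prog where
  "LEVELS = Seq (block [IConst 7 0, IAdd 10 2 36, RConst 17 1, RConst 18 0, RConst 19 1]) (While (RLess 18 19) PLB)"

lemma runs_LEVELS:
  assumes s: "ireg s 2 = p" "ireg s 3 = 1" "ireg s 36 = 0" "rreg s 14 = real d"
  shows "runs LEVELS s (\<lambda>s'. frame {7,10,20,23,24,25,26} {17,18,19} {0} {} s s' \<and> coins s' = coins s \<and> ireg s' 7 = ll d p \<and>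
     ireg s' 10 = p div 2 ^ ll d p \<and> rreg s' 18 = 4 ^ ll d p \<and> (\<forall>j<ll d p. iarr s' 0 j = of_bool (odd (p div 2 ^ j)))) (ll d p * (9 * p + 16) + 7)"
proof -
  let ?l = "ll d p"
  let ?I = "\<lambda>i s'. frame {7,10,20,23,24,25,26} {17,18,19} {0} {} s s' \<and> coins s' = coins s \<and> ireg s' 7 = i \<and>
     ireg s' 10 = p div 2 ^ i \<and> rreg s' 17 = 2 ^ i \<and> rreg s' 18 = (if i = 0 then 0 else 4 ^ i) \<and> rreg s' 19 = (if i = 0 then 1 else real d ^ (p div 2 ^ i)) \<and>
     (\<forall>j<i. iarr s' 0 j = of_bool (odd (p div 2 ^ j)))"
  have l1: "1 \<le> ?l" using LeastI_ex[OF stopl_ex] unfolding ll_def stopl_def by blast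
  have "runs LEVELS s (?I ?l) (6 + (?l * ((5 * p + 4 + (9 + (p * 4 + 2))) + 1) + 1))"
    unfolding LEVELS_def
  proof (rule runs_Seq[where Q = "?I 0"])
    show "runs (block [IConst 7 0, IAdd 10 2 36, RConst 17 1, RConst 18 0, RConst 19 1]) s (?I 0) 6"
      by (rule runs_block', simp add: steps_simps s) (auto simp: frame_def)
    fix s1 assume I0: "?I 0 s1"
    show "runs (While (RLess 18 19) PLB) s1 (?I ?l) (?l * ((5 * p + 4 + (9 + (p * 4 + 2))) + 1) + 1)"
      unfolding ll_def
    proof (rule runs_while_Least[where I = ?I and P = "stopl d p", OF stopl_ex])
      fix i s2 assume I: "?I i s2" and nP: "\<not> stopl d p i"
      have e: "ireg s2 3 = 1" "ireg s2 36 = 0" "ireg s2 10 = p div 2 ^ i" "rreg s2 14 = d" "ireg s2 7 = i"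
        "rreg s2 17 = 2 ^ i" using I s by (simp_all add: frame_def)
      have pd: "p div 2 ^ i div 2 = p div 2 ^ Suc i" by (simp only: power_Suc2 div_mult2_eq)
      have pp: "p div 2 ^ i \<le> p" "p div 2 ^ Suc i \<le> p" by auto
      have rb: "runs PLB s2 (?I (Suc i)) ((5 * (p div 2 ^ i) + 4) + (9 + ((p div 2 ^ Suc i) * (2 + 2) + 2)))"
        unfolding PLB_def
      proof (rule runs_Seq[OF runs_HALF[OF e(1,3)]])
        fix s3 assume A: "frame {23,24} {} {} {} s2 s3 \<and> coins s3 = coins s2 \<and> ireg s3 23 = p div 2 ^ i div 2"
        have a: "ireg s3 23 = p div 2 ^ Suc i" "ireg s3 10 = p div 2 ^ i" "ireg s3 7 = i" "ireg s3 3 = 1" "ireg s3 36 = 0" "rreg s3 17 = 2 ^ i"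
          "rreg s3 14 = d" using A e pd by (simp_all add: frame_def)
        have m: "p div 2 ^ i - 2 * (p div 2 ^ Suc i) = of_bool (odd (p div 2 ^ i))"
          unfolding pd[symmetric] by (simp add: minus_mult_div_eq_mod mod_2_eq_odd)
        let ?J = "\<lambda>j s'. frame {7,10,20,23,24,25,26} {17,18,19} {0} {} s s' \<and> coins s' = coins s \<and> ireg s' 7 = Suc i \<and>
          ireg s' 10 = p div 2 ^ Suc i \<and> rreg s' 17 = 2 ^ Suc i \<and> rreg s' 18 = 4 ^ Suc i \<and> rreg s' 19 = real d ^ j \<and>
          (\<forall>j<Suc i. iarr s' 0 j = of_bool (odd (p div 2 ^ j)))"
        show "runs (Seq (block [IAdd 25 23 23, ISub 26 10 25, IStore 0 7 26, IAdd 7 7 3, IAdd 10 23 36, RAdd 17 17 17, RMul 18 17 17, RConst 19 1])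
           (FOR 20 10 (block [RMul 19 19 14]))) s3 (?I (Suc i)) (9 + ((p div 2 ^ Suc i) * (2 + 2) + 2))"
        proof (rule runs_Seq[where Q = "?J 0"])
          have p4: "2 * 2 ^ i * (2 * 2 ^ i) = (4 * 4 ^ i :: real)" by (simp flip: power_mult_distrib)
          show "runs (block [IAdd 25 23 23, ISub 26 10 25, IStore 0 7 26, IAdd 7 7 3, IAdd 10 23 36, RAdd 17 17 17, RMul 18 17 17, RConst 19 1]) s3 (?J 0) 9"
            by (rule runs_block', simp add: steps_simps a p4) (use I A m in \<open>auto simp: frame_def less_Suc_eq\<close>)
          fix s4 assume J: "?J 0 s4"
          show "runs (FOR 20 10 (block [RMul 19 19 14])) s4 (?I (Suc i)) ((p div 2 ^ Suc i) * (2 + 2) + 2)"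
          proof (rule runs_conseq[OF runs_FOR[where I = ?J and T = 2 and m = "p div 2 ^ Suc i"]])
            fix j s5 assume J5: "?J j s5" and q: "ireg s5 20 = j" "ireg s5 10 = p div 2 ^ Suc i" "ireg s5 3 = 1"
            have e5: "rreg s5 14 = d" using J5 s by (simp add: frame_def)
            show "runs (block [RMul 19 19 14]) s5 (\<lambda>s2. ?J (Suc j) s2 \<and> ireg s2 20 = j \<and> ireg s2 10 = p div 2 ^ Suc i \<and> ireg s2 3 = 1) 2"
              by (rule runs_block', simp add: steps_simps q e5) (use J5 q in \<open>auto simp: frame_def\<close>)
          qed (use J s in \<open>auto simp: frame_def iset_def\<close>)
        qed
      qed
      have "holds (RLess 18 19) s2"
      proof (cases "i = 0")
        case False
        then have "4 ^ i < d ^ (p div 2 ^ i)" using nP by (simp add: stopl_def)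
        then have "real (4 ^ i) < real (d ^ (p div 2 ^ i))" by (rule of_nat_less_iff[THEN iffD2])
        then show ?thesis using False I by simp
      qed (use I in simp)
      moreover have "runs PLB s2 (?I (Suc i)) (5 * p + 4 + (9 + (p * 4 + 2)))"
      proof (rule runs_conseq[OF rb])
        have "5 * a + 4 + (9 + (b * (2 + 2) + 2)) \<le> 5 * p + 4 + (9 + (p * 4 + 2))" if "a \<le> p" "b \<le> p" for a b
          using that by simp
        from this[OF pp] show "5 * (p div 2 ^ i) + 4 + (9 + (p div 2 ^ Suc i * (2 + 2) + 2)) \<le> 5 * p + 4 + (9 + (p * 4 + 2))" .
      qed
      ultimately show "holds (RLess 18 19) s2 \<and> runs PLB s2 (?I (Suc i)) (5 * p + 4 + (9 + (p * 4 + 2)))"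
        by (rule conjI)
    next
      fix i s2 assume I: "?I i s2" and P: "stopl d p i"
      have "real (d ^ (p div 2 ^ i)) \<le> real (4 ^ i)" using P unfolding stopl_def by (simp only: of_nat_le_iff)
      then show "\<not> holds (RLess 18 19) s2" using I P by (auto simp: stopl_def)
    qed (use I0 in auto)
  qed
  then show ?thesis by (rule runs_conseq) (use l1 in \<open>auto simp: algebra_simps\<close>)
qed

text \<open>Of the four factors \<open>k\<close>, three come from the cubed Khintchine constant with moments of order about \<open>16 k\<close>
  and one from the union bound in the matrix Bernstein inequality.\<close>

definition tbase :: "nat \<Rightarrow> nat \<Rightarrow> real \<Rightarrow> real" where
  "tbase k n \<epsilon> = 2 ^ 46 * real k ^ 4 * real n / (\<epsilon> * \<epsilon>)"

text \<open>Rounding the number of samples to a power of four makes the scale factor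
  \<open>1 / sqrt M = 1 / 2 ^ t\<close> computable without a square root.\<close>

definition lg4 :: "nat \<Rightarrow> real \<Rightarrow> nat" where "lg4 t x = (LEAST i. x \<le> 4 ^ (t + i))"
definition lg2 :: "nat \<Rightarrow> nat \<Rightarrow> nat" where "lg2 t d = (LEAST i. d \<le> 2 ^ (2 * t + i))"

lemma lg4_ex: "\<exists>i. x \<le> (4::real) ^ (t + i)"
proof -
  obtain i where "x < 4 ^ i" using real_arch_pow[of 4 x] by auto
  also have "(4::real) ^ i \<le> 4 ^ (t + i)" by (rule power_increasing) auto
  finally show ?thesis by (intro exI[of _ i]) simp
qed

lemma lg2_ex: "\<exists>i. d \<le> (2::nat) ^ (2 * t + i)"
proof -
  have "d \<le> 2 ^ d" by (simp add: less_imp_le)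
  also have "(2::nat) ^ d \<le> 2 ^ (2 * t + d)" by (rule power_increasing) auto
  finally show ?thesis by blast
qed

text \<open>The large constant is \<open>2 ^ 46\<close>. Half of the transform length, in register
  9, is the value saved before the last doubling, as integers cannot be divided.\<close>

definition SIZES :: prog where
  "SIZES = Seq (block [RConst 21 70368744177664, RMul 22 16 16, RMul 22 22 22, RMul 21 21 22, RMul 21 21 13, RMul 22 0 0, RDiv 21 21 22,
       RMul 23 21 18, RAdd 24 20 20, RMul 24 24 24, RMul 24 21 24, RConst 25 1, RConst 2 1, IConst 5 1, IConst 6 0, IConst 9 0])
     (Seq (While (RLess 25 23) (block [RAdd 25 25 25, RAdd 25 25 25, RAdd 2 2 2, IAdd 5 5 5, IAdd 9 5 36, IAdd 5 5 5, IAdd 6 6 3, IAdd 6 6 3]))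
     (Seq (block [RDiv 2 3 2, IAdd 8 5 36, IAdd 4 5 36])
     (Seq (While (RLess 25 24) (block [RAdd 25 25 25, RAdd 25 25 25, IAdd 8 8 8, IAdd 8 8 8]))
       (While (ILess 4 1) (block [IAdd 9 4 36, IAdd 4 4 4, IAdd 6 6 3])))))"

lemma runs_SIZES:
  assumes s: "ireg s 1 = d" "ireg s 3 = 1" "ireg s 36 = 0" "rreg s 0 = \<epsilon>" "rreg s 3 = 1" "rreg s 13 = real n" "rreg s 16 = real k"
    "rreg s 18 = 4 ^ l" "rreg s 20 = real p" and t1: "1 < tbase k n \<epsilon> * 4 ^ l"
    and t: "t = lg4 0 (tbase k n \<epsilon> * 4 ^ l)" and t2: "t2 = lg4 t (tbase k n \<epsilon> * (2 * real p)\<^sup>2)" and ee: "e = lg2 t d"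
  shows "runs SIZES s (\<lambda>s'. frame {4,5,6,8,9} {2,21,22,23,24,25} {} {} s s' \<and> coins s' = coins s \<and> ireg s' 5 = 4 ^ t \<and> ireg s' 6 = 2 * t + e \<and>
     ireg s' 4 = 2 ^ (2 * t + e) \<and> ireg s' 9 = 2 ^ (2 * t + e - 1) \<and> ireg s' 8 = 4 ^ (t + t2) \<and> rreg s' 2 = 1 / 2 ^ t) (10 * t + 6 * t2 + 5 * e + 30)"
proof -
  let ?tg = "tbase k n \<epsilon> * 4 ^ l" and ?tg2 = "tbase k n \<epsilon> * (2 * real p)\<^sup>2"
  let ?Q = "\<lambda>s'. frame {4,5,6,8,9} {2,21,22,23,24,25} {} {} s s' \<and> coins s' = coins s \<and> ireg s' 5 = 4 ^ t \<and> ireg s' 6 = 2 * t + e \<and>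
     ireg s' 4 = 2 ^ (2 * t + e) \<and> ireg s' 9 = 2 ^ (2 * t + e - 1) \<and> ireg s' 8 = 4 ^ (t + t2) \<and> rreg s' 2 = 1 / 2 ^ t"
  let ?G = "\<lambda>s'. frame {4,5,6,8,9} {2,21,22,23,24,25} {} {} s s' \<and> coins s' = coins s"
  let ?I = "\<lambda>i s'. ?G s' \<and> rreg s' 23 = ?tg \<and> rreg s' 24 = ?tg2 \<and> rreg s' 25 = 4 ^ i \<and> rreg s' 2 = 2 ^ i \<and> ireg s' 5 = 4 ^ i \<and> ireg s' 6 = 2 * i \<and>
     ireg s' 9 = (if i = 0 then 0 else 2 * 4 ^ (i - 1))"
  let ?J = "\<lambda>i s'. ?G s' \<and> rreg s' 24 = ?tg2 \<and> rreg s' 25 = 4 ^ (t + i) \<and> rreg s' 2 = 1 / 2 ^ t \<and> ireg s' 5 = 4 ^ t \<and> ireg s' 6 = 2 * t \<and>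
     ireg s' 9 = 2 ^ (2 * t - 1) \<and> ireg s' 8 = 4 ^ (t + i) \<and> ireg s' 4 = 4 ^ t"
  let ?K = "\<lambda>i s'. ?G s' \<and> rreg s' 2 = 1 / 2 ^ t \<and> ireg s' 5 = 4 ^ t \<and> ireg s' 6 = 2 * t + i \<and>
     ireg s' 9 = 2 ^ (2 * t + i - 1) \<and> ireg s' 8 = 4 ^ (t + t2) \<and> ireg s' 4 = 2 ^ (2 * t + i)"
  \<comment> \<open>The first loop runs at least once; otherwise register 9 would still be
    0.\<close>
  have tpos: "1 \<le> t"
  proof (rule ccontr)
    assume "\<not> 1 \<le> t"
    then have "t = 0" by simp
    then have "?tg \<le> 4 ^ (0 + 0)" using LeastI_ex[OF lg4_ex[of ?tg 0]] t by (simp add: lg4_def)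
    then show False using t1 by simp
  qed
  have p4: "(4::nat) ^ t = 2 * (2 * 4 ^ (t - 1))" "2 * 4 ^ (t - 1) = (2::nat) ^ (2 * t - 1)" "(4::nat) ^ t = 2 ^ (2 * t)"
  proof -
    obtain u where u: "t = Suc u" using tpos by (cases t) auto
    show "(4::nat) ^ t = 2 * (2 * 4 ^ (t - 1))" "2 * 4 ^ (t - 1) = (2::nat) ^ (2 * t - 1)" "(4::nat) ^ t = 2 ^ (2 * t)"
      unfolding u by (simp_all add: power_mult)
  qed
  have "runs SIZES s ?Q (17 + ((t * (9 + 1) + 1) + (4 + ((t2 * (5 + 1) + 1) + (e * (4 + 1) + 1)))))"
    unfolding SIZES_def
  proof (rule runs_Seq[where Q = "?I 0"])
    have r0: "rreg s 0 = \<epsilon>" using s by simp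
    show "runs (block [RConst 21 70368744177664, RMul 22 16 16, RMul 22 22 22, RMul 21 21 22, RMul 21 21 13, RMul 22 0 0, RDiv 21 21 22,
       RMul 23 21 18, RAdd 24 20 20, RMul 24 24 24, RMul 24 21 24, RConst 25 1, RConst 2 1, IConst 5 1, IConst 6 0, IConst 9 0]) s (?I 0) 17"
      by (rule runs_block', simp add: steps_simps s r0)
        (auto simp: frame_def tbase_def power2_eq_square power4_eq_xxxx mult_ac)
    fix s1 assume I0: "?I 0 s1"
    show "runs (Seq (While (RLess 25 23) (block [RAdd 25 25 25, RAdd 25 25 25, RAdd 2 2 2, IAdd 5 5 5, IAdd 9 5 36, IAdd 5 5 5, IAdd 6 6 3, IAdd 6 6 3]))
     (Seq (block [RDiv 2 3 2, IAdd 8 5 36, IAdd 4 5 36])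
     (Seq (While (RLess 25 24) (block [RAdd 25 25 25, RAdd 25 25 25, IAdd 8 8 8, IAdd 8 8 8]))
       (While (ILess 4 1) (block [IAdd 9 4 36, IAdd 4 4 4, IAdd 6 6 3]))))) s1 ?Q ((t * (9 + 1) + 1) + (4 + ((t2 * (5 + 1) + 1) + (e * (4 + 1) + 1))))"
    proof (rule runs_Seq)
      show "runs (While (RLess 25 23) (block [RAdd 25 25 25, RAdd 25 25 25, RAdd 2 2 2, IAdd 5 5 5, IAdd 9 5 36, IAdd 5 5 5, IAdd 6 6 3, IAdd 6 6 3])) s1 (?I t) (t * (9 + 1) + 1)"
        unfolding t lg4_def
      proof (rule runs_while_Least[where I = ?I, OF lg4_ex])
        fix i s2 assume I: "?I i s2" and P: "\<not> ?tg \<le> 4 ^ (0 + i)"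
        have e: "ireg s2 3 = 1" "ireg s2 36 = 0" using I s by (simp_all add: frame_def)
        have "runs (block [RAdd 25 25 25, RAdd 25 25 25, RAdd 2 2 2, IAdd 5 5 5, IAdd 9 5 36, IAdd 5 5 5, IAdd 6 6 3, IAdd 6 6 3]) s2 (?I (Suc i)) 9"
          by (rule runs_block', simp add: steps_simps e) (use I in \<open>auto simp: frame_def\<close>)
        then show "holds (RLess 25 23) s2 \<and> runs (block [RAdd 25 25 25, RAdd 25 25 25, RAdd 2 2 2, IAdd 5 5 5, IAdd 9 5 36, IAdd 5 5 5, IAdd 6 6 3, IAdd 6 6 3]) s2 (?I (Suc i)) 9"
          using I P by simp
      qed (use I0 in auto)
      fix s2 assume I: "?I t s2"
      show "runs (Seq (block [RDiv 2 3 2, IAdd 8 5 36, IAdd 4 5 36])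
        (Seq (While (RLess 25 24) (block [RAdd 25 25 25, RAdd 25 25 25, IAdd 8 8 8, IAdd 8 8 8]))
         (While (ILess 4 1) (block [IAdd 9 4 36, IAdd 4 4 4, IAdd 6 6 3])))) s2 ?Q (4 + ((t2 * (5 + 1) + 1) + (e * (4 + 1) + 1)))"
      proof (rule runs_Seq[where Q = "?J 0"])
        have e: "ireg s2 36 = 0" "rreg s2 3 = 1" using I s by (simp_all add: frame_def)
        show "runs (block [RDiv 2 3 2, IAdd 8 5 36, IAdd 4 5 36]) s2 (?J 0) 4"
          by (rule runs_block', simp add: steps_simps e) (use I tpos p4 in \<open>auto simp: frame_def\<close>)
        fix s3 assume J0: "?J 0 s3"
        show "runs (Seq (While (RLess 25 24) (block [RAdd 25 25 25, RAdd 25 25 25, IAdd 8 8 8, IAdd 8 8 8]))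
         (While (ILess 4 1) (block [IAdd 9 4 36, IAdd 4 4 4, IAdd 6 6 3]))) s3 ?Q ((t2 * (5 + 1) + 1) + (e * (4 + 1) + 1))"
        proof (rule runs_Seq)
          show "runs (While (RLess 25 24) (block [RAdd 25 25 25, RAdd 25 25 25, IAdd 8 8 8, IAdd 8 8 8])) s3 (?J t2) (t2 * (5 + 1) + 1)"
            unfolding t2 lg4_def
          proof (rule runs_while_Least[where I = ?J, OF lg4_ex])
            fix i s4 assume J: "?J i s4" and P: "\<not> ?tg2 \<le> 4 ^ (t + i)"
            have "runs (block [RAdd 25 25 25, RAdd 25 25 25, IAdd 8 8 8, IAdd 8 8 8]) s4 (?J (Suc i)) 5"
              by (rule runs_block', simp add: steps_simps) (use J in \<open>auto simp: frame_def\<close>)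
            then show "holds (RLess 25 24) s4 \<and> runs (block [RAdd 25 25 25, RAdd 25 25 25, IAdd 8 8 8, IAdd 8 8 8]) s4 (?J (Suc i)) 5"
              using J P by simp
          qed (use J0 in auto)
          fix s4 assume J: "?J t2 s4"
          have K0: "?K 0 s4" using J p4 by simp
          have "runs (While (ILess 4 1) (block [IAdd 9 4 36, IAdd 4 4 4, IAdd 6 6 3])) s4 (?K e) (e * (4 + 1) + 1)"
            unfolding ee lg2_def
          proof (rule runs_while_Least[where I = ?K, OF lg2_ex])
            fix i s5 assume K: "?K i s5" and P: "\<not> d \<le> 2 ^ (2 * t + i)"
            have e5: "ireg s5 3 = 1" "ireg s5 36 = 0" "ireg s5 1 = d" using K s by (simp_all add: frame_def)
            have "runs (block [IAdd 9 4 36, IAdd 4 4 4, IAdd 6 6 3]) s5 (?K (Suc i)) 4"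
              by (rule runs_block', simp add: steps_simps e5) (use K in \<open>auto simp: frame_def\<close>)
            then show "holds (ILess 4 1) s5 \<and> runs (block [IAdd 9 4 36, IAdd 4 4 4, IAdd 6 6 3]) s5 (?K (Suc i)) 4"
              using K P e5 by simp
          next
            fix i s5 assume K: "?K i s5" and P: "d \<le> 2 ^ (2 * t + i)"
            have e5: "ireg s5 1 = d" using K s by (simp_all add: frame_def)
            show "\<not> holds (ILess 4 1) s5" using K P e5 by simp
          qed (use K0 in auto)
          then show "runs (While (ILess 4 1) (block [IAdd 9 4 36, IAdd 4 4 4, IAdd 6 6 3])) s4 ?Q (e * (4 + 1) + 1)"
            by (rule runs_conseq) auto
        qed
      qed
    qed
  qed
  then show ?thesis by (rule runs_conseq) auto
qed

subsection \<open>Tensor powers\<close>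

text \<open>The leading base-\<open>d\<close> digit of the index belongs to the first factor, as in
  \<open>kron\<close>. Exponent 0 gives \<open>e0\<close>, the start vector when
  \<open>p < 2 ^ l\<close>.\<close>

fun tp :: "nat \<Rightarrow> (nat \<Rightarrow> real) \<Rightarrow> nat \<Rightarrow> nat \<Rightarrow> real" where
  "tp d x 0 a = of_bool (a = 0)"
| "tp d x (Suc q) a = (if a < d ^ Suc q then x (a div d ^ q) * tp d x q (a mod d ^ q) else 0)"

lemma tp_0: "d ^ q \<le> a \<Longrightarrow> tp d x q a = 0"
  by (cases q) auto

text \<open>Registers 32, 39 and 40 follow the column offset, the data entry and the target cell, so
  that no index has to be multiplied out. The current length in register 11 is multiplied by
  \<open>d\<close> through repeated addition.\<close>

definition KSTEP :: prog where
  "KSTEP = Seq (block [IConst 32 0, IConst 39 0]) (Seq (FOR 20 0 (Seq (block [IAdd 40 32 36]) (Seq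
      (FOR 21 1 (Seq (block [RLoad 10 0 39, IAdd 39 39 3]) (FOR 22 11 (block [IAdd 33 32 22, RLoad 11 4 33, RMul 11 10 11, RStore 9 40 11, IAdd 40 40 3]))))
      (block [IAdd 32 32 4])))) (Seq (block [IConst 12 0]) (Seq (FOR 21 1 (block [IAdd 12 12 11])) (block [IAdd 11 12 36]))))"

lemma runs_KSTEP:
  assumes s: "ireg s 0 = n" "ireg s 1 = d" "ireg s 3 = 1" "ireg s 4 = N" "ireg s 11 = D" "ireg s 36 = 0"
    and D: "1 \<le> D" "d * D \<le> N" and b: "d * D \<le> K" "1 \<le> d" and n: "1 \<le> n"
  shows "runs KSTEP s (\<lambda>s'. frame {11,12,20,21,22,32,33,39,40} {10,11} {} {9} s s' \<and> coins s' = coins s \<and> ireg s' 11 = d * D \<and>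
     (\<forall>j<n. \<forall>y<d * D. rarr s' 9 (j * N + y) = rarr s 0 (j * d + y div D) * rarr s 4 (j * N + y mod D))) (45 * n * K)"
proof -
  let ?v = "\<lambda>j y. rarr s 0 (j * d + y div D) * rarr s 4 (j * N + y mod D)"
  let ?F = "\<lambda>s'. frame {11,12,20,21,22,32,33,39,40} {10,11} {} {9} s s' \<and> coins s' = coins s"
  let ?I = "\<lambda>j s'. ?F s' \<and> ireg s' 11 = D \<and> ireg s' 32 = j * N \<and> ireg s' 39 = j * d \<and> (\<forall>j'<j. \<forall>y<d * D. rarr s' 9 (j' * N + y) = ?v j' y)"
  let ?R = "\<lambda>s'. ?F s' \<and> ireg s' 11 = d * D \<and> (\<forall>j<n. \<forall>y<d * D. rarr s' 9 (j * N + y) = ?v j y)"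
  have "runs KSTEP s ?R (3 + ((n * ((2 + ((d * ((3 + (D * (6 + 2) + 2)) + 2) + 2) + 2)) + 2) + 2) + (2 + ((d * (2 + 2) + 2) + 2))))"
    unfolding KSTEP_def
  proof (rule runs_Seq[where Q = "?I 0"])
    show "runs (block [IConst 32 0, IConst 39 0]) s (?I 0) 3"
      by (rule runs_block', simp add: steps_simps) (use s in \<open>auto simp: frame_def\<close>)
    fix s0 assume I0: "?I 0 s0"
    show "runs (Seq (FOR 20 0 (Seq (block [IAdd 40 32 36]) (Seq
      (FOR 21 1 (Seq (block [RLoad 10 0 39, IAdd 39 39 3]) (FOR 22 11 (block [IAdd 33 32 22, RLoad 11 4 33, RMul 11 10 11, RStore 9 40 11, IAdd 40 40 3]))))
      (block [IAdd 32 32 4])))) (Seq (block [IConst 12 0]) (Seq (FOR 21 1 (block [IAdd 12 12 11])) (block [IAdd 11 12 36])))) s0 ?R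
      ((n * ((2 + ((d * ((3 + (D * (6 + 2) + 2)) + 2) + 2) + 2)) + 2) + 2) + (2 + ((d * (2 + 2) + 2) + 2)))"
    proof (rule runs_Seq)
      show "runs (FOR 20 0 (Seq (block [IAdd 40 32 36]) (Seq
        (FOR 21 1 (Seq (block [RLoad 10 0 39, IAdd 39 39 3]) (FOR 22 11 (block [IAdd 33 32 22, RLoad 11 4 33, RMul 11 10 11, RStore 9 40 11, IAdd 40 40 3]))))
        (block [IAdd 32 32 4])))) s0 (?I n) (n * ((2 + ((d * ((3 + (D * (6 + 2) + 2)) + 2) + 2) + 2)) + 2) + 2)"
      proof (rule runs_FOR[where I = ?I and m = n and T = "2 + ((d * ((3 + (D * (6 + 2) + 2)) + 2) + 2) + 2)"])
        fix j s1 assume j: "j < n" and I: "?I j s1" and q: "ireg s1 20 = j" "ireg s1 0 = n" "ireg s1 3 = 1"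
        let ?J = "\<lambda>b s'. ?F s' \<and> ireg s' 20 = j \<and> ireg s' 11 = D \<and> ireg s' 32 = j * N \<and> ireg s' 39 = j * d + b \<and> ireg s' 40 = j * N + b * D \<and>
          (\<forall>j'<j. \<forall>y<d * D. rarr s' 9 (j' * N + y) = ?v j' y) \<and> (\<forall>y<b * D. rarr s' 9 (j * N + y) = ?v j y)"
        show "runs (Seq (block [IAdd 40 32 36]) (Seq
        (FOR 21 1 (Seq (block [RLoad 10 0 39, IAdd 39 39 3]) (FOR 22 11 (block [IAdd 33 32 22, RLoad 11 4 33, RMul 11 10 11, RStore 9 40 11, IAdd 40 40 3]))))
        (block [IAdd 32 32 4]))) s1 (\<lambda>s2. ?I (Suc j) s2 \<and> ireg s2 20 = j \<and> ireg s2 0 = n \<and> ireg s2 3 = 1) (2 + ((d * ((3 + (D * (6 + 2) + 2)) + 2) + 2) + 2))"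
        proof (rule runs_Seq[where Q = "?J 0"])
          have e: "ireg s1 36 = 0" using I s by (simp add: frame_def)
          show "runs (block [IAdd 40 32 36]) s1 (?J 0) 2"
            by (rule runs_block', simp add: steps_simps e) (use I q in \<open>auto simp: frame_def\<close>)
          fix s2 assume J0: "?J 0 s2"
          show "runs (Seq (FOR 21 1 (Seq (block [RLoad 10 0 39, IAdd 39 39 3]) (FOR 22 11 (block [IAdd 33 32 22, RLoad 11 4 33, RMul 11 10 11, RStore 9 40 11, IAdd 40 40 3]))))
            (block [IAdd 32 32 4])) s2 (\<lambda>s2. ?I (Suc j) s2 \<and> ireg s2 20 = j \<and> ireg s2 0 = n \<and> ireg s2 3 = 1) ((d * ((3 + (D * (6 + 2) + 2)) + 2) + 2) + 2)"
          proof (rule runs_Seq)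
            show "runs (FOR 21 1 (Seq (block [RLoad 10 0 39, IAdd 39 39 3]) (FOR 22 11 (block [IAdd 33 32 22, RLoad 11 4 33, RMul 11 10 11, RStore 9 40 11, IAdd 40 40 3])))) s2 (?J d) (d * ((3 + (D * (6 + 2) + 2)) + 2) + 2)"
            proof (rule runs_FOR[where I = ?J and m = d and T = "3 + (D * (6 + 2) + 2)"])
              fix b s3 assume b: "b < d" and J: "?J b s3" and q3: "ireg s3 21 = b" "ireg s3 1 = d" "ireg s3 3 = 1"
              let ?L = "\<lambda>a s'. ?F s' \<and> ireg s' 20 = j \<and> ireg s' 21 = b \<and> ireg s' 11 = D \<and> ireg s' 32 = j * N \<and> ireg s' 39 = j * d + Suc b \<and> ireg s' 40 = j * N + (b * D + a) \<and>
                rreg s' 10 = rarr s 0 (j * d + b) \<and>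
                (\<forall>j'<j. \<forall>y<d * D. rarr s' 9 (j' * N + y) = ?v j' y) \<and> (\<forall>y<b * D + a. rarr s' 9 (j * N + y) = ?v j y)"
              show "runs (Seq (block [RLoad 10 0 39, IAdd 39 39 3]) (FOR 22 11 (block [IAdd 33 32 22, RLoad 11 4 33, RMul 11 10 11, RStore 9 40 11, IAdd 40 40 3]))) s3
                 (\<lambda>s2. ?J (Suc b) s2 \<and> ireg s2 21 = b \<and> ireg s2 1 = d \<and> ireg s2 3 = 1) (3 + (D * (6 + 2) + 2))"
              proof (rule runs_Seq[where Q = "?L 0"])
                have e: "rarr s3 0 = rarr s 0" using J by (simp add: frame_def)
                show "runs (block [RLoad 10 0 39, IAdd 39 39 3]) s3 (?L 0) 3"
                  by (rule runs_block', simp add: steps_simps q3 e) (use J q3 in \<open>auto simp: frame_def\<close>)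
                fix s4 assume L0: "?L 0 s4"
                show "runs (FOR 22 11 (block [IAdd 33 32 22, RLoad 11 4 33, RMul 11 10 11, RStore 9 40 11, IAdd 40 40 3])) s4
                  (\<lambda>s2. ?J (Suc b) s2 \<and> ireg s2 21 = b \<and> ireg s2 1 = d \<and> ireg s2 3 = 1) (D * (6 + 2) + 2)"
                proof (rule runs_conseq[OF runs_FOR[where I = ?L and m = D and T = 6]])
                  fix a s5 assume a: "a < D" and L: "?L a s5" and q5: "ireg s5 22 = a" "ireg s5 11 = D" "ireg s5 3 = 1"
                  have "Suc b * D \<le> d * D" using b by (intro mult_le_mono1) simp
                  then have y: "b * D + a < d * D" using a by simp
                  have e: "rarr s5 4 = rarr s 4" "ireg s5 40 = j * N + (b * D + a)" "ireg s5 32 = j * N" "rreg s5 10 = rarr s 0 (j * d + b)" using L by (simp_all add: frame_def)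
                  have w: "rarr s 0 (j * d + b) * rarr s 4 (j * N + a) = ?v j (b * D + a)" using a by simp
                  have nj: "j' * N + y' \<noteq> j * N + (b * D + a)" if "j' < j" "y' < d * D" for j' y'
                  proof -
                    have "Suc j' * N \<le> j * N" using that by (intro mult_le_mono1) simp
                    then show ?thesis using that D by simp
                  qed
                  show "runs (block [IAdd 33 32 22, RLoad 11 4 33, RMul 11 10 11, RStore 9 40 11, IAdd 40 40 3]) s5
                    (\<lambda>s2. ?L (Suc a) s2 \<and> ireg s2 22 = a \<and> ireg s2 11 = D \<and> ireg s2 3 = 1) 6"
                    by (rule runs_block', simp add: steps_simps q5 e w del: mult_cancel_left mult_cancel_right)
                       (use L q5 nj in \<open>auto simp: frame_def less_Suc_eq\<close>)
                next
                  fix s5 assume L: "?L D s5"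
                  have "ireg s5 1 = d" "ireg s5 3 = 1" using L s by (simp_all add: frame_def)
                  then show "?J (Suc b) s5 \<and> ireg s5 21 = b \<and> ireg s5 1 = d \<and> ireg s5 3 = 1"
                    using L by (auto simp: add.commute)
                qed (use L0 s in \<open>auto simp: frame_def iset_def\<close>)
              qed
            qed (use J0 s in \<open>auto simp: frame_def iset_def\<close>)
            fix s3 assume J: "?J d s3"
            have e: "ireg s3 4 = N" "ireg s3 0 = n" "ireg s3 3 = 1" using J s by (simp_all add: frame_def)
            show "runs (block [IAdd 32 32 4]) s3 (\<lambda>s2. ?I (Suc j) s2 \<and> ireg s2 20 = j \<and> ireg s2 0 = n \<and> ireg s2 3 = 1) 2"
              by (rule runs_block', simp add: steps_simps e) (use J in \<open>auto simp: frame_def less_Suc_eq\<close>)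
          qed
        qed
      qed (use I0 s in \<open>auto simp: frame_def iset_def\<close>)
      fix s1 assume I: "?I n s1"
      let ?E = "\<lambda>b s'. ?F s' \<and> ireg s' 11 = D \<and> ireg s' 12 = b * D \<and> (\<forall>j<n. \<forall>y<d * D. rarr s' 9 (j * N + y) = ?v j y)"
      show "runs (Seq (block [IConst 12 0]) (Seq (FOR 21 1 (block [IAdd 12 12 11])) (block [IAdd 11 12 36]))) s1 ?R (2 + ((d * (2 + 2) + 2) + 2))"
      proof (rule runs_Seq[where Q = "?E 0"])
        show "runs (block [IConst 12 0]) s1 (?E 0) 2"
          by (rule runs_block', simp add: steps_simps) (use I in \<open>auto simp: frame_def\<close>)
        fix s2 assume E0: "?E 0 s2"
        show "runs (Seq (FOR 21 1 (block [IAdd 12 12 11])) (block [IAdd 11 12 36])) s2 ?R ((d * (2 + 2) + 2) + 2)"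
        proof (rule runs_Seq)
          show "runs (FOR 21 1 (block [IAdd 12 12 11])) s2 (?E d) (d * (2 + 2) + 2)"
          proof (rule runs_FOR[where I = ?E and m = d and T = 2])
            fix b s3 assume E: "?E b s3" and q3: "ireg s3 21 = b" "ireg s3 1 = d" "ireg s3 3 = 1"
            show "runs (block [IAdd 12 12 11]) s3 (\<lambda>s2. ?E (Suc b) s2 \<and> ireg s2 21 = b \<and> ireg s2 1 = d \<and> ireg s2 3 = 1) 2"
              by (rule runs_block', simp add: steps_simps q3) (use E q3 in \<open>auto simp: frame_def\<close>)
          qed (use E0 s in \<open>auto simp: frame_def iset_def\<close>)
          fix s3 assume E: "?E d s3"
          have e: "ireg s3 36 = 0" using E s by (simp add: frame_def)
          show "runs (block [IAdd 11 12 36]) s3 ?R 2"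
            by (rule runs_block', simp add: steps_simps e) (use E in \<open>auto simp: frame_def\<close>)
        qed
      qed
    qed
  qed
  then show ?thesis
  proof (rule runs_conseq)
    have dK: "d * 1 \<le> K" using D(1) b(1) mult_le_mono2[of 1 D d] by linarith
    have K: "1 \<le> K" using dK b by linarith
    have nK: "1 * 1 \<le> n * K" "1 * d \<le> n * K" "n * 1 \<le> n * K" using n K dK by (intro mult_le_mono; simp)+
    have nd: "n * (d * D) \<le> n * K" "n * d \<le> n * K" using b dK by (intro mult_le_mono; simp)+
    have "d * ((3 + (D * (6 + 2) + 2)) + 2) = 8 * (d * D) + 7 * d" by (simp add: algebra_simps)
    then have eq: "n * ((2 + ((d * ((3 + (D * (6 + 2) + 2)) + 2) + 2) + 2)) + 2) = 8 * (n * (d * D)) + 7 * (n * d) + 8 * n"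
      by (simp add: algebra_simps)
    have "3 + ((8 * a + 7 * b + 8 * c + 2) + (2 + ((d * (2 + 2) + 2) + 2))) \<le> 45 * k"
      if "1 * 1 \<le> k" "1 * d \<le> k" "c * 1 \<le> k" "a \<le> k" "b \<le> k" for a b c k :: nat
      using that by simp
    from this[OF nK nd]
    show "3 + ((n * ((2 + ((d * ((3 + (D * (6 + 2) + 2)) + 2) + 2) + 2)) + 2) + 2) + (2 + ((d * (2 + 2) + 2) + 2))) \<le> 45 * n * K"
      unfolding eq mult.assoc[of 45] .
  qed auto
qed

lemma stride_other:
  assumes "a < N" "i < c" "c \<le> N" "c \<le> (a::nat)"
  shows "j * N + a \<noteq> j' * N + i"
proof
  assume eq: "j * N + a = j' * N + i"
  have "(j * N + a) mod N = a" "(j' * N + i) mod N = i" using assms by auto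
  then show False using eq assms by simp
qed

definition KLOOP :: prog where
  "KLOOP = FOR 23 10 (Seq KSTEP (TRANSFER 9 4 4 4 11))"

text \<open>Every round is charged for the final length \<open>d ^ q\<close>; the resulting factor
  \<open>q\<close> is shown to be harmless in \<open>base_le\<close>.\<close>

lemma runs_KLOOP:
  assumes s: "ireg s 0 = n" "ireg s 1 = d" "ireg s 3 = 1" "ireg s 4 = N" "ireg s 10 = q" "ireg s 11 = 1" "ireg s 36 = 0"
    and d: "1 \<le> d" "d ^ q \<le> N" and n: "1 \<le> n"
    and x: "\<And>j u. j < n \<Longrightarrow> u < d \<Longrightarrow> rarr s 0 (j * d + u) = x j u"
    and z: "\<And>j a. j < n \<Longrightarrow> a < N \<Longrightarrow> rarr s 4 (j * N + a) = of_bool (a = 0)"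
  shows "runs KLOOP s (\<lambda>s'. frame {11,12,20,21,22,23,32,33,34,37,38,39,40} {10,11} {} {4,9} s s' \<and> coins s' = coins s \<and>
     (\<forall>j<n. \<forall>a<N. rarr s' 4 (j * N + a) = tp d (x j) q a)) (66 * q * n * d ^ q + 2)"
proof -
  let ?I = "\<lambda>i s'. frame {11,12,20,21,22,23,32,33,34,37,38,39,40} {10,11} {} {4,9} s s' \<and> coins s' = coins s \<and> ireg s' 11 = d ^ i \<and>
     (\<forall>j<n. \<forall>a<N. rarr s' 4 (j * N + a) = tp d (x j) i a)"
  let ?K = "d ^ q"
  have K1: "1 \<le> ?K" using d by simp
  have "runs KLOOP s (?I q) (q * ((45 * n * ?K + 19 * n * ?K) + 2) + 2)"
    unfolding KLOOP_def
  proof (rule runs_FOR[where I = ?I and m = q and T = "45 * n * ?K + 19 * n * ?K"])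
    fix i s1 assume i: "i < q" and I: "?I i s1" and r: "ireg s1 23 = i" "ireg s1 10 = q" "ireg s1 3 = 1"
    have e: "ireg s1 0 = n" "ireg s1 1 = d" "ireg s1 4 = N" "ireg s1 36 = 0" "rarr s1 0 = rarr s 0" using I s by (simp_all add: frame_def)
    have dK: "d * d ^ i \<le> ?K" using power_increasing[of "Suc i" q d] i d by simp
    have dN: "d * d ^ i \<le> N" using dK d by linarith
    have di: "1 \<le> d ^ i" using d by simp
    show "runs (Seq KSTEP (TRANSFER 9 4 4 4 11)) s1 (\<lambda>s2. ?I (Suc i) s2 \<and> ireg s2 23 = i \<and> ireg s2 10 = q \<and> ireg s2 3 = 1) (45 * n * ?K + 19 * n * ?K)"
    proof (rule runs_Seq[OF runs_KSTEP[where n = n and d = d and N = N and D = "d ^ i" and K = ?K]])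
      fix s2 assume A: "frame {11,12,20,21,22,32,33,39,40} {10,11} {} {9} s1 s2 \<and> coins s2 = coins s1 \<and> ireg s2 11 = d * d ^ i \<and>
        (\<forall>j<n. \<forall>y<d * d ^ i. rarr s2 9 (j * N + y) = rarr s1 0 (j * d + y div d ^ i) * rarr s1 4 (j * N + y mod d ^ i))"
      show "runs (TRANSFER 9 4 4 4 11) s2 (\<lambda>s2. ?I (Suc i) s2 \<and> ireg s2 23 = i \<and> ireg s2 10 = q \<and> ireg s2 3 = 1) (19 * n * ?K)"
      proof (rule runs_conseq[OF runs_TRANSFER[where n = n and a = N and b = N and c = "d * d ^ i"]])
        fix s3 assume B: "frame {20,21,33,34,37,38} {10} {} {4} s2 s3 \<and> coins s3 = coins s2 \<and>
          (\<forall>j<n. \<forall>y<d * d ^ i. rarr s3 4 (j * N + y) = rarr s2 9 (j * N + y)) \<and>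
          (\<forall>y. (\<forall>j<n. \<forall>i'<d * d ^ i. y \<noteq> j * N + i') \<longrightarrow> rarr s3 4 y = rarr s2 4 y)"
        have "rarr s3 4 (j * N + a) = tp d (x j) (Suc i) a" if j: "j < n" and a: "a < N" for j a
        proof (cases "a < d * d ^ i")
          case True
          have 1: "a div d ^ i < d" using True by (simp add: less_mult_imp_div_less)
          have "a mod d ^ i < d ^ i" using di by (intro mod_less_divisor) linarith
          then have 2: "a mod d ^ i < N" using dN mult_le_mono1[OF d(1), of "d ^ i"] by linarith
          have "rarr s3 4 (j * N + a) = rarr s 0 (j * d + a div d ^ i) * rarr s1 4 (j * N + a mod d ^ i)"
            using A B True j e by simp
          also have "\<dots> = x j (a div d ^ i) * tp d (x j) i (a mod d ^ i)" using x[OF j 1] I j 2 by simp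
          finally show ?thesis using True by simp
        next
          case False
          have "\<forall>j'<n. \<forall>i'<d * d ^ i. j * N + a \<noteq> j' * N + i'"
            using stride_other[OF a _ dN] False by auto
          then have "rarr s3 4 (j * N + a) = rarr s2 4 (j * N + a)" using B by blast
          also have "\<dots> = tp d (x j) i a" using A I j a by (simp add: frame_def)
          also have "\<dots> = 0"
          proof (rule tp_0)
            show "d ^ i \<le> a" using False mult_le_mono1[OF d(1), of "d ^ i"] by linarith
          qed
          finally show ?thesis using False by simp
        qed
        moreover have "frame {11,12,20,21,22,23,32,33,34,37,38,39,40} {10,11} {} {4,9} s s3" using I A B by (auto simp: frame_def)
        moreover have "coins s3 = coins s" "ireg s3 11 = d ^ Suc i" "ireg s3 23 = i" "ireg s3 10 = q" "ireg s3 3 = 1"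
          using A B I r by (simp_all add: frame_def)
        ultimately show "?I (Suc i) s3 \<and> ireg s3 23 = i \<and> ireg s3 10 = q \<and> ireg s3 3 = 1" by blast
      next
        have 1: "n * (d * d ^ i) \<le> n * ?K" "n * 1 \<le> n * ?K" "1 * 1 \<le> n * ?K" using dK K1 n by (intro mult_le_mono; simp)+
        have 2: "n * (7 * (d * d ^ i) + 7) = 7 * (n * (d * d ^ i)) + 7 * n" by (simp add: algebra_simps)
        have "7 * a + 7 * b + 5 \<le> 19 * k" if "a \<le> k" "b * 1 \<le> k" "1 * 1 \<le> k" for a b k :: nat using that by simp
        from this[OF 1] show "n * (7 * (d * d ^ i) + 7) + 5 \<le> 19 * n * ?K" unfolding 2 mult.assoc[of 19] .
      qed (use A e r dN in \<open>auto simp: frame_def\<close>)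
    qed (use I e r di dN dK d n in \<open>auto simp: frame_def\<close>)
  next
    have 1: "q * 1 \<le> q * (n * ?K)" using K1 n mult_le_mono[of 1 n 1 ?K] by (intro mult_le_mono) auto
    have "q * (45 * n * ?K + 19 * n * ?K + 2) = 64 * (q * (n * ?K)) + 2 * q" by (simp add: algebra_simps)
    then show "q * (45 * n * ?K + 19 * n * ?K + 2) + 2 \<le> q * (45 * n * ?K + 19 * n * ?K + 2) + 2" by simp
  qed (use s z in \<open>auto simp: frame_def iset_def\<close>)
  then show ?thesis
  proof (rule runs_conseq)
    have 1: "q * 1 \<le> q * (n * ?K)" using K1 n mult_le_mono[of 1 n 1 ?K] by (intro mult_le_mono) auto
    have 2: "q * (45 * n * ?K + 19 * n * ?K + 2) = 64 * (q * (n * ?K)) + 2 * q" by (simp add: algebra_simps)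
    have "64 * a + 2 * b + 2 \<le> 66 * a + 2" if "b * 1 \<le> a" for a b :: nat using that by simp
    from this[OF 1] show "q * (45 * n * ?K + 19 * n * ?K + 2) + 2 \<le> 66 * q * n * ?K + 2" unfolding 2 by (simp only: mult.assoc)
  qed auto
qed

text \<open>Array 10 holds a single 1. Copying it with source stride 0 and count 1 puts
  \<open>e0\<close> into every column of a zero array.\<close>

definition DATA :: prog where
  "DATA = Seq (block [RStore 10 36 3]) (Seq (TRANSFER 0 1 2 4 1) (Seq (TRANSFER 10 36 3 4 3) (Seq (FOR 21 5 (block [RStore 5 21 2]))
     (Seq (TRANSFER 10 36 4 4 3) (Seq (block [IConst 11 1]) KLOOP)))))"

lemma runs_DATA:
  assumes s: "ireg s 0 = n" "ireg s 1 = d" "ireg s 3 = 1" "ireg s 4 = N" "ireg s 5 = M" "ireg s 10 = q" "ireg s 36 = 0" "rreg s 3 = 1" "rreg s 2 = sc"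
    and z: "rarr s 2 = (\<lambda>_. 0)" "rarr s 3 = (\<lambda>_. 0)" "rarr s 4 = (\<lambda>_. 0)"
    and d: "1 \<le> d" "d ^ q \<le> N" "d \<le> N" and n: "1 \<le> n"
    and x: "\<And>j u. j < n \<Longrightarrow> u < d \<Longrightarrow> rarr s 0 (j * d + u) = x j u" "\<And>j u. d \<le> u \<Longrightarrow> x j u = 0"
  shows "runs DATA s (\<lambda>s'. frame {11,12,20,21,22,23,32,33,34,37,38,39,40} {10,11} {} {2,3,4,5,9,10} s s' \<and> coins s' = coins s \<and>
     (\<forall>j<n. \<forall>a<N. rarr s' 2 (j * N + a) = x j a) \<and> (\<forall>j<n. \<forall>a<N. rarr s' 3 (j * N + a) = e0 a) \<and> (\<forall>i<M. rarr s' 5 i = sc) \<and>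
     (\<forall>j<n. \<forall>a<N. rarr s' 4 (j * N + a) = tp d (x j) q a)) (7 * n * d + 35 * n + 4 * M + 66 * q * n * d ^ q + 40)"
proof -
  have N: "1 \<le> N" using d by linarith
  let ?A = "{11,12,20,21,22,23,32,33,34,37,38,39,40}" and ?B = "{10,11}" and ?D = "{2,3,4,5,9,10}"
  let ?F = "\<lambda>s'. frame ?A ?B {} ?D s s' \<and> coins s' = coins s"
  let ?X = "\<lambda>s'. \<forall>j<n. \<forall>a<N. rarr s' 2 (j * N + a) = x j a"
  let ?E = "\<lambda>s'. \<forall>j<n. \<forall>a<N. rarr s' 3 (j * N + a) = e0 a"
  let ?S = "\<lambda>s'. \<forall>i<M. rarr s' 5 i = sc"
  let ?Q = "\<lambda>s'. frame ?A ?B {} ?D s s' \<and> coins s' = coins s \<and> ?X s' \<and> ?E s' \<and> ?S s' \<and> (\<forall>j<n. \<forall>a<N. rarr s' 4 (j * N + a) = tp d (x j) q a)"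
  have unit: "rarr s'' t (j * N + a) = of_bool (a = 0)"
    if "\<forall>j<n. \<forall>i<1. rarr s'' t (j * N + i) = rarr s' 10 (j * 0 + i)" "\<forall>y. (\<forall>j<n. \<forall>i<1. y \<noteq> j * N + i) \<longrightarrow> rarr s'' t y = rarr s' t y"
      "rarr s' 10 0 = 1" "rarr s' t = (\<lambda>_. 0)" "j < n" "a < N" for s' s'' :: state and t j a
  proof (cases "a = 0")
    case False
    have "\<forall>j'<n. \<forall>i'<1. j * N + a \<noteq> j' * N + i'"
      using stride_other[OF that(6) _ N] False by auto
    then show ?thesis using that(2,4) False by simp
  qed (use that in simp)
  have "runs DATA s ?Q (2 + ((n * (7 * d + 7) + 5) + ((n * (7 * 1 + 7) + 5) + ((M * (2 + 2) + 2) + ((n * (7 * 1 + 7) + 5) + (2 + (66 * q * n * d ^ q + 2)))))))"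
    unfolding DATA_def
  proof (rule runs_Seq[where Q = "\<lambda>s'. ?F s' \<and> rarr s' 10 0 = 1 \<and> rarr s' 2 = (\<lambda>_. 0) \<and> rarr s' 3 = (\<lambda>_. 0) \<and> rarr s' 4 = (\<lambda>_. 0)"])
    show "runs (block [RStore 10 36 3]) s (\<lambda>s'. ?F s' \<and> rarr s' 10 0 = 1 \<and> rarr s' 2 = (\<lambda>_. 0) \<and> rarr s' 3 = (\<lambda>_. 0) \<and> rarr s' 4 = (\<lambda>_. 0)) 2"
      by (rule runs_block', simp add: steps_simps s z) (auto simp: frame_def)
    fix s1 assume 1: "?F s1 \<and> rarr s1 10 0 = 1 \<and> rarr s1 2 = (\<lambda>_. 0) \<and> rarr s1 3 = (\<lambda>_. 0) \<and> rarr s1 4 = (\<lambda>_. 0)"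
    show "runs (Seq (TRANSFER 0 1 2 4 1) (Seq (TRANSFER 10 36 3 4 3) (Seq (FOR 21 5 (block [RStore 5 21 2]))
     (Seq (TRANSFER 10 36 4 4 3) (Seq (block [IConst 11 1]) KLOOP))))) s1 ?Q ((n * (7 * d + 7) + 5) + ((n * (7 * 1 + 7) + 5) + ((M * (2 + 2) + 2) + ((n * (7 * 1 + 7) + 5) + (2 + (66 * q * n * d ^ q + 2))))))"
    proof (rule runs_Seq[OF runs_TRANSFER[where n = n and a = d and b = N and c = d]])
      fix s2 assume A: "frame {20,21,33,34,37,38} {10} {} {2} s1 s2 \<and> coins s2 = coins s1 \<and>
          (\<forall>j<n. \<forall>i<d. rarr s2 2 (j * N + i) = rarr s1 0 (j * d + i)) \<and>
          (\<forall>y. (\<forall>j<n. \<forall>i<d. y \<noteq> j * N + i) \<longrightarrow> rarr s2 2 y = rarr s1 2 y)"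
      have F2: "?F s2" "rarr s2 10 0 = 1" "rarr s2 3 = (\<lambda>_. 0)" "rarr s2 4 = (\<lambda>_. 0)" using 1 A by (auto simp: frame_def)
      have "rarr s2 2 (j * N + a) = x j a" if "j < n" "a < N" for j a
      proof (cases "a < d")
        case True
        have "rarr s1 0 = rarr s 0" using 1 by (simp add: frame_def)
        then show ?thesis using A True that x by simp
      next
        case False
        have "\<forall>j'<n. \<forall>i'<d. j * N + a \<noteq> j' * N + i'" using stride_other[OF that(2) _ d(3)] False by auto
        then have "rarr s2 2 (j * N + a) = 0" using A 1 by simp
        then show ?thesis using x(2) False by simp
      qed
      then have X2: "?X s2" by blast
      show "runs (Seq (TRANSFER 10 36 3 4 3) (Seq (FOR 21 5 (block [RStore 5 21 2]))
       (Seq (TRANSFER 10 36 4 4 3) (Seq (block [IConst 11 1]) KLOOP)))) s2 ?Q ((n * (7 * 1 + 7) + 5) + ((M * (2 + 2) + 2) + ((n * (7 * 1 + 7) + 5) + (2 + (66 * q * n * d ^ q + 2)))))"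
      proof (rule runs_Seq[OF runs_TRANSFER[where n = n and a = 0 and b = N and c = 1]])
        fix s3 assume B: "frame {20,21,33,34,37,38} {10} {} {3} s2 s3 \<and> coins s3 = coins s2 \<and>
          (\<forall>j<n. \<forall>i<1. rarr s3 3 (j * N + i) = rarr s2 10 (j * 0 + i)) \<and>
          (\<forall>y. (\<forall>j<n. \<forall>i<1. y \<noteq> j * N + i) \<longrightarrow> rarr s3 3 y = rarr s2 3 y)"
        have F3: "?F s3" "rarr s3 10 0 = 1" "rarr s3 4 = (\<lambda>_. 0)" "?X s3" using F2 X2 B by (auto simp: frame_def)
        have E3: "?E s3" using B F2 unit[of s3 3 s2] by (auto simp: e0_def)
        have r3: "ireg s3 5 = M" "ireg s3 3 = 1" using F3 s by (simp_all add: frame_def)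
        let ?I = "\<lambda>i s'. ?F s' \<and> rarr s' 10 0 = 1 \<and> rarr s' 4 = (\<lambda>_. 0) \<and> ?X s' \<and> ?E s' \<and> (\<forall>i'<i. rarr s' 5 i' = sc)"
        show "runs (Seq (FOR 21 5 (block [RStore 5 21 2])) (Seq (TRANSFER 10 36 4 4 3) (Seq (block [IConst 11 1]) KLOOP))) s3 ?Q ((M * (2 + 2) + 2) + ((n * (7 * 1 + 7) + 5) + (2 + (66 * q * n * d ^ q + 2))))"
        proof (rule runs_Seq)
          show "runs (FOR 21 5 (block [RStore 5 21 2])) s3 (?I M) (M * (2 + 2) + 2)"
          proof (rule runs_FOR[where I = ?I and m = M and T = 2])
            fix i s4 assume I: "?I i s4" and q4: "ireg s4 21 = i" "ireg s4 5 = M" "ireg s4 3 = 1"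
            have e: "rreg s4 2 = sc" using I s by (simp add: frame_def)
            show "runs (block [RStore 5 21 2]) s4 (\<lambda>s2. ?I (Suc i) s2 \<and> ireg s2 21 = i \<and> ireg s2 5 = M \<and> ireg s2 3 = 1) 2"
              by (rule runs_block', simp add: steps_simps q4 e) (use I q4 in \<open>auto simp: frame_def less_Suc_eq\<close>)
          qed (use F3 E3 r3 in \<open>auto simp: frame_def iset_def\<close>)
          fix s4 assume I: "?I M s4"
          have r4: "ireg s4 0 = n" "ireg s4 3 = 1" "ireg s4 4 = N" "ireg s4 36 = 0" using I s by (simp_all add: frame_def)
          show "runs (Seq (TRANSFER 10 36 4 4 3) (Seq (block [IConst 11 1]) KLOOP)) s4 ?Q ((n * (7 * 1 + 7) + 5) + (2 + (66 * q * n * d ^ q + 2)))"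
          proof (rule runs_Seq[OF runs_TRANSFER[where n = n and a = 0 and b = N and c = 1]])
            fix s5 assume C: "frame {20,21,33,34,37,38} {10} {} {4} s4 s5 \<and> coins s5 = coins s4 \<and>
              (\<forall>j<n. \<forall>i<1. rarr s5 4 (j * N + i) = rarr s4 10 (j * 0 + i)) \<and>
              (\<forall>y. (\<forall>j<n. \<forall>i<1. y \<noteq> j * N + i) \<longrightarrow> rarr s5 4 y = rarr s4 4 y)"
            have F5: "?F s5" "?X s5" "?E s5" "?S s5" using I C by (auto simp: frame_def)
            have U5: "rarr s5 4 (j * N + a) = of_bool (a = 0)" if "j < n" "a < N" for j a
              using C I that unit[of s5 4 s4] by auto
            let ?s6 = "iset 11 1 s5"
            show "runs (Seq (block [IConst 11 1]) KLOOP) s5 ?Q (2 + (66 * q * n * d ^ q + 2))"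
            proof (rule runs_Seq[where Q = "\<lambda>s'. s' = ?s6"])
              show "runs (block [IConst 11 1]) s5 (\<lambda>s'. s' = ?s6) 2" by (rule runs_block) auto
              fix s6 assume s6: "s6 = ?s6"
              have F6: "?F s6" "?X s6" "?E s6" "?S s6" "ireg s6 11 = 1" using F5 s6 by (auto simp: frame_def iset_def)
              have r6: "ireg s6 0 = n" "ireg s6 1 = d" "ireg s6 3 = 1" "ireg s6 4 = N" "ireg s6 10 = q" "ireg s6 36 = 0" "rarr s6 0 = rarr s 0"
                using F6 s by (simp_all add: frame_def)
              show "runs KLOOP s6 ?Q (66 * q * n * d ^ q + 2)"
              proof (rule runs_conseq[OF runs_KLOOP[where x = x and N = N and d = d and n = n and q = q]])
                fix s7 assume Dd: "frame {11,12,20,21,22,23,32,33,34,37,38,39,40} {10,11} {} {4,9} s6 s7 \<and> coins s7 = coins s6 \<and>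
                  (\<forall>j<n. \<forall>a<N. rarr s7 4 (j * N + a) = tp d (x j) q a)"
                show "?Q s7" using Dd F6 by (auto simp: frame_def)
              qed (use r6 F6 d n x U5 s6 in \<open>auto simp: iset_def\<close>)
            qed
          qed (use r4 N in auto)
        qed
      qed (use F2 s N in \<open>auto simp: frame_def\<close>)
    qed (use 1 s d in \<open>auto simp: frame_def\<close>)
  qed
  then show ?thesis by (rule runs_conseq) (auto simp: algebra_simps)
qed

section \<open>The complete program and its parameters\<close>

definition PROG :: prog where
  "PROG = Seq CONSTS (Seq LEVELS (Seq SIZES (Seq DATA MAIN)))"

context
  fixes n d p :: nat and \<epsilon> \<delta> :: real
begin

definition qk :: nat where "qk = kk n d \<epsilon> \<delta>"
definition ql :: nat where "ql = ll d p"
definition qq :: nat where "qq = p div 2 ^ ql"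
definition qt :: nat where "qt = lg4 0 (tbase qk n \<epsilon> * 4 ^ ql)"
definition qt2 :: nat where "qt2 = lg4 qt (tbase qk n \<epsilon> * (2 * real p)\<^sup>2)"
definition qe :: nat where "qe = lg2 qt d"
text \<open>One transform length \<open>2 ^ qL\<close>, at least the number of samples and at least
  \<open>d\<close>, serves all levels, the data and the bottom tensor power alike.\<close>

definition qL :: nat where "qL = 2 * qt + qe"
definition qM :: nat where "qM = 4 ^ qt"
text \<open>The number of output rows, including zero rows. The samples number about
  \<open>tbase * 4 ^ ql\<close>, which can be much less than the order
  \<open>n p^2 / \<epsilon>^2\<close> required from below; \<open>(2 * p)\<^sup>2\<close> takes the
  place of \<open>4 ^ ql\<close>.\<close>

definition qm :: nat where "qm = 4 ^ (qt + qt2)"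
definition qsc :: real where "qsc = 1 / 2 ^ qt"
definition qbits :: "bool list" where "qbits = machine.bits (\<lambda>j. odd (p div 2 ^ j)) ql"

definition qT :: nat where
  "qT = (4 * n + 4 * d + 4 * p + 4 * qk + 30) + ((ql * (9 * p + 16) + 7) + ((10 * qt + 6 * qt2 + 5 * qe + 30) +
     ((7 * n * d + 35 * n + 4 * qM + 66 * qq * n * d ^ qq + 40) + (ql * (280 * n * qL * 2 ^ qL + 1) + (n * (7 * qM + 7) + 8)))))"

definition colf :: "real mat \<Rightarrow> nat \<Rightarrow> nat \<Rightarrow> real" where
  "colf X j a = (if a < d then index_mat X (a, j) else 0)"

lemma ql_props: "1 \<le> ql" "d ^ qq \<le> 4 ^ ql"
  using LeastI_ex[OF stopl_ex, of d p] unfolding ql_def ll_def qq_def stopl_def by auto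

context
  assumes pos: "0 < n" "0 < d" "0 < \<epsilon>" "\<epsilon> < 1" "0 < \<delta>" "\<delta> < 1"
begin

lemma qk_prop: "real n * real d \<le> 2 ^ qk * (\<epsilon> * \<delta>)"
  unfolding qk_def kk_def using pos by (intro LeastI_ex[OF kk_ex]) simp

lemma qk_pos: "1 \<le> qk"
proof (rule ccontr)
  assume "\<not> 1 \<le> qk"
  then have "qk = 0" by simp
  then have "real n * real d \<le> \<epsilon> * \<delta>" using qk_prop by simp
  also have "\<epsilon> * \<delta> < 1 * 1" using pos by (intro mult_strict_mono) auto
  also have "1 * 1 \<le> real n * real d" using pos by (intro mult_mono) auto
  finally show False by simp
qed

lemma tbase_ge: "2 ^ 46 \<le> tbase qk n \<epsilon>"
proof -
  have "\<epsilon> * \<epsilon> \<le> 1 * 1" using pos by (intro mult_mono) auto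
  moreover have "1 * 1 \<le> real qk ^ 4 * real n" using qk_pos pos by (intro mult_mono) auto
  ultimately have "2 ^ 46 * 1 / 1 \<le> 2 ^ 46 * (real qk ^ 4 * real n) / (\<epsilon> * \<epsilon>)" using pos by (intro frac_le mult_mono) auto
  then show ?thesis by (simp add: tbase_def mult.assoc)
qed

lemma qM_ge: "tbase qk n \<epsilon> * 4 ^ ql \<le> real qM"
  using LeastI_ex[OF lg4_ex[of "tbase qk n \<epsilon> * 4 ^ ql" 0]] by (simp add: qM_def qt_def lg4_def)

lemma pow_ql_le_qM: "4 ^ ql \<le> qM"
proof -
  have "1 * 4 ^ ql \<le> tbase qk n \<epsilon> * 4 ^ ql" using tbase_ge by (intro mult_right_mono) auto
  then have "4 ^ ql \<le> real qM" using qM_ge by linarith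
  then have "real (4 ^ ql) \<le> real qM" by simp
  then show ?thesis by (simp only: of_nat_le_iff)
qed

lemma qL_props: "1 \<le> qL" "qM \<le> 2 ^ qL" "d \<le> 2 ^ qL" "d ^ qq \<le> qM"
proof -
  show "d ^ qq \<le> qM" using ql_props pow_ql_le_qM by linarith
  show "d \<le> 2 ^ qL" using LeastI_ex[OF lg2_ex[of d qt]] by (simp add: qL_def qe_def lg2_def)
  have "(4::nat) ^ qt = 2 ^ (2 * qt)" by (simp add: power_mult)
  also have "\<dots> \<le> 2 ^ qL" unfolding qL_def by (rule power_increasing) auto
  finally show "qM \<le> 2 ^ qL" by (simp add: qM_def)
  have "(4::nat) ^ 1 \<le> 4 ^ ql" using ql_props(1) by (intro power_increasing) auto
  then have "4 \<le> qM" using pow_ql_le_qM by simp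
  then have "qt \<noteq> 0" by (auto simp: qM_def intro: ccontr)
  then show "1 \<le> qL" by (simp add: qL_def)
qed

lemma runs_PROG:
  assumes w: "length w = 3 * flen qL qM * ql"
  shows "runs PROG (input_state n d p \<epsilon> \<delta> X w) (\<lambda>s'. ireg s' 0 = qm \<and> (\<forall>j<n. \<forall>i<qm. rarr s' 1 (j * qm + i) =
      sk qL qM qsc qbits w (colf X j) (tp d (colf X j) qq) i)) qT"
proof -
  interpret mc: machine n qL qM ql qm qsc "colf X" "\<lambda>j. odd (p div 2 ^ j)"
    by unfold_locales (use pos qL_props in auto)
  let ?s = "input_state n d p \<epsilon> \<delta> X w"
  let ?Q = "\<lambda>s'. ireg s' 0 = qm \<and> (\<forall>j<n. \<forall>i<qm. rarr s' 1 (j * qm + i) = sk qL qM qsc qbits w (colf X j) (tp d (colf X j) qq) i)"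
  have s: "ireg ?s 0 = n" "ireg ?s 1 = d" "ireg ?s 2 = p" "rreg ?s 0 = \<epsilon>" "rreg ?s 1 = \<delta>" "coins ?s = w"
    "\<And>r. r \<noteq> 0 \<Longrightarrow> rarr ?s r = (\<lambda>_. 0)"
    by (auto simp: input_state_def)
  have x: "rarr ?s 0 (j * d + u) = colf X j u" if "j < n" "u < d" for j u
  proof -
    have "Suc j * d \<le> n * d" using that by (intro mult_le_mono1) simp
    then have "j * d + u < n * d" using that by simp
    then show ?thesis using that by (simp add: input_state_def colf_def)
  qed
  show ?thesis
    unfolding PROG_def qT_def
  proof (rule runs_Seq[OF runs_CONSTS[OF s(1-5) pos(3,5), folded qk_def]])
    fix s1 assume A: "frame {3,20,36} {3,12,13,14,15,16,20} {} {} ?s s1 \<and> coins s1 = coins ?s \<and> ireg s1 3 = 1 \<and> ireg s1 36 = 0 \<and> rreg s1 3 = 1 \<and>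
     rreg s1 13 = n \<and> rreg s1 14 = d \<and> rreg s1 20 = p \<and> rreg s1 16 = qk"
    have a2: "ireg s1 2 = p" "ireg s1 3 = 1" "ireg s1 36 = 0" "rreg s1 14 = real d" using A s by (simp_all add: frame_def)
    show "runs (Seq LEVELS (Seq SIZES (Seq DATA MAIN))) s1 ?Q ((ql * (9 * p + 16) + 7) + ((10 * qt + 6 * qt2 + 5 * qe + 30) +
     ((7 * n * d + 35 * n + 4 * qM + 66 * qq * n * d ^ qq + 40) + (ql * (280 * n * qL * 2 ^ qL + 1) + (n * (7 * qM + 7) + 8)))))"
    proof (rule runs_Seq[OF runs_LEVELS[OF a2, folded ql_def, folded qq_def]])
      fix s2 assume B: "frame {7,10,20,23,24,25,26} {17,18,19} {0} {} s1 s2 \<and> coins s2 = coins s1 \<and> ireg s2 7 = ql \<and>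
        ireg s2 10 = qq \<and> rreg s2 18 = 4 ^ ql \<and> (\<forall>j<ql. iarr s2 0 j = of_bool (odd (p div 2 ^ j)))"
      have b: "ireg s2 1 = d" "ireg s2 3 = 1" "ireg s2 36 = 0" "rreg s2 0 = \<epsilon>" "rreg s2 3 = 1" "rreg s2 13 = real n" "rreg s2 16 = real qk"
        "rreg s2 18 = 4 ^ ql" "rreg s2 20 = real p"
        using A B s unfolding frame_def by simp_all
      have "1 * 1 < tbase qk n \<epsilon> * 4 ^ ql" using tbase_ge by (intro mult_less_le_imp_less) auto
      then have t1: "1 < tbase qk n \<epsilon> * 4 ^ ql" by simp
      show "runs (Seq SIZES (Seq DATA MAIN)) s2 ?Q ((10 * qt + 6 * qt2 + 5 * qe + 30) +
        ((7 * n * d + 35 * n + 4 * qM + 66 * qq * n * d ^ qq + 40) + (ql * (280 * n * qL * 2 ^ qL + 1) + (n * (7 * qM + 7) + 8))))"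
      proof (rule runs_Seq[OF runs_SIZES[OF b t1 qt_def qt2_def qe_def, folded qL_def qM_def qm_def qsc_def]])
        fix s3 assume C: "frame {4,5,6,8,9} {2,21,22,23,24,25} {} {} s2 s3 \<and> coins s3 = coins s2 \<and> ireg s3 5 = qM \<and> ireg s3 6 = qL \<and>
          ireg s3 4 = 2 ^ qL \<and> ireg s3 9 = 2 ^ (qL - 1) \<and> ireg s3 8 = qm \<and> rreg s3 2 = qsc"
        have i3: "ireg s3 r = ireg s2 r" if "r \<notin> {4,5,6,8,9}" for r using C that by (simp add: frame_def)
        have r3: "rreg s3 r = rreg s2 r" if "r \<notin> {2,21,22,23,24,25}" for r using C that by (simp add: frame_def)
        have i2: "ireg s2 0 = n"
        proof -
          have "ireg s2 0 = ireg s1 0" using B by (simp add: frame_def)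
          also have "\<dots> = ireg ?s 0" using A by (simp add: frame_def)
          finally show ?thesis using s by simp
        qed
        have c: "ireg s3 0 = n" "ireg s3 1 = d" "ireg s3 3 = 1" "ireg s3 4 = 2 ^ qL" "ireg s3 5 = qM" "ireg s3 10 = qq" "ireg s3 36 = 0" "rreg s3 3 = 1" "rreg s3 2 = qsc"
          "ireg s3 7 = ql" "ireg s3 6 = qL" "ireg s3 8 = qm" "ireg s3 9 = 2 ^ (qL - 1)"
          using i3[of 0] i3[of 1] i3[of 3] i3[of 10] i3[of 36] i3[of 7] r3[of 3] b i2 B C by simp_all
        have ar: "rarr s3 r = rarr ?s r" "iarr s3 0 = iarr s2 0" for r using A B C by (simp_all add: frame_def)
        have dN: "d ^ qq \<le> 2 ^ qL" using qL_props by linarith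
        have x3: "rarr s3 0 (j * d + u) = colf X j u" if "j < n" "u < d" for j u using x[OF that] ar(1)[of 0] by simp
        have z3: "rarr s3 2 = (\<lambda>_. 0)" "rarr s3 3 = (\<lambda>_. 0)" "rarr s3 4 = (\<lambda>_. 0)"
          using ar(1) s(7) by simp_all
        have d1: "1 \<le> d" "1 \<le> n" using pos by simp_all
        have x0: "colf X j u = 0" if "d \<le> u" for j u using that by (simp add: colf_def)
        show "runs (Seq DATA MAIN) s3 ?Q ((7 * n * d + 35 * n + 4 * qM + 66 * qq * n * d ^ qq + 40) + (ql * (280 * n * qL * 2 ^ qL + 1) + (n * (7 * qM + 7) + 8)))"
        proof (rule runs_Seq[OF runs_DATA[OF c(1-9) z3 d1(1) dN qL_props(3) d1(2) x3 x0]])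
          fix s4 assume D: "frame {11,12,20,21,22,23,32,33,34,37,38,39,40} {10,11} {} {2,3,4,5,9,10} s3 s4 \<and> coins s4 = coins s3 \<and>
            (\<forall>j<n. \<forall>a<2 ^ qL. rarr s4 2 (j * 2 ^ qL + a) = colf X j a) \<and> (\<forall>j<n. \<forall>a<2 ^ qL. rarr s4 3 (j * 2 ^ qL + a) = e0 a) \<and> (\<forall>i<qM. rarr s4 5 i = qsc) \<and>
            (\<forall>j<n. \<forall>a<2 ^ qL. rarr s4 4 (j * 2 ^ qL + a) = tp d (colf X j) qq a)"
          have i4: "ireg s4 r = ireg s3 r" if "r \<notin> {11,12,20,21,22,23,32,33,34,37,38,39,40}" for r using D that by (simp add: frame_def)
          have r4: "ireg s4 0 = n" "ireg s4 3 = 1" "ireg s4 4 = 2 ^ qL" "ireg s4 5 = qM" "ireg s4 6 = qL" "ireg s4 8 = qm" "ireg s4 9 = 2 ^ (qL - 1)" "ireg s4 36 = 0"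
            "ireg s4 7 = ql"
            using c i4[of 0] i4[of 3] i4[of 4] i4[of 5] i4[of 6] i4[of 8] i4[of 9] i4[of 36] i4[of 7] by simp_all
          have r4': "rarr s4 1 = (\<lambda>_. 0)"
          proof -
            have "rarr s4 1 = rarr s3 1" using D by (simp add: frame_def)
            then show ?thesis using ar(1)[of 1] s(7)[of 1] by simp
          qed
          have r4'': "iarr s4 0 = iarr s2 0" using D ar(2) by (simp add: frame_def)
          have bt: "\<forall>j<ql. iarr s4 0 j = of_bool (odd (p div 2 ^ j))" using B r4'' by metis
          have st: "mc.stat s4" unfolding mc.stat_def using r4 r4' bt D by blast
          have zr: "mc.Zrep (\<lambda>j. tp d (colf X j) qq) s4" unfolding mc.Zrep_def using D by blast
          have cs: "coins s4 = w" using A B C D s by simp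
          have mm: "qM \<le> qm" unfolding qM_def qm_def by (rule power_increasing) auto
          show "runs MAIN s4 ?Q (ql * (280 * n * qL * 2 ^ qL + 1) + (n * (7 * qM + 7) + 8))"
            using mc.runs_MAIN[OF st zr r4(9), unfolded cs, OF w _ mm] tp_0 qL_props(4)
            unfolding qbits_def by (meson order_trans)
        qed (use c ar s(7) pos qL_props dN x in \<open>auto simp: colf_def\<close>)
      qed
    qed
  qed
qed

end

end

subsection \<open>Choice of the parameters\<close>

text \<open>The quotient of \<open>(1 + j) ^ 4\<close> by \<open>(9 / 4) ^ j\<close> is largest at
  \<open>j = 4\<close>, just below 25; from there on the left side grows by at most
  \<open>(6 / 5) ^ 4 < 9 / 4\<close> per step.\<close>

lemma pow4_le_geometric: "(1 + real j) ^ 4 \<le> 25 * (9 / 4) ^ j"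
proof -
  have big: "(1 + real (j + 4)) ^ 4 \<le> 25 * (9 / 4) ^ (j + 4)" for j
  proof (induction j)
    case (Suc j)
    have "1 + real (Suc j + 4) \<le> 6 / 5 * (1 + real (j + 4))" by simp
    then have "(1 + real (Suc j + 4)) ^ 4 \<le> (6 / 5 * (1 + real (j + 4))) ^ 4" by (intro power_mono) auto
    also have "\<dots> = (6 / 5) ^ 4 * (1 + real (j + 4)) ^ 4" by (simp only: power_mult_distrib)
    also have "\<dots> \<le> 9 / 4 * (25 * (9 / 4) ^ (j + 4))" using Suc by (intro mult_mono) (auto simp: power4_eq_xxxx)
    finally show ?case by (simp only: add_Suc power_Suc mult_ac)
  qed (simp add: power4_eq_xxxx)
  consider "j = 0" | "j = 1" | "j = 2" | "j = 3" | "j = (j - 4) + 4" by linarith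
  then show ?thesis
  proof cases
    case 5
    then show ?thesis using big[of "j - 4"] by simp
  qed (simp_all add: power4_eq_xxxx power2_eq_square power3_eq_cube)
qed

text \<open>The bound by \<open>(3 / 4) ^ l\<close> is what defeats the union bound in
  \<open>T1\<close>; the last identity feeds the sample size estimate \<open>T3\<close>.\<close>

lemma eta_bounds:
  assumes "0 < \<epsilon>" "\<epsilon> < 1" "r < l"
  shows "0 < eta \<epsilon> l r" "eta \<epsilon> l r \<le> (3 / 4) ^ l" "eta \<epsilon> l r \<le> 1"
    "(eta \<epsilon> l r)\<^sup>2 * 4 ^ l = \<epsilon>\<^sup>2 / 36 * (9 / 4) ^ (l - r)"
proof -
  show "0 < eta \<epsilon> l r" using assms by (simp add: eta_def)
  have lr: "(3 / 4 :: real) ^ l = (3 / 4) ^ (l - r) * (3 / 4) ^ r" using assms by (simp flip: power_add)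
  have "eta \<epsilon> l r = (\<epsilon> / 6) * ((3 / 4) ^ (l - r) * (1 / 2) ^ r)" by (simp add: eta_def power_one_over)
  also have "\<dots> \<le> 1 * ((3 / 4) ^ (l - r) * (3 / 4) ^ r)"
    using assms by (intro mult_mono power_mono) auto
  finally show "eta \<epsilon> l r \<le> (3 / 4) ^ l" unfolding lr by simp
  moreover have "(3 / 4 :: real) ^ l \<le> 1" by (simp add: power_le_one)
  ultimately show "eta \<epsilon> l r \<le> 1" by linarith
  have "(4::real) ^ l = 4 ^ (l - r) * 4 ^ r" using assms by (simp flip: power_add)
  moreover have "((2::real) ^ r)\<^sup>2 = 4 ^ r" "((3 / 4 :: real) ^ (l - r))\<^sup>2 = (9 / 16) ^ (l - r)"
    unfolding power2_eq_square power_mult_distrib[symmetric] by simp_all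
  moreover have "(9 / 16 :: real) ^ (l - r) * 4 ^ (l - r) = (9 / 4) ^ (l - r)" unfolding power_mult_distrib[symmetric] by simp
  ultimately show "(eta \<epsilon> l r)\<^sup>2 * 4 ^ l = \<epsilon>\<^sup>2 / 36 * (9 / 4) ^ (l - r)"
  proof -
    have "(\<epsilon> / 6 * x / y)\<^sup>2 * (u * y\<^sup>2) = \<epsilon>\<^sup>2 / 36 * (x\<^sup>2 * u)" if "y \<noteq> 0" for x y u :: real
      using that by (simp add: power_mult_distrib power_divide)
    from this[of "2 ^ r" "(3 / 4) ^ (l - r)" "4 ^ (l - r)"] show ?thesis
      if "(4::real) ^ l = 4 ^ (l - r) * 4 ^ r" "((2::real) ^ r)\<^sup>2 = 4 ^ r" "((3 / 4 :: real) ^ (l - r))\<^sup>2 = (9 / 16) ^ (l - r)"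
        "(9 / 16 :: real) ^ (l - r) * 4 ^ (l - r) = (9 / 4) ^ (l - r)"
      unfolding that eta_def by simp
  qed
qed

lemma exp_neg_le_pow: "exp (- real x) \<le> 1 / 2 ^ x"
proof -
  have "2 \<le> exp (1::real)" using exp_ge_add_one_self[of 1] by simp
  then have "2 ^ x \<le> exp (1::real) ^ x" by (intro power_mono) auto
  also have "\<dots> = exp (real x)" by (simp flip: exp_of_nat_mult)
  finally show ?thesis by (simp add: exp_minus inverse_eq_divide frac_le)
qed

locale level_params =
  fixes n d k l L M r :: nat and \<epsilon> \<delta> :: real
  assumes \<epsilon>: "0 < \<epsilon>" "\<epsilon> < 1" and \<delta>: "0 < \<delta>" and k: "1 \<le> k" and n1: "1 \<le> n"
    and n: "real n \<le> 2 ^ k" and d: "real d \<le> 2 ^ k" and ek: "1 \<le> 2 ^ k * \<epsilon>" and dk: "1 \<le> 2 ^ k * \<delta>"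
    and M: "tbase k n \<epsilon> * 4 ^ l \<le> real M" "real M \<le> 4 * (tbase k n \<epsilon> * 4 ^ l)"
    and L: "2 ^ L \<le> 2 * max M d" and r: "r < l"
begin

abbreviation "j \<equiv> l - r"
text \<open>\<open>1 / 2 ^ \<kappa>\<close> is within the failure probability allowed at this level
  (\<open>target\<close>), so moments of order proportional to \<kappa> suffice.\<close>

abbreviation "\<kappa> \<equiv> k + j"
abbreviation "a \<equiv> 16 * \<kappa>"
definition "s = (2 * real (a + 2)) ^ 3"
definition "\<tau> = 2 ^ 13 * s * real n"
definition "B = 4 * \<tau> / eta \<epsilon> l r"

lemma s_pos: "1 \<le> s" "0 < \<tau>" "1 \<le> \<tau>"
proof -
  show 1: "1 \<le> s" unfolding s_def by (rule one_le_power) simp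
  have "1 * 1 * 1 \<le> (2::real) ^ 13 * s * real n" using 1 n1 by (intro mult_mono) auto
  then show "1 \<le> \<tau>" by (simp add: \<tau>_def)
  then show "0 < \<tau>" by simp
qed

lemma dfact_s: "dfact (a + 2) ^ 3 \<le> s ^ (a + 2)" "dfact a ^ 3 \<le> s ^ a"
proof -
  have "dfact (a + 2) ^ 3 \<le> ((2 * real (a + 2)) ^ (a + 2)) ^ 3" by (intro power_mono dfact_le) auto
  then show "dfact (a + 2) ^ 3 \<le> s ^ (a + 2)" unfolding s_def by (simp only: power_mult[symmetric] mult.commute)
  have "dfact a ^ 3 \<le> ((2 * real a) ^ a) ^ 3" by (intro power_mono dfact_le) auto
  also have "\<dots> = ((2 * real a) ^ 3) ^ a" by (simp only: power_mult[symmetric] mult.commute)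
  also have "\<dots> \<le> s ^ a" unfolding s_def by (intro power_mono) auto
  finally show "dfact a ^ 3 \<le> s ^ a" .
qed

lemma tbase_le: "tbase k n \<epsilon> \<le> 2 ^ (46 + 7 * k)"
proof -
  have "1 / \<epsilon> \<le> 2 ^ k" using ek \<epsilon> by (simp add: field_simps)
  moreover have "real k \<le> 2 ^ k" by (rule less_imp_le[OF of_nat_less_two_power])
  ultimately have "2 ^ 46 * real k ^ 4 * real n * (1 / \<epsilon>) * (1 / \<epsilon>) \<le> 2 ^ 46 * (2 ^ k) ^ 4 * 2 ^ k * 2 ^ k * 2 ^ k"
    using n \<epsilon> by (intro mult_mono power_mono) auto
  also have "\<dots> = 2 ^ 46 * (2 ^ k) ^ 7"
  proof -
    have "c * x ^ 4 * x * x * x = c * x ^ 7" for c x :: real by (simp add: eval_nat_numeral)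
    then show ?thesis .
  qed
  also have "\<dots> = 2 ^ (46 + 7 * k)" by (simp only: power_add power_mult[symmetric] mult.commute)
  finally show ?thesis by (simp add: tbase_def)
qed

text \<open>A crude power of two in which only the coefficient 2 of \<open>l\<close> matters: cubed
  in the row count, it gives the \<open>2 ^ (6 * l)\<close> that \<open>T1\<close> cancels.\<close>

lemma M_le: "real M \<le> 2 ^ (48 + 7 * k + 2 * l)"
proof -
  have "real M \<le> 4 * (2 ^ (46 + 7 * k) * 4 ^ l)" 
  proof -
    have "tbase k n \<epsilon> * 4 ^ l \<le> 2 ^ (46 + 7 * k) * 4 ^ l" by (intro mult_right_mono tbase_le) auto
    then show ?thesis using M(2) by linarith
  qed
  also have "\<dots> = 2 ^ (48 + 7 * k + 2 * l)" by (simp add: power_add power_mult)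
  finally show ?thesis .
qed

lemma N_le: "(2::real) ^ L \<le> 2 ^ (49 + 7 * k + 2 * l)"
proof -
  have "real d \<le> 2 ^ (48 + 7 * k + 2 * l)" by (rule order_trans[OF d power_increasing]) auto
  then have "2 * max (real M) (real d) \<le> 2 * 2 ^ (48 + 7 * k + 2 * l)" using M_le by (intro mult_left_mono) auto
  moreover have "(2::real) ^ L \<le> 2 * max (real M) (real d)"
  proof -
    have "real (2 ^ L) \<le> real (2 * max M d)" using L by (simp only: of_nat_le_iff)
    then show ?thesis by (simp add: of_nat_max)
  qed
  moreover have "(2::real) ^ (49 + 7 * k + 2 * l) = 2 * 2 ^ (48 + 7 * k + 2 * l)" by (simp add: power_add)
  ultimately show ?thesis by linarith
qed

lemma target: "1 / 2 ^ \<kappa> \<le> \<delta> / 2 ^ j"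
proof -
  have "1 / 2 ^ k \<le> \<delta>" using dk by (simp add: field_simps)
  then have "1 / 2 ^ k / 2 ^ j \<le> \<delta> / 2 ^ j" by (intro divide_right_mono) auto
  then show ?thesis by (simp add: power_add)
qed

text \<open>The number of rows contributes \<open>2 ^ (6 * l)\<close>, and \<open>l\<close> is not
  bounded in terms of \<open>k\<close>. It is cancelled because the moment order is at least 16,
  \<open>\<eta> \<le> (3 / 4) ^ l\<close> and \<open>(3 / 4) ^ 16 \<le> 1 / 2 ^ 6\<close>. The rest
  is beaten by the factor \<open>2 ^ 15\<close> per moment, \<open>2 ^ 13\<close> from \<tau> and 4
  from \<open>B\<close>.\<close>

lemma T1: "(2 ^ L) ^ 3 * dfact a ^ 3 * real n ^ a / B ^ a \<le> 1 / 2 ^ \<kappa> / 4"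
proof -
  let ?\<eta> = "eta \<epsilon> l r"
  have \<eta>: "0 < ?\<eta>" "?\<eta> \<le> (3 / 4) ^ l" using eta_bounds[OF \<epsilon> r] by auto
  have Bp: "0 < B" using s_pos \<eta> by (simp add: B_def)
  have "dfact a ^ 3 * real n ^ a / B ^ a \<le> s ^ a * real n ^ a / B ^ a"
    using dfact_s Bp by (intro divide_right_mono mult_right_mono) auto
  also have "\<dots> = (s * real n / B) ^ a" by (simp add: power_mult_distrib power_divide)
  also have "s * real n / B = ?\<eta> / 2 ^ 15" using s_pos n1 by (simp add: B_def \<tau>_def field_simps)
  also have "(?\<eta> / 2 ^ 15) ^ a \<le> ((3 / 4) ^ l / 2 ^ 15) ^ a" using \<eta> by (intro power_mono divide_right_mono) auto
  also have "\<dots> = (((3 / 4) ^ 16) ^ l) ^ \<kappa> / 2 ^ (240 * \<kappa>)"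
  proof -
    have "(x ^ l) ^ a = ((x ^ 16) ^ l) ^ \<kappa>" for x :: real by (simp only: power_mult[symmetric] mult_ac)
    moreover have "((2::real) ^ 15) ^ a = 2 ^ (240 * \<kappa>)"
    proof -
      have "15 * a = 240 * \<kappa>" by simp
      then show ?thesis by (simp only: power_mult[symmetric])
    qed
    ultimately show ?thesis by (simp only: power_divide[of "(3 / 4) ^ l"])
  qed
  also have "\<dots> \<le> (1 / 2 ^ 6) ^ l / 2 ^ (240 * \<kappa>)"
  proof (intro divide_right_mono)
    have "(((3 / 4 :: real) ^ 16) ^ l) ^ \<kappa> \<le> (((3 / 4) ^ 16) ^ l) ^ 1"
      using k by (intro power_decreasing) (auto simp: power_le_one)
    also have "\<dots> \<le> (1 / 2 ^ 6) ^ l" unfolding power_one_right by (intro power_mono) (auto simp: power_divide)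
    finally show "(((3 / 4 :: real) ^ 16) ^ l) ^ \<kappa> \<le> (1 / 2 ^ 6) ^ l" .
  qed simp
  finally have 1: "dfact a ^ 3 * real n ^ a / B ^ a \<le> 1 / (2 ^ (6 * l) * 2 ^ (240 * \<kappa>))"
    by (simp add: power_one_over power_mult)
  have "(2 ^ L) ^ 3 * (dfact a ^ 3 * real n ^ a / B ^ a) \<le> (2 ^ (49 + 7 * k + 2 * l)) ^ 3 * (1 / (2 ^ (6 * l) * 2 ^ (240 * \<kappa>)))"
    using Bp by (intro mult_mono power_mono N_le 1) auto
  also have "\<dots> = 2 ^ (147 + 21 * k + 6 * l) / (2 ^ (6 * l) * 2 ^ (240 * \<kappa>))" by (simp add: power_mult[symmetric] algebra_simps)
  also have "\<dots> = 2 ^ (147 + 21 * k) / 2 ^ (240 * \<kappa>)" by (simp add: power_add)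
  also have "\<dots> \<le> 2 ^ (238 * \<kappa>) / 2 ^ (240 * \<kappa>)" using k by (intro divide_right_mono power_increasing) auto
  also have "\<dots> = 1 / 2 ^ (2 * \<kappa>)"
  proof -
    have "240 * \<kappa> = 238 * \<kappa> + 2 * \<kappa>" by simp
    then show ?thesis by (simp only: power_add) simp
  qed
  also have "\<dots> \<le> 1 / 2 ^ (\<kappa> + 2)" using k r by (intro divide_left_mono power_increasing) auto
  finally show ?thesis by (simp add: power_add mult.assoc)
qed

text \<open>Every moment gains \<open>2 ^ 13\<close> from \<tau> against one surplus factor
  \<open>s * n\<close> in all; no count of rows enters.\<close>

lemma T2: "dfact (a + 2) ^ 3 * real n ^ (a + 2) / (\<tau> ^ a * \<tau>) \<le> 1 / 2 ^ \<kappa> / 4"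
proof -
  have sn: "0 < s * real n" using s_pos n1 by simp
  have "dfact (a + 2) ^ 3 * real n ^ (a + 2) / (\<tau> ^ a * \<tau>) \<le> s ^ (a + 2) * real n ^ (a + 2) / (\<tau> ^ a * \<tau>)"
    using dfact_s s_pos by (intro divide_right_mono mult_right_mono) auto
  also have "\<dots> = (s * real n) ^ (a + 2) / \<tau> ^ (a + 1)" by (simp add: power_mult_distrib mult.commute)
  also have "\<tau> ^ (a + 1) = 2 ^ (13 * (a + 1)) * (s * real n) ^ (a + 1)"
    unfolding \<tau>_def mult.assoc power_mult_distrib[of "2 ^ 13"] by (simp only: power_mult)
  also have "(s * real n) ^ (a + 2) / (2 ^ (13 * (a + 1)) * (s * real n) ^ (a + 1)) = s * real n / 2 ^ (13 * (a + 1))"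
  proof -
    have "(s * real n) ^ (a + 2) = (s * real n) * (s * real n) ^ (a + 1)" by simp
    moreover have "u * x / (c * x) = u / c" if "x \<noteq> 0" for u x c :: real using that by simp
    ultimately show ?thesis using sn by (metis less_irrefl zero_less_power)
  qed
  also have "\<dots> \<le> 2 ^ (3 * (a + 2)) * 2 ^ a / 2 ^ (13 * (a + 1))"
  proof (intro divide_right_mono mult_mono)
    have "2 * real (a + 2) \<le> 2 ^ (a + 2)"
    proof -
      have "2 * x \<le> 2 ^ x" if "1 \<le> x" for x :: nat using that by (induction x rule: dec_induct) auto
      from this[of "a + 2"] have "real (2 * (a + 2)) \<le> real (2 ^ (a + 2))" by (simp only: of_nat_le_iff)
      then show ?thesis by simp
    qed
    then have "s \<le> (2 ^ (a + 2)) ^ 3" unfolding s_def by (intro power_mono) auto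
    then show "s \<le> 2 ^ (3 * (a + 2))" by (simp only: power_mult[symmetric] mult.commute)
    show "real n \<le> 2 ^ a" by (rule order_trans[OF n power_increasing]) auto
  qed auto
  also have "\<dots> \<le> 1 / 2 ^ (\<kappa> + 2)"
  proof -
    have "(2::real) ^ (3 * (a + 2)) * 2 ^ a * 2 ^ (\<kappa> + 2) = 2 ^ (3 * (a + 2) + a + (\<kappa> + 2))" by (simp only: power_add)
    also have "\<dots> \<le> 2 ^ (13 * (a + 1))" using k by (intro power_increasing) auto
    finally show ?thesis by (simp add: field_simps)
  qed
  finally show ?thesis by (simp add: power_add mult.assoc)
qed

text \<open>The exponent must reach \<open>2 * \<kappa> + 3\<close>: one \<kappa> for the dimension
  factor \<open>n \<le> 2 ^ \<kappa>\<close>, one for the failure probability, 3 for the constants 2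
  and 4.\<close>

lemma T3: "2 * real n * exp (- (M * (eta \<epsilon> l r)\<^sup>2 / (4 * (\<tau> + \<tau>)))) \<le> 1 / 2 ^ \<kappa> / 4"
proof -
  let ?\<eta> = "eta \<epsilon> l r"
  have "real (2 * \<kappa> + 3) * (8 * \<tau>) \<le> M * ?\<eta>\<^sup>2"
  proof -
    have \<kappa>1: "1 \<le> real \<kappa>" using k by simp
    have "s \<le> (36 * real \<kappa>) ^ 3" unfolding s_def using \<kappa>1 by (intro power_mono) auto
    also have "\<dots> = 46656 * real \<kappa> ^ 3" by (simp only: power_mult_distrib) simp
    finally have s: "s \<le> 46656 * real \<kappa> ^ 3" .
    have "real (2 * \<kappa> + 3) * (8 * \<tau>) \<le> (5 * real \<kappa>) * (8 * (2 ^ 13 * (46656 * real \<kappa> ^ 3) * real n))"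
      unfolding \<tau>_def using \<kappa>1 s s_pos by (intro mult_mono mult_left_mono mult_right_mono) auto
    also have "\<dots> = (40 * 8192 * 46656) * real \<kappa> ^ 4 * real n" by (simp add: power4_eq_xxxx power3_eq_cube)
    also have "\<dots> \<le> (40 * 8192 * 46656) * (real k ^ 4 * (25 * (9 / 4) ^ j)) * real n"
    proof (intro mult_right_mono mult_left_mono)
      \<comment> \<open>The dependence on the level is separated from \<open>k\<close>, since only
        the former is paid for by the growth of \<open>\<eta>\<^sup>2 * 4 ^ l\<close>.\<close>
      have "real j \<le> real k * real j" using k by (simp add: mult_le_cancel_right1)
      then have "real \<kappa> \<le> real k * (1 + real j)" by (simp add: distrib_left)
      then have "real \<kappa> ^ 4 \<le> (real k * (1 + real j)) ^ 4" by (intro power_mono) auto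
      also have "\<dots> = real k ^ 4 * (1 + real j) ^ 4" by (simp only: power_mult_distrib)
      also have "\<dots> \<le> real k ^ 4 * (25 * (9 / 4) ^ j)" by (intro mult_left_mono pow4_le_geometric) auto
      finally show "real \<kappa> ^ 4 \<le> real k ^ 4 * (25 * (9 / 4) ^ j)" .
    qed auto
    also have "\<dots> = (40 * 8192 * 46656 * 25 * 36) * (real k ^ 4 * real n / 36 * (9 / 4) ^ j)" by simp
    \<comment> \<open>This fixes the constant in \<open>tbase\<close>: \<open>40 = 5 * 8\<close> and
      \<open>8192 = 2 ^ 13\<close> come from the exponent and \<tau>, \<open>46656 = 36 ^ 3\<close>
      from \<open>s\<close>, 25 from \<open>pow4_le_geometric\<close> and 36 from the square of
      \<open>\<epsilon> / 6\<close>.\<close>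
    also have "\<dots> \<le> 2 ^ 46 * (real k ^ 4 * real n / 36 * (9 / 4) ^ j)" by (intro mult_right_mono) auto
    also have "\<dots> = (2 ^ 46 * real k ^ 4 * real n / (\<epsilon> * \<epsilon>)) * (\<epsilon>\<^sup>2 / 36 * (9 / 4) ^ j)"
      using \<epsilon> by (simp add: power2_eq_square)
    also have "\<dots> = (tbase k n \<epsilon> * 4 ^ l) * ?\<eta>\<^sup>2"
      unfolding eta_bounds(4)[OF \<epsilon> r, symmetric] tbase_def by (simp only: mult_ac)
    also have "\<dots> \<le> M * ?\<eta>\<^sup>2" using M(1) by (intro mult_right_mono) auto
    finally show ?thesis .
  qed
  then have "real (2 * \<kappa> + 3) \<le> M * ?\<eta>\<^sup>2 / (4 * (\<tau> + \<tau>))"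
    using s_pos by (simp add: field_simps)
  then have "exp (- (M * ?\<eta>\<^sup>2 / (4 * (\<tau> + \<tau>)))) \<le> exp (- real (2 * \<kappa> + 3))" by simp
  also have "\<dots> \<le> 1 / 2 ^ (2 * \<kappa> + 3)" by (rule exp_neg_le_pow)
  finally have "2 * real n * exp (- (M * ?\<eta>\<^sup>2 / (4 * (\<tau> + \<tau>)))) \<le> 2 * 2 ^ \<kappa> * (1 / 2 ^ (2 * \<kappa> + 3))"
    by (intro mult_mono order_trans[OF n power_increasing]) auto
  also have "\<dots> = 1 / 2 ^ \<kappa> / 4"
  proof -
    have "2 * x * (1 / (x * x * 8)) = 1 / x / 4" if "x \<noteq> 0" for x :: real using that by simp
    moreover have "(2::real) ^ (2 * \<kappa> + 3) = 2 ^ \<kappa> * 2 ^ \<kappa> * 8" by (simp only: power_add mult_2) simp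
    ultimately show ?thesis by simp
  qed
  finally show ?thesis .
qed

lemma level_bound:
  assumes M': "0 < M" "M \<le> 2 ^ L" and sc: "sc\<^sup>2 * real M = 1"
  shows "avg (3 * flen L M) (\<lambda>w. of_bool (\<not> approx n (1 - eta \<epsilon> l r) (1 + eta \<epsilon> l r)
        (gr (2 ^ L) (\<lambda>j. level L M sc w (W j) (Z j))) (level_gram (2 ^ L) Z W))) \<le> \<delta> / 2 ^ (l - r)"
proof -
  let ?\<eta> = "eta \<epsilon> l r"
  have \<eta>: "0 < ?\<eta>" "?\<eta> \<le> 1" using eta_bounds[OF \<epsilon> r] by auto
  have B1: "1 \<le> B" using \<eta> s_pos by (simp add: B_def field_simps)
  have B2: "?\<eta> * B \<le> 2 * (\<tau> + \<tau>)" using \<eta> by (simp add: B_def)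
  have "avg (3 * flen L M) (\<lambda>w. of_bool (\<not> approx n (1 - ?\<eta>) (1 + ?\<eta>)
        (gr (2 ^ L) (\<lambda>j. level L M sc w (W j) (Z j))) (level_gram (2 ^ L) Z W))) \<le> 1 / 2 ^ \<kappa> / 4 + 1 / 2 ^ \<kappa> / 4 + 1 / 2 ^ \<kappa> / 4"
    using level_prob[OF s_pos(2) s_pos(2) B1 \<eta>(1) B2 M' sc, of n W Z a] T1 T2 T3 by linarith
  also have "\<dots> \<le> 1 / 2 ^ \<kappa>" by (simp add: field_simps)
  also have "\<dots> \<le> \<delta> / 2 ^ (l - r)" by (rule target)
  finally show ?thesis .
qed

end

section \<open>Sizes of the parameters and the running time\<close>

lemma lg4_upper:
  fixes x :: real
  shows "4 ^ (t + lg4 t x) = (4::real) ^ t \<or> 4 ^ (t + lg4 t x) \<le> 4 * x"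
proof (cases "lg4 t x")
  case (Suc i)
  have "\<not> x \<le> 4 ^ (t + i)" using not_less_Least[of i "\<lambda>i. x \<le> 4 ^ (t + i)"] Suc by (simp add: lg4_def)
  then show ?thesis using Suc by simp
qed simp

lemma lg2_upper: "2 ^ (2 * t + lg2 t d) = (2::nat) ^ (2 * t) \<or> 2 ^ (2 * t + lg2 t d) \<le> 2 * d"
proof (cases "lg2 t d")
  case (Suc i)
  have "\<not> d \<le> 2 ^ (2 * t + i)" using not_less_Least[of i "\<lambda>i. d \<le> 2 ^ (2 * t + i)"] Suc by (simp add: lg2_def)
  then show ?thesis using Suc by simp
qed simp

text \<open>The quantity whose powers \<open>soft_O\<close> suppresses.\<close>

definition Lam :: "nat \<Rightarrow> nat \<Rightarrow> real \<Rightarrow> real \<Rightarrow> real" where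
  "Lam n d \<epsilon> \<delta> = 1 + ln (real n * real d / (\<epsilon> * \<delta>))"

context
  fixes n d p :: nat and \<epsilon> \<delta> :: real
  assumes pos: "0 < n" "0 < d" "0 < \<epsilon>" "\<epsilon> < 1" "0 < \<delta>" "\<delta> < 1" and p: "0 < p"
begin

private abbreviation "K \<equiv> qk n d \<epsilon> \<delta>"
private abbreviation "l \<equiv> ql d p"
private abbreviation "q \<equiv> qq d p"
private abbreviation "t \<equiv> qt n d p \<epsilon> \<delta>"
private abbreviation "t2 \<equiv> qt2 n d p \<epsilon> \<delta>"
private abbreviation "L \<equiv> qL n d p \<epsilon> \<delta>"
private abbreviation "M \<equiv> qM n d p \<epsilon> \<delta>"
private abbreviation "m \<equiv> qm n d p \<epsilon> \<delta>"
private abbreviation "tb \<equiv> tbase K n \<epsilon>"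

lemmas pos6 = pos(1) pos(2) pos(3) pos(4) pos(5) pos(6)
lemmas kp = qk_prop[OF pos6] qk_pos[OF pos6]

lemma k_consequences: "real n \<le> 2 ^ K" "real d \<le> 2 ^ K" "1 \<le> 2 ^ K * \<epsilon>" "1 \<le> 2 ^ K * \<delta>"
proof -
  have nd: "1 \<le> real n" "1 \<le> real d" using pos by auto
  have e: "\<epsilon> * \<delta> \<le> 1 * 1" using pos by (intro mult_mono) auto
  have "2 ^ K * (\<epsilon> * \<delta>) \<le> 2 ^ K * 1" using e by (intro mult_left_mono) auto
  then have nd2: "real n * real d \<le> 2 ^ K" using kp(1) by linarith
  show "real n \<le> 2 ^ K" using nd2 mult_left_mono[OF nd(2), of "real n"] by linarith
  show "real d \<le> 2 ^ K" using nd2 mult_right_mono[OF nd(1), of "real d"] by linarith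
  have one: "1 \<le> real n * real d" using nd mult_mono[of 1 "real n" 1 "real d"] by simp
  have "2 ^ K * (\<epsilon> * \<delta>) \<le> 2 ^ K * (\<epsilon> * 1)" using pos by (intro mult_left_mono) auto
  then show "1 \<le> 2 ^ K * \<epsilon>" using kp(1) one by linarith
  have "2 ^ K * (\<epsilon> * \<delta>) \<le> 2 ^ K * (1 * \<delta>)" using pos by (intro mult_left_mono mult_right_mono) auto
  then show "1 \<le> 2 ^ K * \<delta>" using kp(1) one by linarith
qed

lemma tb_pos: "1 \<le> tb" using tbase_ge[OF pos6] by simp

lemma M_upper: "real M \<le> 4 * (tb * 4 ^ l)"
proof -
  have "1 \<le> tb * 4 ^ l" using tb_pos mult_mono[of 1 tb 1 "4 ^ l"] by simp
  then show ?thesis using lg4_upper[of 0 "tb * 4 ^ l"] by (auto simp: qM_def qt_def)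
qed

lemma N_upper: "2 ^ L \<le> 2 * max M d"
proof -
  have "(2::nat) ^ (2 * t) = M" by (simp add: qM_def power_mult)
  then show ?thesis using lg2_upper[of t d] by (auto simp: qL_def qe_def)
qed

lemma level_params: "r < l \<Longrightarrow> level_params n d K l L M r \<epsilon> \<delta>"
  using pos k_consequences kp qM_ge[OF pos6, of p] M_upper N_upper
  by unfold_locales auto

text \<open>Minimality at \<open>i = l - 1\<close> gives \<open>4 ^ i < d ^ h\<close> with
  \<open>h = p div 2 ^ i\<close>. So \<open>h\<close> is positive, and \<open>d \<le> 2 ^ K\<close>
  yields \<open>2 * i < K * h\<close>; times \<open>2 ^ i\<close> the right-hand side is at most
  \<open>K * p\<close>. The case \<open>l = 1\<close> is separate because \<open>stopl\<close>
  excludes 0 outright.\<close>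

lemma two_pow_l: "2 ^ l \<le> 2 * p" "l \<le> p" "real l * 2 ^ l \<le> 2 * real K * real p"
proof -
  have *: "2 ^ l \<le> 2 * p \<and> l \<le> p \<and> l * 2 ^ l \<le> 2 * K * p"
  proof (cases "l \<le> 1")
    case True
    then have "l = 1" using ql_props(1)[of d p] by simp
    moreover have "1 \<le> K * p" using kp p by simp
    ultimately show ?thesis using p by simp
  next
    case False
    then obtain i where i: "l = Suc i" "1 \<le> i" by (cases l) auto
    have "\<not> stopl d p i" using not_less_Least[of i "stopl d p"] i by (simp add: ql_def ll_def)
    then have big: "4 ^ i < d ^ (p div 2 ^ i)" using i by (simp add: stopl_def)
    define h where "h = p div 2 ^ i"
    have h1: "1 \<le> h" using big unfolding h_def[symmetric] by (cases h) auto
    have ph: "h * 2 ^ i \<le> p" unfolding h_def by simp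
    have pi: "2 ^ i \<le> p" using mult_le_mono1[OF h1, of "2 ^ i"] ph by linarith
    have "i < 2 ^ i" by simp
    then have lp: "l \<le> p" using pi i by linarith
    have "real (2 ^ (2 * i)) < real (d ^ h)" using big unfolding h_def by (simp only: of_nat_less_iff power_mult) simp
    also have "real (d ^ h) \<le> (2 ^ K) ^ h" using k_consequences(2) by (simp add: power_mono)
    finally have "(2::real) ^ (2 * i) < 2 ^ (K * h)" by (simp add: power_mult)
    then have "2 * i < K * h" by simp
    then have "l \<le> K * h" using i by linarith
    then have "l * 2 ^ i \<le> K * h * 2 ^ i" by simp
    also have "\<dots> \<le> K * p" using ph by (simp add: mult.assoc)
    finally show ?thesis using pi lp i by simp
  qed
  show "2 ^ l \<le> 2 * p" "l \<le> p" using * by auto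
  have "real (l * 2 ^ l) \<le> real (2 * K * p)" using * by (simp only: of_nat_le_iff)
  then show "real l * 2 ^ l \<le> 2 * real K * real p" by simp
qed

lemma four_pow_l: "(4::real) ^ l \<le> (2 * real p)\<^sup>2"
proof -
  have "real (2 ^ l) \<le> real (2 * p)" using two_pow_l(1) by (simp only: of_nat_le_iff)
  then have "((2::real) ^ l)\<^sup>2 \<le> (2 * real p)\<^sup>2" by (intro power_mono) auto
  moreover have "((2::real) ^ l)\<^sup>2 = 4 ^ l" unfolding power2_eq_square power_mult_distrib[symmetric] by simp
  ultimately show ?thesis by simp
qed

lemma m_lower: "tb * (2 * real p)\<^sup>2 \<le> real m"
  using LeastI_ex[OF lg4_ex[of "tb * (2 * real p)\<^sup>2" t]] by (simp add: qm_def qt2_def lg4_def)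

text \<open>The search for \<open>m\<close> starts at \<open>M\<close>; \<open>four_pow_l\<close>
  ensures that this start is not already too large.\<close>

lemma m_upper: "real m \<le> 4 * (tb * (2 * real p)\<^sup>2)"
proof -
  have "real M \<le> 4 * (tb * (2 * real p)\<^sup>2)"
    using M_upper mult_left_mono[OF four_pow_l, of tb] tb_pos by linarith
  moreover have "real M = 4 ^ t" "real m = 4 ^ (t + t2)" by (simp_all add: qM_def qm_def)
  ultimately show ?thesis using lg4_upper[of t "tb * (2 * real p)\<^sup>2"] unfolding qt2_def by auto
qed

lemma M_le_m: "M \<le> m" unfolding qM_def qm_def by (rule power_increasing) auto

private abbreviation "\<Lambda> \<equiv> Lam n d \<epsilon> \<delta>"

lemma K_le_Lam: "real K \<le> 3 * \<Lambda>"
proof -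
  obtain k where k: "K = Suc k" using kp(2) by (cases K) auto
  have "\<not> real n * real d \<le> 2 ^ k * (\<epsilon> * \<delta>)"
    using not_less_Least[of k "\<lambda>k. real n * real d \<le> 2 ^ k * (\<epsilon> * \<delta>)"] k by (simp add: qk_def kk_def)
  then have "2 ^ k \<le> real n * real d / (\<epsilon> * \<delta>)" using pos by (simp add: field_simps)
  then have "ln (2 ^ k) \<le> ln (real n * real d / (\<epsilon> * \<delta>))" using pos by (intro ln_mono) auto
  then have "real k * ln 2 \<le> \<Lambda> - 1" by (simp add: ln_realpow Lam_def)
  moreover have "real k * (1 / 2) \<le> real k * ln 2"
    using ln_2_less_1 ln2_ge_two_thirds by (intro mult_left_mono) auto
  ultimately show ?thesis using k by simp
qed

definition "budget = real n * real d + (real n)\<^sup>2 * (real p)\<^sup>2 / \<epsilon>\<^sup>2"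

lemma tb_eq: "tb = 2 ^ 46 * real K ^ 4 * real n / \<epsilon>\<^sup>2" by (simp add: tbase_def power2_eq_square)

lemma p2_le: "(real p)\<^sup>2 \<le> budget" "real n * (real p)\<^sup>2 \<le> budget" "real n * real d \<le> budget" "1 \<le> budget" "real p \<le> budget"
proof -
  have e: "1 \<le> 1 / \<epsilon>\<^sup>2" using pos by (simp add: power_le_one)
  have n: "1 \<le> real n" "1 \<le> real d" "1 \<le> real p" using pos p by auto
  have "1 * 1 * (real p)\<^sup>2 * 1 \<le> real n * real n * (real p)\<^sup>2 * (1 / \<epsilon>\<^sup>2)" using n e by (intro mult_mono) auto
  then have 1: "(real p)\<^sup>2 \<le> (real n)\<^sup>2 * (real p)\<^sup>2 / \<epsilon>\<^sup>2" by (simp add: power2_eq_square)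
  have "real n * 1 * (real p)\<^sup>2 * 1 \<le> real n * real n * (real p)\<^sup>2 * (1 / \<epsilon>\<^sup>2)" using n e by (intro mult_mono) auto
  then have 2: "real n * (real p)\<^sup>2 \<le> (real n)\<^sup>2 * (real p)\<^sup>2 / \<epsilon>\<^sup>2" by (simp add: power2_eq_square)
  have 3: "0 \<le> real n * real d" "0 \<le> (real n)\<^sup>2 * (real p)\<^sup>2 / \<epsilon>\<^sup>2" by auto
  show "(real p)\<^sup>2 \<le> budget" "real n * (real p)\<^sup>2 \<le> budget" "real n * real d \<le> budget" unfolding budget_def using 1 2 3 by linarith+
  have "real p * 1 \<le> real p * real p" using n by (intro mult_left_mono) auto
  then show "real p \<le> budget" using \<open>(real p)\<^sup>2 \<le> budget\<close> by (simp add: power2_eq_square)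
  then show "1 \<le> budget" using n by linarith
qed

lemma n_m_le: "real n * real m \<le> 16 * 2 ^ 46 * real K ^ 4 * budget"
proof -
  have "real n * real m \<le> real n * (4 * (tb * (2 * real p)\<^sup>2))" using m_upper by (intro mult_left_mono) auto
  also have "\<dots> = 16 * 2 ^ 46 * real K ^ 4 * ((real n)\<^sup>2 * (real p)\<^sup>2 / \<epsilon>\<^sup>2)"
    unfolding tb_eq by (simp add: power2_eq_square)
  also have "\<dots> \<le> 16 * 2 ^ 46 * real K ^ 4 * budget" by (intro mult_left_mono) (auto simp: budget_def)
  finally show ?thesis .
qed

lemma l_le_t: "l \<le> t"
proof -
  have "(4::nat) ^ l \<le> 4 ^ t" using pow_ql_le_qM[OF pos6, of p] by (simp add: qM_def)
  then show ?thesis by simp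
qed

text \<open>If the data dimension dominates, \<open>L\<close> is of order \<open>K\<close>, and so
  is \<open>l\<close>. Otherwise \<open>2 ^ L = M\<close> and \<open>L\<close> is of order
  \<open>K * l\<close>, so two factors \<open>l\<close> stand beside \<open>4 ^ l\<close>; the
  square of \<open>l * 2 ^ l \<le> 2 * K * p\<close> absorbs them. Of the seven factors
  \<open>K\<close>, four come from \<open>tb\<close>, one from \<open>L\<close> and two from this
  square.\<close>

lemma main_le: "real l * real n * real L * 2 ^ L \<le> 912 * 2 ^ 46 * real K ^ 7 * budget"
proof (cases "2 ^ L \<le> 2 * d")
  case True
  then have "real (2 ^ L) \<le> real (2 * d)" by (simp only: of_nat_le_iff)
  then have N: "(2::real) ^ L \<le> 2 * real d" by simp
  also have "\<dots> \<le> 2 ^ Suc K" using k_consequences(2) by simp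
  finally have "L \<le> Suc K" by (simp del: power_Suc)
  then have L: "real L \<le> 2 * real K" using kp(2) by linarith
  have l: "real l \<le> 2 * real K" using l_le_t L by (simp add: qL_def)
  have "real l * real n * real L * 2 ^ L \<le> (2 * real K) * real n * (2 * real K) * (2 * real d)"
    using l L N by (intro mult_mono) auto
  also have "\<dots> = 8 * real K ^ 2 * (real n * real d)" by (simp add: power2_eq_square)
  also have "\<dots> \<le> 912 * 2 ^ 46 * real K ^ 7 * budget"
    using kp(2) p2_le by (intro mult_mono power_increasing) auto
  finally show ?thesis .
next
  case False
  then have e: "2 ^ L = (2::nat) ^ (2 * t)" using lg2_upper[of t d] by (auto simp: qL_def qe_def)
  then have L: "L = 2 * t" by simp
  have MN: "(2::real) ^ L = real M" unfolding L qM_def by (simp add: power_mult)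
  interpret lp: level_params n d K l L M 0 \<epsilon> \<delta> using level_params ql_props(1)[of d p] by simp
  have "(2::real) ^ L \<le> 2 ^ (48 + 7 * K + 2 * l)" unfolding MN by (rule lp.M_le)
  then have "L \<le> 48 + 7 * K + 2 * l" by simp
  also have "\<dots> \<le> 57 * (K * l)"
  proof -
    have "1 * 1 \<le> K * l" "K * 1 \<le> K * l" "1 * l \<le> K * l" using kp(2) ql_props(1)[of d p] by (intro mult_le_mono; simp)+
    then show ?thesis by linarith
  qed
  finally have "real L \<le> real (57 * (K * l))" by (simp only: of_nat_le_iff)
  then have L2: "real L \<le> 57 * real K * real l" by simp
  have "real l * real n * real L * 2 ^ L \<le> real l * real n * (57 * real K * real l) * (4 * (tb * 4 ^ l))"
    unfolding MN using L2 M_upper by (intro mult_mono) auto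
  also have "(4::real) ^ l = 2 ^ l * 2 ^ l" unfolding power_mult_distrib[symmetric] by simp
  also have "real l * real n * (57 * real K * real l) * (4 * (tb * (2 ^ l * 2 ^ l))) = 228 * real K * real n * tb * ((real l * 2 ^ l) * (real l * 2 ^ l))" by simp
  also have "\<dots> \<le> 228 * real K * real n * tb * ((2 * real K * real p) * (2 * real K * real p))"
  proof (rule mult_left_mono)
    show "(real l * 2 ^ l) * (real l * 2 ^ l) \<le> (2 * real K * real p) * (2 * real K * real p)"
      by (rule mult_mono[OF two_pow_l(3) two_pow_l(3)]) auto
  qed (use tb_pos in auto)
  also have "\<dots> = 912 * 2 ^ 46 * real K ^ 7 * ((real n)\<^sup>2 * (real p)\<^sup>2 / \<epsilon>\<^sup>2)"
    unfolding tb_eq by (simp add: power2_eq_square eval_nat_numeral)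
  also have "\<dots> \<le> 912 * 2 ^ 46 * real K ^ 7 * budget" by (intro mult_left_mono) (auto simp: budget_def)
  finally show ?thesis .
qed

text \<open>For \<open>2 \<le> d\<close> the stopping rule gives
  \<open>2 ^ q \<le> d ^ q \<le> 4 ^ l\<close>, so forming the exact power is no dearer than the
  levels. For \<open>d = 1\<close> the exponent \<open>q\<close> may be of order \<open>p\<close>,
  but each round then costs only about \<open>n\<close>.\<close>

lemma base_le: "real q * real n * real (d ^ q) \<le> real n * real p + 2 * (real l * real n * real L * 2 ^ L)"
proof (cases "d = 1")
  case True
  have "real q \<le> real p" by (simp add: qq_def)
  then have "real q * real n * real (d ^ q) \<le> real n * real p" using True by (simp add: mult.commute mult_left_mono)
  moreover have "0 \<le> real l * real n * real L * 2 ^ L" by simp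
  ultimately show ?thesis by linarith
next
  case False
  then have d: "2 \<le> d" using pos by simp
  have "(2::nat) ^ q \<le> d ^ q" using d by (rule power_mono) simp
  also have "\<dots> \<le> 4 ^ l" by (rule ql_props)
  finally have "(2::nat) ^ q \<le> 2 ^ (2 * l)" by (simp add: power_mult)
  then have q: "real q \<le> 2 * real l" by simp
  have "d ^ q \<le> 2 ^ L" using qL_props(2,4)[OF pos6, of p] by linarith
  then have "real (d ^ q) \<le> real (2 ^ L)" by (simp only: of_nat_le_iff)
  then have D: "real (d ^ q) \<le> real L * 2 ^ L"
  proof -
    have "1 * 2 ^ L \<le> real L * 2 ^ L" using qL_props(1)[OF pos6, of p] by (intro mult_right_mono) auto
    moreover have "real (d ^ q) \<le> 2 ^ L" using \<open>real (d ^ q) \<le> real (2 ^ L)\<close> by simp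
    ultimately show ?thesis by linarith
  qed
  have "real q * real n * real (d ^ q) \<le> (2 * real l) * real n * (real L * 2 ^ L)" using q D by (intro mult_mono) auto
  also have "\<dots> = 2 * (real l * real n * real L * 2 ^ L)" by simp
  also have "\<dots> \<le> real n * real p + 2 * (real l * real n * real L * 2 ^ L)" by simp
  finally show ?thesis .
qed

lemma qT_le: "real (qT n d p \<epsilon> \<delta>) \<le> 10 ^ 21 * real K ^ 7 * budget"
proof -
  let ?W = "real l * real n * real L * 2 ^ L" and ?Y = "real K ^ 7 * budget"
  have K1: "1 \<le> real K" using kp(2) by simp
  have Y: "budget \<le> ?Y" "real K * budget \<le> ?Y" "real K ^ 4 * budget \<le> ?Y"
  proof -
    have g: "0 \<le> budget" using p2_le by linarith
    show "budget \<le> ?Y" using mult_right_mono[OF one_le_power[OF K1, of 7] g] by simp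
    show "real K * budget \<le> ?Y" using mult_right_mono[OF power_increasing[of 1 7 "real K"] g] K1 by simp
    show "real K ^ 4 * budget \<le> ?Y" using mult_right_mono[OF power_increasing[of 4 7 "real K"] g] K1 by simp
  qed
  have nn: "1 \<le> real n" "1 \<le> real d" "1 \<le> real p" using pos p by auto
  have small: "real n \<le> real n * real d" "real d \<le> real n * real d" "real n * real p \<le> real n * (real p)\<^sup>2"
    using nn mult_left_mono[OF nn(2), of "real n"] mult_right_mono[OF nn(1), of "real d"]
      mult_left_mono[OF mult_left_mono[OF nn(3), of "real p"], of "real n"] by (simp_all add: power2_eq_square)
  have Kg: "real K \<le> real K * budget" using mult_left_mono[OF p2_le(4), of "real K"] by simp
  have lp: "real l * real p \<le> (real p)\<^sup>2" "real l \<le> real p" using two_pow_l(2) by (simp_all add: power2_eq_square mult_right_mono)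
  have tm: "real t + real t2 \<le> real m"
  proof -
    have "t + t2 < 2 ^ (t + t2)" by simp
    also have "(2::nat) ^ (t + t2) \<le> 4 ^ (t + t2)" by (rule power_mono) auto
    finally have "t + t2 \<le> m" by (simp add: qm_def)
    then show ?thesis by (simp flip: of_nat_add)
  qed
  have mn: "real m \<le> real n * real m" using mult_right_mono[OF nn(1), of "real m"] by simp
  have MM: "real M \<le> real m" "real n * real M \<le> real n * real m" using M_le_m by (simp_all add: mult_left_mono)
  have e: "real (qe n d p \<epsilon> \<delta>) \<le> real d"
  proof -
    have "d \<le> 2 ^ d" by (simp add: less_imp_le)
    also have "(2::nat) ^ d \<le> 2 ^ (2 * t + d)" by (rule power_increasing) auto
    finally have "lg2 t d \<le> d" unfolding lg2_def by (rule Least_le)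
    then show ?thesis by (simp add: qe_def)
  qed
  have t0: "0 \<le> real t" "0 \<le> real t2" by auto
  have "real (qT n d p \<epsilon> \<delta>) = (4 * real n + 4 * real d + 4 * real p + 4 * real K + 30) + ((9 * (real l * real p) + 16 * real l + 7) + ((10 * real t + 6 * real t2 + 5 * real (qe n d p \<epsilon> \<delta>) + 30) +
     ((7 * (real n * real d) + 35 * real n + 4 * real M + 66 * (real q * real n * real (d ^ q)) + 40) + ((280 * ?W + real l) + (7 * (real n * real M) + 7 * real n + 8)))))"
    unfolding qT_def by (simp add: algebra_simps)
  also have "\<dots> \<le> 1000 * budget + 4 * (real K * budget) + 100 * (real n * real m) + 500 * ?W"
  proof -
    have "0 \<le> ?W" "0 \<le> real n * real m" by auto
    then show ?thesis using small Kg lp tm mn MM e t0 base_le p2_le by linarith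
  qed
  also have "\<dots> \<le> 1000 * ?Y + 4 * ?Y + 100 * (16 * 2 ^ 46 * ?Y) + 500 * (912 * 2 ^ 46 * ?Y)"
  proof -
    have "real n * real m \<le> 16 * 2 ^ 46 * (real K ^ 4 * budget)" "?W \<le> 912 * 2 ^ 46 * ?Y"
      using n_m_le main_le by (simp_all only: mult.assoc)
    moreover have "1000 * g + 4 * kg + 100 * x + 500 * w \<le> 1000 * y + 4 * y + 100 * (16 * 2 ^ 46 * y) + 500 * (912 * 2 ^ 46 * y)"
      if "x \<le> 16 * 2 ^ 46 * u" "w \<le> 912 * 2 ^ 46 * y" "g \<le> y" "kg \<le> y" "u \<le> y" for g kg x w u y :: real
      using that by simp
    ultimately show ?thesis using Y by blast
  qed
  also have "\<dots> \<le> 10 ^ 21 * ?Y" using Y(1) p2_le(4) by simp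
  finally show ?thesis by (simp add: mult.assoc)
qed

end

lemma soft_O_m: "soft_O (\<lambda>n d p \<epsilon> \<delta>. real (qm n d p \<epsilon> \<delta>)) (\<lambda>n d p \<epsilon> \<delta>. real n * real p ^ 2 / \<epsilon> ^ 2)"
  unfolding soft_O_def
proof (intro exI[of _ "16 * 2 ^ 46 * 3 ^ 4 :: real"] conjI exI[of _ "4 :: nat"] allI impI)
  fix n d p :: nat and \<epsilon> \<delta> :: real assume "valid_params n d p \<epsilon> \<delta>"
  then have v: "0 < n" "0 < d" "0 < \<epsilon>" "\<epsilon> < 1" "0 < \<delta>" "\<delta> < 1" "0 < p" by (auto simp: valid_params_def)
  let ?K = "real (qk n d \<epsilon> \<delta>)"
  have "?K ^ 4 \<le> (3 * Lam n d \<epsilon> \<delta>) ^ 4" using K_le_Lam[OF v] by (intro power_mono) auto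
  then have K: "?K ^ 4 \<le> 3 ^ 4 * Lam n d \<epsilon> \<delta> ^ 4" by (simp only: power_mult_distrib)
  have "real (qm n d p \<epsilon> \<delta>) \<le> 16 * 2 ^ 46 * ?K ^ 4 * (real n * real p ^ 2 / \<epsilon> ^ 2)"
    using m_upper[OF v] unfolding tb_eq[OF v] by (simp add: power_mult_distrib)
  also have "\<dots> \<le> 16 * 2 ^ 46 * (3 ^ 4 * Lam n d \<epsilon> \<delta> ^ 4) * (real n * real p ^ 2 / \<epsilon> ^ 2)"
    using K v by (intro mult_right_mono mult_left_mono) auto
  finally show "real (qm n d p \<epsilon> \<delta>) \<le> 16 * 2 ^ 46 * 3 ^ 4 * (1 + ln (real n * real d / (\<epsilon> * \<delta>))) ^ 4 * (real n * real p ^ 2 / \<epsilon> ^ 2)"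
    by (simp only: Lam_def mult.assoc)
qed auto

lemma soft_O_m': "soft_O (\<lambda>n d p \<epsilon> \<delta>. real n * real p ^ 2 / \<epsilon> ^ 2) (\<lambda>n d p \<epsilon> \<delta>. real (qm n d p \<epsilon> \<delta>))"
  unfolding soft_O_def
proof (intro exI[of _ "1 :: real"] conjI exI[of _ "0 :: nat"] allI impI)
  fix n d p :: nat and \<epsilon> \<delta> :: real assume "valid_params n d p \<epsilon> \<delta>"
  then have v: "0 < n" "0 < d" "0 < \<epsilon>" "\<epsilon> < 1" "0 < \<delta>" "\<delta> < 1" "0 < p" by (auto simp: valid_params_def)
  have "1 \<le> real (qk n d \<epsilon> \<delta>) ^ 4" using kp(2)[OF v] by simp
  then have "1 * (real n * real p ^ 2 / \<epsilon> ^ 2) \<le> (4 * 2 ^ 46 * real (qk n d \<epsilon> \<delta>) ^ 4) * (real n * real p ^ 2 / \<epsilon> ^ 2)"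
    using v by (intro mult_right_mono) auto
  also have "\<dots> = tbase (qk n d \<epsilon> \<delta>) n \<epsilon> * (2 * real p)\<^sup>2" unfolding tb_eq[OF v] by (simp add: power_mult_distrib)
  also have "\<dots> \<le> real (qm n d p \<epsilon> \<delta>)" by (rule m_lower[OF v])
  finally show "real n * real p ^ 2 / \<epsilon> ^ 2 \<le> 1 * (1 + ln (real n * real d / (\<epsilon> * \<delta>))) ^ 0 * real (qm n d p \<epsilon> \<delta>)" by simp
qed auto

lemma soft_O_T: "soft_O (\<lambda>n d p \<epsilon> \<delta>. real (qT n d p \<epsilon> \<delta>)) (\<lambda>n d p \<epsilon> \<delta>. real n * real d + real n ^ 2 * real p ^ 2 / \<epsilon> ^ 2)"
  unfolding soft_O_def
proof (intro exI[of _ "10 ^ 21 * 3 ^ 7 :: real"] conjI exI[of _ "7 :: nat"] allI impI)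
  fix n d p :: nat and \<epsilon> \<delta> :: real assume "valid_params n d p \<epsilon> \<delta>"
  then have v: "0 < n" "0 < d" "0 < \<epsilon>" "\<epsilon> < 1" "0 < \<delta>" "\<delta> < 1" "0 < p" by (auto simp: valid_params_def)
  let ?K = "real (qk n d \<epsilon> \<delta>)"
  have "?K ^ 7 \<le> (3 * Lam n d \<epsilon> \<delta>) ^ 7" using K_le_Lam[OF v] by (intro power_mono) auto
  then have K: "?K ^ 7 \<le> 3 ^ 7 * Lam n d \<epsilon> \<delta> ^ 7" by (simp only: power_mult_distrib)
  have "real (qT n d p \<epsilon> \<delta>) \<le> 10 ^ 21 * ?K ^ 7 * (real n * real d + real n ^ 2 * real p ^ 2 / \<epsilon> ^ 2)"
    using qT_le[OF v] by (simp add: budget_def[OF v])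
  also have "\<dots> \<le> 10 ^ 21 * (3 ^ 7 * Lam n d \<epsilon> \<delta> ^ 7) * (real n * real d + real n ^ 2 * real p ^ 2 / \<epsilon> ^ 2)"
    using K by (intro mult_right_mono mult_left_mono) auto
  finally show "real (qT n d p \<epsilon> \<delta>) \<le> 10 ^ 21 * 3 ^ 7 * (1 + ln (real n * real d / (\<epsilon> * \<delta>))) ^ 7 * (real n * real d + real n ^ 2 * real p ^ 2 / \<epsilon> ^ 2)"
    by (simp only: Lam_def mult.assoc)
qed auto

subsection \<open>Tensor powers as arrays\<close>

lemma sum_lessThan_mult:
  fixes f :: "nat \<Rightarrow> real"
  shows "(\<Sum>K<a * b. f K) = (\<Sum>I<a. \<Sum>J<b. f (I * b + J))"
proof (induction a)
  case (Suc a)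
  have "(\<Sum>K<Suc a * b. f K) = (\<Sum>K<a * b. f K) + (\<Sum>J<b. f (a * b + J))"
    using sum.atLeastLessThan_concat[of 0 "a * b" "a * b + b" f] sum.shift_bounds_nat_ivl[of f 0 "a * b" b]
    by (simp add: lessThan_atLeast0 add.commute)
  then show ?case using Suc by simp
qed simp

lemma div_mod_stride:
  assumes "J < (b::nat)"
  shows "(I * b + J) div b = I" "(I * b + J) mod b = J"
  using assms by (simp_all add: div_add1_eq)

text \<open>Indices are strings of base-\<open>d\<close> digits, and concatenation leaves the
  leading digit of the first string in front.\<close>

lemma tp_prod:
  assumes "I < d ^ a" "J < d ^ b"
  shows "tp d x (a + b) (I * d ^ b + J) = tp d x a I * tp d x b J"
  using assms(1)
proof (induction a arbitrary: I)
  case 0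
  then show ?case by simp
next
  case (Suc a)
  let ?y = "I * d ^ b + J"
  have d: "0 < d" using Suc.prems by (cases d) auto
  have yd: "?y div d ^ b = I" "?y mod d ^ b = J" using div_mod_stride[OF assms(2)] by simp_all
  have dv: "?y div d ^ (a + b) = I div d ^ a"
    unfolding add.commute[of a b] power_add div_mult2_eq yd ..
  have md: "?y mod d ^ (a + b) = (I mod d ^ a) * d ^ b + J"
    unfolding add.commute[of a b] power_add mod_mult2_eq yd by simp
  have "Suc I * d ^ b \<le> d ^ Suc a * d ^ b" using Suc.prems by (intro mult_le_mono1) simp
  then have lt: "?y < d ^ Suc (a + b)" using assms(2) by (simp add: power_add mult_ac)
  have "tp d x (Suc a + b) ?y = x (I div d ^ a) * tp d x (a + b) ((I mod d ^ a) * d ^ b + J)"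
    using lt dv md by simp
  also have "\<dots> = x (I div d ^ a) * (tp d x a (I mod d ^ a) * tp d x b J)"
    using Suc.IH[of "I mod d ^ a"] d by simp
  finally show ?case using Suc.prems by simp
qed

lemma tp_inner: "(\<Sum>I<d ^ e. tp d x e I * tp d y e I) = (\<Sum>u<d. x u * y u) ^ e"
proof (induction e)
  case (Suc e)
  have "(\<Sum>I<d ^ Suc e. tp d x (Suc e) I * tp d y (Suc e) I) = (\<Sum>u<d. \<Sum>J<d ^ e. (x u * y u) * (tp d x e J * tp d y e J))"
    unfolding power_Suc sum_lessThan_mult
  proof (intro sum.cong refl)
    fix u J assume u: "u \<in> {..<d}" and J: "J \<in> {..<d ^ e}"
    have "Suc u * d ^ e \<le> d * d ^ e" using u by (intro mult_le_mono1) simp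
    then have "u * d ^ e + J < d ^ Suc e" using J by simp
    then show "tp d x (Suc e) (u * d ^ e + J) * tp d y (Suc e) (u * d ^ e + J) = (x u * y u) * (tp d x e J * tp d y e J)"
      using div_mod_stride[of J "d ^ e" u] J by simp
  qed
  also have "\<dots> = (\<Sum>u<d. x u * y u) ^ Suc e"
    unfolding sum_distrib_left[symmetric] Suc by (simp add: sum_distrib_right mult.commute)
  finally show ?case .
qed simp

subsection \<open>Linear forms in tensor powers\<close>

text \<open>Linearity in the tensor power. In this way a sketch computed without forming the full
  tensor power is recognised as one matrix applied to it. The support condition is that of
  zero-padded columns.\<close>

definition lf :: "nat \<Rightarrow> nat \<Rightarrow> ((nat \<Rightarrow> real) \<Rightarrow> real) \<Rightarrow> bool" where
  "lf d e f \<longleftrightarrow> (\<exists>c. \<forall>x. (\<forall>a\<ge>d. x a = 0) \<longrightarrow> f x = (\<Sum>I<d ^ e. c I * tp d x e I))"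

lemma lf_add: "lf d e f \<Longrightarrow> lf d e g \<Longrightarrow> lf d e (\<lambda>x. f x + g x)"
proof -
  assume "lf d e f" "lf d e g"
  then obtain c c' where "\<forall>x. (\<forall>a\<ge>d. x a = 0) \<longrightarrow> f x = (\<Sum>I<d ^ e. c I * tp d x e I)"
    "\<forall>x. (\<forall>a\<ge>d. x a = 0) \<longrightarrow> g x = (\<Sum>I<d ^ e. c' I * tp d x e I)" by (auto simp: lf_def)
  then show ?thesis unfolding lf_def
    by (intro exI[of _ "\<lambda>I. c I + c' I"]) (simp add: distrib_right sum.distrib)
qed

lemma lf_cmult: "lf d e f \<Longrightarrow> lf d e (\<lambda>x. k * f x)"
proof -
  assume "lf d e f"
  then obtain c where "\<forall>x. (\<forall>a\<ge>d. x a = 0) \<longrightarrow> f x = (\<Sum>I<d ^ e. c I * tp d x e I)" by (auto simp: lf_def)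
  then show ?thesis unfolding lf_def
    by (intro exI[of _ "\<lambda>I. k * c I"]) (simp add: sum_distrib_left mult.assoc)
qed

lemma lf_0: "lf d e (\<lambda>x. 0)"
  unfolding lf_def by (intro exI[of _ "\<lambda>_. 0"]) simp

text \<open>The coefficients of a product form the outer product, placed at concatenated
  indices.\<close>

lemma lf_mult:
  assumes "lf d a f" "lf d b g"
  shows "lf d (a + b) (\<lambda>x. f x * g x)"
proof -
  obtain c c' where c: "\<And>x. (\<forall>a\<ge>d. x a = 0) \<Longrightarrow> f x = (\<Sum>I<d ^ a. c I * tp d x a I)"
    "\<And>x. (\<forall>a\<ge>d. x a = 0) \<Longrightarrow> g x = (\<Sum>I<d ^ b. c' I * tp d x b I)" using assms by (auto simp: lf_def)
  show ?thesis unfolding lf_def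
  proof (intro exI[of _ "\<lambda>K. c (K div d ^ b) * c' (K mod d ^ b)"] allI impI)
    fix x :: "nat \<Rightarrow> real" assume x: "\<forall>a\<ge>d. x a = 0"
    have "f x * g x = (\<Sum>I<d ^ a. \<Sum>J<d ^ b. (c I * tp d x a I) * (c' J * tp d x b J))"
      unfolding c(1)[OF x] c(2)[OF x] by (rule sum_product)
    also have "\<dots> = (\<Sum>I<d ^ a. \<Sum>J<d ^ b. c ((I * d ^ b + J) div d ^ b) * c' ((I * d ^ b + J) mod d ^ b) * tp d x (a + b) (I * d ^ b + J))"
      by (intro sum.cong refl) (simp add: tp_prod div_mod_stride)
    also have "\<dots> = (\<Sum>K<d ^ (a + b). c (K div d ^ b) * c' (K mod d ^ b) * tp d x (a + b) K)"
      unfolding power_add sum_lessThan_mult ..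
    finally show "f x * g x = \<dots>" .
  qed
qed

lemma lf_tp: "lf d e (\<lambda>x. tp d x e a)"
proof (cases "a < d ^ e")
  case True
  have "tp d x e a = (\<Sum>I<d ^ e. of_bool (I = a) * tp d x e I)" for x
  proof -
    have "(\<Sum>I<d ^ e. of_bool (I = a) * tp d x e I) = (\<Sum>I<d ^ e. if I = a then tp d x e a else 0)"
      by (intro sum.cong) auto
    then show ?thesis using True by simp
  qed
  then show ?thesis unfolding lf_def by (intro exI[of _ "\<lambda>I. of_bool (I = a)"] allI impI)
next
  case False
  then show ?thesis using lf_0 by (simp add: tp_0)
qed

lemma lf_component: "lf d 1 (\<lambda>x. x a)"
proof (cases "a < d")
  case True
  then show ?thesis using lf_tp[of d 1 a] by simp
next
  case False
  then show ?thesis unfolding lf_def by (intro exI[of _ "\<lambda>_. 0"]) simp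
qed

lemma lf_const: "lf d 0 (\<lambda>x. k)"
  unfolding lf_def by (intro exI[of _ "\<lambda>_. k"]) simp

text \<open>Argued round by round, because the coefficient formula \<open>had_eq\<close> is
  available only below \<open>2 ^ L\<close> whereas \<open>i\<close> is arbitrary here.\<close>

lemma lf_had:
  assumes "\<And>a. lf d e (\<lambda>x. F x a)"
  shows "lf d e (\<lambda>x. had L (F x) i)"
proof -
  have "lf d e (\<lambda>x. (hstep H ^^ t) (F x) i)" for H t
  proof (induction t arbitrary: i)
    case (Suc t)
    have m: "lf d e (\<lambda>x. u x - v x)" if "lf d e u" "lf d e v" for u v
      using lf_add[OF that(1) lf_cmult[OF that(2), of "-1"]] by simp
    have s: "(hstep H ^^ Suc t) (F x) i = (if i < H then (hstep H ^^ t) (F x) (2 * i) + (hstep H ^^ t) (F x) (2 * i + 1)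
       else (hstep H ^^ t) (F x) (2 * (i - H)) - (hstep H ^^ t) (F x) (2 * (i - H) + 1))" for x
      unfolding funpow.simps comp_def by (rule hstep_def)
    show ?case unfolding s
      by (cases "i < H") (simp_all only: if_True if_False lf_add m Suc)
  qed (use assms in simp)
  then show ?thesis by (simp add: had_def)
qed

lemma lf_fact_sk: "(\<And>a. lf d e (\<lambda>x. F x a)) \<Longrightarrow> lf d e (\<lambda>x. fact_sk L w (F x) i)"
  unfolding fact_sk_def by (intro lf_had lf_cmult)

lemma lf_level:
  assumes "\<And>a. lf d b (\<lambda>x. u x a)" "\<And>a. lf d e (\<lambda>x. z x a)"
  shows "lf d (2 * e + b) (\<lambda>x. level L M sc w (u x) (z x) i)"
proof (cases "i < M")
  case True
  have "lf d ((e + e) + b) (\<lambda>x. (sc * fact_sk L w (z x) i * fact_sk L (drop (flen L M) w) (z x) i) *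
     fact_sk L (drop (flen L M) (drop (flen L M) w)) (u x) i)"
    by (intro lf_mult lf_cmult lf_fact_sk assms)
  then show ?thesis using True by (simp add: level_def mult_2)
qed (simp add: level_def lf_0)

lemma lf_sk:
  assumes "\<And>a. lf d e (\<lambda>x. z x a)"
  shows "lf d (expo e bs) (\<lambda>x. sk L M sc bs w x (z x) i)"
  using assms
proof (induction bs arbitrary: e w z)
  case (Cons b bs)
  have u: "lf d (of_bool b) (\<lambda>x. (if b then x else e0) a)" for a
    using lf_component lf_const by (cases b) auto
  show ?case
    using Cons.IH[OF lf_level[OF u Cons.prems]] by simp
qed simp

subsection \<open>Matrices\<close>

lemma vec_tpow_tp:
  assumes "x \<in> carrier_vec d"
  shows "dim_vec (vec_tpow x e) = d ^ e \<and> (\<forall>I<d ^ e. vec_index (vec_tpow x e) I = tp d (\<lambda>a. if a < d then vec_index x a else 0) e I)"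
proof (induction e)
  case (Suc e)
  have dx: "dim_vec x = d" using assms by simp
  show ?case
  proof (intro conjI allI impI)
    show "dim_vec (vec_tpow x (Suc e)) = d ^ Suc e" using Suc dx by (simp add: kron_def)
    fix I assume I: "I < d ^ Suc e"
    then have "0 < d ^ e" by (cases d) auto
    then have 1: "I mod d ^ e < d ^ e" "I div d ^ e < d" using I by (auto simp: less_mult_imp_div_less)
    show "vec_index (vec_tpow x (Suc e)) I = tp d (\<lambda>a. if a < d then vec_index x a else 0) (Suc e) I"
      using Suc dx I 1 by (simp add: kron_def)
  qed
qed simp

lemma mat_tpow_tp:
  assumes "X \<in> carrier_mat d n" "I < d ^ p" "j < n"
  shows "index_mat (mat_tpow X p) (I, j) = tp d (colf d X j) p I"
proof -
  have "col X j \<in> carrier_vec d" using assms by auto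
  then have "vec_index (vec_tpow (col X j) p) I = tp d (\<lambda>a. if a < d then vec_index (col X j) a else 0) p I"
    using vec_tpow_tp assms(2) by blast
  moreover have "(\<lambda>a. if a < d then vec_index (col X j) a else 0) = colf d X j"
    using assms by (auto simp: colf_def)
  ultimately show ?thesis using assms by (simp add: mat_tpow_def)
qed

lemma mat_tpow_carrier: "X \<in> carrier_mat d n \<Longrightarrow> mat_tpow X p \<in> carrier_mat (d ^ p) n"
  by (auto simp: mat_tpow_def)

lemma gram_index:
  assumes "A \<in> carrier_mat m n" "i < n" "j < n"
  shows "index_mat (gram A) (i, j) = (\<Sum>a<m. index_mat A (a, i) * index_mat A (a, j))"
  using assms by (simp add: gram_def scalar_prod_def lessThan_atLeast0)

lemma gram_carrier: "A \<in> carrier_mat m n \<Longrightarrow> gram A \<in> carrier_mat n n"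
  by (auto simp: gram_def)

lemma loewner_leI:
  assumes A: "A \<in> carrier_mat n n" and B: "B \<in> carrier_mat n n"
    and k: "\<And>i j. i < n \<Longrightarrow> j < n \<Longrightarrow> index_mat A (i, j) = k i j" "\<And>i j. i < n \<Longrightarrow> j < n \<Longrightarrow> index_mat B (i, j) = k' i j"
    and sym: "\<And>i j. k i j = k j i" "\<And>i j. k' i j = k' j i"
    and le: "\<And>c. Kq n k c \<le> Kq n k' c"
  shows "A \<preceq>\<^sub>L B"
proof -
  have BA: "B - A \<in> carrier_mat n n" using A B by auto
  have ix: "index_mat (B - A) (i, j) = k' i j - k i j" if "i < n" "j < n" for i j using that A B k by simp
  have "0 \<le> scalar_prod v (mult_mat_vec (B - A) v)" if v: "v \<in> carrier_vec n" for v
  proof -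
    have "scalar_prod v (mult_mat_vec (B - A) v) = (\<Sum>i<n. vec_index v i * (\<Sum>j<n. (k' i j - k i j) * vec_index v j))"
    proof -
      have "vec_index (mult_mat_vec (B - A) v) i = (\<Sum>j<n. (k' i j - k i j) * vec_index v j)" if i: "i < n" for i
      proof -
        have "vec_index (mult_mat_vec (B - A) v) i = (\<Sum>j<n. index_mat (B - A) (i, j) * vec_index v j)"
          using BA i v A B by (simp add: scalar_prod_def lessThan_atLeast0)
        also have "\<dots> = (\<Sum>j<n. (k' i j - k i j) * vec_index v j)"
          using ix i by (intro sum.cong) auto
        finally show ?thesis .
      qed
      then show ?thesis using BA A by (simp add: scalar_prod_def lessThan_atLeast0)
    qed
    also have "\<dots> = Kq n k' (vec_index v) - Kq n k (vec_index v)"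
      by (simp add: Kq_def sum_distrib_left algebra_simps sum_subtractf)
    finally show ?thesis using le by simp
  qed
  moreover have "transpose_mat (B - A) = B - A"
    using A B ix sym by (intro eq_matI) auto
  ultimately show ?thesis using A B BA by (simp add: loewner_le_def psd_def square_mat.simps)
qed

lemma Kq_scale: "Kq n (\<lambda>i j. \<alpha> * k i j) c = \<alpha> * Kq n k c"
  by (simp add: Kq_def sum_distrib_left mult_ac)

lemma loewner_of_approx:
  assumes A: "A \<in> carrier_mat m n" "B \<in> carrier_mat m' n"
    and k: "\<And>i j. i < n \<Longrightarrow> j < n \<Longrightarrow> index_mat (gram A) (i, j) = k i j" "\<And>i j. i < n \<Longrightarrow> j < n \<Longrightarrow> index_mat (gram B) (i, j) = k' i j"
    and sym: "\<And>i j. k i j = k j i" "\<And>i j. k' i j = k' j i"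
    and ap: "approx n lo hi k k'"
  shows "lo \<cdot>\<^sub>m gram B \<preceq>\<^sub>L gram A" "gram A \<preceq>\<^sub>L hi \<cdot>\<^sub>m gram B"
proof -
  have gA: "gram A \<in> carrier_mat n n" and gB: "gram B \<in> carrier_mat n n" using A gram_carrier by auto
  have s: "index_mat (\<alpha> \<cdot>\<^sub>m gram B) (i, j) = \<alpha> * k' i j" if "i < n" "j < n" for i j \<alpha>
    using gB k that by simp
  show "lo \<cdot>\<^sub>m gram B \<preceq>\<^sub>L gram A"
    using ap sym gA gB k s
    by (intro loewner_leI[where n = n and k = "\<lambda>i j. lo * k' i j" and k' = k]) (auto simp: approx_def Kq_scale)
  show "gram A \<preceq>\<^sub>L hi \<cdot>\<^sub>m gram B"
    using ap sym gA gB k s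
    by (intro loewner_leI[where n = n and k = k and k' = "\<lambda>i j. hi * k' i j"]) (auto simp: approx_def Kq_scale)
qed

subsection \<open>The sketch\<close>

lemma expo_bits: "expo (p div 2 ^ l) (machine.bits (\<lambda>j. odd (p div 2 ^ j)) l) = p"
proof -
  \<comment> \<open>\<open>bits\<close> depends on the locale through \<open>bit\<close> alone; the
    values 1 only satisfy its assumptions.\<close>
  have b: "machine.bits f r = map f (rev [0..<r])" for f r
    by (rule machine.bits_def[of 1 1 1]) (unfold_locales; simp)
  show ?thesis
  proof (induction l)
    case (Suc l)
    have "2 * (p div 2 ^ Suc l) + of_bool (odd (p div 2 ^ l)) = p div 2 ^ l"
    proof -
      have "p div 2 ^ Suc l = p div 2 ^ l div 2" by (simp only: power_Suc2 div_mult2_eq)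
      then show ?thesis by (simp add: odd_two_times_div_two_succ)
    qed
    then show ?case using Suc by (simp add: b)
  qed (simp add: b)
qed

lemma length_qbits: "length (qbits d p) = ql d p"
proof -
  have b: "machine.bits f r = map f (rev [0..<r])" for f r
    by (rule machine.bits_def[of 1 1 1]) (unfold_locales; simp)
  show ?thesis by (simp add: qbits_def b)
qed

text \<open>Without any level the start vector would be returned as it is; \<open>1 \<le> l\<close>
  in \<open>stopl\<close> rules this out.\<close>

lemma sk_zero:
  assumes "bs \<noteq> []" "M \<le> i"
  shows "sk L M sc bs w x z i = 0"
  using assms(1)
proof (induction bs arbitrary: w z)
  case IH: (Cons b bs)
  show ?case
  proof (cases bs)
    case Nil
    then show ?thesis using assms(2) by (simp add: level_def)
  next
    case (Cons b' bs')
    then show ?thesis unfolding sk.simps(2)[of _ _ _ b] by (intro IH.IH) simp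
  qed
qed simp

context
  fixes n d p :: nat and \<epsilon> \<delta> :: real
begin

definition out :: "real mat \<Rightarrow> bool list \<Rightarrow> nat \<Rightarrow> nat \<Rightarrow> real" where
  "out X w j = sk (qL n d p \<epsilon> \<delta>) (qM n d p \<epsilon> \<delta>) (qsc n d p \<epsilon> \<delta>) (qbits d p) w (colf d X j) (tp d (colf d X j) (qq d p))"

lemma ex_sketch_coeffs:
  "\<exists>c. \<forall>X j i. out X w j i = (\<Sum>I<d ^ p. c i I * tp d (colf d X j) p I)"
proof -
  have "lf d p (\<lambda>x. sk (qL n d p \<epsilon> \<delta>) (qM n d p \<epsilon> \<delta>) (qsc n d p \<epsilon> \<delta>) (qbits d p) w x (tp d x (qq d p)) i)" for i
    using lf_sk[where e = "qq d p" and bs = "qbits d p" and z = "\<lambda>x. tp d x (qq d p)", OF lf_tp] expo_bits by (simp add: qbits_def qq_def)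
  then have "\<exists>c. \<forall>x. (\<forall>a\<ge>d. x a = 0) \<longrightarrow> sk (qL n d p \<epsilon> \<delta>) (qM n d p \<epsilon> \<delta>) (qsc n d p \<epsilon> \<delta>) (qbits d p) w x (tp d x (qq d p)) i =
     (\<Sum>I<d ^ p. c I * tp d x p I)" for i by (simp add: lf_def)
  then obtain c where "\<And>i x. (\<forall>a\<ge>d. x a = 0) \<Longrightarrow> sk (qL n d p \<epsilon> \<delta>) (qM n d p \<epsilon> \<delta>) (qsc n d p \<epsilon> \<delta>) (qbits d p) w x (tp d x (qq d p)) i =
     (\<Sum>I<d ^ p. c i I * tp d x p I)" by metis
  then show ?thesis unfolding out_def by (intro exI[of _ c]) (simp add: colf_def)
qed

text \<open>Tensor powers are symmetric, so the coefficients are in general not unique. They are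
  chosen from the coins alone, uniformly in \<open>X\<close>, which makes the sketch
  oblivious.\<close>

definition coeffs :: "bool list \<Rightarrow> nat \<Rightarrow> nat \<Rightarrow> real" where
  "coeffs w = (SOME c. \<forall>X j i. out X w j i = (\<Sum>I<d ^ p. c i I * tp d (colf d X j) p I))"

lemma coeffs: "out X w j i = (\<Sum>I<d ^ p. coeffs w i I * tp d (colf d X j) p I)"
  using someI_ex[OF ex_sketch_coeffs[of w]] unfolding coeffs_def by blast

definition Smat :: "bool list \<Rightarrow> real mat" where
  "Smat w = mat (qm n d p \<epsilon> \<delta>) (d ^ p) (\<lambda>(i, I). coeffs w i I)"

definition ncoins :: nat where "ncoins = 3 * flen (qL n d p \<epsilon> \<delta>) (qM n d p \<epsilon> \<delta>) * ql d p"

lemma Smat_carrier: "Smat w \<in> carrier_mat (qm n d p \<epsilon> \<delta>) (d ^ p)" by (simp add: Smat_def)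

lemma Smat_apply:
  assumes "X \<in> carrier_mat d n" "i < qm n d p \<epsilon> \<delta>" "j < n"
  shows "index_mat (Smat w * mat_tpow X p) (i, j) = out X w j i"
proof -
  note T = mat_tpow_carrier[OF assms(1), of p]
  have "index_mat (Smat w * mat_tpow X p) (i, j) = (\<Sum>I<d ^ p. coeffs w i I * index_mat (mat_tpow X p) (I, j))"
    using assms T by (simp add: Smat_def scalar_prod_def lessThan_atLeast0)
  also have "\<dots> = (\<Sum>I<d ^ p. coeffs w i I * tp d (colf d X j) p I)"
    using assms by (intro sum.cong) (auto simp: mat_tpow_tp)
  finally show ?thesis by (simp add: coeffs)
qed

end

section \<open>The embedding guarantee and the theorem\<close>

lemma sum_pad:
  fixes f :: "nat \<Rightarrow> real"
  assumes "\<And>a. A \<le> a \<Longrightarrow> f a = 0" "A \<le> B"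
  shows "(\<Sum>a<B. f a) = (\<Sum>a<A. f a)"
  using assms by (intro sum.mono_neutral_right) auto

text \<open>Zero padding changes no Gram matrix, so sums over \<open>d\<close>, \<open>M\<close>,
  \<open>m\<close> and \<open>2 ^ L\<close> cells can be exchanged. The bottom tensor power is
  exact, so the composition starts with error exponent 0.\<close>

lemma sketch_embeds:
  fixes n d p :: nat and \<epsilon> \<delta> :: real
  assumes pos: "0 < n" "0 < d" "0 < \<epsilon>" "\<epsilon> < 1" "0 < \<delta>" "\<delta> < 1" and p: "0 < p" and X: "X \<in> carrier_mat d n"
  shows "1 - \<delta> \<le> measure_pmf.prob (map_pmf (Smat n d p \<epsilon> \<delta>) (coin_tosses (ncoins n d p \<epsilon> \<delta>)))
     {S. (1 - \<epsilon>) \<cdot>\<^sub>m gram (mat_tpow X p) \<preceq>\<^sub>L gram (S * mat_tpow X p) \<and>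
         gram (S * mat_tpow X p) \<preceq>\<^sub>L (1 + \<epsilon>) \<cdot>\<^sub>m gram (mat_tpow X p)}"
proof -
  let ?L = "qL n d p \<epsilon> \<delta>" and ?M = "qM n d p \<epsilon> \<delta>" and ?m = "qm n d p \<epsilon> \<delta>" and ?l = "ql d p" and ?bs = "qbits d p"
  let ?E = "{S. (1 - \<epsilon>) \<cdot>\<^sub>m gram (mat_tpow X p) \<preceq>\<^sub>L gram (S * mat_tpow X p) \<and>
         gram (S * mat_tpow X p) \<preceq>\<^sub>L (1 + \<epsilon>) \<cdot>\<^sub>m gram (mat_tpow X p)}"
  let ?g = "gr (2 ^ ?L) (colf d X)"
  let ?Z = "\<lambda>j. tp d (colf d X j) (qq d p)"
  let ?good = "\<lambda>w. approx n (1 - \<epsilon>) (1 + \<epsilon>) (gr (2 ^ ?L) (out n d p \<epsilon> \<delta> X w)) (\<lambda>i j. ?g i j ^ p)"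
  note Lp = qL_props[OF pos, of p]
  have g: "?g i j = (\<Sum>u<d. colf d X i u * colf d X j u)" for i j
    unfolding gr_def using Lp by (intro sum_pad) (auto simp: colf_def)
  have e: "expo (qq d p) ?bs = p" using expo_bits by (simp add: qbits_def qq_def)
  have M: "0 < ?M" "?M \<le> 2 ^ ?L" using Lp by (auto simp: qM_def)
  have sc: "(qsc n d p \<epsilon> \<delta>)\<^sup>2 * real ?M = 1"
  proof -
    have "((2::real) ^ qt n d p \<epsilon> \<delta>)\<^sup>2 = 4 ^ qt n d p \<epsilon> \<delta>"
      unfolding power2_eq_square power_mult_distrib[symmetric] by simp
    then show ?thesis by (simp add: qsc_def qM_def power_divide)
  qed
  have Z0: "gr (2 ^ ?L) ?Z i j = ?g i j ^ qq d p" for i j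
  proof -
    have "gr (2 ^ ?L) ?Z i j = (\<Sum>a<d ^ qq d p. ?Z i a * ?Z j a)"
      unfolding gr_def using Lp by (intro sum_pad) (auto simp: tp_0)
    then show ?thesis by (simp add: tp_inner g)
  qed
  have prob: "avg (3 * flen ?L ?M * length ?bs) (\<lambda>w. of_bool (\<not> ?good w)) \<le> \<delta> / 2 ^ (?l - length ?bs)"
  proof -
    have outf: "out n d p \<epsilon> \<delta> X w = (\<lambda>j. sk ?L ?M (qsc n d p \<epsilon> \<delta>) ?bs w (colf d X j) (?Z j))" for w
      by (rule ext) (rule out_def)
    have "avg (3 * flen ?L ?M * length ?bs) (\<lambda>w. of_bool (\<not> approx n (1 - \<epsilon>) (1 + \<epsilon>)
       (gr (2 ^ ?L) (\<lambda>j. sk ?L ?M (qsc n d p \<epsilon> \<delta>) ?bs w (colf d X j) (?Z j))) (\<lambda>i j. gr (2 ^ ?L) (colf d X) i j ^ expo (qq d p) ?bs))) \<le> \<delta> / 2 ^ (?l - length ?bs)"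
    proof (rule sketch_prob[OF M sc pos(3,4), where h = 0])
      fix r Z W assume r: "r < ?l"
      interpret lp: level_params n d "qk n d \<epsilon> \<delta>" ?l ?L ?M r \<epsilon> \<delta> by (rule level_params[OF pos p r])
      show "avg (3 * flen ?L ?M) (\<lambda>w. of_bool (\<not> approx n (1 - eta \<epsilon> ?l r) (1 + eta \<epsilon> ?l r)
        (gr (2 ^ ?L) (\<lambda>j. level ?L ?M (qsc n d p \<epsilon> \<delta>) w (W j) (Z j))) (level_gram (2 ^ ?L) Z W))) \<le> \<delta> / 2 ^ (?l - r)"
        by (rule lp.level_bound[OF M sc])
    next
      have "Kq n (gr (2 ^ ?L) ?Z) c = Kq n (\<lambda>i j. ?g i j ^ qq d p) c" for c by (simp add: Kq_def Z0)
      then show "approx n (exp (- 2 * 0)) (exp 0) (gr (2 ^ ?L) ?Z) (\<lambda>i j. gr (2 ^ ?L) (colf d X) i j ^ qq d p)"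
        by (simp add: approx_def)
    qed (use pos length_qbits in auto)
    then show ?thesis unfolding e outf .
  qed
  have good: "Smat n d p \<epsilon> \<delta> w \<in> ?E" if gw: "?good w" for w
  proof -
    let ?A = "Smat n d p \<epsilon> \<delta> w * mat_tpow X p"
    have A: "?A \<in> carrier_mat ?m n" using Smat_carrier mat_tpow_carrier[OF X] by (rule mult_carrier_mat)
    have ne: "?bs \<noteq> []" using length_qbits[of d p] ql_props(1)[of d p] by auto
    have Mm: "?M \<le> ?m" by (rule M_le_m[OF pos p])
    have z: "out n d p \<epsilon> \<delta> X w j a = 0" if "?M \<le> a" for j a
      unfolding out_def by (rule sk_zero[OF ne that])
    have k1: "index_mat (gram ?A) (i, j) = gr (2 ^ ?L) (out n d p \<epsilon> \<delta> X w) i j" if "i < n" "j < n" for i j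
    proof -
      have "index_mat (gram ?A) (i, j) = (\<Sum>a<?m. out n d p \<epsilon> \<delta> X w i a * out n d p \<epsilon> \<delta> X w j a)"
        unfolding gram_index[OF A that] using that by (intro sum.cong) (auto simp: Smat_apply[OF X])
      also have "\<dots> = (\<Sum>a<?M. out n d p \<epsilon> \<delta> X w i a * out n d p \<epsilon> \<delta> X w j a)" using z Mm by (intro sum_pad) auto
      also have "\<dots> = gr (2 ^ ?L) (out n d p \<epsilon> \<delta> X w) i j" unfolding gr_def using z M by (intro sum_pad[symmetric]) auto
      finally show ?thesis .
    qed
    have k2: "index_mat (gram (mat_tpow X p)) (i, j) = ?g i j ^ p" if "i < n" "j < n" for i j
    proof -
      have "index_mat (gram (mat_tpow X p)) (i, j) = (\<Sum>I<d ^ p. tp d (colf d X i) p I * tp d (colf d X j) p I)"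
        unfolding gram_index[OF mat_tpow_carrier[OF X] that] using that by (intro sum.cong) (auto simp: mat_tpow_tp[OF X])
      then show ?thesis by (simp add: tp_inner g)
    qed
    show ?thesis
      using loewner_of_approx[OF A mat_tpow_carrier[OF X] k1 k2 _ _ gw] by (simp add: gr_def mult.commute)
  qed
  have len: "3 * flen ?L ?M * length ?bs = ncoins n d p \<epsilon> \<delta>" by (simp add: ncoins_def length_qbits)
  have "1 - \<delta> \<le> 1 - avg (ncoins n d p \<epsilon> \<delta>) (\<lambda>w. of_bool (\<not> ?good w))"
    using prob unfolding len by (simp add: length_qbits)
  also have "\<dots> = avg (ncoins n d p \<epsilon> \<delta>) (\<lambda>w. 1 + (-1) * of_bool (\<not> ?good w))"
    unfolding avg_add avg_cmult by simp
  also have "\<dots> \<le> avg (ncoins n d p \<epsilon> \<delta>) (\<lambda>w. indicator ?E (Smat n d p \<epsilon> \<delta> w))"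
    using good by (intro avg_mono) (auto simp: indicator_def)
  finally show ?thesis unfolding prob_coin_tosses .
qed

lemma PROG_sketches:
  fixes n d p :: nat and \<epsilon> \<delta> :: real
  assumes pos: "0 < n" "0 < d" "0 < \<epsilon>" "\<epsilon> < 1" "0 < \<delta>" "\<delta> < 1" and p: "0 < p"
  shows "sketches_in_time PROG n d p \<epsilon> \<delta> (map_pmf (Smat n d p \<epsilon> \<delta>) (coin_tosses (ncoins n d p \<epsilon> \<delta>))) (real (qT n d p \<epsilon> \<delta>))"
  unfolding sketches_in_time_def
proof (rule exI[of _ "ncoins n d p \<epsilon> \<delta>"], rule exI[of _ "Smat n d p \<epsilon> \<delta>"], intro conjI refl ballI allI impI)
  fix X :: "real mat" and w :: "bool list" assume X: "X \<in> carrier_mat d n" and w: "length w = ncoins n d p \<epsilon> \<delta>"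
  have A: "Smat n d p \<epsilon> \<delta> w * mat_tpow X p \<in> carrier_mat (qm n d p \<epsilon> \<delta>) n"
    using Smat_carrier mat_tpow_carrier[OF X] by (rule mult_carrier_mat)
  obtain t s where t: "exec PROG (input_state n d p \<epsilon> \<delta> X w) t s" "t \<le> qT n d p \<epsilon> \<delta>" "ireg s 0 = qm n d p \<epsilon> \<delta>"
    and o: "\<And>j i. j < n \<Longrightarrow> i < qm n d p \<epsilon> \<delta> \<Longrightarrow> rarr s 1 (j * qm n d p \<epsilon> \<delta> + i) = out n d p \<epsilon> \<delta> X w j i"
    using runs_PROG[OF pos, of w p X] w by (auto simp: runs_def ncoins_def out_def)
  have "outputs s (Smat n d p \<epsilon> \<delta> w * mat_tpow X p)"
    using A t o Smat_apply[OF X] unfolding outputs_def carrier_matD[OF A] by simp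
  then show "\<exists>t s. exec PROG (input_state n d p \<epsilon> \<delta> X w) t s \<and> real t \<le> real (qT n d p \<epsilon> \<delta>) \<and> outputs s (Smat n d p \<epsilon> \<delta> w * mat_tpow X p)"
    using t by auto
qed

theorem mainTheorem4:
  shows "\<exists>(m :: nat quantity) (D :: real mat pmf quantity) (T :: real quantity) (P :: prog).
    soft_Theta (\<lambda>n d p \<epsilon> \<delta>. real (m n d p \<epsilon> \<delta>)) (\<lambda>n d p \<epsilon> \<delta>. real n * real p ^ 2 / \<epsilon> ^ 2) \<and>
    soft_O T (\<lambda>n d p \<epsilon> \<delta>. real n * real d + real n ^ 2 * real p ^ 2 / \<epsilon> ^ 2) \<and>
    (\<forall>n d p \<epsilon> \<delta>. 0 < n \<longrightarrow> 0 < d \<longrightarrow> 0 < p \<longrightarrow> 0 < \<epsilon> \<longrightarrow> \<epsilon> < 1 \<longrightarrow> 0 < \<delta> \<longrightarrow> \<delta> < 1 \<longrightarrow>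
      (\<forall>S \<in> set_pmf (D n d p \<epsilon> \<delta>). S \<in> carrier_mat (m n d p \<epsilon> \<delta>) (d ^ p)) \<and>
      (\<forall>X \<in> carrier_mat d n.
        measure_pmf.prob (D n d p \<epsilon> \<delta>)
          {S. (1 - \<epsilon>) \<cdot>\<^sub>m gram (mat_tpow X p) \<preceq>\<^sub>L gram (S * mat_tpow X p) \<and>
              gram (S * mat_tpow X p) \<preceq>\<^sub>L (1 + \<epsilon>) \<cdot>\<^sub>m gram (mat_tpow X p)} \<ge> 1 - \<delta>) \<and>
      sketches_in_time P n d p \<epsilon> \<delta> (D n d p \<epsilon> \<delta>) (T n d p \<epsilon> \<delta>))"
proof (intro exI[of _ qm] exI[of _ "\<lambda>n d p \<epsilon> \<delta>. map_pmf (Smat n d p \<epsilon> \<delta>) (coin_tosses (ncoins n d p \<epsilon> \<delta>))"]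
    exI[of _ "\<lambda>n d p \<epsilon> \<delta>. real (qT n d p \<epsilon> \<delta>)"] exI[of _ PROG] conjI allI impI ballI)
  show "soft_Theta (\<lambda>n d p \<epsilon> \<delta>. real (qm n d p \<epsilon> \<delta>)) (\<lambda>n d p \<epsilon> \<delta>. real n * real p ^ 2 / \<epsilon> ^ 2)"
    using soft_O_m soft_O_m' by (simp add: soft_Theta_def)
  show "soft_O (\<lambda>n d p \<epsilon> \<delta>. real (qT n d p \<epsilon> \<delta>)) (\<lambda>n d p \<epsilon> \<delta>. real n * real d + real n ^ 2 * real p ^ 2 / \<epsilon> ^ 2)"
    by (rule soft_O_T)
qed (use Smat_carrier sketch_embeds PROG_sketches in auto)

end
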